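(* Assume $\zeta_{ij}(x)=\frac{\alpha_{ij}x^{s_{ij}}}{(1-x)^{\delta_{ij}}}\prod_{e=1}^{\#_{ij}}(1-xq_e^{ij})$ for all $i,j\in I$, with $\alpha_{ij},q_e^{ij}\in\mathbb K^\times$, $s_{ij}\in\mathbb Z$, $\#_{ij}\in\mathbb Z_{\ge0}$. Then for every $\mathbf n=(n_i)_{i\in I}\in\mathbb N^I$ with $n=\sum_{i\in I}n_i$, and every $p=(p_{ia})_{i\in I,a\in\{1,\dots,n_i\}}\in(\mathbb K^\times)^n/\mathbb K^\times$, there exists a homogeneous ideal $$\mathcal I_{p,\mathbf n}\subseteq\mathbb K[z_{i1}^{\pm1},\dots,z_{in_i}^{\pm1}]_{i\in I}$$ supported on the one-dimensional locus $(z_{ia})_{i\in I,a\in\{1,\dots,n_i\}}\in p\,\mathbb K^\times$, such that (for all $\mathbf n\in\mathbb N^I$, and for both signs) $$\mathcal S_{\pm\mathbf n}=\mathcal V_{\pm\mathbf n}\ \cap\bigcap_{\substack{\mathbf 0\le\mathbf k\le\mathbf n\\ p\in(\mathbb K^\times)^k/\mathbb K^\times}}\mathcal I_{p,\mathbf k}^{(\mathbf n)},\qquad\text{where } k=|\mathbf k|.$$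
   Context: Notation: $\mathbb N=\{0,1,2,\dots\}$; $\mathbb K$ is a field of characteristic $0$; $I$ is a finite set; $\delta_{ij}$ is the Kronecker delta; $\varsigma^i\in\mathbb N^I$ has entry $1$ in position $i$ and $0$ elsewhere; for $\mathbf n\in\mathbb N^I$, $|\mathbf n|=\sum_in_i$ and $\mathbf n!=\prod_in_i!$; $\mathbf 0\le\mathbf k\le\mathbf n$ means $0\le k_i\le n_i$ for all $i$. The group $\mathbb K^\times$ acts on $(\mathbb K^\times)^n$ by simultaneous rescaling. Ideals. Homogeneous refers to total degree with all $z_{ia}$ of degree $1$. An ideal is "supported on $p\mathbb K^\times$" if the quotient of the Laurent polynomial ring by it is supported on the closed subscheme $p\mathbb K^\times\cong\operatorname{Spec}\mathbb K[x^{\pm1}]$ given by $z_{ia}=p_{ia}x$ (i.e. defined by the ideal generated by all $p_{jb}z_{ia}-p_{ia}z_{jb}$). For $\mathbf 0\le\mathbf k\le\mathbf n$ and an ideal $\mathcal I_{\mathbf k}\subseteq\mathbb K[z_{i1}^{\pm1},\dots,z_{ik_i}^{\pm1}]_{i\in I}$, write $$\mathcal I_{\mathbf k}^{(\mathbf n)}=\bigcap_{C}\ \big(\text{ideal generated by }\varphi_C(\mathcal I_{\mathbf k})\big)\subseteq\mathbb K[z_{i1}^{\pm1},\dots,z_{in_i}^{\pm1}]_{i\in I},$$ where $C$ runs over all choices, for each $i\in I$, of distinct $c^{(i)}_1,\dots,c^{(i)}_{k_i}\in\{1,\dots,n_i\}$, and $\varphi_C$ is the ring homomorphism $z_{ia}\mapsto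 z_{i c_a^{(i)}}$. Quadratic quantum loop groups. $\widetilde{\mathbf U}^+$ is the $\mathbb K$-algebra generated by $\{e_{i,d}\}_{i\in I,d\in\mathbb Z}$ modulo $e_i(z)e_j(w)\zeta_{ji}(w/z)=e_j(w)e_i(z)\zeta_{ij}(z/w)$ for all $i,j\in I$, where $e_i(z)=\sum_{d}e_{i,d}z^{-d}$ and the relation means equality of all coefficients (if $i=j$, one first clears the denominators $z-w$). $\widetilde{\mathbf U}^-$ is generated by $\{f_{i,d}\}$ modulo $f_i(z)f_j(w)\zeta_{ij}(z/w)=f_j(w)f_i(z)\zeta_{ji}(w/z)$, with the same conventions. Big shuffle algebras. As vector spaces $\mathcal V^+=\mathcal V^-=\bigoplus_{\mathbf n}\mathbb K[z_{i1}^{\pm1},\dots,z_{in_i}^{\pm1}]_{i\in I}^{\mathrm{sym}}$, where sym (resp. Sym) means symmetric (resp. symmetrization, i.e. sum over $\prod_iS(n_i)$) in $z_{i1},z_{i2},\dots$ for each $i$ separately; the $\mathbf n$-th summand is $\mathcal V_{\mathbf n}\subset\mathcal V^+$, respectively $\mathcal V_{-\mathbf n}\subset\mathcal V^-$. The product in $\mathcal V^+$ is $$R*R'=\mathrm{Sym}\Big[\tfrac{R(\dots,z_{i1},\dots,z_{in_i},\dots)R'(\dots,z_{i,n_i+1},\dots,z_{i,n_i+n_i'},\dots)}{\mathbf n!\,\mathbf n'!}\prod_{i,j\in I}\ \prod_{1\le a\le n_i,\ n_j<b\le n_j+n'_j}\zeta_{ij}\big(\tfrac{z_{ia}}{z_{jb}}\big)\Big];$$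 in $\mathcal V^-$ one replaces $\zeta_{ij}(z_{ia}/z_{jb})$ by $\zeta_{ji}(z_{jb}/z_{ia})$. There are algebra homomorphisms $\widetilde\Upsilon^\pm:\widetilde{\mathbf U}^\pm\to\mathcal V^\pm$, $e_{i,d},f_{i,d}\mapsto z_{i1}^d$; put $K^\pm=\operatorname{Ker}\widetilde\Upsilon^\pm$. Pairings. $\int_{|z_1|\gg\dots\gg|z_n|}F\prod_aDz_a$ denotes the constant term of the expansion of the rational function $F$ in the region $|z_1|\gg\dots\gg|z_n|$; similarly for $\ll$. There are well-defined pairings $\widetilde{\mathbf U}^+\otimes\mathcal V^-\to\mathbb K$ and $\mathcal V^+\otimes\widetilde{\mathbf U}^-\to\mathbb K$ given, for $R^\pm\in\mathcal V_{\pm\mathbf n}$, by $$\langle e_{i_1,d_1}\cdots e_{i_n,d_n},R^-\rangle=\int_{|z_1|\gg\dots\gg|z_n|}\frac{z_1^{d_1}\cdots z_n^{d_n}R^-(z_1,\dots,z_n)}{\prod_{a<b}\zeta_{i_bi_a}(z_b/z_a)}\prod_aDz_a,$$ $$\langle R^+,f_{i_1,-d_1}\cdots f_{i_n,-d_n}\rangle=\int_{|z_1|\ll\dots\ll|z_n|}\frac{z_1^{-d_1}\cdots z_n^{-d_n}R^+(z_1,\dots,z_n)}{\prod_{a<b}\zeta_{i_ai_b}(z_a/z_b)}\prod_aDz_a$$ if $\varsigma^{i_1}+\dots+\varsigma^{i_n}=\mathbf n$, and $0$ otherwise; here $z_a$ is identified with a variable $z_{i_a\bullet_a}$ of $R^\pm$,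 distinct $a$ giving distinct variables. Then $\mathcal S^-=\{R\in\mathcal V^-:\langle K^+,R\rangle=0\}$, $\mathcal S^+=\{R\in\mathcal V^+:\langle R,K^-\rangle=0\}$, and $\mathcal S_{\pm\mathbf n}=\mathcal S^\pm\cap\mathcal V_{\pm\mathbf n}$. *)

theory Defs
  imports
    "HOL-Library.Poly_Mapping"
    "HOL-Library.FuncSet"
    "HOL-Computational_Algebra.Fraction_Field"
    "HOL-Combinatorics.Permutations"
    "HOL-Algebra.QuotRing"
begin

text \<open>\<open>Z i a\<close> is the variable $z_{ia}$; positions \<open>a\<close> count from 1.\<close>

datatype 'i zvar = Z (colour: 'i) (pos: nat)

text \<open>
  The library shows that Laurent polynomials form an integral domain only when the variables are
  linearly ordered. An arbitrary choice of order supplies this instance without ordering the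
  index type; no definition below mentions the order.
\<close>

instantiation zvar :: (type) linorder
begin

definition less_eq_zvar :: "'a zvar \<Rightarrow> 'a zvar \<Rightarrow> bool" where
  "less_eq_zvar x y \<longleftrightarrow> (x, y) \<in> (SOME r :: 'a zvar rel. well_order_on UNIV r)"

definition less_zvar :: "'a zvar \<Rightarrow> 'a zvar \<Rightarrow> bool" where
  "less_zvar x y \<longleftrightarrow> x \<le> y \<and> x \<noteq> y"

instance
proof -
  define r where "r = (SOME r :: 'a zvar rel. well_order_on UNIV r)"
  have "well_order_on UNIV r"
    unfolding r_def by (rule someI_ex) (rule well_order_on)
  then have lin: "refl r" "trans r" "antisym r" "total r"
    by (auto simp: order_on_defs)
  have le: "x \<le> y \<longleftrightarrow> (x, y) \<in> r" for x y :: "'a zvar"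
    by (simp add: less_eq_zvar_def r_def)
  show "OFCLASS('a zvar, linorder_class)"
  proof
    fix x y z :: "'a zvar"
    show "x < y \<longleftrightarrow> x \<le> y \<and> \<not> y \<le> x"
      using lin(1) antisymD[OF lin(3)] by (auto simp: less_zvar_def le refl_on_def)
    show "x \<le> x" using lin(1) by (simp add: le refl_on_def)
    show "x \<le> y \<Longrightarrow> y \<le> z \<Longrightarrow> x \<le> z" using transD[OF lin(2)] unfolding le .
    show "x \<le> y \<Longrightarrow> y \<le> x \<Longrightarrow> x = y" using antisymD[OF lin(3)] unfolding le .
    show "x \<le> y \<or> y \<le> x" using lin(1,4) by (cases "x = y") (auto simp: le total_on_def refl_on_def)
  qed
qed

end

type_synonym 'i expo = "'i zvar \<Rightarrow>\<^sub>0 int"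
type_synonym ('i, 'k) laurent = "'i expo \<Rightarrow>\<^sub>0 'k"
type_synonym ('i, 'k) ratfun = "('i, 'k) laurent fract"

abbreviation zpow :: "'i zvar \<Rightarrow> int \<Rightarrow> ('i, 'k::comm_ring_1) laurent" where
  "zpow v d \<equiv> Poly_Mapping.single (Poly_Mapping.single v d) 1"

abbreviation cst :: "'k \<Rightarrow> ('i, 'k::comm_ring_1) laurent" where
  "cst c \<equiv> Poly_Mapping.single 0 c"

definition rat :: "('i, 'k::field) laurent \<Rightarrow> ('i, 'k) ratfun" where
  "rat f = Fraction_Field.Fract f 1"

definition zrat :: "'i zvar \<Rightarrow> ('i, 'k::field) ratfun" where
  "zrat v = rat (zpow v 1)"

definition crat :: "'k \<Rightarrow> ('i, 'k::field) ratfun" where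
  "crat c = rat (cst c)"

text \<open>The homomorphism $z_v \mapsto z_{\sigma(v)}$.\<close>

definition zmap :: "('i zvar \<Rightarrow> 'i zvar) \<Rightarrow> ('i, 'k::comm_ring_1) laurent \<Rightarrow> ('i, 'k) laurent" where
  "zmap \<sigma> f = (\<Sum>m\<in>Poly_Mapping.keys f.
     Poly_Mapping.single
       (\<Sum>v\<in>Poly_Mapping.keys m. Poly_Mapping.single (\<sigma> v) (Poly_Mapping.lookup m v))
       (Poly_Mapping.lookup f m))"

definition zvars :: "('i \<Rightarrow> nat) \<Rightarrow> 'i zvar set" where
  "zvars n = {Z i a | i a. 1 \<le> a \<and> a \<le> n i}"

definition laurents :: "('i \<Rightarrow> nat) \<Rightarrow> ('i, 'k::comm_ring_1) laurent set" where
  "laurents n = {f. \<forall>m\<in>Poly_Mapping.keys f. Poly_Mapping.keys m \<subseteq> zvars n}"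

definition ring_on :: "'a::ring_1 set \<Rightarrow> 'a ring" where
  "ring_on A = \<lparr>carrier = A, mult = (*), one = 1, zero = 0, add = (+)\<rparr>"

abbreviation laurent_ring :: "('i \<Rightarrow> nat) \<Rightarrow> ('i, 'k::comm_ring_1) laurent ring" where
  "laurent_ring n \<equiv> ring_on (laurents n)"

definition colour_perms :: "('i \<Rightarrow> nat) \<Rightarrow> ('i zvar \<Rightarrow> 'i zvar) set" where
  "colour_perms n = {\<sigma>. \<sigma> permutes zvars n \<and> (\<forall>v. colour (\<sigma> v) = colour v)}"

definition sym_laurents :: "('i \<Rightarrow> nat) \<Rightarrow> ('i, 'k::comm_ring_1) laurent set" where
  "sym_laurents n = {f \<in> laurents n. \<forall>\<sigma>\<in>colour_perms n. zmap \<sigma> f = f}"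

definition total_degree :: "'i expo \<Rightarrow> int" where
  "total_degree m = (\<Sum>v\<in>Poly_Mapping.keys m. Poly_Mapping.lookup m v)"

definition hom_component :: "int \<Rightarrow> ('i, 'k::comm_ring_1) laurent \<Rightarrow> ('i, 'k) laurent" where
  "hom_component d f = (\<Sum>m | m \<in> Poly_Mapping.keys f \<and> total_degree m = d.
     Poly_Mapping.single m (Poly_Mapping.lookup f m))"

definition homogeneous :: "('i, 'k::comm_ring_1) laurent set \<Rightarrow> bool" where
  "homogeneous J \<longleftrightarrow> (\<forall>f\<in>J. \<forall>d. hom_component d f \<in> J)"

definition torus :: "('i \<Rightarrow> nat) \<Rightarrow> ('i zvar \<Rightarrow> 'k::field) set" where
  "torus n = zvars n \<rightarrow>\<^sub>E (UNIV - {0})"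

definition rescaling :: "('i \<Rightarrow> nat) \<Rightarrow> ('i zvar \<Rightarrow> 'k::field) rel" where
  "rescaling n = {(p, p'). p \<in> torus n \<and> p' \<in> torus n \<and>
     (\<exists>c. c \<noteq> 0 \<and> (\<forall>v\<in>zvars n. p' v = c * p v))}"

definition torus_orbits :: "('i \<Rightarrow> nat) \<Rightarrow> ('i zvar \<Rightarrow> 'k::field) set set" where
  "torus_orbits n = torus n // rescaling n"

text \<open>Support of the module $R/J$, i.e. the set of primes containing $J$.\<close>

definition quot_support :: "'a ring \<Rightarrow> 'a set \<Rightarrow> 'a set set" where
  "quot_support R J = {Q. primeideal Q R \<and> J \<subseteq> Q}"

definition line_ideal :: "('i \<Rightarrow> nat) \<Rightarrow> ('i zvar \<Rightarrow> 'k::field) \<Rightarrow> ('i, 'k) laurent set" where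
  "line_ideal n p = Idl\<^bsub>laurent_ring n\<^esub>
     {cst (p v) * zpow u 1 - cst (p u) * zpow v 1 | u v. u \<in> zvars n \<and> v \<in> zvars n}"

definition supported_on_line ::
    "('i \<Rightarrow> nat) \<Rightarrow> ('i zvar \<Rightarrow> 'k::field) set \<Rightarrow> ('i, 'k) laurent set \<Rightarrow> bool" where
  "supported_on_line n P J \<longleftrightarrow>
     (\<forall>p\<in>P. quot_support (laurent_ring n) J \<subseteq> quot_support (laurent_ring n) (line_ideal n p))"

definition choices :: "('i \<Rightarrow> nat) \<Rightarrow> ('i \<Rightarrow> nat) \<Rightarrow> ('i \<Rightarrow> nat \<Rightarrow> nat) set" where
  "choices k n = {C. \<forall>i. inj_on (C i) {1..k i} \<and> C i ` {1..k i} \<subseteq> {1..n i}}"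

definition induced_ideal ::
    "('i \<Rightarrow> nat) \<Rightarrow> ('i \<Rightarrow> nat) \<Rightarrow> ('i, 'k::comm_ring_1) laurent set \<Rightarrow> ('i, 'k) laurent set" where
  "induced_ideal k n J =
     (\<Inter>C\<in>choices k n. Idl\<^bsub>laurent_ring n\<^esub> (zmap (\<lambda>v. Z (colour v) (C (colour v) (pos v))) ` J))"

datatype pm = Plus | Minus

primrec opp :: "pm \<Rightarrow> pm" where
  "opp Plus = Minus"
| "opp Minus = Plus"

text \<open>Words under concatenation, so that \<open>'a word \<Rightarrow>\<^sub>0 'k\<close> is the free algebra on \<open>'a\<close>.\<close>

datatype 'a word = Word (letters: "'a list")

instantiation word :: (type) monoid_add
begin

definition zero_word :: "'a word" where
  "zero_word = Word []"

definition plus_word :: "'a word \<Rightarrow> 'a word \<Rightarrow> 'a word" where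
  "plus_word v w = Word (letters v @ letters w)"

instance
  by standard (auto simp: zero_word_def plus_word_def)

end

text \<open>The letter \<open>(i, d)\<close> stands for $e_{i,d}$ or $f_{i,d}$, depending on the sign.\<close>

type_synonym ('i, 'k) free = "('i \<times> int) word \<Rightarrow>\<^sub>0 'k"

abbreviation gen :: "'i \<Rightarrow> int \<Rightarrow> ('i, 'k::comm_ring_1) free" where
  "gen i d \<equiv> Poly_Mapping.single (Word [(i, d)]) 1"

text \<open>
  The family $\zeta_{ij}$ enters as a family of functions on the field of rational functions.
  In the relations, \<open>Z i 1\<close> and \<open>Z j 2\<close> play the roles of $z$ and $w$. The Laurent polynomials
  \<open>A\<close> and \<open>B\<close> are the two rational functions multiplying $e_i(z) e_j(w)$ and $e_j(w) e_i(z)$ (or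
  the corresponding products of $f$'s), after multiplication by $z - w$ if $i = j$. As
  $e_i(z) = \sum_d e_{i,d} z^{-d}$, the coefficient of $z^a w^b$ in $e_i(z) e_j(w) z^x w^y$
  is $e_{i,x-a} e_{j,y-b}$.
\<close>

definition relations ::
    "pm \<Rightarrow> ('i \<Rightarrow> 'i \<Rightarrow> ('i, 'k::field) ratfun \<Rightarrow> ('i, 'k) ratfun) \<Rightarrow> ('i, 'k) free set" where
  "relations \<epsilon> \<zeta> =
     {(\<Sum>m\<in>Poly_Mapping.keys A. Poly_Mapping.single 0 (Poly_Mapping.lookup A m) *
          gen i (Poly_Mapping.lookup m z - a) * gen j (Poly_Mapping.lookup m w - b)) -
      (\<Sum>m\<in>Poly_Mapping.keys B. Poly_Mapping.single 0 (Poly_Mapping.lookup B m) *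
          gen j (Poly_Mapping.lookup m w - b) * gen i (Poly_Mapping.lookup m z - a))
      | i j z w A B a b.
        z = Z i 1 \<and> w = Z j 2 \<and>
        rat A = (if i = j then zrat z - zrat w else 1) *
          (case \<epsilon> of Plus \<Rightarrow> \<zeta> j i (zrat w / zrat z) | Minus \<Rightarrow> \<zeta> i j (zrat z / zrat w)) \<and>
        rat B = (if i = j then zrat z - zrat w else 1) *
          (case \<epsilon> of Plus \<Rightarrow> \<zeta> i j (zrat z / zrat w) | Minus \<Rightarrow> \<zeta> j i (zrat w / zrat z))}"

definition loop_group ::
    "pm \<Rightarrow> ('i \<Rightarrow> 'i \<Rightarrow> ('i, 'k::field) ratfun \<Rightarrow> ('i, 'k) ratfun) \<Rightarrow> ('i, 'k) free set ring" where
  "loop_group \<epsilon> \<zeta> = ring_on UNIV Quot (Idl\<^bsub>ring_on UNIV\<^esub> (relations \<epsilon> \<zeta>))"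

type_synonym ('i, 'k) graded = "('i \<Rightarrow> nat) \<Rightarrow>\<^sub>0 ('i, 'k) laurent"

definition big_shuffle :: "('i, 'k::comm_ring_1) graded set" where
  "big_shuffle = {R. \<forall>n. Poly_Mapping.lookup R n \<in> sym_laurents n}"

definition unit_vec :: "'i \<Rightarrow> 'i \<Rightarrow> nat" where
  "unit_vec i = (\<lambda>j. if j = i then 1 else 0)"

text \<open>The symmetrization is a Laurent polynomial, although its summands have poles.\<close>

definition shuffle_comp ::
    "pm \<Rightarrow> ('i::finite \<Rightarrow> 'i \<Rightarrow> ('i, 'k::field_char_0) ratfun \<Rightarrow> ('i, 'k) ratfun) \<Rightarrow>
     ('i \<Rightarrow> nat) \<Rightarrow> ('i \<Rightarrow> nat) \<Rightarrow> ('i, 'k) laurent \<Rightarrow> ('i, 'k) laurent \<Rightarrow> ('i, 'k) laurent" where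
  "shuffle_comp \<epsilon> \<zeta> n n' R R' = the_inv rat
     (\<Sum>\<sigma>\<in>colour_perms (\<lambda>i. n i + n' i).
        rat (zmap \<sigma> R * zmap (\<lambda>v. \<sigma> (Z (colour v) (n (colour v) + pos v))) R') /
        of_nat ((\<Prod>i\<in>UNIV. fact (n i)) * (\<Prod>i\<in>UNIV. fact (n' i))) *
        (\<Prod>i\<in>UNIV. \<Prod>j\<in>UNIV. \<Prod>a\<in>{1..n i}. \<Prod>b\<in>{n j<..n j + n' j}.
           case \<epsilon> of
             Plus \<Rightarrow> \<zeta> i j (zrat (\<sigma> (Z i a)) / zrat (\<sigma> (Z j b)))
           | Minus \<Rightarrow> \<zeta> j i (zrat (\<sigma> (Z j b)) / zrat (\<sigma> (Z i a)))))"

definition shuffle ::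
    "pm \<Rightarrow> ('i::finite \<Rightarrow> 'i \<Rightarrow> ('i, 'k::field_char_0) ratfun \<Rightarrow> ('i, 'k) ratfun) \<Rightarrow>
     ('i, 'k) graded \<Rightarrow> ('i, 'k) graded \<Rightarrow> ('i, 'k) graded" where
  "shuffle \<epsilon> \<zeta> R R' = (\<Sum>n\<in>Poly_Mapping.keys R. \<Sum>n'\<in>Poly_Mapping.keys R'.
     Poly_Mapping.single (\<lambda>i. n i + n' i)
       (shuffle_comp \<epsilon> \<zeta> n n' (Poly_Mapping.lookup R n) (Poly_Mapping.lookup R' n')))"

primrec upsilon_word ::
    "pm \<Rightarrow> ('i::finite \<Rightarrow> 'i \<Rightarrow> ('i, 'k::field_char_0) ratfun \<Rightarrow> ('i, 'k) ratfun) \<Rightarrow>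
     ('i \<times> int) list \<Rightarrow> ('i, 'k) graded" where
  "upsilon_word \<epsilon> \<zeta> [] = Poly_Mapping.single (\<lambda>_. 0) 1"
| "upsilon_word \<epsilon> \<zeta> (x # xs) =
     shuffle \<epsilon> \<zeta> (Poly_Mapping.single (unit_vec (fst x)) (zpow (Z (fst x) 1) (snd x)))
       (upsilon_word \<epsilon> \<zeta> xs)"

definition upsilon_free ::
    "pm \<Rightarrow> ('i::finite \<Rightarrow> 'i \<Rightarrow> ('i, 'k::field_char_0) ratfun \<Rightarrow> ('i, 'k) ratfun) \<Rightarrow>
     ('i, 'k) free \<Rightarrow> ('i, 'k) graded" where
  "upsilon_free \<epsilon> \<zeta> x = (\<Sum>w\<in>Poly_Mapping.keys x.
     Poly_Mapping.map (\<lambda>f. cst (Poly_Mapping.lookup x w) * f) (upsilon_word \<epsilon> \<zeta> (letters w)))"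

text \<open>
  Elements of \<open>loop_group \<epsilon> \<zeta>\<close> are cosets in the free algebra; maps out of it are given by the
  common value on all representatives.
\<close>

definition upsilon ::
    "pm \<Rightarrow> ('i::finite \<Rightarrow> 'i \<Rightarrow> ('i, 'k::field_char_0) ratfun \<Rightarrow> ('i, 'k) ratfun) \<Rightarrow>
     ('i, 'k) free set \<Rightarrow> ('i, 'k) graded" where
  "upsilon \<epsilon> \<zeta> X = the_elem (upsilon_free \<epsilon> \<zeta> ` X)"

definition ker_upsilon ::
    "pm \<Rightarrow> ('i::finite \<Rightarrow> 'i \<Rightarrow> ('i, 'k::field_char_0) ratfun \<Rightarrow> ('i, 'k) ratfun) \<Rightarrow>
     ('i, 'k) free set set" where
  "ker_upsilon \<epsilon> \<zeta> = {X \<in> carrier (loop_group \<epsilon> \<zeta>). upsilon \<epsilon> \<zeta> X = 0}"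

text \<open>
  \<open>E\<close> (a family of coefficients) is the expansion of \<open>F\<close> in the region
  $|v_1| \gg \dots \gg |v_n|$, where \<open>vs = [v\<^sub>1, \<dots>, v\<^sub>n]\<close>: it is a finite sum of monomials times
  power series in $v_2/v_1, \dots, v_n/v_{n-1}$, and $D E = N$ where $F = N/D$ with Laurent
  polynomials $N$ and $D$. Such an \<open>E\<close> is unique if it exists.
\<close>

definition cone :: "'i zvar list \<Rightarrow> 'i expo set" where
  "cone vs = {\<Sum>a<length vs - 1.
     Poly_Mapping.single (vs ! Suc a) (int (c a)) - Poly_Mapping.single (vs ! a) (int (c a)) | c. True}"

definition is_expansion ::
    "'i zvar list \<Rightarrow> ('i, 'k::field) ratfun \<Rightarrow> ('i expo \<Rightarrow> 'k) \<Rightarrow> bool" where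
  "is_expansion vs F E \<longleftrightarrow>
     (\<exists>M. finite M \<and> (\<forall>m. E m \<noteq> 0 \<longrightarrow> (\<exists>m0\<in>M. m - m0 \<in> cone vs))) \<and>
     (\<exists>N D. D \<noteq> 0 \<and> F = Fraction_Field.Fract N D \<and>
        (\<forall>m. (\<Sum>d\<in>Poly_Mapping.keys D. Poly_Mapping.lookup D d * E (m - d)) = Poly_Mapping.lookup N m))"

definition constant_term :: "'i zvar list \<Rightarrow> ('i, 'k::field) ratfun \<Rightarrow> 'k" where
  "constant_term vs F = (THE c. \<exists>E. is_expansion vs F E \<and> E 0 = c)"

definition weight :: "('i \<times> int) list \<Rightarrow> 'i \<Rightarrow> nat" where
  "weight w i = length (filter (\<lambda>x. fst x = i) w)"

text \<open>
  The \<open>a\<close>-th letter (counted from 0), of colour $i$, is matched with the first variable of colour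
  $i$ not matched with an earlier letter. For symmetric \<open>R\<close> any other matching gives the same value.
\<close>

definition word_var :: "('i \<times> int) list \<Rightarrow> nat \<Rightarrow> 'i zvar" where
  "word_var w a = Z (fst (w ! a)) (card {b. b \<le> a \<and> fst (w ! b) = fst (w ! a)})"

definition pairing_word ::
    "pm \<Rightarrow> ('i \<Rightarrow> 'i \<Rightarrow> ('i, 'k::field) ratfun \<Rightarrow> ('i, 'k) ratfun) \<Rightarrow>
     ('i \<times> int) list \<Rightarrow> ('i, 'k) graded \<Rightarrow> 'k" where
  "pairing_word \<epsilon> \<zeta> w R =
     (let n = length w;
          z = (\<lambda>a. zrat (word_var w a));
          vs = map (word_var w) [0..<n]
      in constant_term (case \<epsilon> of Plus \<Rightarrow> vs | Minus \<Rightarrow> rev vs)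
           ((\<Prod>a<n. z a powi snd (w ! a)) * rat (Poly_Mapping.lookup R (weight w)) /
            (\<Prod>b<n. \<Prod>a<b.
               case \<epsilon> of
                 Plus \<Rightarrow> \<zeta> (fst (w ! b)) (fst (w ! a)) (z b / z a)
               | Minus \<Rightarrow> \<zeta> (fst (w ! a)) (fst (w ! b)) (z a / z b))))"

definition pairing_free ::
    "pm \<Rightarrow> ('i \<Rightarrow> 'i \<Rightarrow> ('i, 'k::field) ratfun \<Rightarrow> ('i, 'k) ratfun) \<Rightarrow>
     ('i, 'k) free \<Rightarrow> ('i, 'k) graded \<Rightarrow> 'k" where
  "pairing_free \<epsilon> \<zeta> x R =
     (\<Sum>w\<in>Poly_Mapping.keys x. Poly_Mapping.lookup x w * pairing_word \<epsilon> \<zeta> (letters w) R)"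

text \<open>
  The sign is that of the quantum loop group: \<open>pairing Plus \<zeta> X R\<close> is $\langle X, R \rangle$ for
  $R$ in the negative shuffle algebra, and \<open>pairing Minus \<zeta> X R\<close> is $\langle R, X \rangle$ for
  $R$ in the positive one.
\<close>

definition pairing ::
    "pm \<Rightarrow> ('i \<Rightarrow> 'i \<Rightarrow> ('i, 'k::field) ratfun \<Rightarrow> ('i, 'k) ratfun) \<Rightarrow>
     ('i, 'k) free set \<Rightarrow> ('i, 'k) graded \<Rightarrow> 'k" where
  "pairing \<epsilon> \<zeta> X R = the_elem ((\<lambda>x. pairing_free \<epsilon> \<zeta> x R) ` X)"

definition shuffle_algebra ::
    "pm \<Rightarrow> ('i::finite \<Rightarrow> 'i \<Rightarrow> ('i, 'k::field_char_0) ratfun \<Rightarrow> ('i, 'k) ratfun) \<Rightarrow>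
     ('i, 'k) graded set" where
  "shuffle_algebra \<epsilon> \<zeta> =
     {R \<in> big_shuffle. \<forall>X\<in>ker_upsilon (opp \<epsilon>) \<zeta>. pairing (opp \<epsilon>) \<zeta> X R = 0}"

text \<open>The degree \<open>n\<close> part, as a set of Laurent polynomials.\<close>

definition shuffle_part ::
    "pm \<Rightarrow> ('i::finite \<Rightarrow> 'i \<Rightarrow> ('i, 'k::field_char_0) ratfun \<Rightarrow> ('i, 'k) ratfun) \<Rightarrow>
     ('i \<Rightarrow> nat) \<Rightarrow> ('i, 'k) laurent set" where
  "shuffle_part \<epsilon> \<zeta> n =
     {R \<in> sym_laurents n. Poly_Mapping.single n R \<in> shuffle_algebra \<epsilon> \<zeta>}"

end

theory Submission
  imports Defs
begin

text \<open>
  For an ordering of the variables $z_{ia}$, $1 \le a \le n_i$, let its kernel be the product of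
  $1 / \zeta_{ji}(z_v / z_u)$ over all pairs of variables with \<open>u\<close> (of colour \<open>i\<close>) before \<open>v\<close> (of colour
  \<open>j\<close>). By definition of the product, $\widetilde\Upsilon$ of a word is the symmetrization of a monomial times
  the product of $\zeta$ over the pairs of an ordering. Division by the product of $\zeta$ over all pairs of
  distinct variables turns the latter product into the kernel. So an element of the kernel of
  $\widetilde\Upsilon$ amounts to a relation, with Laurent polynomial coefficients, among the kernels of
  the orderings, and its pairing with \<open>R\<close> is the constant term of \<open>R\<close> times the combination in which each kernel is
  replaced by its expansion along its own ordering. Therefore the shuffle algebra, for either sign, is
  the symmetric part of an ideal \<open>J\<close> of Laurent polynomials, those that annihilate all discrepancies
  between expansions of a relation (\<open>shuffle_part_eq\<close>).

  Write \<open>J A\<close> for the analogous ideal for a set \<open>A\<close> of variables. It is homogeneous, closed under taking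
  coefficients with respect to the variables outside \<open>A\<close> (\<open>J_pcomp\<close>, \<open>J_coef\<close>), equivariant under renaming
  (\<open>J_zmap\<close>), and contained in \<open>J B\<close> for all subsets \<open>B\<close> of \<open>A\<close> (\<open>J_antimono\<close>). Let $J^<$ be the set of
  Laurent polynomials that lie in \<open>J B\<close> for all proper subsets \<open>B\<close> of the variables. The crucial fact is
  \<open>separated_blocks\<close>: if the variables are split into two blocks, the product of the denominators of the
  kernels across the blocks multiplies $J^<$ into \<open>J\<close>, since after this multiplication kernels and
  expansions factor according to the blocks. These denominators are products of factors $z_u - c z_v$ up
  to units. Hence a prime associated to $J^< / J$ contains, for each partition into two blocks, some
  $z_u - c z_v$ linking the blocks; so it contains the ideal of a line $p \mathbb{K}^\times$
  (\<open>associated_line\<close>).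

  For each line choose a homogeneous ideal $I_p$ containing \<open>J\<close>, maximal among those that meet the torsion of
  $J^<$ modulo \<open>J\<close> along the line only in \<open>J\<close>. The ring is Noetherian, and maximality forces powers of the
  equations $p_v z_u - p_u z_v$ into $I_p$, so $I_p$ is supported on the line
  (\<open>supported_ideal_exists\<close>). An element of $J^<$ in all $I_p$ lies in \<open>J\<close>: otherwise some multiple outside
  \<open>J\<close> would be torsion along a line. The induced ideals in the theorem test the coefficients of \<open>R\<close> with respect
  to subsets of the variables, up to permutations. By induction on the number of variables, those for proper
  subsets describe $J^<$, and those for the full set then cut out \<open>J\<close>.
\<close>

abbreviation lookup where "lookup \<equiv> Poly_Mapping.lookup"
abbreviation keys where "keys \<equiv> Poly_Mapping.keys"
abbreviation single where "single \<equiv> Poly_Mapping.single"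

section \<open>Laurent polynomials and rational functions\<close>

lemma poly_mapping_as_sum: "f = (\<Sum>m\<in>keys f. single m (lookup f m))"
  by (rule poly_mapping_eqI) (auto simp: lookup_sum lookup_single when_def in_keys_iff)

lemma poly_mapping_linear_induct [case_names zero single add]:
  fixes f :: "'a \<Rightarrow>\<^sub>0 'b::comm_monoid_add"
  assumes "P 0" "\<And>m c. P (single m c)" "\<And>f g. P f \<Longrightarrow> P g \<Longrightarrow> P (f + g)"
  shows "P f"
proof -
  have "P (\<Sum>m\<in>S. single m (lookup f m))" if "finite S" for S
    using that by induction (auto intro: assms)
  from this[of "keys f"] show ?thesis using poly_mapping_as_sum[of f] by simp
qed

lemma rat_0 [simp]: "rat 0 = 0" and rat_1 [simp]: "rat 1 = 1"
  by (auto simp: rat_def fract_collapse)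

lemma rat_add: "rat (f + g) = rat f + rat g"
  and rat_mult: "rat (f * g) = rat f * rat g"
  and rat_diff: "rat (f - g) = rat f - rat g"
  and rat_minus: "rat (- f) = - rat f"
  by (auto simp: rat_def)

lemma rat_eq_iff [simp]: "rat f = rat g \<longleftrightarrow> f = g"
  by (auto simp: rat_def eq_fract)

lemma rat_eq_0_iff [simp]: "rat f = 0 \<longleftrightarrow> f = 0"
  using rat_eq_iff[of f 0] by (simp del: rat_eq_iff)

lemma rat_sum: "rat (\<Sum>x\<in>A. f x) = (\<Sum>x\<in>A. rat (f x))"
  by (induction A rule: infinite_finite_induct) (auto simp: rat_add)

lemma rat_prod: "rat (\<Prod>x\<in>A. f x) = (\<Prod>x\<in>A. rat (f x))"
  by (induction A rule: infinite_finite_induct) (auto simp: rat_mult)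

lemma rat_of_nat: "rat (of_nat k) = of_nat k"
  by (induction k) (auto simp: rat_add)

lemma Fract_eq_divide: "b \<noteq> 0 \<Longrightarrow> Fraction_Field.Fract a b = rat a / rat b"
  by (simp add: rat_def)

lemma ratfun_cases:
  obtains a b where "F = rat a / rat b" "b \<noteq> 0"
  by (cases F) (auto simp: Fract_eq_divide)

lemma of_nat_ratfun_eq_0_iff [simp]:
  "(of_nat k :: ('i, 'k::field_char_0) ratfun) = 0 \<longleftrightarrow> k = 0"
  unfolding rat_of_nat[symmetric] rat_eq_0_iff by simp

section \<open>Formal series and their expansions\<close>

type_synonym ('i, 'k) series = "'i expo \<Rightarrow> 'k"

text \<open>
  Formal series form a module over the Laurent polynomials; the equation $D E = N$ that defines an
  expansion is \<open>act D E = lookup N\<close>.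
\<close>

definition act :: "('i, 'k::comm_ring_1) laurent \<Rightarrow> ('i, 'k) series \<Rightarrow> ('i, 'k) series" where
  "act D E m = (\<Sum>d\<in>keys D. lookup D d * E (m - d))"

lemma act_superset:
  assumes "finite S" "keys D \<subseteq> S"
  shows "act D E m = (\<Sum>d\<in>S. lookup D d * E (m - d))"
  unfolding act_def using assms by (intro sum.mono_neutral_left) (auto simp: in_keys_iff)

lemma act_0_left [simp]: "act 0 E = (\<lambda>_. 0)"
  and act_0_right [simp]: "act D (\<lambda>_. 0) = (\<lambda>_. 0)"
  by (auto simp: act_def)

lemma act_single: "act (single d c) E m = c * E (m - d)"
  by (auto simp: act_def)

lemma act_add_left: "act (D + D') E m = act D E m + act D' E m"
proof -
  have "keys (D + D') \<subseteq> keys D \<union> keys D'" by (rule Poly_Mapping.keys_add)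
  then show ?thesis
    by (subst (1 2 3) act_superset[of "keys D \<union> keys D'"])
      (auto simp: lookup_add algebra_simps sum.distrib)
qed

lemma act_diff_left: "act (D - D') E m = act D E m - act D' E m"
  using act_add_left[of "D - D'" D' E m] by simp

lemma act_add_right: "act D (\<lambda>m. E m + E' m) m = act D E m + act D E' m"
  by (simp add: act_def algebra_simps sum.distrib)

lemma act_diff_right: "act D (\<lambda>m. E m - E' m) m = act D E m - act D E' m"
  by (simp add: act_def algebra_simps sum_subtractf)

lemma act_sum_right: "act D (\<lambda>m. \<Sum>x\<in>A. E x m) m = (\<Sum>x\<in>A. act D (E x) m)"
  by (induction A rule: infinite_finite_induct) (auto simp: act_add_right)

lemma act_mult: "act (D * D') E = act D (act D' E)"
proof (induction D rule: poly_mapping_linear_induct)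
  case (single d c)
  have "act (single d c * D') E m = act (single d c) (act D' E) m" for m
  proof (induction D' rule: poly_mapping_linear_induct)
    case (single d' c')
    then show ?case by (simp add: mult_single act_single algebra_simps)
  next
    case (add f g)
    then show ?case by (simp add: distrib_left act_add_left act_single)
  qed (simp add: act_single)
  then show ?case by auto
qed (auto simp: distrib_right act_add_left fun_eq_iff)

lemma act_1 [simp]: "act 1 E = E"
  by (auto simp: single_one[symmetric] act_single fun_eq_iff simp del: single_one)

lemma act_lookup: "act D (lookup f) = lookup (D * f)"
proof (induction D rule: poly_mapping_linear_induct)
  case (single d c)
  have "act (single d c) (lookup f) m = lookup (single d c * f) m" for m
  proof (induction f rule: poly_mapping_linear_induct)
    case (single d' c')
    then show ?case
      by (auto simp: mult_single act_single lookup_single when_def algebra_simps)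
  next
    case (add f g)
    then show ?case by (simp add: distrib_left lookup_add act_single algebra_simps)
  qed (simp add: act_single)
  then show ?case by auto
qed (auto simp: distrib_right act_add_left lookup_add fun_eq_iff)

lemma act_commute: "act D (act D' E) = act D' (act D E)"
  by (metis act_mult mult.commute)

subsection \<open>Cones\<close>

text \<open>
  Cones, kernels and expansions depend on an ordering only through its pairs (earlier, later). Working
  with sets of such pairs makes it easy to compare different orderings.
\<close>

primrec bef :: "'a list \<Rightarrow> ('a \<times> 'a) set" where
  "bef [] = {}"
| "bef (x # xs) = {x} \<times> set xs \<union> bef xs"

lemma bef_conv_nth: "bef xs = {(xs ! a, xs ! b) | a b. a < b \<and> b < length xs}"
proof (induction xs)
  case (Cons x xs)
  show ?case
  proof (intro equalityI subsetI)
    fix p assume "p \<in> bef (x # xs)"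
    then consider y where "p = (x, y)" "y \<in> set xs" | "p \<in> bef xs" by auto
    then show "p \<in> {((x # xs) ! a, (x # xs) ! b) | a b. a < b \<and> b < length (x # xs)}"
    proof cases
      case 1
      then obtain b where "b < length xs" "p = ((x # xs) ! 0, (x # xs) ! Suc b)"
        by (auto simp: in_set_conv_nth)
      then show ?thesis by (intro CollectI exI[of _ 0] exI[of _ "Suc b"]) auto
    next
      case 2
      then obtain a b where "a < b" "b < length xs" "p = (xs ! a, xs ! b)" using Cons by auto
      then show ?thesis by (intro CollectI exI[of _ "Suc a"] exI[of _ "Suc b"]) auto
    qed
  next
    fix p assume "p \<in> {((x # xs) ! a, (x # xs) ! b) | a b. a < b \<and> b < length (x # xs)}"
    then obtain a b where ab: "a < b" "b < length (x # xs)" "p = ((x # xs) ! a, (x # xs) ! b)" by auto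
    then show "p \<in> bef (x # xs)" by (cases a; cases b) (auto simp: Cons)
  qed
qed simp

lemma bef_subset: "bef xs \<subseteq> set xs \<times> set xs"
  by (induction xs) auto

lemma bef_append: "bef (xs @ ys) = bef xs \<union> bef ys \<union> set xs \<times> set ys"
  by (induction xs) auto

lemma bef_filter: "bef (filter P xs) = {(u, v) \<in> bef xs. P u \<and> P v}"
  by (induction xs) auto

lemma bef_map: "bef (map f xs) = map_prod f f ` bef xs"
  by (induction xs) (auto simp: image_Un)

lemma finite_bef [simp]: "finite (bef xs)"
  by (rule finite_subset[OF bef_subset]) simp

lemma bef_irrefl: "distinct xs \<Longrightarrow> (u, v) \<in> bef xs \<Longrightarrow> u \<noteq> v"
  by (induction xs) auto

lemma bef_total: "u \<in> set xs \<Longrightarrow> v \<in> set xs \<Longrightarrow> u \<noteq> v \<Longrightarrow> (u, v) \<in> bef xs \<or> (v, u) \<in> bef xs"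
  by (induction xs) auto

lemma bef_antisym: "distinct xs \<Longrightarrow> (u, v) \<in> bef xs \<Longrightarrow> (v, u) \<notin> bef xs"
  using bef_subset by (induction xs) fastforce+

text \<open>The exponent of $z_v / z_u$.\<close>

definition shift :: "'i zvar \<Rightarrow> 'i zvar \<Rightarrow> 'i expo" where
  "shift u v = single v 1 - single u 1"

lemma cone_0: "0 \<in> cone vs"
  unfolding cone_def by (intro CollectI exI[of _ "\<lambda>_. 0"]) simp

lemma cone_add: "x \<in> cone vs \<Longrightarrow> y \<in> cone vs \<Longrightarrow> x + y \<in> cone vs"
proof -
  assume "x \<in> cone vs" "y \<in> cone vs"
  then obtain c d :: "nat \<Rightarrow> nat" where
    "x = (\<Sum>a<length vs - 1. single (vs ! Suc a) (int (c a)) - single (vs ! a) (int (c a)))"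
    "y = (\<Sum>a<length vs - 1. single (vs ! Suc a) (int (d a)) - single (vs ! a) (int (d a)))"
    unfolding cone_def by blast
  then show ?thesis unfolding cone_def
    by (intro CollectI exI[of _ "\<lambda>a. c a + d a"])
      (simp add: sum.distrib[symmetric] single_add algebra_simps)
qed

lemma cone_shift:
  assumes "(u, v) \<in> bef vs" shows "shift u v \<in> cone vs"
proof -
  obtain a b where ab: "a < b" "b < length vs" "u = vs ! a" "v = vs ! b"
    using assms unfolding bef_conv_nth by blast
  have "shift (vs ! a) (vs ! b) \<in> cone vs" using ab(1,2)
  proof (induction b)
    case (Suc b)
    have *: "shift (vs ! b) (vs ! Suc b) \<in> cone vs"
    proof -
      have "(\<Sum>c<length vs - 1. single (vs ! Suc c) (int (if c = b then 1 else 0)) - single (vs ! c) (int (if c = b then 1 else 0)))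
        = (\<Sum>c<length vs - 1. if c = b then shift (vs ! b) (vs ! Suc b) else 0)"
        by (rule sum.cong) (auto simp: shift_def)
      also have "\<dots> = shift (vs ! b) (vs ! Suc b)" using Suc.prems by (subst sum.delta) auto
      finally show ?thesis unfolding cone_def by (intro CollectI exI[of _ "\<lambda>c. if c = b then 1 else 0"]) simp
    qed
    show ?case
    proof (cases "a = b")
      case False
      then have "shift (vs ! a) (vs ! b) \<in> cone vs" using Suc by auto
      from cone_add[OF this *] show ?thesis by (simp add: shift_def)
    qed (use * in auto)
  qed simp
  then show ?thesis using ab by simp
qed

text \<open>
  The cone is generated by the ratios of neighbours, hence by all ratios $z_v / z_u$ with \<open>u\<close> before \<open>v\<close>.
\<close>

lemma cone_induct [consumes 1, case_names zero shift]:
  assumes "m \<in> cone vs" "P 0" "\<And>m u v. (u, v) \<in> bef vs \<Longrightarrow> P m \<Longrightarrow> P (m + shift u v)"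
  shows "P m"
proof -
  obtain c :: "nat \<Rightarrow> nat" where
    m: "m = (\<Sum>a<length vs - 1. single (vs ! Suc a) (int (c a)) - single (vs ! a) (int (c a)))"
    using assms(1) unfolding cone_def by blast
  have "P x \<Longrightarrow> P (x + (\<Sum>a<k. single (vs ! Suc a) (int (c a)) - single (vs ! a) (int (c a))))"
    if "k \<le> length vs - 1" for k x using that
  proof (induction k arbitrary: x)
    case (Suc k)
    have bef: "(vs ! k, vs ! Suc k) \<in> bef vs"
      using Suc.prems unfolding bef_conv_nth by (intro CollectI exI[of _ k] exI[of _ "Suc k"]) auto
    have "P y \<Longrightarrow> P (y + (single (vs ! Suc k) (int l) - single (vs ! k) (int l)))" for y l
    proof (induction l)
      case (Suc l)
      from assms(3)[OF bef Suc(1)[OF Suc(2)]] show ?case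
        by (simp add: shift_def single_add algebra_simps)
    qed simp
    from this[OF Suc.IH[OF Suc.prems(1)], of "c k"] Suc.prems(2) show ?case
      by (simp add: algebra_simps)
  qed simp
  from this[of "length vs - 1" 0] assms(2) show ?thesis by (simp add: m)
qed

lemma cone_mono:
  assumes "bef us \<subseteq> bef vs" shows "cone us \<subseteq> cone vs"
proof
  fix m assume "m \<in> cone us"
  then show "m \<in> cone vs"
    by (induction rule: cone_induct) (use assms in \<open>auto intro: cone_0 cone_add cone_shift\<close>)
qed

text \<open>
  For \<open>S\<close> an initial segment of the ordering this is nonnegative on the cone, and it is 1 on
  $z_v / z_u$ if the segment separates \<open>u\<close> from \<open>v\<close>.
\<close>

definition pweight :: "'i zvar set \<Rightarrow> 'i expo \<Rightarrow> int" where
  "pweight S m = - (\<Sum>x\<in>S. lookup m x)"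

lemma pweight_add: "pweight S (m + m') = pweight S m + pweight S m'"
  by (simp add: pweight_def lookup_add sum.distrib)

lemma pweight_shift:
  "finite S \<Longrightarrow> pweight S (shift u v) = (if u \<in> S then 1 else 0) - (if v \<in> S then 1 else 0)"
  by (auto simp: pweight_def shift_def lookup_minus lookup_single when_def sum_subtractf)

lemma pweight_prefix_nonneg:
  assumes "distinct vs" "(u, v) \<in> bef vs"
  shows "pweight (set (take k vs)) (shift u v) \<ge> 0"
proof -
  have "v \<in> set (take k vs) \<Longrightarrow> u \<in> set (take k vs)"
    using assms
  proof (induction vs arbitrary: k)
    case (Cons x vs)
    then show ?case using bef_subset[of vs] by (cases k) (auto dest: in_set_takeD)
  qed simp
  then show ?thesis by (auto simp: pweight_shift)
qed

lemma pweight_prefix_pos: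
  assumes "distinct vs" "(u, v) \<in> bef vs"
  obtains k where "pweight (set (take k vs)) (shift u v) = 1"
proof -
  obtain a b where ab: "a < b" "b < length vs" "u = vs ! a" "v = vs ! b"
    using assms(2) unfolding bef_conv_nth by blast
  have "u \<in> set (take b vs)" using ab by (auto simp: in_set_conv_nth)
  moreover have "v \<notin> set (take b vs)"
    using ab assms(1) by (auto simp: in_set_conv_nth distinct_conv_nth)
  ultimately show ?thesis using that[of b] by (auto simp: pweight_shift)
qed

text \<open>
  For \<open>K\<close> a cone this is the support condition on expansions. Smaller sets \<open>K\<close> record which ratios of
  variables a series really involves.
\<close>

definition bdd :: "'i expo set \<Rightarrow> ('i, 'k::zero) series \<Rightarrow> bool" where
  "bdd K E \<longleftrightarrow> (\<exists>M. finite M \<and> (\<forall>m. E m \<noteq> 0 \<longrightarrow> (\<exists>m0\<in>M. m - m0 \<in> K)))"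

lemma bddI: "finite M \<Longrightarrow> (\<And>m. E m \<noteq> 0 \<Longrightarrow> \<exists>m0\<in>M. m - m0 \<in> K) \<Longrightarrow> bdd K E"
  unfolding bdd_def by blast

lemma bdd_mono: "bdd K E \<Longrightarrow> K \<subseteq> K' \<Longrightarrow> bdd K' E"
  unfolding bdd_def by (meson subsetD)

lemma bdd_add: 
  fixes E E' :: "('i, 'k::comm_ring_1) series"
  assumes "bdd K E" "bdd K E'" shows "bdd K (\<lambda>m. E m + E' m)"
proof -
  obtain M M' where *: "finite M" "\<forall>m. E m \<noteq> 0 \<longrightarrow> (\<exists>m0\<in>M. m - m0 \<in> K)"
    "finite M'" "\<forall>m. E' m \<noteq> 0 \<longrightarrow> (\<exists>m0\<in>M'. m - m0 \<in> K)"
    using assms unfolding bdd_def by blast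
  have "\<exists>m0\<in>M \<union> M'. m - m0 \<in> K" if "E m + E' m \<noteq> 0" for m
  proof -
    have "E m \<noteq> 0 \<or> E' m \<noteq> 0" using that by auto
    then show ?thesis using *(2,4) by blast
  qed
  then show ?thesis using *(1,3) by (intro bddI[of "M \<union> M'"]) auto
qed

lemma bdd_diff:
  fixes E E' :: "('i, 'k::comm_ring_1) series"
  assumes "bdd K E" "bdd K E'" shows "bdd K (\<lambda>m. E m - E' m)"
proof -
  have "bdd K (\<lambda>m. - E' m)" using assms(2) unfolding bdd_def by simp
  from bdd_add[OF assms(1) this] show ?thesis by simp
qed

lemma bdd_act: 
  fixes E :: "('i, 'k::comm_ring_1) series"
  assumes "bdd K E" shows "bdd K (act D E)"
proof -
  obtain M where M: "finite M" "\<forall>m. E m \<noteq> 0 \<longrightarrow> (\<exists>m0\<in>M. m - m0 \<in> K)"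
    using assms unfolding bdd_def by blast
  show ?thesis
  proof (rule bddI[of "(\<lambda>(d, m). d + m) ` (keys D \<times> M)"])
    fix m assume "act D E m \<noteq> 0"
    then obtain d where d: "d \<in> keys D" "E (m - d) \<noteq> 0"
      unfolding act_def by (metis (no_types, lifting) mult_zero_right sum.neutral)
    then obtain m0 where "m0 \<in> M" "m - d - m0 \<in> K" using M by blast
    then show "\<exists>m0\<in>(\<lambda>(d, m). d + m) ` (keys D \<times> M). m - m0 \<in> K"
      using d by (intro bexI[of _ "d + m0"]) (auto simp: algebra_simps)
  qed (use M in auto)
qed

lemma bdd_lookup: "0 \<in> K \<Longrightarrow> bdd K (lookup f)"
  by (rule bddI[of "keys f"]) (auto simp: in_keys_iff intro!: bexI)

subsection \<open>Torsion-freeness\<close>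

text \<open>
  In the lowest weight that occurs in \<open>E\<close>, multiplication by \<open>D\<close> is multiplication by the single lowest
  monomial of \<open>D\<close>.
\<close>

lemma unique_minimum_injective:
  fixes E :: "('i, 'k::idom) series" and \<gamma> :: "'i expo \<Rightarrow> int"
  assumes add: "\<And>a b. \<gamma> (a + b) = \<gamma> a + \<gamma> b"
    and low: "\<And>m. E m \<noteq> 0 \<Longrightarrow> \<gamma> m \<ge> L"
    and d0: "d0 \<in> keys D" "\<And>d. d \<in> keys D \<Longrightarrow> d \<noteq> d0 \<Longrightarrow> \<gamma> d > \<gamma> d0"
    and "act D E = (\<lambda>_. 0)"
  shows "E = (\<lambda>_. 0)"
proof (rule ccontr)
  assume "E \<noteq> (\<lambda>_. 0)"
  then obtain m where m: "E m \<noteq> 0" by auto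
  have diff: "\<gamma> (a - b) = \<gamma> a - \<gamma> b" for a b using add[of "a - b" b] by simp
  obtain m where m: "E m \<noteq> 0" "\<And>m'. E m' \<noteq> 0 \<Longrightarrow> nat (\<gamma> m - L) \<le> nat (\<gamma> m' - L)"
    using ex_has_least_nat[of "\<lambda>m. E m \<noteq> 0" m "\<lambda>m. nat (\<gamma> m - L)"] m by blast
  have "lookup D d * E (m + d0 - d) = (if d = d0 then lookup D d0 * E m else 0)" if "d \<in> keys D" for d
  proof (cases "d = d0")
    case False
    have "E (m + d0 - d) = 0"
    proof (rule ccontr)
      assume *: "E (m + d0 - d) \<noteq> 0"
      from m(2)[OF this] low[OF this] low[OF m(1)] d0(2)[OF that False] show False
        by (simp add: diff add)
    qed
    then show ?thesis using False by simp
  qed simp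
  then have "act D E (m + d0) = lookup D d0 * E m"
    unfolding act_def using d0(1) by (simp add: sum.delta)
  then show False using assms(5) m(1) d0(1) by (simp add: fun_eq_iff in_keys_iff)
qed

text \<open>
  At the first position of the ordering where the two exponents differ, the weight of the initial
  segment ending there separates them. If they agree on the whole ordering, the exponent of a variable
  outside it does, and that is zero on the cone.
\<close>

lemma separating_weight:
  fixes d d' :: "'i expo"
  assumes "distinct vs" "d \<noteq> d'"
  obtains \<gamma> :: "'i expo \<Rightarrow> int" where "\<And>a b. \<gamma> (a + b) = \<gamma> a + \<gamma> b"
    "\<And>m. m \<in> cone vs \<Longrightarrow> \<gamma> m \<ge> 0" "\<gamma> d \<noteq> \<gamma> d'"
proof (cases "\<exists>a<length vs. lookup d (vs ! a) \<noteq> lookup d' (vs ! a)")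
  case True
  define a where "a = (LEAST a. a < length vs \<and> lookup d (vs ! a) \<noteq> lookup d' (vs ! a))"
  have a: "a < length vs \<and> lookup d (vs ! a) \<noteq> lookup d' (vs ! a)"
    unfolding a_def by (rule LeastI_ex) (use True in auto)
  have less: "lookup d (vs ! b) = lookup d' (vs ! b)" if "b < a" for b
    using not_less_Least[of b "\<lambda>a. a < length vs \<and> lookup d (vs ! a) \<noteq> lookup d' (vs ! a)"] that a
    unfolding a_def[symmetric] by auto
  show ?thesis
  proof (rule that[of "pweight (set (take (Suc a) vs))"])
    show "pweight (set (take (Suc a) vs)) m \<ge> 0" if "m \<in> cone vs" for m
      using that pweight_prefix_nonneg[OF assms(1)]
      by (induction rule: cone_induct) (force simp: pweight_add pweight_def[of _ 0])+
    have *: "set (take (Suc a) vs) = insert (vs ! a) (set (take a vs))"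
      using a by (simp add: take_Suc_conv_app_nth)
    have "vs ! a \<notin> set (take a vs)" using a assms(1) by (auto simp: in_set_conv_nth distinct_conv_nth)
    moreover have "(\<Sum>x\<in>set (take a vs). lookup d x) = (\<Sum>x\<in>set (take a vs). lookup d' x)"
      by (rule sum.cong) (auto simp: in_set_conv_nth less)
    ultimately show "pweight (set (take (Suc a) vs)) d \<noteq> pweight (set (take (Suc a) vs)) d'"
      using a by (simp add: pweight_def *)
  qed (rule pweight_add)
next
  case False
  obtain v where v: "lookup d v \<noteq> lookup d' v" using assms(2) by (meson poly_mapping_eqI)
  then have "v \<notin> set vs" using False by (auto simp: in_set_conv_nth)
  have "lookup m v = 0" if "m \<in> cone vs" for m
    using that bef_subset[of vs] \<open>v \<notin> set vs\<close>
    by (induction rule: cone_induct) (auto simp: lookup_add shift_def lookup_minus lookup_single when_def)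
  then show ?thesis using v by (intro that[of "\<lambda>m. lookup m v"]) (auto simp: lookup_add)
qed

text \<open>
  If \<open>D\<close> has at least two monomials, choose a weight that is nonnegative on the cone and separates them.
  The lowest part of a nonzero \<open>E\<close> is then annihilated by the lowest part of \<open>D\<close>, which has fewer
  monomials.
\<close>

lemma torsion_free:
  fixes E :: "('i, 'k::idom) series"
  assumes "distinct vs" "bdd (cone vs) E" "D \<noteq> 0" "act D E = (\<lambda>_. 0)"
  shows "E = (\<lambda>_. 0)"
  using assms(2-)
proof (induction "card (keys D)" arbitrary: D E rule: less_induct)
  case less
  show ?case
  proof (cases "\<exists>d\<in>keys D. \<exists>d'\<in>keys D. d \<noteq> d'")
    case False
    obtain d where "d \<in> keys D" using less.prems(2) by (metis ex_in_conv keys_eq_empty)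
    then have "keys D = {d}" using False by auto
    have "E m = 0" for m
    proof -
      have "act D E (m + d) = lookup D d * E m" unfolding act_def \<open>keys D = {d}\<close> by simp
      then show ?thesis using less.prems(3) \<open>d \<in> keys D\<close> by (auto simp: in_keys_iff fun_eq_iff)
    qed
    then show ?thesis by auto
  next
    case True
    then obtain d d' where d: "d \<in> keys D" "d' \<in> keys D" "d \<noteq> d'" by blast
    obtain \<gamma> :: "'i expo \<Rightarrow> int" where add: "\<And>a b. \<gamma> (a + b) = \<gamma> a + \<gamma> b"
      and cone: "\<And>m. m \<in> cone vs \<Longrightarrow> \<gamma> m \<ge> 0" and dd: "\<gamma> d \<noteq> \<gamma> d'"
      using separating_weight[OF assms(1) d(3)] by metis
    have diff: "\<gamma> (a - b) = \<gamma> a - \<gamma> b" for a b using add[of "a - b" b] by simp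
    show ?thesis
    proof (rule ccontr)
      assume E: "E \<noteq> (\<lambda>_. 0)"
      obtain M where M: "finite M" "\<forall>m. E m \<noteq> 0 \<longrightarrow> (\<exists>m0\<in>M. m - m0 \<in> cone vs)"
        using less.prems(1) unfolding bdd_def by blast
      have low: "\<gamma> m \<ge> Min (\<gamma> ` M)" if m: "E m \<noteq> 0" for m
      proof -
        obtain m0 where m0: "m0 \<in> M" "m - m0 \<in> cone vs" using M m by blast
        have "\<gamma> m0 \<ge> Min (\<gamma> ` M)" using M m0 by auto
        then show ?thesis using cone[OF m0(2)] by (simp add: diff)
      qed
      define L where "L = Min (\<gamma> ` M)"
      obtain m1 where "E m1 \<noteq> 0" using E by auto
      then obtain m where m: "E m \<noteq> 0" "\<And>m'. E m' \<noteq> 0 \<Longrightarrow> nat (\<gamma> m - L) \<le> nat (\<gamma> m' - L)"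
        using ex_has_least_nat[of "\<lambda>m. E m \<noteq> 0" m1 "\<lambda>m. nat (\<gamma> m - L)"] by blast
      define e where "e = \<gamma> m"
      have e: "\<gamma> m' \<ge> e" if "E m' \<noteq> 0" for m'
        using m(2)[OF that] low[OF that] low[OF m(1)] unfolding e_def L_def by linarith
      define \<delta> where "\<delta> = Min (\<gamma> ` keys D)"
      have \<delta>: "\<gamma> d \<ge> \<delta>" if "d \<in> keys D" for d unfolding \<delta>_def using that by auto
      have "\<delta> \<in> \<gamma> ` keys D" unfolding \<delta>_def using d by (intro Min_in) auto
      then obtain d1 where d1: "d1 \<in> keys D" "\<gamma> d1 = \<delta>" by auto
      define D1 where "D1 = (\<Sum>d | d \<in> keys D \<and> \<gamma> d = \<delta>. single d (lookup D d))"
      have lD1: "lookup D1 d = (if \<gamma> d = \<delta> then lookup D d else 0)" for d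
        unfolding D1_def by (auto simp: lookup_sum lookup_single when_def in_keys_iff)
      have kD1: "keys D1 = {d \<in> keys D. \<gamma> d = \<delta>}" by (auto simp: in_keys_iff lD1 split: if_splits)
      define E1 where "E1 = (\<lambda>m. if \<gamma> m = e then E m else 0)"
      have "d \<notin> keys D1 \<or> d' \<notin> keys D1" using dd by (auto simp: kD1)
      then have "keys D1 \<subset> keys D" using d kD1 by auto
      then have card: "card (keys D1) < card (keys D)" by (simp add: psubset_card_mono)
      have "D1 \<noteq> 0" using d1 lD1[of d1] by (auto simp: in_keys_iff)
      have "bdd (cone vs) E1" using M unfolding E1_def by (intro bddI[of M]) (auto split: if_splits)
      have "act D1 E1 x = 0" for x
      proof (cases "\<gamma> x = e + \<delta>")
        case True
        have "act D1 E1 x = (\<Sum>d\<in>keys D. lookup D1 d * E1 (x - d))"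
          by (rule act_superset) (auto simp: kD1)
        also have "\<dots> = act D E x" unfolding act_def
        proof (rule sum.cong)
          fix d assume dk: "d \<in> keys D"
          show "lookup D1 d * E1 (x - d) = lookup D d * E (x - d)"
          proof (cases "\<gamma> d = \<delta>")
            case False
            have "E (x - d) = 0" using e[of "x - d"] \<delta>[OF dk] False True by (auto simp: diff)
            then show ?thesis by (simp add: lD1 False)
          qed (simp add: lD1 E1_def True diff)
        qed simp
        finally show ?thesis using less.prems(3) by simp
      next
        case False
        then show ?thesis unfolding act_def by (intro sum.neutral) (auto simp: kD1 E1_def diff)
      qed
      then have "E1 = (\<lambda>_. 0)"
        using less.hyps[OF card \<open>bdd (cone vs) E1\<close> \<open>D1 \<noteq> 0\<close>] by auto
      then show False using m(1) by (auto simp: E1_def e_def fun_eq_iff split: if_splits)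
    qed
  qed
qed

subsection \<open>Expansions\<close>

lemma is_expansion_iff:
  "is_expansion vs F E \<longleftrightarrow>
     bdd (cone vs) E \<and> (\<exists>N D. D \<noteq> 0 \<and> rat D * F = rat N \<and> act D E = lookup N)"
proof -
  have "F = Fraction_Field.Fract N D \<longleftrightarrow> rat D * F = rat N" if "D \<noteq> 0" for N D
    using that by (auto simp: Fract_eq_divide field_simps)
  then have "(\<exists>N D. D \<noteq> 0 \<and> F = Fraction_Field.Fract N D \<and>
        (\<forall>m. (\<Sum>d\<in>keys D. lookup D d * E (m - d)) = lookup N m)) \<longleftrightarrow>
      (\<exists>N D. D \<noteq> 0 \<and> rat D * F = rat N \<and> act D E = lookup N)"
    by (intro ex_cong1 conj_cong refl) (auto simp: fun_eq_iff act_def)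
  then show ?thesis unfolding is_expansion_def bdd_def by (rule arg_cong)
qed

text \<open>
  Both series satisfy the same equation after multiplication by both denominators, and denominators
  act injectively.
\<close>

lemma is_expansion_unique:
  assumes "distinct vs" "is_expansion vs F E" "is_expansion vs F E'"
  shows "E = E'"
proof -
  obtain N D where 1: "bdd (cone vs) E" "D \<noteq> 0" "rat D * F = rat N" "act D E = lookup N"
    using assms(2) unfolding is_expansion_iff by blast
  obtain N' D' where 2: "bdd (cone vs) E'" "D' \<noteq> 0" "rat D' * F = rat N'" "act D' E' = lookup N'"
    using assms(3) unfolding is_expansion_iff by blast
  have "rat (D' * N) = rat (D * N')" by (simp add: rat_mult flip: 1(3) 2(3))
  then have "act (D * D') E = act (D * D') E'"
    by (metis 1(4) 2(4) act_lookup act_mult act_commute rat_eq_iff)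
  then have "act (D * D') (\<lambda>m. E m - E' m) = (\<lambda>_. 0)" by (auto simp: act_diff_right fun_eq_iff)
  from torsion_free[OF assms(1) bdd_diff[OF 1(1) 2(1)] _ this] 1(2) 2(2) show ?thesis
    by (auto simp: fun_eq_iff)
qed

definition expn :: "'i zvar list \<Rightarrow> ('i, 'k::field) ratfun \<Rightarrow> ('i, 'k) series" where
  "expn vs F = (THE E. is_expansion vs F E)"

lemma expn_eqI: "distinct vs \<Longrightarrow> is_expansion vs F E \<Longrightarrow> expn vs F = E"
  unfolding expn_def using is_expansion_unique by blast

lemma constant_term_eq:
  assumes "distinct vs" "is_expansion vs F E" shows "constant_term vs F = expn vs F 0"
  unfolding constant_term_def expn_eqI[OF assms] using assms is_expansion_unique by blast

definition expandable :: "'i zvar list \<Rightarrow> ('i, 'k::field) ratfun \<Rightarrow> bool" where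
  "expandable vs F \<longleftrightarrow> (\<exists>E. is_expansion vs F E)"

lemma is_expansion_expn: "distinct vs \<Longrightarrow> expandable vs F \<Longrightarrow> is_expansion vs F (expn vs F)"
  unfolding expandable_def using expn_eqI by metis

lemma is_expansion_rat: "is_expansion vs (rat f) (lookup f)"
  unfolding is_expansion_iff
  by (intro conjI bdd_lookup cone_0 exI[of _ f] exI[of _ 1]) simp_all

lemma is_expansion_add:
  assumes "is_expansion vs F E" "is_expansion vs F' E'"
  shows "is_expansion vs (F + F') (\<lambda>m. E m + E' m)"
proof -
  obtain N D where 1: "bdd (cone vs) E" "D \<noteq> 0" "rat D * F = rat N" "act D E = lookup N"
    using assms(1) unfolding is_expansion_iff by blast
  obtain N' D' where 2: "bdd (cone vs) E'" "D' \<noteq> 0" "rat D' * F' = rat N'" "act D' E' = lookup N'"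
    using assms(2) unfolding is_expansion_iff by blast
  have "rat (D * D') * (F + F') = rat (D' * N + D * N')"
    by (simp add: rat_mult rat_add algebra_simps flip: 1(3) 2(3))
  moreover have "act (D * D') (\<lambda>m. E m + E' m) = lookup (D' * N + D * N')"
  proof
    fix m
    have "act (D * D') E = lookup (D' * N)" "act (D * D') E' = lookup (D * N')"
      by (metis 1(4) 2(4) act_lookup act_mult act_commute)+
    then show "act (D * D') (\<lambda>m. E m + E' m) m = lookup (D' * N + D * N') m"
      by (simp add: act_add_right lookup_add)
  qed
  ultimately show ?thesis unfolding is_expansion_iff using 1 2 bdd_add[OF 1(1) 2(1)]
    by (intro conjI exI[of _ "D' * N + D * N'"] exI[of _ "D * D'"]) auto
qed

lemma is_expansion_act:
  assumes "is_expansion vs F E"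
  shows "is_expansion vs (rat f * F) (act f E)"
proof -
  obtain N D where 1: "bdd (cone vs) E" "D \<noteq> 0" "rat D * F = rat N" "act D E = lookup N"
    using assms unfolding is_expansion_iff by blast
  have "rat D * (rat f * F) = rat (f * N)" by (simp add: rat_mult algebra_simps flip: 1(3))
  moreover have "act D (act f E) = lookup (f * N)" by (metis 1(4) act_commute act_lookup)
  ultimately show ?thesis unfolding is_expansion_iff using 1 bdd_act by blast
qed

lemma is_expansion_mono:
  assumes "is_expansion us F E" "bef us \<subseteq> bef vs" shows "is_expansion vs F E"
  using assms cone_mono bdd_mono unfolding is_expansion_iff by blast

lemma expandable_rat: "expandable vs (rat f)"
  using is_expansion_rat unfolding expandable_def by blast

lemma expandable_add: "expandable vs F \<Longrightarrow> expandable vs F' \<Longrightarrow> expandable vs (F + F')"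
  using is_expansion_add unfolding expandable_def by blast

lemma expandable_sum: "(\<And>x. x \<in> A \<Longrightarrow> expandable vs (F x)) \<Longrightarrow> expandable vs (\<Sum>x\<in>A. F x)"
  using expandable_rat[of vs 0] by (induction A rule: infinite_finite_induct) (auto intro: expandable_add)

lemma expn_rat: "distinct vs \<Longrightarrow> expn vs (rat f) = lookup f"
  by (rule expn_eqI) (auto intro: is_expansion_rat)

lemma expn_0: "distinct vs \<Longrightarrow> expn vs 0 = (\<lambda>_. 0)"
  using expn_rat[of vs 0] by (auto simp: fun_eq_iff)

lemma expn_add: "distinct vs \<Longrightarrow> expandable vs F \<Longrightarrow> expandable vs F' \<Longrightarrow>
    expn vs (F + F') = (\<lambda>m. expn vs F m + expn vs F' m)"
  by (intro expn_eqI is_expansion_add is_expansion_expn)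

lemma expn_mult: "distinct vs \<Longrightarrow> expandable vs F \<Longrightarrow> expn vs (rat f * F) = act f (expn vs F)"
  by (intro expn_eqI is_expansion_act is_expansion_expn)

lemma expn_sum: "distinct vs \<Longrightarrow> (\<And>x. x \<in> A \<Longrightarrow> expandable vs (F x)) \<Longrightarrow>
    expn vs (\<Sum>x\<in>A. F x) = (\<lambda>m. \<Sum>x\<in>A. expn vs (F x) m)"
  by (induction A rule: infinite_finite_induct)
    (auto simp: expn_0 expn_add expandable_sum)

lemma expn_mono: "distinct vs \<Longrightarrow> bef us \<subseteq> bef vs \<Longrightarrow> distinct us \<Longrightarrow> expandable us F \<Longrightarrow> expn vs F = expn us F"
  by (rule expn_eqI, assumption, rule is_expansion_mono, rule is_expansion_expn)

primrec geom :: "'k::comm_ring_1 \<Rightarrow> 'i expo \<Rightarrow> ('i, 'k) series \<Rightarrow> nat \<Rightarrow> ('i, 'k) series" where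
  "geom q w E 0 m = 0"
| "geom q w E (Suc k) m = E m + q * geom q w E k (m - w)"

text \<open>
  Division by $1 - q z_v / z_u$. In a weight in which $z_v / z_u$ has degree 1 and \<open>E\<close> is bounded below,
  each coefficient of the partial sums becomes stationary. The support stays in translates of any \<open>K\<close>
  that is stable under $z_v / z_u$.
\<close>

lemma geometric_series:
  fixes E :: "('i, 'k::comm_ring_1) series"
  assumes vs: "distinct vs" and uv: "(u, v) \<in> bef vs"
    and K: "K \<subseteq> cone vs" "\<And>m. m \<in> K \<Longrightarrow> m + shift u v \<in> K" and E: "bdd K E"
  obtains E' where "bdd K E'" "act (1 - single (shift u v) q) E' = E"
proof -
  obtain k where k: "pweight (set (take k vs)) (shift u v) = 1"
    using pweight_prefix_pos[OF vs uv] .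
  define \<gamma> where "\<gamma> = pweight (set (take k vs))"
  have add: "\<gamma> (a + b) = \<gamma> a + \<gamma> b" for a b by (simp add: \<gamma>_def pweight_add)
  have diff: "\<gamma> (a - b) = \<gamma> a - \<gamma> b" for a b using add[of "a - b" b] by simp
  have cone: "\<gamma> m \<ge> 0" if "m \<in> cone vs" for m
    using that pweight_prefix_nonneg[OF vs]
    by (induction rule: cone_induct) (force simp: \<gamma>_def pweight_add pweight_def[of _ 0])+
  let ?w = "shift u v"
  have w: "\<gamma> ?w = 1" using k by (simp add: \<gamma>_def)
  obtain M where M: "finite M" "\<forall>m. E m \<noteq> 0 \<longrightarrow> (\<exists>m0\<in>M. m - m0 \<in> K)"
    using E unfolding bdd_def by blast
  define L where "L = Min (\<gamma> ` M)"
  have low: "\<gamma> m \<ge> L" if m: "E m \<noteq> 0" for m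
  proof -
    obtain m0 where m0: "m0 \<in> M" "m - m0 \<in> K" using M m by blast
    have "\<gamma> m0 \<ge> L" using M m0 by (auto simp: L_def)
    moreover have "\<gamma> (m - m0) \<ge> 0" using cone K m0 by blast
    ultimately show ?thesis by (simp add: diff)
  qed
  have zero: "geom q ?w E k m = 0" if "\<gamma> m < L" for k m using that
  proof (induction k arbitrary: m)
    case (Suc k)
    then show ?case using low[of m] by (auto simp: diff w)
  qed simp
  have stable: "geom q ?w E k m = geom q ?w E (Suc k) m" if "\<gamma> m < L + int k" for k m using that
  proof (induction k arbitrary: m)
    case 0
    then show ?case using zero[of m "Suc 0"] by simp
  next
    case (Suc k)
    have "geom q ?w E k (m - ?w) = geom q ?w E (Suc k) (m - ?w)"
      using Suc.prems by (intro Suc.IH) (simp add: diff w)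
    then show ?case by (simp only: geom.simps)
  qed
  define B where "B m = nat (\<gamma> m - L + 1)" for m
  define E' where "E' m = geom q ?w E (B m) m" for m
  have "E' m = E m + q * E' (m - ?w)" for m
  proof (cases "\<gamma> m < L")
    case True
    then have "\<gamma> (m - ?w) < L" by (simp add: diff w)
    then show ?thesis using zero low[of m] True by (auto simp: E'_def)
  next
    case False
    have "B m = Suc (B (m - ?w))" using False by (simp add: B_def diff w)
    then show ?thesis by (simp add: E'_def)
  qed
  note unroll = this
  have "act (1 - single ?w q) E' m = E m" for m
    by (subst act_diff_left, subst act_1, subst act_single, subst unroll) simp
  then have "act (1 - single ?w q) E' = E" by auto
  moreover have "bdd K E'"
  proof (rule bddI[OF M(1)])
    have "\<exists>m0\<in>M. m - m0 \<in> K" if "geom q ?w E k m \<noteq> 0" for k m using that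
    proof (induction k arbitrary: m)
      case (Suc k)
      show ?case
      proof (cases "E m = 0")
        case True
        then have "geom q ?w E k (m - ?w) \<noteq> 0" using Suc.prems by auto
        then obtain m0 where m0: "m0 \<in> M" "m - ?w - m0 \<in> K" using Suc.IH by blast
        from K(2)[OF this(2)] m0(1) show ?thesis by (auto simp: algebra_simps)
      qed (use M in blast)
    qed simp
    then show "\<exists>m0\<in>M. m - m0 \<in> K" if "E' m \<noteq> 0" for m using that unfolding E'_def by blast
  qed
  ultimately show ?thesis using that by blast
qed

section \<open>Gradings\<close>

definition pcomp :: "('i expo \<Rightarrow> 'g) \<Rightarrow> 'g \<Rightarrow> ('i, 'k::comm_ring_1) laurent \<Rightarrow> ('i, 'k) laurent" where
  "pcomp \<gamma> g f = (\<Sum>m | m \<in> keys f \<and> \<gamma> m = g. single m (lookup f m))"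

definition scomp :: "('i expo \<Rightarrow> 'g) \<Rightarrow> 'g \<Rightarrow> ('i, 'k::comm_ring_1) series \<Rightarrow> ('i, 'k) series" where
  "scomp \<gamma> g E m = (if \<gamma> m = g then E m else 0)"

lemma lookup_pcomp: "lookup (pcomp \<gamma> g f) m = (if \<gamma> m = g then lookup f m else 0)"
  unfolding pcomp_def by (auto simp: lookup_sum lookup_single when_def in_keys_iff)

lemma scomp_lookup: "scomp \<gamma> g (lookup f) = lookup (pcomp \<gamma> g f)"
  by (auto simp: scomp_def lookup_pcomp fun_eq_iff)

lemma keys_pcomp: "keys (pcomp \<gamma> g f) = {m \<in> keys f. \<gamma> m = g}"
  by (auto simp: in_keys_iff lookup_pcomp split: if_splits)

lemma pcomp_0 [simp]: "pcomp \<gamma> g 0 = 0"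
  by (simp add: pcomp_def)

lemma pcomp_add: "pcomp \<gamma> g (f + f') = pcomp \<gamma> g f + pcomp \<gamma> g f'"
  by (rule poly_mapping_eqI) (simp add: lookup_pcomp lookup_add)

lemma pcomp_sum: "pcomp \<gamma> g (\<Sum>x\<in>A. f x) = (\<Sum>x\<in>A. pcomp \<gamma> g (f x))"
  by (induction A rule: infinite_finite_induct) (auto simp: pcomp_add)

lemma pcomp_decompose:
  assumes "finite G" "\<gamma> ` keys f \<subseteq> G"
  shows "f = (\<Sum>g\<in>G. pcomp \<gamma> g f)"
proof (rule poly_mapping_eqI)
  fix m
  show "lookup f m = lookup (\<Sum>g\<in>G. pcomp \<gamma> g f) m"
    using assms by (cases "m \<in> keys f") (auto simp: lookup_sum lookup_pcomp in_keys_iff)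
qed

definition homdeg :: "('i expo \<Rightarrow> 'g) \<Rightarrow> 'g \<Rightarrow> ('i, 'k::comm_ring_1) laurent \<Rightarrow> bool" where
  "homdeg \<gamma> g f \<longleftrightarrow> (\<forall>m\<in>keys f. \<gamma> m = g)"

locale grading =
  fixes \<gamma> :: "'i expo \<Rightarrow> 'g::ab_group_add"
  assumes add: "\<gamma> (a + b) = \<gamma> a + \<gamma> b"
begin

lemma zero: "\<gamma> 0 = 0"
  using add[of 0 0] by simp

lemma diff: "\<gamma> (a - b) = \<gamma> a - \<gamma> b"
  using add[of "a - b" b] by (simp add: algebra_simps)

lemma uminus: "\<gamma> (- b) = - \<gamma> b"
  using diff[of 0 b] by (simp add: zero)

lemma homdeg_1: "homdeg \<gamma> 0 1"
  by (auto simp: homdeg_def zero)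

lemma homdeg_single: "\<gamma> m = g \<Longrightarrow> homdeg \<gamma> g (single m c)"
  by (auto simp: homdeg_def)

lemma homdeg_diff: "homdeg \<gamma> g f \<Longrightarrow> homdeg \<gamma> g f' \<Longrightarrow> homdeg \<gamma> g (f - f')"
  unfolding homdeg_def by (metis in_keys_iff lookup_minus diff_self)

lemma homdeg_mult: "homdeg \<gamma> g f \<Longrightarrow> homdeg \<gamma> g' f' \<Longrightarrow> homdeg \<gamma> (g + g') (f * f')"
  using Poly_Mapping.keys_mult[of f f'] unfolding homdeg_def by (force simp: add)

lemma homdeg_prod: "(\<And>x. x \<in> A \<Longrightarrow> homdeg \<gamma> 0 (f x)) \<Longrightarrow> homdeg \<gamma> 0 (\<Prod>x\<in>A. f x)"
proof (induction A rule: infinite_finite_induct)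
  case (insert x A)
  then show ?case using homdeg_mult[of 0 "f x" 0 "\<Prod>x\<in>A. f x"] by auto
qed (auto intro: homdeg_1)

lemma scomp_act:
  assumes "homdeg \<gamma> h D" shows "scomp \<gamma> (h + g) (act D E) = act D (scomp \<gamma> g E)"
proof
  fix m
  show "scomp \<gamma> (h + g) (act D E) m = act D (scomp \<gamma> g E) m"
  proof (cases "\<gamma> m = h + g")
    case True
    then have "lookup D d * E (m - d) = lookup D d * scomp \<gamma> g E (m - d)" if "d \<in> keys D" for d
      using assms that by (simp add: scomp_def homdeg_def diff)
    then show ?thesis using True by (simp add: scomp_def[of _ "h + g"] act_def)
  next
    case False
    then have "scomp \<gamma> g E (m - d) = 0" if "d \<in> keys D" for d
      using assms that by (auto simp: scomp_def homdeg_def diff)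
    then show ?thesis using False by (simp add: scomp_def[of _ "h + g"] act_def)
  qed
qed

lemma scomp_act_0: "homdeg \<gamma> 0 D \<Longrightarrow> scomp \<gamma> g (act D E) = act D (scomp \<gamma> g E)"
  using scomp_act[of 0 D g E] by simp

lemma pcomp_mult: "homdeg \<gamma> h D \<Longrightarrow> pcomp \<gamma> (h + g) (D * f) = D * pcomp \<gamma> g f"
  using scomp_act[of h D g "lookup f"] unfolding act_lookup scomp_lookup
  by (simp only: lookup_inject)

lemma pcomp_mult_0: "homdeg \<gamma> 0 D \<Longrightarrow> pcomp \<gamma> g (D * f) = D * pcomp \<gamma> g f"
  using pcomp_mult[of 0 D g f] by simp

lemma homdeg_pcomp: "homdeg \<gamma> g (pcomp \<gamma> g f)"
  by (auto simp: homdeg_def keys_pcomp)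

end

lemma bdd_scomp: "bdd K E \<Longrightarrow> bdd K (scomp \<gamma> g E)"
  unfolding bdd_def scomp_def by (auto split: if_splits)

definition restrict_exp :: "'i zvar set \<Rightarrow> 'i expo \<Rightarrow> 'i expo" where
  "restrict_exp X m = (\<Sum>v | v \<in> keys m \<and> v \<in> X. single v (lookup m v))"

lemma lookup_restrict_exp: "lookup (restrict_exp X m) v = (if v \<in> X then lookup m v else 0)"
  unfolding restrict_exp_def by (auto simp: lookup_sum lookup_single when_def in_keys_iff)

interpretation restrict_exp: grading "restrict_exp X"
  by unfold_locales (rule poly_mapping_eqI, simp add: lookup_restrict_exp lookup_add)

lemma restrict_exp_eq_0: "keys m \<inter> X = {} \<Longrightarrow> restrict_exp X m = 0"
  by (rule poly_mapping_eqI) (auto simp: lookup_restrict_exp in_keys_iff)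

lemma restrict_exp_id: "keys m \<subseteq> X \<Longrightarrow> restrict_exp X m = m"
  by (rule poly_mapping_eqI) (auto simp: lookup_restrict_exp in_keys_iff)

lemma keys_restrict_exp: "keys (restrict_exp X m) = keys m \<inter> X"
  by (auto simp: in_keys_iff lookup_restrict_exp split: if_splits)

definition laurents_in :: "'i zvar set \<Rightarrow> ('i, 'k::comm_ring_1) laurent set" where
  "laurents_in X = {f. \<forall>m\<in>keys f. keys m \<subseteq> X}"

lemma laurents_eq: "laurents n = laurents_in (zvars n)"
  by (simp add: laurents_def laurents_in_def)

lemma laurents_in_0 [simp]: "0 \<in> laurents_in X"
  and laurents_in_1 [simp]: "1 \<in> laurents_in X"
  by (auto simp: laurents_in_def)

lemma laurents_in_single: "keys m \<subseteq> X \<Longrightarrow> single m c \<in> laurents_in X"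
  by (auto simp: laurents_in_def)

lemma laurents_in_add: "f \<in> laurents_in X \<Longrightarrow> f' \<in> laurents_in X \<Longrightarrow> f + f' \<in> laurents_in X"
  using Poly_Mapping.keys_add[of f f'] unfolding laurents_in_def by blast

lemma laurents_in_uminus: "f \<in> laurents_in X \<Longrightarrow> - f \<in> laurents_in X"
  unfolding laurents_in_def by (auto simp: in_keys_iff)

lemma laurents_in_diff: "f \<in> laurents_in X \<Longrightarrow> f' \<in> laurents_in X \<Longrightarrow> f - f' \<in> laurents_in X"
  using laurents_in_add[of f X "- f'"] laurents_in_uminus[of f' X] by simp

lemma laurents_in_mult: "f \<in> laurents_in X \<Longrightarrow> f' \<in> laurents_in X \<Longrightarrow> f * f' \<in> laurents_in X"
proof -
  assume *: "f \<in> laurents_in X" "f' \<in> laurents_in X"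
  show ?thesis unfolding laurents_in_def
  proof (intro CollectI ballI)
    fix m assume "m \<in> keys (f * f')"
    then obtain a b where ab: "a \<in> keys f" "b \<in> keys f'" "m = a + b"
      using Poly_Mapping.keys_mult[of f f'] by blast
    then show "keys m \<subseteq> X"
      using * Poly_Mapping.keys_add[of a b] unfolding laurents_in_def by blast
  qed
qed

lemma laurents_in_sum: "(\<And>x. x \<in> A \<Longrightarrow> f x \<in> laurents_in X) \<Longrightarrow> (\<Sum>x\<in>A. f x) \<in> laurents_in X"
  by (induction A rule: infinite_finite_induct) (auto intro: laurents_in_add)

lemma laurents_in_prod: "(\<And>x. x \<in> A \<Longrightarrow> f x \<in> laurents_in X) \<Longrightarrow> (\<Prod>x\<in>A. f x) \<in> laurents_in X"
  by (induction A rule: infinite_finite_induct) (auto intro: laurents_in_mult)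

lemma laurents_in_power: "f \<in> laurents_in X \<Longrightarrow> f ^ k \<in> laurents_in X"
  by (induction k) (auto intro: laurents_in_mult)

lemma laurents_in_mono: "X \<subseteq> Y \<Longrightarrow> laurents_in X \<subseteq> laurents_in Y"
  unfolding laurents_in_def by blast

lemma laurents_in_pcomp: "f \<in> laurents_in X \<Longrightarrow> pcomp \<gamma> g f \<in> laurents_in X"
  unfolding laurents_in_def by (auto simp: keys_pcomp)

lemma homdeg_restrict_exp_iff: "homdeg (restrict_exp (- X)) 0 f \<longleftrightarrow> f \<in> laurents_in X"
proof -
  have "restrict_exp (- X) m = 0 \<longleftrightarrow> keys m \<subseteq> X" for m
  proof -
    have "restrict_exp (- X) m = 0 \<longleftrightarrow> keys (restrict_exp (- X) m) = {}" by simp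
    also have "\<dots> \<longleftrightarrow> keys m \<subseteq> X" unfolding keys_restrict_exp by blast
    finally show ?thesis .
  qed
  then show ?thesis by (simp add: homdeg_def laurents_in_def)
qed

text \<open>
  The coefficient of the monomial \<open>e\<close> in the variables outside \<open>X\<close>, as a Laurent polynomial in \<open>X\<close>. It
  is 0 if \<open>e\<close> involves \<open>X\<close>.
\<close>

definition coef :: "'i zvar set \<Rightarrow> 'i expo \<Rightarrow> ('i, 'k::comm_ring_1) laurent \<Rightarrow> ('i, 'k) laurent" where
  "coef X e f = single (- e) 1 * pcomp (restrict_exp (- X)) e f"

lemma pcomp_eq_coef: "pcomp (restrict_exp (- X)) e f = single e 1 * coef X e f"
  by (simp add: coef_def mult_single flip: mult.assoc)

lemma lookup_coef: "lookup (coef X e f) m = (if restrict_exp (- X) (m + e) = e then lookup f (m + e) else 0)"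
proof -
  have "lookup (coef X e f) m = act (single (- e) 1) (lookup (pcomp (restrict_exp (- X)) e f)) m"
    by (simp add: coef_def act_lookup)
  then show ?thesis by (simp add: act_single lookup_pcomp)
qed

lemma coef_laurents_in: "coef X e f \<in> laurents_in X"
  unfolding laurents_in_def
proof (intro CollectI ballI)
  fix m assume "m \<in> keys (coef X e f)"
  then have *: "restrict_exp (- X) (m + e) = e" by (auto simp: in_keys_iff lookup_coef split: if_splits)
  have "lookup m v = 0" if "v \<notin> X" for v
    using arg_cong[OF *, of "\<lambda>x. lookup x v"] that by (simp add: lookup_restrict_exp lookup_add)
  then show "keys m \<subseteq> X" by (auto simp: in_keys_iff)
qed

lemma coef_add: "coef X e (f + f') = coef X e f + coef X e f'"
  by (simp add: coef_def pcomp_add distrib_left)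

lemma coef_sum: "coef X e (\<Sum>x\<in>A. f x) = (\<Sum>x\<in>A. coef X e (f x))"
  by (simp add: coef_def pcomp_sum sum_distrib_left)

lemma coef_mult: "D \<in> laurents_in X \<Longrightarrow> coef X e (D * f) = D * coef X e f"
  using restrict_exp.pcomp_mult_0[of "- X" D e f] unfolding homdeg_restrict_exp_iff
  by (simp add: coef_def algebra_simps)

lemma coef_decompose: "f = (\<Sum>e\<in>restrict_exp (- X) ` keys f. single e 1 * coef X e f)"
  unfolding pcomp_eq_coef[symmetric] by (rule pcomp_decompose) auto

section \<open>Kernels of orderings\<close>

definition ords :: "'a set \<Rightarrow> 'a list set" where
  "ords A = {vs. distinct vs \<and> set vs = A}"

lemma finite_ords: "finite A \<Longrightarrow> finite (ords A)"
proof -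
  assume "finite A"
  then have "finite {vs. set vs \<subseteq> A \<and> length vs \<le> card A}" by (rule finite_lists_length_le)
  moreover have "ords A \<subseteq> {vs. set vs \<subseteq> A \<and> length vs \<le> card A}"
    by (auto simp: ords_def distinct_card[symmetric])
  ultimately show ?thesis by (rule finite_subset[rotated])
qed

locale zeta_data =
  fixes \<zeta> :: "'i::finite \<Rightarrow> 'i \<Rightarrow> ('i, 'k::field_char_0) ratfun \<Rightarrow> ('i, 'k) ratfun"
    and \<alpha> :: "'i \<Rightarrow> 'i \<Rightarrow> 'k"
    and s :: "'i \<Rightarrow> 'i \<Rightarrow> int"
    and N :: "'i \<Rightarrow> 'i \<Rightarrow> nat"
    and q :: "'i \<Rightarrow> 'i \<Rightarrow> nat \<Rightarrow> 'k"
  assumes alpha_nz: "\<And>i j. \<alpha> i j \<noteq> 0"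
    and q_nz: "\<And>i j e. e \<in> {1..N i j} \<Longrightarrow> q i j e \<noteq> 0"
    and zeta_eq: "\<And>i j x. \<zeta> i j x =
      crat (\<alpha> i j) * x powi s i j / (1 - x) ^ (if i = j then 1 else 0) *
      (\<Prod>e = 1..N i j. 1 - x * crat (q i j e))"
begin

definition zt :: "'i zvar \<Rightarrow> 'i zvar \<Rightarrow> ('i, 'k) ratfun" where
  "zt u v = \<zeta> (colour u) (colour v) (zrat u / zrat v)"

text \<open>
  The kernel $1 / \zeta_{ji}(z_v / z_u)$ of a pair is the quotient of \<open>num\<close>, a unit times $1 - z_v / z_u$ or
  just a unit, by \<open>den\<close>, a product of factors that are inverted by geometric series in $z_v / z_u$.
\<close>

definition den :: "'i zvar \<Rightarrow> 'i zvar \<Rightarrow> ('i, 'k) laurent" where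
  "den u v = (\<Prod>e = 1..N (colour v) (colour u). 1 - single (shift u v) (q (colour v) (colour u) e))"

definition num :: "'i zvar \<Rightarrow> 'i zvar \<Rightarrow> ('i, 'k) laurent" where
  "num u v = single (single u (s (colour v) (colour u)) - single v (s (colour v) (colour u))) (1 / \<alpha> (colour v) (colour u)) *
     (if colour u = colour v then 1 - single (shift u v) 1 else 1)"

definition kr :: "'i zvar \<times> 'i zvar \<Rightarrow> ('i, 'k) ratfun" where
  "kr p = 1 / zt (snd p) (fst p)"

end

lemma zrat_powi: "(zrat v :: ('i, 'k::field) ratfun) powi k = rat (zpow v k)"
proof -
  have nat: "(zrat v :: ('i, 'k) ratfun) ^ n = rat (zpow v (int n))" for n
    by (induction n) (auto simp: zrat_def mult_single rat_mult[symmetric] single_add[symmetric])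
  show ?thesis
  proof (cases "k \<ge> 0")
    case True
    then show ?thesis using nat[of "nat k"] by (simp add: power_int_def)
  next
    case False
    have "rat (zpow v k) * rat (zpow v (- k)) = (1 :: ('i, 'k) ratfun)"
      by (simp add: rat_mult[symmetric] mult_single single_add[symmetric])
    then have "inverse (rat (zpow v (- k))) = (rat (zpow v k) :: ('i, 'k) ratfun)"
      by (intro inverse_unique) (simp add: mult.commute)
    then show ?thesis using False nat[of "nat (- k)"]
      by (simp add: power_int_def power_inverse)
  qed
qed

lemma single_eq_0_iff [simp]: "single m c = 0 \<longleftrightarrow> c = 0"
  by (metis lookup_single_eq lookup_zero single_zero)

lemma zrat_nz [simp]: "zrat v \<noteq> 0"
  by (simp add: zrat_def)

lemma zrat_divide: "(zrat v :: ('i, 'k::field) ratfun) / zrat u = rat (single (shift u v) 1)"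
proof -
  have "rat (single (shift u v) 1) * zrat u = (zrat v :: ('i, 'k) ratfun)"
    by (simp add: zrat_def rat_mult[symmetric] mult_single shift_def)
  then show ?thesis by (simp add: eq_divide_eq divide_eq_eq)
qed

lemma single_nz_diff:
  assumes "m \<noteq> 0" shows "1 - single m (c :: 'k::comm_ring_1) \<noteq> 0"
proof
  assume "1 - single m c = 0"
  then have "lookup (1 - single m c) 0 = 0" by simp
  then show False using assms by (simp add: lookup_minus lookup_single)
qed

lemma single_neq_1 [simp]: "m \<noteq> 0 \<Longrightarrow> single m (c :: 'k::comm_ring_1) \<noteq> 1"
  using single_nz_diff[of m c] by auto

lemma shift_nz: "u \<noteq> v \<Longrightarrow> shift u v \<noteq> 0"
proof
  assume "u \<noteq> v" "shift u v = 0"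
  then have "lookup (shift u v) v = 0" by simp
  then show False using \<open>u \<noteq> v\<close> by (simp add: shift_def lookup_minus lookup_single)
qed

context zeta_data
begin

lemma den_nz: "u \<noteq> v \<Longrightarrow> den u v \<noteq> 0"
  by (auto simp: den_def single_nz_diff shift_nz)

lemma zt_num_den: "u \<noteq> v \<Longrightarrow> rat (num u v) * zt v u = rat (den u v)"
proof -
  assume uv: "u \<noteq> v"
  define i j where "i = colour v" and "j = colour u"
  define x where "x = (rat (single (shift u v) 1) :: ('i, 'k) ratfun)"
  have x: "x = zrat v / zrat u" by (simp add: x_def zrat_divide)
  have "x \<noteq> 1" using single_nz_diff[OF shift_nz[OF uv], of "1 :: 'k"]
    unfolding x_def by (metis rat_1 rat_eq_iff right_minus_eq)
  have den: "rat (den u v) = (\<Prod>e = 1..N i j. 1 - x * crat (q i j e))"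
    by (simp add: den_def rat_prod rat_diff i_def j_def x_def crat_def rat_mult[symmetric] mult_single)
  have zt: "zt v u = crat (\<alpha> i j) * x powi s i j / (1 - x) ^ (if i = j then 1 else 0) * rat (den u v)"
    unfolding zt_def zeta_eq den x i_def j_def ..
  have "rat (num u v) = rat (single (single u (s i j) - single v (s i j)) (1 / \<alpha> i j)) * (1 - x) ^ (if i = j then 1 else 0)"
    by (auto simp: num_def rat_mult i_def j_def x_def rat_diff)
  also have "single (single u (s i j) - single v (s i j)) (1 / \<alpha> i j) =
      cst (1 / \<alpha> i j) * zpow u (s i j) * zpow v (- s i j)"
    by (simp add: mult_single single_uminus)
  also have "rat \<dots> = crat (1 / \<alpha> i j) * zrat u powi s i j * zrat v powi (- s i j)"
    by (simp add: rat_mult zrat_powi crat_def)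
  also have "\<dots> = crat (1 / \<alpha> i j) * x powi (- s i j)"
    by (simp add: x power_int_divide_distrib power_int_minus field_simps)
  finally have num: "rat (num u v) = crat (1 / \<alpha> i j) * x powi (- s i j) * (1 - x) ^ (if i = j then 1 else 0)" .
  have "crat (1 / \<alpha> i j) * crat (\<alpha> i j) = (1 :: ('i, 'k) ratfun)"
    by (simp add: crat_def rat_mult[symmetric] mult_single alpha_nz)
  moreover have "x powi (- s i j) * x powi s i j = 1" by (simp add: x power_int_minus)
  ultimately show ?thesis using \<open>x \<noteq> 1\<close> unfolding num zt
    by (simp add: divide_simps) (metis (no_types, lifting) mult.assoc mult.commute mult.left_commute mult_1)
qed

lemma zt_nz: "u \<noteq> v \<Longrightarrow> zt v u \<noteq> 0"
  using zt_num_den[of u v] den_nz[of u v] by auto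

lemma kr_num_den: "u \<noteq> v \<Longrightarrow> rat (den u v) * kr (u, v) = rat (num u v)"
  using zt_num_den[of u v] zt_nz[of u v] by (simp add: kr_def field_simps)

definition denp :: "('i zvar \<times> 'i zvar) set \<Rightarrow> ('i, 'k) laurent" where
  "denp P = (\<Prod>p\<in>P. den (fst p) (snd p))"

definition nump :: "('i zvar \<times> 'i zvar) set \<Rightarrow> ('i, 'k) laurent" where
  "nump P = (\<Prod>p\<in>P. num (fst p) (snd p))"

definition krp :: "('i zvar \<times> 'i zvar) set \<Rightarrow> ('i, 'k) ratfun" where
  "krp P = (\<Prod>p\<in>P. kr p)"

abbreviation kap :: "'i zvar list \<Rightarrow> ('i, 'k) ratfun" where
  "kap vs \<equiv> krp (bef vs)"

lemma krp_num_den: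
  "(\<And>u v. (u, v) \<in> P \<Longrightarrow> u \<noteq> v) \<Longrightarrow> rat (denp P) * krp P = rat (nump P)"
  unfolding denp_def krp_def nump_def rat_prod prod.distrib[symmetric]
  by (rule prod.cong) (auto simp: kr_num_den)

lemma denp_nz: "(\<And>u v. (u, v) \<in> P \<Longrightarrow> u \<noteq> v) \<Longrightarrow> denp P \<noteq> 0"
  unfolding denp_def by (cases "finite P") (auto simp: den_nz)

lemma krp_union: "finite P \<Longrightarrow> finite Q \<Longrightarrow> P \<inter> Q = {} \<Longrightarrow> krp (P \<union> Q) = krp P * krp Q"
  unfolding krp_def by (rule prod.union_disjoint)

lemma denp_union: "finite P \<Longrightarrow> finite Q \<Longrightarrow> P \<inter> Q = {} \<Longrightarrow> denp (P \<union> Q) = denp P * denp Q"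
  unfolding denp_def by (rule prod.union_disjoint)

lemma denp_homdeg:
  assumes "grading \<gamma>" "\<And>u v. (u, v) \<in> P \<Longrightarrow> \<gamma> (shift u v) = 0"
  shows "homdeg \<gamma> 0 (denp P)"
proof -
  interpret grading \<gamma> by fact
  show ?thesis unfolding denp_def den_def
    by (intro homdeg_prod homdeg_diff homdeg_1 homdeg_single) (use assms in auto)
qed

lemma nump_homdeg:
  assumes "grading \<gamma>" "\<And>u v. (u, v) \<in> P \<Longrightarrow> \<gamma> (shift u v) = 0"
  shows "homdeg \<gamma> 0 (nump P)"
proof -
  interpret grading \<gamma> by fact
  have eq: "\<gamma> (single u k) = \<gamma> (single v k)" if uv: "(u, v) \<in> P" for u v and k :: int
  proof -
    have 1: "\<gamma> (single v 1) = \<gamma> (single u 1)" using assms(2)[OF uv] by (simp add: shift_def diff)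
    have 2: "\<gamma> (single v (int n)) = \<gamma> (single u (int n))" for n
    proof (induction n)
      case (Suc n)
      then show ?case using 1 by (simp add: single_add add)
    qed simp
    show ?thesis
    proof (cases "k \<ge> 0")
      case True
      then show ?thesis using 2[of "nat k"] by simp
    next
      case False
      then show ?thesis using 2[of "nat (- k)"] by (simp add: single_uminus uminus)
    qed
  qed
  have "homdeg \<gamma> 0 (num u v)" if "(u, v) \<in> P" for u v
  proof -
    have "homdeg \<gamma> (0 + 0) (num u v)" unfolding num_def
      by (intro homdeg_mult homdeg_single)
        (use assms(2)[OF that] eq[OF that] in \<open>auto simp: diff intro!: homdeg_diff homdeg_1 homdeg_single\<close>)
    then show ?thesis by simp
  qed
  then show ?thesis unfolding nump_def by (intro homdeg_prod) auto
qed

subsection \<open>Expanding the kernels\<close>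

lemma expansion_divide:
  assumes "distinct vs" "(u, v) \<in> bef vs" "K \<subseteq> cone vs" "\<And>m. m \<in> K \<Longrightarrow> m + shift u v \<in> K"
    and "is_expansion vs F E" "bdd K E" "rat (1 - single (shift u v) c) * F' = F"
  shows "\<exists>E'. is_expansion vs F' E' \<and> bdd K E'"
proof -
  let ?d = "1 - single (shift u v) c"
  obtain E' where E': "bdd K E'" "act ?d E' = E"
    using geometric_series[OF assms(1-4,6)] by metis
  obtain N D where 1: "bdd (cone vs) E" "D \<noteq> 0" "rat D * F = rat N" "act D E = lookup N"
    using assms(5) unfolding is_expansion_iff by blast
  have "?d \<noteq> 0" using bef_irrefl[OF assms(1,2)] by (simp add: single_nz_diff shift_nz)
  then have "D * ?d \<noteq> 0" using 1 by simp
  moreover have "rat (D * ?d) * F' = rat N" using 1(3) assms(7) by (simp add: rat_mult mult.assoc)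
  moreover have "act (D * ?d) E' = lookup N" by (simp add: act_mult E' 1)
  ultimately show ?thesis unfolding is_expansion_iff using E' bdd_mono[OF E'(1) assms(3)] by blast
qed

text \<open>
  The numerators keep the support condition and each factor of the denominators is divided out by a
  geometric series.
\<close>

lemma expansion_krp:
  assumes vs: "distinct vs" and K: "K \<subseteq> cone vs" "0 \<in> K"
    and P: "P \<subseteq> bef vs" "\<And>m u v. m \<in> K \<Longrightarrow> (u, v) \<in> P \<Longrightarrow> m + shift u v \<in> K"
  shows "\<exists>E. is_expansion vs (rat r * krp P) E \<and> bdd K E"
proof -
  have "finite P" using P(1) finite_bef by (rule finite_subset)
  then show ?thesis using P
  proof (induction P)
    case empty
    then show ?case using is_expansion_rat[of vs r] bdd_lookup[OF K(2), of r] by (auto simp: krp_def)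
  next
    case (insert p P)
    obtain u v where p: "p = (u, v)" by (cases p)
    have uv: "(u, v) \<in> bef vs" and step: "\<And>m. m \<in> K \<Longrightarrow> m + shift u v \<in> K" using insert.prems p by auto
    have "u \<noteq> v" using bef_irrefl[OF vs uv] .
    obtain E where E: "is_expansion vs (rat r * krp P) E" "bdd K E" using insert by auto
    have base: "is_expansion vs (rat (num u v) * (rat r * krp P)) (act (num u v) E)" "bdd K (act (num u v) E)"
      by (rule is_expansion_act[OF E(1)]) (rule bdd_act[OF E(2)])
    let ?c = "\<lambda>e. q (colour v) (colour u) e"
    \<comment> \<open>The first \<open>n\<close> factors of the denominator have been divided out.\<close>
    let ?G = "\<lambda>n. rat r * krp (insert p P) * rat (\<Prod>e\<in>{n<..N (colour v) (colour u)}. 1 - single (shift u v) (?c e))"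
    have *: "\<exists>E'. is_expansion vs (?G n) E' \<and> bdd K E'" if "n \<le> N (colour v) (colour u)" for n
    proof -
      show ?thesis using that
      proof (induction n)
        case 0
        have "rat (num u v) * (rat r * krp P) = ?G 0"
        proof -
          have "?G 0 = rat r * krp (insert p P) * rat (den u v)"
            by (simp add: den_def atLeastSucAtMost_greaterThanAtMost[symmetric])
          also have "\<dots> = rat r * krp P * (rat (den u v) * kr (u, v))"
            using insert.hyps p by (simp add: krp_def)
          finally show ?thesis unfolding kr_num_den[OF \<open>u \<noteq> v\<close>] by (simp only: mult_ac)
        qed
        then show ?case using base by (intro exI conjI) (simp_all only:)
      next
        case (Suc n)
        then obtain E1 where E1: "is_expansion vs (?G n) E1" "bdd K E1" by auto
        have "{n<..N (colour v) (colour u)} = insert (Suc n) {Suc n<..N (colour v) (colour u)}"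
          using Suc.prems by auto
        then have "rat (1 - single (shift u v) (?c (Suc n))) * ?G (Suc n) = ?G n"
          by (simp add: rat_mult mult_ac)
        from expansion_divide[OF vs uv K(1) step E1 this] show ?case .
      qed
    qed
    from *[of "N (colour v) (colour u)"] show ?case by simp
  qed
qed

lemma expandable_krp:
  assumes "distinct vs" "P \<subseteq> bef vs" shows "expandable vs (rat r * krp P)"
  using expansion_krp[OF assms(1) order_refl cone_0 assms(2)] assms
  unfolding expandable_def by (blast intro: cone_add cone_shift)

lemma expandable_kap: "distinct vs \<Longrightarrow> expandable vs (rat r * kap vs)"
  by (rule expandable_krp) auto

lemma act_denp_expn:
  assumes "distinct vs"
  shows "act (denp (bef vs)) (expn vs (rat r * kap vs)) = lookup (nump (bef vs) * r)"
proof -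
  have "act (denp (bef vs)) (expn vs (rat r * kap vs)) = expn vs (rat (denp (bef vs)) * (rat r * kap vs))"
    by (rule expn_mult[symmetric, OF assms expandable_kap[OF assms]])
  also have "rat (denp (bef vs)) * (rat r * kap vs) = rat (nump (bef vs) * r)"
    using krp_num_den[of "bef vs"] bef_irrefl[OF assms] by (simp add: rat_mult algebra_simps)
  finally show ?thesis by (simp add: expn_rat[OF assms])
qed

text \<open>
  As the denominator of a kernel is explicit, one equation characterizes the expansion.
\<close>

lemma expn_kap_eqI:
  assumes "distinct vs" "bdd (cone vs) E" "act (denp (bef vs)) E = lookup (nump (bef vs) * r)"
  shows "expn vs (rat r * kap vs) = E"
proof (rule expn_eqI[OF assms(1)])
  show "is_expansion vs (rat r * kap vs) E" unfolding is_expansion_iff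
  proof (intro conjI exI)
    show "denp (bef vs) \<noteq> 0" using denp_nz bef_irrefl[OF assms(1)] by blast
    show "rat (denp (bef vs)) * (rat r * kap vs) = rat (nump (bef vs) * r)"
      using krp_num_den[of "bef vs"] bef_irrefl[OF assms(1)] by (simp add: rat_mult algebra_simps)
  qed (use assms in auto)
qed

section \<open>The ideal annihilating the discrepancies of expansions\<close>

definition syz :: "'i zvar set \<Rightarrow> ('i zvar list \<Rightarrow> ('i, 'k) laurent) \<Rightarrow> bool" where
  "syz A f \<longleftrightarrow> (\<Sum>vs\<in>ords A. rat (f vs) * kap vs) = 0"

text \<open>
  \<open>syz A f\<close> says that \<open>f\<close> is a relation, with Laurent polynomial coefficients, among the kernels of the
  orderings of \<open>A\<close> as rational functions. The kernels are expanded in different regions, so the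
  corresponding combination of expansions need not vanish; \<open>J A\<close> consists of the Laurent polynomials that
  annihilate all these discrepancies. The coefficients and the elements of \<open>J A\<close> may involve variables
  outside \<open>A\<close>, so that the ideals for different \<open>A\<close> can be compared.
\<close>

definition J :: "'i zvar set \<Rightarrow> ('i, 'k) laurent set" where
  "J A = {R. \<forall>f. syz A f \<longrightarrow> (\<forall>m. (\<Sum>vs\<in>ords A. expn vs (rat (f vs * R) * kap vs) m) = 0)}"

text \<open>
  A relation may repeat orderings: collect the coefficients of each ordering.
\<close>

lemma J_indexed:
  assumes "finite A" "R \<in> J A" "finite W" "\<And>w. w \<in> W \<Longrightarrow> vs w \<in> ords A"
    and "(\<Sum>w\<in>W. rat (f w) * kap (vs w)) = 0"
  shows "(\<Sum>w\<in>W. expn (vs w) (rat (f w * R) * kap (vs w)) m) = 0"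
proof -
  define f' where "f' us = (\<Sum>w | w \<in> W \<and> vs w = us. f w)" for us
  have "(\<Sum>us\<in>ords A. rat (f' us) * kap us) = (\<Sum>us\<in>ords A. \<Sum>w | w \<in> W \<and> vs w = us. rat (f w) * kap (vs w))"
    by (intro sum.cong refl) (simp add: f'_def rat_sum sum_distrib_right)
  also have "\<dots> = (\<Sum>w\<in>W. rat (f w) * kap (vs w))"
    using assms finite_ords by (intro sum.group) auto
  finally have "syz A f'" using assms(5) by (simp add: syz_def)
  then have "(\<Sum>us\<in>ords A. expn us (rat (f' us * R) * kap us) m) = 0"
    using assms(2) unfolding J_def by blast
  also have "(\<Sum>us\<in>ords A. expn us (rat (f' us * R) * kap us) m) =
    (\<Sum>us\<in>ords A. \<Sum>w | w \<in> W \<and> vs w = us. expn (vs w) (rat (f w * R) * kap (vs w)) m)"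
  proof (intro sum.cong refl)
    fix us assume "us \<in> ords A"
    then have us: "distinct us" by (simp add: ords_def)
    have "rat (f' us * R) * kap us = (\<Sum>w | w \<in> W \<and> vs w = us. rat (f w * R) * kap us)"
      by (simp add: f'_def rat_sum sum_distrib_right)
    then have "expn us (rat (f' us * R) * kap us) m = (\<Sum>w | w \<in> W \<and> vs w = us. expn us (rat (f w * R) * kap us) m)"
      using expn_sum[OF us, of "{w \<in> W. vs w = us}" "\<lambda>w. rat (f w * R) * kap us"] expandable_kap[OF us]
      by simp
    also have "\<dots> = (\<Sum>w | w \<in> W \<and> vs w = us. expn (vs w) (rat (f w * R) * kap (vs w)) m)"
      by (rule sum.cong) auto
    finally show "expn us (rat (f' us * R) * kap us) m = (\<Sum>w | w \<in> W \<and> vs w = us. expn (vs w) (rat (f w * R) * kap (vs w)) m)" .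
  qed
  also have "\<dots> = (\<Sum>w\<in>W. expn (vs w) (rat (f w * R) * kap (vs w)) m)"
    using assms finite_ords by (intro sum.group) auto
  finally show ?thesis .
qed

lemma expn_kap_mult:
  "distinct vs \<Longrightarrow> expn vs (rat (r * f) * kap vs) = act r (expn vs (rat f * kap vs))"
  using expn_mult[OF _ expandable_kap, of vs r f] by (simp add: rat_mult mult.assoc)

lemma expn_kap_add:
  "distinct vs \<Longrightarrow> expn vs (rat (f + g) * kap vs) m = expn vs (rat f * kap vs) m + expn vs (rat g * kap vs) m"
  using expn_add[OF _ expandable_kap expandable_kap, of vs f g] by (simp add: rat_add distrib_right)

lemma expn_kap_sum:
  "distinct vs \<Longrightarrow> expn vs (rat (\<Sum>x\<in>X. f x) * kap vs) m = (\<Sum>x\<in>X. expn vs (rat (f x) * kap vs) m)"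
  by (induction X rule: infinite_finite_induct) (auto simp: expn_kap_add expn_0)

lemma J_0: "0 \<in> J A"
  unfolding J_def by (auto intro!: sum.neutral simp: expn_0 ords_def)

lemma J_add: "R \<in> J A \<Longrightarrow> R' \<in> J A \<Longrightarrow> R + R' \<in> J A"
proof -
  assume *: "R \<in> J A" "R' \<in> J A"
  have "(\<Sum>vs\<in>ords A. expn vs (rat (f vs * (R + R')) * kap vs) m) = 0" if "syz A f" for f m
  proof -
    have "(\<Sum>vs\<in>ords A. expn vs (rat (f vs * (R + R')) * kap vs) m) =
      (\<Sum>vs\<in>ords A. expn vs (rat (f vs * R) * kap vs) m + expn vs (rat (f vs * R') * kap vs) m)"
      by (intro sum.cong refl) (simp add: distrib_left expn_kap_add ords_def)
    then show ?thesis using * that by (simp add: sum.distrib J_def)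
  qed
  then show ?thesis by (simp add: J_def)
qed

lemma J_mult: "R \<in> J A \<Longrightarrow> r * R \<in> J A"
proof -
  assume *: "R \<in> J A"
  have "(\<Sum>vs\<in>ords A. expn vs (rat (f vs * (r * R)) * kap vs) m) = 0" if "syz A f" for f m
  proof -
    have "(\<Sum>vs\<in>ords A. expn vs (rat (f vs * (r * R)) * kap vs) m) =
      (\<Sum>vs\<in>ords A. act r (expn vs (rat (f vs * R) * kap vs)) m)"
      by (intro sum.cong refl) (simp add: mult.left_commute[of _ r] expn_kap_mult ords_def)
    also have "\<dots> = act r (\<lambda>m. \<Sum>vs\<in>ords A. expn vs (rat (f vs * R) * kap vs) m) m"
      by (rule act_sum_right[symmetric])
    also have "\<dots> = 0" using * that by (simp add: J_def)
    finally show ?thesis .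
  qed
  then show ?thesis by (simp add: J_def)
qed

lemma J_sum: "(\<And>x. x \<in> X \<Longrightarrow> f x \<in> J A) \<Longrightarrow> (\<Sum>x\<in>X. f x) \<in> J A"
  by (induction X rule: infinite_finite_induct) (auto intro: J_0 J_add)

lemma J_uminus: "R \<in> J A \<Longrightarrow> - R \<in> J A"
  using J_mult[of R A "- 1"] by simp

lemma J_diff: "R \<in> J A \<Longrightarrow> R' \<in> J A \<Longrightarrow> R - R' \<in> J A"
  using J_add[of R A "- R'"] J_uminus[of R' A] by simp

lemma bef_ords: "vs \<in> ords A \<Longrightarrow> (u, v) \<in> bef vs \<Longrightarrow> u \<in> A \<and> v \<in> A \<and> u \<noteq> v"
  using bef_subset[of vs] bef_irrefl[of vs u v] by (auto simp: ords_def)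

text \<open>
  The numerators of all kernels over a common denominator. They turn relations between rational
  functions into relations between Laurent polynomials, which can be split by degree.
\<close>

definition clr :: "'i zvar set \<Rightarrow> 'i zvar list \<Rightarrow> ('i, 'k) laurent" where
  "clr A vs = nump (bef vs) * denp ((A \<times> A - Id) - bef vs)"

lemma clear_denominators:
  assumes "finite A" "vs \<in> ords A"
  shows "rat (denp (A \<times> A - Id)) * kap vs = rat (clr A vs)"
proof -
  have sub: "bef vs \<subseteq> A \<times> A - Id" using bef_ords[OF assms(2)] by auto
  have "denp (A \<times> A - Id) = denp (bef vs \<union> ((A \<times> A - Id) - bef vs))" using sub by (simp add: Un_absorb1)
  also have "\<dots> = denp (bef vs) * denp ((A \<times> A - Id) - bef vs)"
    using assms by (intro denp_union) auto
  finally have "denp (A \<times> A - Id) = denp (bef vs) * denp ((A \<times> A - Id) - bef vs)" .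
  moreover have "rat (denp (bef vs)) * kap vs = rat (nump (bef vs))"
    by (rule krp_num_den) (use bef_ords[OF assms(2)] in blast)
  ultimately show ?thesis
    by (simp add: clr_def rat_mult)
qed

lemma denp_total_nz: "denp (A \<times> A - Id) \<noteq> 0"
  by (rule denp_nz) auto

lemma syz_clr:
  assumes "finite A" shows "syz A f \<longleftrightarrow> (\<Sum>vs\<in>ords A. clr A vs * f vs) = 0"
proof -
  have "rat (denp (A \<times> A - Id)) * (\<Sum>vs\<in>ords A. rat (f vs) * kap vs) = (\<Sum>vs\<in>ords A. rat (f vs) * (rat (denp (A \<times> A - Id)) * kap vs))"
    by (simp add: sum_distrib_left mult.left_commute)
  also have "\<dots> = (\<Sum>vs\<in>ords A. rat (f vs) * rat (clr A vs))"
    by (intro sum.cong refl) (simp add: clear_denominators[OF assms])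
  also have "\<dots> = rat (\<Sum>vs\<in>ords A. clr A vs * f vs)"
    by (simp add: rat_sum rat_mult mult.commute)
  finally have eq: "rat (denp (A \<times> A - Id)) * (\<Sum>vs\<in>ords A. rat (f vs) * kap vs) = rat (\<Sum>vs\<in>ords A. clr A vs * f vs)" .
  have "x = 0 \<longleftrightarrow> y = 0" if "d * x = y" "d \<noteq> 0" for d x y :: "('i, 'k) ratfun"
    using that by auto
  from this[OF eq] denp_total_nz[of A] show ?thesis unfolding syz_def rat_eq_0_iff by blast
qed

lemma clr_homdeg:
  assumes "grading \<gamma>" "\<And>u v. u \<in> A \<Longrightarrow> v \<in> A \<Longrightarrow> \<gamma> (shift u v) = 0" "vs \<in> ords A"
  shows "homdeg \<gamma> 0 (clr A vs)"
proof -
  interpret grading \<gamma> by fact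
  have "homdeg \<gamma> (0 + 0) (clr A vs)" unfolding clr_def
    by (intro homdeg_mult nump_homdeg denp_homdeg assms(1)) (use assms(2) bef_ords[OF assms(3)] in auto)
  then show ?thesis by simp
qed

text \<open>
  In a grading in which the variables of the ordering have equal degrees, numerators and denominators of
  the kernel have degree 0.
\<close>

lemma expn_kap_pcomp:
  assumes "grading \<gamma>" "distinct vs" "\<And>u v. (u, v) \<in> bef vs \<Longrightarrow> \<gamma> (shift u v) = 0"
  shows "expn vs (rat (pcomp \<gamma> g r) * kap vs) = scomp \<gamma> g (expn vs (rat r * kap vs))"
proof -
  interpret grading \<gamma> by fact
  note hom = denp_homdeg[OF assms(1,3), of "bef vs"] nump_homdeg[OF assms(1,3), of "bef vs"]
  show ?thesis
  proof (rule expn_kap_eqI[OF assms(2)])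
    have "bdd (cone vs) (expn vs (rat r * kap vs))"
      using is_expansion_expn[OF assms(2) expandable_kap[OF assms(2)]] unfolding is_expansion_iff by blast
    then show "bdd (cone vs) (scomp \<gamma> g (expn vs (rat r * kap vs)))" by (rule bdd_scomp)
    show "act (denp (bef vs)) (scomp \<gamma> g (expn vs (rat r * kap vs))) = lookup (nump (bef vs) * pcomp \<gamma> g r)"
      using scomp_act_0[OF hom(1), of g "expn vs (rat r * kap vs)"] act_denp_expn[OF assms(2), of r]
        pcomp_mult_0[OF hom(2), of g r] by (simp add: scomp_lookup)
  qed
qed

lemma syz_pcomp:
  assumes "grading \<gamma>" "finite A" "\<And>u v. u \<in> A \<Longrightarrow> v \<in> A \<Longrightarrow> \<gamma> (shift u v) = 0" "syz A f"
  shows "syz A (\<lambda>vs. pcomp \<gamma> h (f vs))"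
proof -
  interpret grading \<gamma> by fact
  have "(\<Sum>vs\<in>ords A. clr A vs * pcomp \<gamma> h (f vs)) = pcomp \<gamma> h (\<Sum>vs\<in>ords A. clr A vs * f vs)"
    unfolding pcomp_sum using clr_homdeg[OF assms(1,3)]
    by (intro sum.cong refl) (simp add: pcomp_mult_0)
  then show ?thesis using assms(4) unfolding syz_clr[OF assms(2)] by simp
qed

text \<open>
  The components of a relation are relations. The component of degree \<open>h + g\<close> of what \<open>R\<close> does to the
  component of degree \<open>h\<close> is what the component of degree \<open>g\<close> of \<open>R\<close> does to it.
\<close>

lemma J_pcomp:
  assumes "grading \<gamma>" "finite A" "\<And>u v. u \<in> A \<Longrightarrow> v \<in> A \<Longrightarrow> \<gamma> (shift u v) = 0" "R \<in> J A"
  shows "pcomp \<gamma> g R \<in> J A"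
proof -
  interpret grading \<gamma> by fact
  have "(\<Sum>vs\<in>ords A. expn vs (rat (f vs * pcomp \<gamma> g R) * kap vs) m) = 0" if f: "syz A f" for f m
  proof -
    define H where "H = (\<Union>vs\<in>ords A. \<gamma> ` keys (f vs))"
    have H: "finite H" using finite_ords[OF assms(2)] by (simp add: H_def)
    have syz: "syz A (\<lambda>vs. pcomp \<gamma> h (f vs))" for h by (rule syz_pcomp[OF assms(1-3) f])
    have "expn vs (rat (f vs * pcomp \<gamma> g R) * kap vs) m =
      (\<Sum>h\<in>H. scomp \<gamma> (h + g) (expn vs (rat (pcomp \<gamma> h (f vs) * R) * kap vs)) m)" if vs: "vs \<in> ords A" for vs
    proof -
      have d: "distinct vs" using vs by (simp add: ords_def)
      have sh: "\<gamma> (shift u v) = 0" if "(u, v) \<in> bef vs" for u v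
        using assms(3) bef_ords[OF vs that] by auto
      have "f vs = (\<Sum>h\<in>H. pcomp \<gamma> h (f vs))"
        using H vs by (intro pcomp_decompose) (auto simp: H_def)
      then have "f vs * pcomp \<gamma> g R = (\<Sum>h\<in>H. pcomp \<gamma> h (f vs) * pcomp \<gamma> g R)"
        by (metis sum_distrib_right)
      also have "\<dots> = (\<Sum>h\<in>H. pcomp \<gamma> (h + g) (pcomp \<gamma> h (f vs) * R))"
        by (intro sum.cong refl) (simp add: pcomp_mult homdeg_pcomp)
      finally show ?thesis
        by (simp add: expn_kap_sum[OF d] expn_kap_pcomp[OF assms(1) d sh])
    qed
    then have "(\<Sum>vs\<in>ords A. expn vs (rat (f vs * pcomp \<gamma> g R) * kap vs) m) =
      (\<Sum>vs\<in>ords A. \<Sum>h\<in>H. scomp \<gamma> (h + g) (expn vs (rat (pcomp \<gamma> h (f vs) * R) * kap vs)) m)"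
      by (intro sum.cong) auto
    also have "\<dots> = (\<Sum>h\<in>H. \<Sum>vs\<in>ords A. scomp \<gamma> (h + g) (expn vs (rat (pcomp \<gamma> h (f vs) * R) * kap vs)) m)"
      by (rule sum.swap)
    also have "\<dots> = 0"
    proof (rule sum.neutral, rule ballI)
      fix h
      have "(\<Sum>vs\<in>ords A. expn vs (rat (pcomp \<gamma> h (f vs) * R) * kap vs) m) = 0"
        using assms(4) syz[of h] unfolding J_def by blast
      then show "(\<Sum>vs\<in>ords A. scomp \<gamma> (h + g) (expn vs (rat (pcomp \<gamma> h (f vs) * R) * kap vs)) m) = 0"
        by (cases "\<gamma> m = h + g") (simp_all add: scomp_def)
    qed
    finally show ?thesis .
  qed
  then show ?thesis by (simp add: J_def)
qed

lemma restrict_exp_shift: "u \<in> A \<Longrightarrow> v \<in> A \<Longrightarrow> restrict_exp (- A) (shift u v) = 0"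
  by (rule poly_mapping_eqI) (auto simp: lookup_restrict_exp shift_def lookup_minus lookup_single)

lemma J_coef: "finite A \<Longrightarrow> R \<in> J A \<Longrightarrow> coef A e R \<in> J A"
  unfolding coef_def
  by (rule J_mult, rule J_pcomp[OF restrict_exp.grading_axioms])
    (simp_all add: restrict_exp_shift)

lemma J_iff_coef: "finite A \<Longrightarrow> R \<in> J A \<longleftrightarrow> (\<forall>e. coef A e R \<in> J A)"
proof
  assume "\<forall>e. coef A e R \<in> J A"
  then show "R \<in> J A" by (subst coef_decompose[of R A]) (intro J_sum J_mult, simp)
qed (simp add: J_coef)

end

section \<open>Restricting to fewer variables\<close>

context zeta_data
begin

definition low :: "('i expo \<Rightarrow> int) \<Rightarrow> ('i, 'k) series \<Rightarrow> bool" where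
  "low \<gamma> E \<longleftrightarrow> (\<exists>L. \<forall>m. E m \<noteq> 0 \<longrightarrow> \<gamma> m \<ge> L)"

lemma low_act:
  assumes "grading \<gamma>" "low \<gamma> E" shows "low \<gamma> (act D E)"
proof -
  interpret grading \<gamma> by fact
  obtain L where L: "\<And>m. E m \<noteq> 0 \<Longrightarrow> \<gamma> m \<ge> L" using assms(2) unfolding low_def by blast
  show ?thesis unfolding low_def
  proof (intro exI[of _ "L + Min (\<gamma> ` keys D)"] allI impI)
    fix m assume "act D E m \<noteq> 0"
    then obtain d where d: "d \<in> keys D" "E (m - d) \<noteq> 0"
      unfolding act_def by (metis (no_types, lifting) mult_zero_right sum.neutral)
    then have "\<gamma> d \<ge> Min (\<gamma> ` keys D)" by auto
    then show "\<gamma> m \<ge> L + Min (\<gamma> ` keys D)" using L[OF d(2)] by (simp add: diff)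
  qed
qed

text \<open>
  Up to a unit the numerator is 1 or $1 - z_v / z_u$, with lowest term 1.
\<close>

lemma num_injective:
  assumes "grading \<gamma>" "low \<gamma> E" "\<gamma> (shift u v) > 0" "act (num u v) E = (\<lambda>_. 0)"
  shows "E = (\<lambda>_. 0)"
proof -
  interpret grading \<gamma> by fact
  define D where "D = (if colour u = colour v then 1 - single (shift u v) 1 else (1 :: ('i, 'k) laurent))"
  define e where "e = single u (s (colour v) (colour u)) - single v (s (colour v) (colour u))"
  have sh: "shift u v \<noteq> 0" using assms(3) zero by auto
  have "act (single e (1 / \<alpha> (colour v) (colour u))) (act D E) = (\<lambda>_. 0)"
    using assms(4) by (simp add: num_def D_def e_def act_mult)
  then have "act D E (m - e) = 0" for m
    using alpha_nz by (auto simp: fun_eq_iff act_single)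
  from this[of "m + e" for m] have D: "act D E = (\<lambda>_. 0)" by auto
  obtain L where L: "\<And>m. E m \<noteq> 0 \<Longrightarrow> \<gamma> m \<ge> L" using assms(2) unfolding low_def by blast
  have lD: "lookup D m = (if m = 0 then 1 else if m = shift u v \<and> colour u = colour v then - 1 else 0)" for m
    using sh by (auto simp: D_def lookup_minus lookup_single lookup_one when_def)
  show ?thesis
    by (rule unique_minimum_injective[where ?d0.0 = 0 and D = D, OF add L _ _ D])
      (use assms(3) in \<open>auto simp: in_keys_iff lD zero split: if_splits\<close>)
qed

lemma nump_injective:
  assumes "grading \<gamma>" "finite P" "\<And>u v. (u, v) \<in> P \<Longrightarrow> \<gamma> (shift u v) > 0"
  shows "low \<gamma> E \<Longrightarrow> act (nump P) E = (\<lambda>_. 0) \<Longrightarrow> E = (\<lambda>_. 0)"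
  using assms(2,3)
proof (induction P)
  case empty
  then show ?case by (simp add: nump_def)
next
  case (insert p P)
  obtain u v where p: "p = (u, v)" by (cases p)
  have "act (num u v) (act (nump P) E) = (\<lambda>_. 0)"
    using insert.prems insert.hyps p by (simp add: nump_def act_mult)
  then have "act (nump P) E = (\<lambda>_. 0)"
    using num_injective[OF assms(1) low_act[OF assms(1) insert.prems(1)]] insert.prems p by blast
  then show ?case using insert by blast
qed

lemma bdd_expn_kap: "distinct vs \<Longrightarrow> bdd (cone vs) (expn vs (rat r * kap vs))"
  using is_expansion_expn[OF _ expandable_kap] unfolding is_expansion_iff by blast

text \<open>
  Append the variables outside \<open>A\<close>, in a fixed order \<open>\<beta>\<close>, to all orderings of \<open>A\<close>. This multiplies all
  kernels by one factor, so a relation for \<open>A\<close>, multiplied by the denominator of that factor, is a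
  relation for \<open>V\<close>. Its discrepancy is the one for \<open>A\<close> times the numerator of that factor, and the
  numerator acts injectively on series bounded below in a suitable weight.
\<close>

lemma J_antimono:
  assumes "finite V" "A \<subseteq> V" "R \<in> J V" shows "R \<in> J A"
proof -
  have fA: "finite A" using assms finite_subset by blast
  obtain \<beta> where \<beta>: "set \<beta> = V - A" "distinct \<beta>" using assms(1) finite_distinct_list[of "V - A"] by auto
  define P where "P = bef \<beta> \<union> A \<times> set \<beta>"
  have neq: "u \<noteq> v" if "(u, v) \<in> P" for u v using that bef_irrefl[OF \<beta>(2)] \<beta> by (auto simp: P_def)
  have P: "finite P" using fA by (simp add: P_def)
  define pos where "pos = the_inv_into {..<length \<beta>} ((!) \<beta>)"
  have pos: "pos (\<beta> ! a) = a" if "a < length \<beta>" for a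
    unfolding pos_def using that \<beta>(2) by (intro the_inv_into_f_f) (auto simp: inj_on_nth)
  \<comment> \<open>The weight is 0 on \<open>A\<close> and increases along \<open>\<beta>\<close>: it is constant on translates of cones of \<open>A\<close>, and positive on
    the pairs that were added.\<close>
  define \<gamma> :: "'i expo \<Rightarrow> int" where "\<gamma> m = (\<Sum>x\<in>set \<beta>. int (Suc (pos x)) * lookup m x)" for m
  have \<gamma>: "grading \<gamma>"
    by unfold_locales (simp add: \<gamma>_def lookup_add distrib_left sum.distrib)
  interpret grading \<gamma> by fact
  have \<gamma>_shift: "\<gamma> (shift u v) = (if v \<in> set \<beta> then int (Suc (pos v)) else 0) - (if u \<in> set \<beta> then int (Suc (pos u)) else 0)" for u v
    by (simp add: \<gamma>_def shift_def lookup_minus lookup_single when_def right_diff_distrib sum_subtractf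
        if_distrib[of "(*) _"] sum.delta cong: if_cong)
  have pos_less: "\<gamma> (shift u v) > 0" if "(u, v) \<in> P" for u v
  proof (cases "(u, v) \<in> bef \<beta>")
    case True
    then obtain a b where ab: "a < b" "b < length \<beta>" "u = \<beta> ! a" "v = \<beta> ! b" unfolding bef_conv_nth by blast
    then show ?thesis using pos[of a] pos[of b] by (simp add: \<gamma>_shift)
  next
    case False
    then show ?thesis using that \<beta> by (auto simp: P_def \<gamma>_shift)
  qed
  have "(\<Sum>vs\<in>ords A. expn vs (rat (f vs * R) * kap vs) m) = 0" if f: "syz A f" for f m
  proof -
    define S where "S m = (\<Sum>vs\<in>ords A. expn vs (rat (f vs * R) * kap vs) m)" for m
    have app: "vs @ \<beta> \<in> ords V" if "vs \<in> ords A" for vs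
      using that \<beta> assms(2) by (auto simp: ords_def)
    have kap: "kap (vs @ \<beta>) = kap vs * krp P" if vs: "vs \<in> ords A" for vs
    proof -
      have "bef (vs @ \<beta>) = bef vs \<union> P" using vs by (auto simp: bef_append P_def ords_def)
      moreover have "bef vs \<inter> P = {}" using bef_ords[OF vs] bef_subset[of \<beta>] \<beta> by (auto simp: P_def)
      ultimately show ?thesis using P by (simp add: krp_union)
    qed
    have DP: "rat (denp P) * krp P = rat (nump P)" by (rule krp_num_den) (rule neq)
    have eq: "rat (f vs * denp P * r) * kap (vs @ \<beta>) = rat (nump P) * (rat (f vs * r) * kap vs)"
      if "vs \<in> ords A" for vs r
      unfolding kap[OF that] DP[symmetric] rat_mult by (simp only: mult_ac)
    have "(\<Sum>vs\<in>ords A. rat (f vs * denp P) * kap (vs @ \<beta>)) = rat (nump P) * (\<Sum>vs\<in>ords A. rat (f vs) * kap vs)"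
      using eq[of _ 1] by (simp add: sum_distrib_left)
    then have *: "(\<Sum>vs\<in>ords A. rat (f vs * denp P) * kap (vs @ \<beta>)) = 0" using f by (simp add: syz_def)
    have "(\<Sum>vs\<in>ords A. expn (vs @ \<beta>) (rat (f vs * denp P * R) * kap (vs @ \<beta>)) m) = act (nump P) S m" for m
    proof -
      have "expn (vs @ \<beta>) (rat (f vs * denp P * R) * kap (vs @ \<beta>)) = act (nump P) (expn vs (rat (f vs * R) * kap vs))"
        if vs: "vs \<in> ords A" for vs
      proof -
        have d: "distinct (vs @ \<beta>)" "distinct vs" using app[OF vs] by (auto simp: ords_def)
        have mono: "bef vs \<subseteq> bef (vs @ \<beta>)" by (auto simp: bef_append)
        have "expandable (vs @ \<beta>) (rat (f vs * R) * kap vs)" by (rule expandable_krp[OF d(1) mono])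
        then have "expn (vs @ \<beta>) (rat (nump P) * (rat (f vs * R) * kap vs)) = act (nump P) (expn (vs @ \<beta>) (rat (f vs * R) * kap vs))"
          by (rule expn_mult[OF d(1)])
        also have "expn (vs @ \<beta>) (rat (f vs * R) * kap vs) = expn vs (rat (f vs * R) * kap vs)"
          by (rule expn_mono[OF d(1) mono d(2) expandable_kap[OF d(2)]])
        finally show ?thesis unfolding eq[OF vs] .
      qed
      then show ?thesis unfolding S_def act_sum_right by (intro sum.cong) auto
    qed
    then have "act (nump P) S = (\<lambda>_. 0)"
      using J_indexed[OF assms(1,3) finite_ords[OF fA] app *] by auto
    moreover have "low \<gamma> S"
    proof -
      have "low \<gamma> (expn vs (rat (f vs * R) * kap vs))" if vs: "vs \<in> ords A" for vs
      proof -
        have "distinct vs" using vs by (simp add: ords_def)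
        then obtain M where M: "finite M" "\<And>m. expn vs (rat (f vs * R) * kap vs) m \<noteq> 0 \<Longrightarrow> \<exists>m0\<in>M. m - m0 \<in> cone vs"
          using bdd_expn_kap[of vs "f vs * R"] unfolding bdd_def by blast
        have cone: "\<gamma> m = 0" if "m \<in> cone vs" for m using that
        proof (induction rule: cone_induct)
          case (shift m u v)
          then show ?case using bef_ords[OF vs shift(1)] \<beta> by (simp add: add \<gamma>_shift)
        qed (rule zero)
        show ?thesis unfolding low_def
        proof (intro exI[of _ "Min (\<gamma> ` M)"] allI impI)
          fix m assume "expn vs (rat (f vs * R) * kap vs) m \<noteq> 0"
          then obtain m0 where m0: "m0 \<in> M" "m - m0 \<in> cone vs" using M by blast
          then have "\<gamma> m = \<gamma> m0" using cone[of "m - m0"] by (simp add: diff)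
          then show "\<gamma> m \<ge> Min (\<gamma> ` M)" using M m0 by auto
        qed
      qed
      then obtain L where L: "\<And>vs m. vs \<in> ords A \<Longrightarrow> expn vs (rat (f vs * R) * kap vs) m \<noteq> 0 \<Longrightarrow> \<gamma> m \<ge> L vs"
        unfolding low_def by metis
      show ?thesis unfolding low_def
      proof (intro exI[of _ "Min (L ` ords A)"] allI impI)
        fix m assume "S m \<noteq> 0"
        then obtain vs where vs: "vs \<in> ords A" "expn vs (rat (f vs * R) * kap vs) m \<noteq> 0"
          unfolding S_def by (meson sum.neutral)
        have "Min (L ` ords A) \<le> L vs" using vs finite_ords[OF fA] by auto
        then show "\<gamma> m \<ge> Min (L ` ords A)" using L[OF vs] by linarith
      qed
    qed
    ultimately have "S = (\<lambda>_. 0)" using nump_injective[OF \<gamma> P pos_less] by blast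
    then show ?thesis by (simp add: S_def fun_eq_iff)
  qed
  then show ?thesis by (simp add: J_def)
qed

section \<open>Two separated blocks of variables\<close>

text \<open>
  Over a field, an element of both ideals is a sum of products \<open>a * b\<close>. Write \<open>R\<close> as a sum of \<open>a x * b x\<close>
  with \<open>a x\<close> in the first ideal, and pick a monomial \<open>m\<close> of some \<open>a x\<close>. The coefficient of \<open>m\<close> in \<open>R\<close> is a
  linear combination of the \<open>b y\<close> in which \<open>b x\<close> occurs, and it lies in the second ideal since that ideal
  is closed under coefficients. Eliminating \<open>b x\<close> splits off a product and shortens the sum.
\<close>

lemma intersection_of_ideals_in_disjoint_variables:
  assumes fin: "finite A" "finite B" and disj: "A \<inter> B = {}"
    and R: "R \<in> laurents_in (A \<union> B)" "R \<in> J A" "R \<in> J B"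
    and zero: "Q 0" and plus: "\<And>x y. Q x \<Longrightarrow> Q y \<Longrightarrow> Q (x + y)"
    and prod: "\<And>a b. a \<in> J A \<Longrightarrow> a \<in> laurents_in A \<Longrightarrow> b \<in> J B \<Longrightarrow> b \<in> laurents_in B \<Longrightarrow> Q (a * b)"
  shows "Q R"
proof -
  have claim: "Q R" if "finite F" "\<And>x. x \<in> F \<Longrightarrow> a x \<in> J A" "\<And>x. x \<in> F \<Longrightarrow> a x \<in> laurents_in A"
    "\<And>x. x \<in> F \<Longrightarrow> b x \<in> laurents_in B" "R = (\<Sum>x\<in>F. a x * b x)" "R \<in> J B"
    for F :: "'i expo set" and a b R
    using that
  proof (induction F arbitrary: a b R)
    case empty
    then show ?case using zero by simp
  next
    case (insert x F)
    show ?case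
    proof (cases "a x = 0")
      case True
      then show ?thesis using insert by (intro insert.IH[of a b]) auto
    next
      case False
      then obtain m where m: "m \<in> keys (a x)" by (metis ex_in_conv keys_eq_empty)
      define k where "k y = lookup (a y) m" for y
      have kx: "k x \<noteq> 0" using m by (simp add: k_def in_keys_iff)
      have mA: "keys m \<subseteq> A" using m insert.prems(2)[of x] by (auto simp: laurents_in_def)
      have coef: "coef B m (a y * b y) = cst (k y) * b y" if "y \<in> insert x F" for y
      proof -
        have "coef B m (a y * b y) = b y * coef B m (a y)"
          using insert.prems(3)[OF that] by (simp add: coef_mult mult.commute[of "a y"])
        also have "coef B m (a y) = cst (k y)"
        proof (rule poly_mapping_eqI)
          fix m'
          have "lookup (a y) (m' + m) = 0" if "m' \<noteq> 0" "restrict_exp (- B) (m' + m) = m"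
          proof (rule ccontr)
            assume "lookup (a y) (m' + m) \<noteq> 0"
            then have "keys (m' + m) \<subseteq> A" using insert.prems(2)[OF \<open>y \<in> insert x F\<close>]
              by (auto simp: laurents_in_def in_keys_iff)
            then have "restrict_exp (- B) (m' + m) = m' + m" using disj by (intro restrict_exp_id) auto
            then show False using that by simp
          qed
          moreover have "restrict_exp (- B) m = m" using mA disj by (intro restrict_exp_id) auto
          ultimately show "lookup (coef B m (a y)) m' = lookup (cst (k y)) m'"
            by (auto simp: lookup_coef lookup_single when_def k_def)
        qed
        finally show ?thesis by (simp add: mult.commute)
      qed
      define b' where "b' = coef B m R"
      have b': "b' \<in> J B" "b' \<in> laurents_in B"
        unfolding b'_def using J_coef[OF fin(2) insert.prems(5)] coef_laurents_in by auto
      have "b' = (\<Sum>y\<in>insert x F. cst (k y) * b y)"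
        unfolding b'_def insert.prems(4) coef_sum by (rule sum.cong) (auto simp: coef)
      then have "b' = cst (k x) * b x + (\<Sum>y\<in>F. cst (k y) * b y)"
        using insert.hyps by simp
      moreover have inv: "cst (1 / k x) * cst (k x) = (1 :: ('i, 'k) laurent)" using kx by (simp add: mult_single)
      ultimately have bx: "cst (1 / k x) * b' = b x + cst (1 / k x) * (\<Sum>y\<in>F. cst (k y) * b y)"
        by (simp only: distrib_left) (simp flip: mult.assoc)
      define a' where "a' = a x * cst (1 / k x)"
      define a'' where "a'' y = a y - cst (k y) * a'" for y
      have "a' * b' = a x * (cst (1 / k x) * b')" by (simp add: a'_def mult_ac)
      also have "\<dots> = a x * b x + (\<Sum>y\<in>F. cst (k y) * a' * b y)"
        unfolding bx by (simp add: distrib_left sum_distrib_left a'_def mult_ac)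
      finally have R': "R - a' * b' = (\<Sum>y\<in>F. a'' y * b y)"
        using insert.hyps by (simp add: insert.prems(4) a''_def left_diff_distrib sum_subtractf)
      have a': "a' \<in> J A" "a' \<in> laurents_in A"
        using insert.prems(1,2)[of x] J_mult[of "a x" A "cst (1 / k x)"]
        by (auto simp: a'_def mult.commute intro!: laurents_in_mult laurents_in_single)
      have "Q (R - a' * b')"
      proof (rule insert.IH[OF _ _ _ R'])
        show "a'' y \<in> J A" if "y \<in> F" for y unfolding a''_def
          using that insert.prems(1) a' by (intro J_diff J_mult) auto
        show "a'' y \<in> laurents_in A" if "y \<in> F" for y unfolding a''_def
          using that insert.prems(2) a' by (intro laurents_in_diff laurents_in_mult laurents_in_single) auto
        show "b y \<in> laurents_in B" if "y \<in> F" for y using that insert.prems(3) by auto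
        show "R - a' * b' \<in> J B" using insert.prems(5) b' by (intro J_diff J_mult) auto
      qed
      from plus[OF prod[OF a' b'] this] show ?thesis by simp
    qed
  qed
  show ?thesis
  proof (rule claim[of "restrict_exp (- A) ` keys R" "\<lambda>e. coef A e R" "\<lambda>e. single e 1"])
    show "R = (\<Sum>e\<in>restrict_exp (- A) ` keys R. coef A e R * single e 1)"
      using coef_decompose[of R A] by (simp add: mult.commute)
    show "single e 1 \<in> laurents_in B" if "e \<in> restrict_exp (- A) ` keys R" for e
    proof -
      have "keys e \<subseteq> B" using that R(1) by (force simp: keys_restrict_exp laurents_in_def)
      then show ?thesis by (rule laurents_in_single)
    qed
  qed (use R fin in \<open>auto intro: J_coef coef_laurents_in\<close>)
qed

lemma cone_keys: "m \<in> cone vs \<Longrightarrow> keys m \<subseteq> set vs"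
proof (induction rule: cone_induct)
  case (shift m u v)
  have "keys (shift u v) \<subseteq> set vs"
    using bef_subset[of vs] shift(1) by (auto simp: in_keys_iff shift_def lookup_minus lookup_single when_def split: if_splits)
  then show ?case using shift(2) Poly_Mapping.keys_add[of m "shift u v"] by blast
qed simp

text \<open>
  Elements of \<open>K\<close> involve only \<open>B\<close> and those of the cone do not. So once the exponents outside \<open>B\<close> are
  fixed, each translate leaves one possibility for the part in the cone.
\<close>

lemma bdd_slice:
  assumes "bdd {x + y | x y. x \<in> cone vs \<and> y \<in> K} E" "set vs \<inter> B = {}" "\<And>y. y \<in> K \<Longrightarrow> keys y \<subseteq> B"
  shows "bdd K (scomp (restrict_exp (- B)) e E)"
proof -
  let ?r = "restrict_exp (- B)"
  obtain M where M: "finite M" "\<And>m. E m \<noteq> 0 \<Longrightarrow> \<exists>m0\<in>M. m - m0 \<in> {x + y | x y. x \<in> cone vs \<and> y \<in> K}"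
    using assms(1) unfolding bdd_def by blast
  have cone: "?r x = x" if "x \<in> cone vs" for x
    using cone_keys[OF that] assms(2) by (intro restrict_exp_id) blast
  show ?thesis
  proof (rule bddI[of "(\<lambda>m0. m0 + (e - ?r m0)) ` M"])
    fix m assume "scomp ?r e E m \<noteq> 0"
    then have m: "?r m = e" "E m \<noteq> 0" by (auto simp: scomp_def split: if_splits)
    then obtain m0 x y where *: "m0 \<in> M" "m - m0 = x + y" "x \<in> cone vs" "y \<in> K" using M(2) by blast
    have "?r y = 0" using assms(3)[OF *(4)] by (intro restrict_exp_eq_0) auto
    have "e - ?r m0 = ?r (m - m0)" using m by (simp add: restrict_exp.diff)
    also have "\<dots> = x" unfolding *(2) restrict_exp.add using cone[OF *(3)] \<open>?r y = 0\<close> by simp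
    finally have "m - (m0 + (e - ?r m0)) = y" using *(2) by (simp add: algebra_simps)
    then show "\<exists>m0\<in>(\<lambda>m0. m0 + (e - ?r m0)) ` M. m - m0 \<in> K" using * by blast
  qed (use M in auto)
qed

lemma bdd_zero_finite:
  fixes E :: "('i, 'k) series"
  assumes "bdd {0} E" obtains t where "lookup t = E"
proof -
  obtain M where "finite M" "\<And>m. E m \<noteq> 0 \<Longrightarrow> \<exists>m0\<in>M. m - m0 = 0" using assms unfolding bdd_def by blast
  then have "finite {m. E m \<noteq> 0}" by (intro finite_subset[of "{m. E m \<noteq> 0}" M]) auto
  then show ?thesis using that[of "Abs_poly_mapping E"] by (simp add: lookup_Abs_poly_mapping)
qed

definition cross :: "'a set \<Rightarrow> 'a set \<Rightarrow> ('a \<times> 'a) set" where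
  "cross A B = A \<times> B \<union> B \<times> A"

text \<open>
  The denominators across the two blocks turn the kernel of an ordering of \<open>A \<union> B\<close> into a Laurent
  polynomial times the kernels of the induced orderings \<open>X\<close> of \<open>A\<close> and \<open>Y\<close> of \<open>B\<close>. Fix the exponent \<open>e\<close> of
  the variables outside \<open>B\<close>. The slice at \<open>e\<close> of the expansion along \<open>X\<close>, with \<open>a\<close> multiplied in, is a
  Laurent polynomial \<open>t\<close>. Because \<open>a\<close> lies in \<open>J A\<close>, these slices are the coefficients of a relation among
  the kernels for \<open>B\<close>; because \<open>b\<close> lies in \<open>J B\<close>, the discrepancy of this relation is killed by \<open>b\<close>.
\<close>

lemma separated_product:
  assumes fin: "finite A" "finite B" and disj: "A \<inter> B = {}"
    and a: "a \<in> J A" "a \<in> laurents_in A" and b: "b \<in> J B" "b \<in> laurents_in B"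
  shows "denp (cross A B) * (a * b) \<in> J (A \<union> B)"
proof -
  define V where "V = A \<union> B"
  have V: "finite V" using fin by (simp add: V_def)
  define X where "X vs = filter (\<lambda>x. x \<in> A) vs" for vs :: "'i zvar list"
  define Y where "Y vs = filter (\<lambda>x. x \<in> B) vs" for vs :: "'i zvar list"
  define C where "C vs = cross A B \<inter> bef vs" for vs
  have X: "X vs \<in> ords A" "distinct (X vs)" and Y: "Y vs \<in> ords B" "distinct (Y vs)" and d: "distinct vs"
    if "vs \<in> ords V" for vs using that by (auto simp: ords_def X_def Y_def V_def)
  have befX: "bef (X vs) = bef vs \<inter> A \<times> A" and befY: "bef (Y vs) = bef vs \<inter> B \<times> B" for vs
    by (auto simp: X_def Y_def bef_filter)
  have cneq: "u \<noteq> v" if "(u, v) \<in> cross A B" for u v using that disj by (auto simp: cross_def)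
  have fcross: "finite (cross A B)" using fin by (simp add: cross_def)
  define c where "c vs = nump (C vs) * denp (cross A B - C vs)" for vs
  have kap: "rat (denp (cross A B)) * kap vs = rat (c vs) * (kap (X vs) * kap (Y vs))" if vs: "vs \<in> ords V" for vs
  proof -
    have "bef vs \<subseteq> V \<times> V" using bef_subset[of vs] vs by (auto simp: ords_def)
    then have "bef vs = bef (X vs) \<union> bef (Y vs) \<union> C vs"
      unfolding befX befY C_def cross_def V_def by blast
    moreover have "bef (X vs) \<inter> bef (Y vs) = {}" "(bef (X vs) \<union> bef (Y vs)) \<inter> C vs = {}"
      unfolding befX befY C_def cross_def using disj by blast+
    ultimately have 1: "kap vs = kap (X vs) * kap (Y vs) * krp (C vs)"
      using krp_union[of "bef (X vs)" "bef (Y vs)"] krp_union[of "bef (X vs) \<union> bef (Y vs)" "C vs"]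
      by (simp add: C_def)
    have "cross A B = C vs \<union> (cross A B - C vs)" by (auto simp: C_def)
    then have 2: "denp (cross A B) = denp (C vs) * denp (cross A B - C vs)"
      using denp_union[of "C vs" "cross A B - C vs"] fcross by (simp add: C_def)
    have 3: "rat (denp (C vs)) * krp (C vs) = rat (nump (C vs))"
      by (rule krp_num_den) (use cneq in \<open>auto simp: C_def\<close>)
    show ?thesis unfolding 1 2 c_def rat_mult 3[symmetric] by (simp only: mult_ac)
  qed
  have "(\<Sum>vs\<in>ords V. expn vs (rat (f vs * (denp (cross A B) * (a * b))) * kap vs) m) = 0" if f: "syz V f" for f m
  proof -
    define h where "h vs = c vs * f vs" for vs
    define H where "H vs = expn (X vs) (rat (h vs * a) * kap (X vs))" for vs
    define G where "G vs = expn vs (rat (h vs * (a * b)) * krp (bef (X vs) \<union> bef (Y vs)))" for vs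
    have kXY: "krp (bef (X vs) \<union> bef (Y vs)) = kap (X vs) * kap (Y vs)" for vs
      using disj by (intro krp_union) (auto simp: befX befY)
    have G: "expn vs (rat (f vs * (denp (cross A B) * (a * b))) * kap vs) = G vs" if vs: "vs \<in> ords V" for vs
    proof -
      have "rat (f vs * (denp (cross A B) * (a * b))) * kap vs = rat (f vs * (a * b)) * (rat (denp (cross A B)) * kap vs)"
        unfolding rat_mult by (simp only: mult_ac)
      also have "\<dots> = rat (h vs * (a * b)) * krp (bef (X vs) \<union> bef (Y vs))"
        unfolding kap[OF vs] kXY h_def rat_mult by (simp only: mult_ac)
      finally show ?thesis by (simp only: G_def)
    qed
    let ?r = "restrict_exp (- B)"
    define e where "e = ?r m"
    \<comment> \<open>The cone of \<open>X vs\<close> involves only variables of \<open>A\<close>, so fixing their exponents leaves a finite sum.\<close>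
    define t where "t vs = (SOME t. lookup t = scomp ?r e (H vs))" for vs
    have t: "lookup (t vs) = scomp ?r e (H vs)" if vs: "vs \<in> ords V" for vs
    proof -
      have "bdd (cone (X vs)) (H vs)" unfolding H_def by (rule bdd_expn_kap[OF X(2)[OF vs]])
      then have "bdd {x + y | x y. x \<in> cone (X vs) \<and> y \<in> {0}} (H vs)" by (rule bdd_mono) auto
      moreover have "set (X vs) \<inter> B = {}" using disj by (auto simp: X_def)
      ultimately have "bdd {0} (scomp ?r e (H vs))" by (rule bdd_slice) auto
      then obtain t' where "lookup t' = scomp ?r e (H vs)" by (rule bdd_zero_finite)
      then show ?thesis unfolding t_def by (rule someI)
    qed
    have G_expand: "expandable vs (rat r * krp (bef (X vs) \<union> bef (Y vs)))" if "vs \<in> ords V" for vs r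
      by (rule expandable_krp[OF d[OF that]]) (auto simp: befX befY)
    have G_bdd: "bdd (cone (Y vs)) (scomp ?r e (G vs))" if vs: "vs \<in> ords V" for vs
    proof (rule bdd_slice)
      let ?K = "{x + y | x y. x \<in> cone (X vs) \<and> y \<in> cone (Y vs)}"
      have "\<exists>E. is_expansion vs (rat (h vs * (a * b)) * krp (bef (X vs) \<union> bef (Y vs))) E \<and> bdd ?K E"
      proof (rule expansion_krp[OF d[OF vs]])
        have "cone (X vs) \<subseteq> cone vs" "cone (Y vs) \<subseteq> cone vs" by (rule cone_mono; auto simp: befX befY)+
        then show "?K \<subseteq> cone vs" by (auto intro: cone_add)
        show "0 \<in> ?K" using cone_0 by (metis (mono_tags, lifting) add_0 mem_Collect_eq)
        fix x u v assume "x \<in> ?K" and uv: "(u, v) \<in> bef (X vs) \<union> bef (Y vs)"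
        then obtain x1 x2 where x: "x = x1 + x2" "x1 \<in> cone (X vs)" "x2 \<in> cone (Y vs)" by blast
        have "x1 + shift u v \<in> cone (X vs) \<or> x2 + shift u v \<in> cone (Y vs)"
          using uv x by (auto intro: cone_add cone_shift)
        then show "x + shift u v \<in> ?K"
        proof
          assume "x1 + shift u v \<in> cone (X vs)"
          then show ?thesis using x by (intro CollectI exI[of _ "x1 + shift u v"] exI[of _ x2]) (auto simp: algebra_simps)
        next
          assume "x2 + shift u v \<in> cone (Y vs)"
          then show ?thesis using x by (intro CollectI exI[of _ x1] exI[of _ "x2 + shift u v"]) (auto simp: algebra_simps)
        qed
      qed (auto simp: befX befY)
      then obtain E where E: "is_expansion vs (rat (h vs * (a * b)) * krp (bef (X vs) \<union> bef (Y vs))) E" "bdd ?K E"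
        by blast
      have "G vs = E" unfolding G_def by (rule expn_eqI[OF d[OF vs] E(1)])
      then show "bdd ?K (G vs)" using E(2) by simp
      show "set (X vs) \<inter> B = {}" using disj by (auto simp: X_def)
      show "keys y \<subseteq> B" if "y \<in> cone (Y vs)" for y using cone_keys[OF that] by (auto simp: Y_def)
    qed
    have homB: "homdeg ?r 0 D" if "D \<in> laurents_in B" for D :: "('i, 'k) laurent"
      using that by (simp add: homdeg_restrict_exp_iff)
    have rB: "?r (shift u v) = 0" if "u \<in> B" "v \<in> B" for u v by (rule restrict_exp_shift[OF that])
    have slice: "scomp ?r e (G vs) = expn (Y vs) (rat (t vs * b) * kap (Y vs))" if vs: "vs \<in> ords V" for vs
    proof (rule expn_kap_eqI[symmetric, OF Y(2)[OF vs] G_bdd[OF vs]])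
      let ?D = "denp (bef (Y vs))" and ?n = "nump (bef (Y vs))"
      have hD: "homdeg ?r 0 ?D" "homdeg ?r 0 ?n"
        by (auto intro!: denp_homdeg nump_homdeg restrict_exp.grading_axioms rB simp: befY)
      have hnb: "homdeg ?r 0 (?n * b)"
        using restrict_exp.homdeg_mult[OF hD(2) homB[OF b(2)]] by simp
      have Dn: "rat ?D * kap (Y vs) = rat ?n"
        by (rule krp_num_den) (use bef_irrefl[OF Y(2)[OF vs]] in blast)
      have "act ?D (G vs) = expn vs (rat ?D * (rat (h vs * (a * b)) * krp (bef (X vs) \<union> bef (Y vs))))"
        unfolding G_def by (rule expn_mult[symmetric, OF d[OF vs] G_expand[OF vs]])
      also have "rat ?D * (rat (h vs * (a * b)) * krp (bef (X vs) \<union> bef (Y vs))) = rat (?n * b) * (rat (h vs * a) * kap (X vs))"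
        unfolding kXY rat_mult Dn[symmetric] by (simp only: mult_ac)
      also have "expn vs \<dots> = act (?n * b) (expn vs (rat (h vs * a) * kap (X vs)))"
        by (rule expn_mult[OF d[OF vs]]) (rule expandable_krp[OF d[OF vs]], auto simp: befX)
      also have "expn vs (rat (h vs * a) * kap (X vs)) = H vs"
        unfolding H_def by (rule expn_mono[OF d[OF vs] _ X(2)[OF vs] expandable_kap[OF X(2)[OF vs]]]) (auto simp: befX)
      finally have "act ?D (G vs) = act (?n * b) (H vs)" .
      then have "act ?D (scomp ?r e (G vs)) = act (?n * b) (scomp ?r e (H vs))"
        using restrict_exp.scomp_act_0[OF hD(1), of e "G vs"] restrict_exp.scomp_act_0[OF hnb, of e "H vs"] by simp
      also have "\<dots> = lookup (?n * (t vs * b))"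
        unfolding t[OF vs, symmetric] act_lookup by (simp add: mult_ac)
      finally show "act ?D (scomp ?r e (G vs)) = lookup (?n * (t vs * b))" .
    qed
    have "(\<Sum>vs\<in>ords V. rat (t vs) * kap (Y vs)) = 0"
    proof -
      let ?D = "denp (B \<times> B - Id)"
      define y where "y vs = clr B (Y vs)" for vs
      have y: "rat ?D * kap (Y vs) = rat (y vs)" if "vs \<in> ords V" for vs
        unfolding y_def by (rule clear_denominators[OF fin(2) Y(1)[OF that]])
      have hy: "homdeg ?r 0 (y vs)" if "vs \<in> ords V" for vs
        unfolding y_def by (rule clr_homdeg[OF restrict_exp.grading_axioms rB Y(1)[OF that]])
      have "(\<Sum>vs\<in>ords V. rat (h vs * y vs) * kap (X vs)) =
        (\<Sum>vs\<in>ords V. rat ?D * (rat (denp (cross A B)) * (rat (f vs) * kap vs)))"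
      proof (intro sum.cong refl)
        fix vs assume vs: "vs \<in> ords V"
        have "rat ?D * (rat (denp (cross A B)) * (rat (f vs) * kap vs)) = rat ?D * rat (f vs) * (rat (denp (cross A B)) * kap vs)"
          by (simp only: mult_ac)
        also have "\<dots> = rat (h vs * y vs) * kap (X vs)"
          unfolding kap[OF vs] h_def rat_mult y[OF vs, symmetric] by (simp only: mult_ac)
        finally show "rat (h vs * y vs) * kap (X vs) = rat ?D * (rat (denp (cross A B)) * (rat (f vs) * kap vs))" ..
      qed
      also have "\<dots> = 0" using f by (simp add: syz_def flip: sum_distrib_left)
      finally have *: "(\<Sum>vs\<in>ords V. rat (h vs * y vs) * kap (X vs)) = 0" .
      have "(\<Sum>vs\<in>ords V. expn (X vs) (rat (h vs * y vs * a) * kap (X vs)) m') = 0" for m'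
        by (rule J_indexed[OF fin(1) a(1) finite_ords[OF V] _ *]) (rule X)
      moreover have "expn (X vs) (rat (h vs * y vs * a) * kap (X vs)) = act (y vs) (H vs)" if "vs \<in> ords V" for vs
        unfolding H_def using expn_kap_mult[OF X(2)[OF that], of "y vs" "h vs * a"] by (simp add: mult_ac)
      ultimately have sum0: "(\<Sum>vs\<in>ords V. act (y vs) (H vs) m') = 0" for m' by simp
      have "lookup (\<Sum>vs\<in>ords V. t vs * y vs) m' = 0" for m'
      proof -
        have "lookup (\<Sum>vs\<in>ords V. t vs * y vs) m' = (\<Sum>vs\<in>ords V. scomp ?r e (act (y vs) (H vs)) m')"
          unfolding lookup_sum
        proof (intro sum.cong refl)
          fix vs assume vs: "vs \<in> ords V"
          have "lookup (t vs * y vs) = act (y vs) (lookup (t vs))" by (simp add: act_lookup mult.commute)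
          then show "lookup (t vs * y vs) m' = scomp ?r e (act (y vs) (H vs)) m'"
            by (simp add: t[OF vs] restrict_exp.scomp_act_0[OF hy[OF vs]])
        qed
        also have "\<dots> = 0" using sum0[of m'] by (cases "?r m' = e") (simp_all add: scomp_def)
        finally show ?thesis .
      qed
      then have "(\<Sum>vs\<in>ords V. t vs * y vs) = 0" by (intro poly_mapping_eqI) simp
      then have "rat (\<Sum>vs\<in>ords V. t vs * y vs) = 0" by simp
      moreover have "rat (\<Sum>vs\<in>ords V. t vs * y vs) = rat ?D * (\<Sum>vs\<in>ords V. rat (t vs) * kap (Y vs))"
        unfolding rat_sum sum_distrib_left
      proof (intro sum.cong refl)
        fix vs assume vs: "vs \<in> ords V"
        show "rat (t vs * y vs) = rat ?D * (rat (t vs) * kap (Y vs))"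
          unfolding rat_mult y[OF vs, symmetric] by (simp only: mult_ac)
      qed
      ultimately show ?thesis using denp_total_nz[of B] by simp
    qed
    from J_indexed[OF fin(2) b(1) finite_ords[OF V] _ this, OF Y(1)]
    have "(\<Sum>vs\<in>ords V. expn (Y vs) (rat (t vs * b) * kap (Y vs)) m) = 0" by blast
    then have "(\<Sum>vs\<in>ords V. scomp ?r e (G vs) m) = 0" by (simp add: slice)
    then show ?thesis by (simp add: G scomp_def e_def)
  qed
  then show ?thesis by (simp add: J_def V_def)
qed

lemma separated_blocks:
  assumes "finite A" "finite B" "A \<inter> B = {}" "R \<in> laurents_in (A \<union> B)" "R \<in> J A" "R \<in> J B"
  shows "denp (cross A B) * R \<in> J (A \<union> B)"
  by (rule intersection_of_ideals_in_disjoint_variables[OF assms, where Q = "\<lambda>R. denp (cross A B) * R \<in> J (A \<union> B)"])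
    (auto simp: J_0 distrib_left intro: J_add separated_product[OF assms(1-3)])

end

section \<open>Ideals of Laurent polynomials\<close>

text \<open>
  Ideals of the ring of Laurent polynomials in \<open>X\<close>, with the operations of the type in place of a ring record.
\<close>

definition lideal :: "'i zvar set \<Rightarrow> ('i, 'k::comm_ring_1) laurent set \<Rightarrow> bool" where
  "lideal X I \<longleftrightarrow> I \<subseteq> laurents_in X \<and> 0 \<in> I \<and> (\<forall>a\<in>I. \<forall>b\<in>I. a + b \<in> I) \<and>
     (\<forall>r\<in>laurents_in X. \<forall>a\<in>I. r * a \<in> I)"

lemma lidealD:
  assumes "lideal X I"
  shows "a \<in> I \<Longrightarrow> a \<in> laurents_in X" "0 \<in> I" "a \<in> I \<Longrightarrow> b \<in> I \<Longrightarrow> a + b \<in> I"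
    "r \<in> laurents_in X \<Longrightarrow> a \<in> I \<Longrightarrow> r * a \<in> I"
  using assms unfolding lideal_def by blast+

lemma lideal_uminus: "lideal X I \<Longrightarrow> a \<in> I \<Longrightarrow> - a \<in> I"
  using lidealD(4)[of X I "- 1" a] by (simp add: laurents_in_uminus)

lemma lideal_diff: "lideal X I \<Longrightarrow> a \<in> I \<Longrightarrow> b \<in> I \<Longrightarrow> a - b \<in> I"
  using lidealD(3)[of X I a "- b"] lideal_uminus[of X I b] by simp

lemma lideal_sum: "lideal X I \<Longrightarrow> (\<And>x. x \<in> S \<Longrightarrow> f x \<in> I) \<Longrightarrow> (\<Sum>x\<in>S. f x) \<in> I"
  by (induction S rule: infinite_finite_induct) (auto intro: lidealD)

lemma ring_on_laurents: "cring (ring_on (laurents_in X :: ('i, 'k::comm_ring_1) laurent set))"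
proof (rule cringI)
  show "abelian_group (ring_on (laurents_in X :: ('i, 'k) laurent set))"
  proof (rule abelian_groupI)
    fix x assume "x \<in> carrier (ring_on (laurents_in X :: ('i, 'k) laurent set))"
    then show "\<exists>y\<in>carrier (ring_on (laurents_in X)). y \<oplus>\<^bsub>ring_on (laurents_in X)\<^esub> x = \<zero>\<^bsub>ring_on (laurents_in X)\<^esub>"
      by (intro bexI[of _ "- x"]) (auto simp: ring_on_def laurents_in_uminus)
  qed (auto simp: ring_on_def laurents_in_add)
  show "comm_monoid (ring_on (laurents_in X :: ('i, 'k) laurent set))"
    by (rule comm_monoidI) (auto simp: ring_on_def laurents_in_mult mult_ac)
qed (auto simp: ring_on_def distrib_right)

lemma ideal_iff_lideal:
  fixes I :: "('i, 'k::comm_ring_1) laurent set"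
  shows "ideal I (ring_on (laurents_in X)) \<longleftrightarrow> lideal X I"
proof
  interpret cring "ring_on (laurents_in X :: ('i, 'k) laurent set)" by (rule ring_on_laurents)
  assume "ideal I (ring_on (laurents_in X))"
  then interpret ideal I "ring_on (laurents_in X)" .
  show "lideal X I" unfolding lideal_def
    using a_subset zero_closed a_closed I_l_closed by (auto simp: ring_on_def)
next
  interpret cring "ring_on (laurents_in X :: ('i, 'k) laurent set)" by (rule ring_on_laurents)
  assume I: "lideal X I"
  have right: "a * x \<in> I" if "a \<in> I" "x \<in> laurents_in X" for a x
    using lidealD(4)[OF I that(2,1)] by (simp add: mult.commute)
  show "ideal I (ring_on (laurents_in X))"
  proof (rule idealI)
    show "ring (ring_on (laurents_in X :: ('i, 'k) laurent set))" by (rule ring_axioms)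
    show "subgroup I (add_monoid (ring_on (laurents_in X)))"
    proof (rule add.subgroupI)
      show "I \<noteq> {}" using lidealD[OF I] by blast
      fix a assume a: "a \<in> I"
      have "\<ominus>\<^bsub>ring_on (laurents_in X)\<^esub> a = - a"
        using lidealD(1)[OF I] a by (intro minus_equality) (auto simp: ring_on_def laurents_in_uminus)
      then show "\<ominus>\<^bsub>ring_on (laurents_in X)\<^esub> a \<in> I" using lideal_uminus[OF I a] by simp
    qed (use lidealD[OF I] in \<open>auto simp: ring_on_def\<close>)
  qed (use lidealD(4)[OF I] right in \<open>auto simp: ring_on_def\<close>)
qed

lemma Idl_eq: "Idl\<^bsub>ring_on (laurents_in X)\<^esub> S = \<Inter>{I. lideal X I \<and> S \<subseteq> I}"
  by (simp add: genideal_def ideal_iff_lideal)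

subsection \<open>The ascending chain condition\<close>

lemma nat_seq_increasing_subseq:
  fixes f :: "nat \<Rightarrow> nat"
  shows "\<exists>r :: nat \<Rightarrow> nat. strict_mono r \<and> mono (\<lambda>k. f (r k))"
proof -
  have "\<exists>n. n > a \<and> (\<forall>m>a. f n \<le> f m)" for a
    using ex_has_least_nat[of "\<lambda>n. n > a" "Suc a" f] by auto
  then obtain g where g: "\<And>a. g a > a" "\<And>a m. m > a \<Longrightarrow> f (g a) \<le> f m" by metis
  define r where "r k = (g ^^ Suc k) 0" for k
  have r: "r (Suc k) = g (r k)" for k by (simp add: r_def)
  have "strict_mono r" unfolding strict_mono_Suc_iff by (simp add: r g)
  moreover have "f (r k) \<le> f (r (Suc k))" for k
  proof -
    have "r (Suc k) > (g ^^ k) 0" using g(1)[of "(g ^^ k) 0"] g(1)[of "r k"] by (simp add: r r_def)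
    then show ?thesis using g(2) by (simp add: r_def)
  qed
  ultimately show ?thesis by (intro exI[of _ r]) (simp add: mono_iff_le_Suc)
qed

text \<open>
  Pass to a subsequence along which each of the finitely many coordinates is nondecreasing.
\<close>

lemma dickson:
  fixes m :: "nat \<Rightarrow> 'i expo"
  assumes "finite X" "\<And>k. keys (m k) \<subseteq> X" "\<And>k v. lookup (m k) v \<ge> 0"
  obtains i j where "i < j" "\<And>v. lookup (m i) v \<le> lookup (m j) v"
proof -
  have "\<exists>r :: nat \<Rightarrow> nat. strict_mono r \<and> (\<forall>v\<in>Y. mono (\<lambda>k. nat (lookup (m (r k)) v)))" if "finite Y" for Y
    using that
  proof induction
    case empty
    show ?case by (intro exI[of _ id]) (auto simp: strict_mono_def)
  next
    case (insert y Y)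
    then obtain r :: "nat \<Rightarrow> nat" where r: "strict_mono r" "\<forall>v\<in>Y. mono (\<lambda>k. nat (lookup (m (r k)) v))" by blast
    obtain r' :: "nat \<Rightarrow> nat" where r': "strict_mono r'" "mono (\<lambda>k. nat (lookup (m (r (r' k))) y))"
      using nat_seq_increasing_subseq[of "\<lambda>k. nat (lookup (m (r k)) y)"] by blast
    have "mono (\<lambda>k. nat (lookup (m (r (r' k))) v))" if "v \<in> Y" for v
      using r(2) that strict_mono_mono[OF r'(1)] unfolding mono_def by blast
    then show ?case using r' r(1)
      by (intro exI[of _ "\<lambda>k. r (r' k)"]) (auto simp: strict_mono_def)
  qed
  from this[OF assms(1)] obtain r :: "nat \<Rightarrow> nat" where r: "strict_mono r" "\<forall>v\<in>X. mono (\<lambda>k. nat (lookup (m (r k)) v))"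
    by blast
  show ?thesis
  proof (rule that)
    show "r 0 < r 1" using r(1) by (simp add: strict_mono_def)
    show "lookup (m (r 0)) v \<le> lookup (m (r 1)) v" for v
    proof (cases "v \<in> X")
      case True
      then have "nat (lookup (m (r 0)) v) \<le> nat (lookup (m (r 1)) v)" using r(2) by (auto simp: mono_def)
      then show ?thesis using assms(3)[of "r 0" v] assms(3)[of "r 1" v] by simp
    next
      case False
      then have "lookup (m (r 0)) v = 0" using assms(2)[of "r 0"] by (meson in_keys_iff subsetD)
      then show ?thesis using assms(3)[of "r 1" v] by simp
    qed
  qed
qed

lemma expo_nonneg: "(\<And>v. lookup m v \<ge> 0) \<Longrightarrow> (m :: 'i expo) \<ge> 0"
proof (rule ccontr)
  assume *: "\<And>v. lookup m v \<ge> 0" "\<not> m \<ge> 0"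
  then have "m < 0" by simp
  then have "\<exists>v. lookup m v < 0" by transfer (auto simp: less_fun_def)
  then show False using *(1) by (meson not_less)
qed

lemma expo_mono: "(\<And>v. lookup m v \<le> lookup m' v) \<Longrightarrow> (m :: 'i expo) \<le> m'"
  using expo_nonneg[of "m' - m"] by (simp add: lookup_minus)

definition nonneg_expos :: "'i zvar set \<Rightarrow> 'i expo set" where
  "nonneg_expos X = {m. keys m \<subseteq> X \<and> (\<forall>v. lookup m v \<ge> 0)}"

text \<open>
  The total order of exponents extends the componentwise order, so a descending sequence contradicts
  Dickson's lemma.
\<close>

lemma wf_nonneg_expos:
  assumes "finite X" shows "wf {(a, b). a < b \<and> a \<in> nonneg_expos X \<and> b \<in> nonneg_expos X}"
  unfolding wf_iff_no_infinite_down_chain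
proof
  assume "\<exists>f. \<forall>k. (f (Suc k), f k) \<in> {(a, b). a < b \<and> a \<in> nonneg_expos X \<and> b \<in> nonneg_expos X}"
  then obtain f where f: "\<And>k. f (Suc k) < f k" "\<And>k. f k \<in> nonneg_expos X" by blast
  obtain i j where ij: "i < j" "\<And>v. lookup (f i) v \<le> lookup (f j) v"
    using dickson[OF assms, of f] f(2) unfolding nonneg_expos_def by blast
  have "f j < f i" using ij(1) f(1) by (induction rule: less_Suc_induct) auto
  with expo_mono[OF ij(2)] show False by simp
qed

text \<open>
  Hilbert's basis theorem by leading terms. Multiplication by a monomial makes exponents nonnegative,
  so one can pick in each \<open>I (Suc k) - I k\<close> an element \<open>f k\<close> with nonnegative exponents whose leading
  exponent is minimal. If the leading monomial of \<open>f i\<close> divides that of \<open>f j\<close>, with \<open>i < j\<close>, subtracting a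
  multiple of \<open>f i\<close> from \<open>f j\<close> gives a smaller leading exponent.
\<close>

lemma no_ascending_chain:
  fixes I :: "nat \<Rightarrow> ('i, 'k::field) laurent set"
  assumes "finite X" "\<And>k. lideal X (I k)" "\<And>k. I k \<subset> I (Suc k)"
  shows False
proof -
  define S where "S k = {f \<in> I (Suc k) - I k. keys f \<subseteq> nonneg_expos X}" for k
  have S_nonzero: "f \<noteq> 0" if "f \<in> S k" for f k using that lidealD(2)[OF assms(2)] by (auto simp: S_def)
  have "\<exists>f\<in>S k. \<forall>g\<in>S k. \<not> Max (keys g) < Max (keys f)" for k
  proof -
    obtain f where f: "f \<in> I (Suc k)" "f \<notin> I k" using assms(3)[of k] by blast
    have fX: "f \<in> laurents_in X" using lidealD(1)[OF assms(2) f(1)] .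
    \<comment> \<open>As \<open>c\<close> bounds all exponents of \<open>f\<close>, multiplication by the monomial \<open>e\<close> makes them nonnegative.\<close>
    define c where "c = (\<Sum>m\<in>keys f. \<Sum>v\<in>X. \<bar>lookup m v\<bar>)"
    define e where "e = (\<Sum>v\<in>X. single v c)"
    have le: "lookup e v = (if v \<in> X then c else 0)" for v
      using assms(1) by (auto simp: e_def lookup_sum lookup_single when_def)
    have eX: "keys e \<subseteq> X" by (auto simp: in_keys_iff le split: if_splits)
    have "single e 1 * f \<in> S k"
    proof -
      have "single (- e) 1 * (single e 1 * f) = f" by (simp add: mult_single flip: mult.assoc)
      moreover have "keys (- e) \<subseteq> X" using eX by (auto simp: in_keys_iff)
      ultimately have "single e 1 * f \<notin> I k"
        using f(2) lidealD(4)[OF assms(2) laurents_in_single] by metis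
      moreover have "single e 1 * f \<in> I (Suc k)"
        by (rule lidealD(4)[OF assms(2) laurents_in_single f(1)]) (rule eX)
      moreover have "keys (single e 1 * f) \<subseteq> nonneg_expos X"
      proof
        fix m assume "m \<in> keys (single e 1 * f)"
        then obtain m' where m': "m = e + m'" "m' \<in> keys f"
          using Poly_Mapping.keys_mult[of "single e 1" f] by auto
        have m'X: "keys m' \<subseteq> X" using fX m' by (auto simp: laurents_in_def)
        have "lookup m v \<ge> 0" for v
        proof (cases "v \<in> X")
          case True
          have "\<bar>lookup m' v\<bar> \<le> (\<Sum>v\<in>X. \<bar>lookup m' v\<bar>)" using True assms(1) by (intro member_le_sum) auto
          also have "\<dots> \<le> c" unfolding c_def using m'(2)
            by (intro member_le_sum[of m' "keys f" "\<lambda>m. \<Sum>v\<in>X. \<bar>lookup m v\<bar>"]) (auto intro: sum_nonneg)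
          finally show ?thesis using True by (simp add: m' lookup_add le)
        next
          case False
          then have "lookup m' v = 0" using m'X by (meson in_keys_iff subsetD)
          then show ?thesis using False by (simp add: m' lookup_add le)
        qed
        moreover have "keys m \<subseteq> X" using m'X eX Poly_Mapping.keys_add[of e m'] by (auto simp: m')
        ultimately show "m \<in> nonneg_expos X" by (auto simp: nonneg_expos_def)
      qed
      ultimately show ?thesis by (simp add: S_def)
    qed
    then have ne: "(\<lambda>f. Max (keys f)) ` S k \<noteq> {}" by blast
    have sub: "(\<lambda>f. Max (keys f)) ` S k \<subseteq> nonneg_expos X"
    proof
      fix m assume "m \<in> (\<lambda>f. Max (keys f)) ` S k"
      then obtain f where f: "m = Max (keys f)" "f \<in> S k" by blast
      have "Max (keys f) \<in> keys f" using S_nonzero[OF f(2)] by (intro Max_in) auto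
      then show "m \<in> nonneg_expos X" using f by (auto simp: S_def)
    qed
    obtain m where "m \<in> (\<lambda>f. Max (keys f)) ` S k"
      "\<And>y. (y, m) \<in> {(a, b). a < b \<and> a \<in> nonneg_expos X \<and> b \<in> nonneg_expos X} \<Longrightarrow> y \<notin> (\<lambda>f. Max (keys f)) ` S k"
      using wfE_min'[OF wf_nonneg_expos[OF assms(1)] ne] by blast
    with sub show ?thesis by blast
  qed
  then obtain f where f: "\<And>k. f k \<in> S k" "\<And>k g. g \<in> S k \<Longrightarrow> \<not> Max (keys g) < Max (keys (f k))"
    by metis
  define l where "l k = Max (keys (f k))" for k
  have l: "l k \<in> keys (f k)" for k unfolding l_def using S_nonzero[OF f(1)] by (intro Max_in) auto
  have l_max: "m \<le> l k" if "m \<in> keys (f k)" for m k unfolding l_def using that by simp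
  have lX: "l k \<in> nonneg_expos X" for k using l[of k] f(1)[of k] by (auto simp: S_def)
  obtain i j where ij: "i < j" "\<And>v. lookup (l i) v \<le> lookup (l j) v"
    using dickson[OF assms(1), of l] lX unfolding nonneg_expos_def by blast
  define e where "e = l j - l i"
  have e: "e \<in> nonneg_expos X"
  proof -
    have "keys e \<subseteq> keys (l i) \<union> keys (l j)" by (auto simp: e_def in_keys_iff lookup_minus)
    then show ?thesis using lX[of i] lX[of j] ij(2) by (auto simp: nonneg_expos_def e_def lookup_minus)
  qed
  define h where "h = single e (lookup (f j) (l j) / lookup (f i) (l i)) * f i"
  define g where "g = f j - h"
  have inc: "I a \<subseteq> I b" if "a \<le> b" for a b by (rule lift_Suc_mono_le[of I, OF _ that]) (use assms(3) in \<open>auto dest: psubset_imp_subset\<close>)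
  have "f i \<in> I j" using f(1)[of i] inc[of "Suc i" j] ij(1) by (auto simp: S_def)
  then have hI: "h \<in> I j" unfolding h_def using e
    by (intro lidealD(4)[OF assms(2)] laurents_in_single) (auto simp: nonneg_expos_def)
  have hkeys: "\<exists>m'\<in>keys (f i). m = e + m'" if "m \<in> keys h" for m
    using that Poly_Mapping.keys_mult[of "single e (lookup (f j) (l j) / lookup (f i) (l i))" "f i"]
    unfolding h_def by (auto split: if_splits)
  have fj: "f j \<in> I (Suc j)" "f j \<notin> I j" "keys (f j) \<subseteq> nonneg_expos X" using f(1)[of j] by (auto simp: S_def)
  have gkeys: "m \<in> keys (f j) \<or> m \<in> keys h" if "m \<in> keys g" for m
  proof (rule ccontr)
    assume "\<not> ?thesis"
    then have "lookup g m = 0" by (simp add: g_def lookup_minus in_keys_iff)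
    then show False using that by (simp add: in_keys_iff)
  qed
  have "g \<in> S j"
  proof -
    have "g \<in> I (Suc j)" unfolding g_def using lideal_diff[OF assms(2) fj(1)] hI inc[of j "Suc j"] by auto
    moreover have "g \<notin> I j"
      using fj(2) lidealD(3)[OF assms(2), of g j h] hI by (auto simp: g_def)
    moreover have "keys g \<subseteq> nonneg_expos X"
    proof
      fix m assume "m \<in> keys g"
      then consider "m \<in> keys (f j)" | "m \<in> keys h" using gkeys by blast
      then show "m \<in> nonneg_expos X"
      proof cases
        case 2
        then obtain m' where m': "m' \<in> keys (f i)" "m = e + m'" using hkeys by blast
        then have "m' \<in> nonneg_expos X" using f(1)[of i] by (auto simp: S_def)
        then show ?thesis using e Poly_Mapping.keys_add[of e m'] by (auto simp: m' nonneg_expos_def lookup_add)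
      qed (use fj in blast)
    qed
    ultimately show ?thesis by (simp add: S_def)
  qed
  moreover have "m < l j" if "m \<in> keys g" for m
  proof -
    from that consider "m \<in> keys (f j)" | "m \<in> keys h" using gkeys by blast
    then have "m \<le> l j"
    proof cases
      case 2
      then obtain m' where m': "m' \<in> keys (f i)" "m = e + m'" using hkeys by blast
      then have "e + m' \<le> e + l i" using l_max[of m' i] by (intro add_left_mono)
      then show ?thesis by (simp add: m' e_def)
    qed (rule l_max)
    moreover have "m \<noteq> l j"
    proof
      assume "m = l j"
      have "lookup h (l j) = act (single e (lookup (f j) (l j) / lookup (f i) (l i))) (lookup (f i)) (l j)"
        by (simp add: h_def act_lookup)
      then have "lookup h (l j) = lookup (f j) (l j)"
        using l[of i] by (simp add: act_single e_def in_keys_iff)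
      then show False using that \<open>m = l j\<close> by (simp add: g_def in_keys_iff lookup_minus)
    qed
    ultimately show ?thesis by simp
  qed
  ultimately show False using f(2)[of g j] S_nonzero[of g j] unfolding l_def
    by (metis Max_in finite_keys keys_eq_empty)
qed

lemma maximal_lideal:
  fixes \<S> :: "('i, 'k::field) laurent set set"
  assumes "finite X" "\<And>I. I \<in> \<S> \<Longrightarrow> lideal X I" "\<S> \<noteq> {}"
  obtains I where "I \<in> \<S>" "\<And>I'. I' \<in> \<S> \<Longrightarrow> I \<subseteq> I' \<Longrightarrow> I' = I"
proof -
  have "\<exists>I\<in>\<S>. \<forall>I'\<in>\<S>. I \<subseteq> I' \<longrightarrow> I' = I"
  proof (rule ccontr)
    assume *: "\<not> ?thesis"
    then obtain g where g: "\<And>I. I \<in> \<S> \<Longrightarrow> g I \<in> \<S> \<and> I \<subset> g I"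
      by (metis psubsetI)
    obtain I0 where I0: "I0 \<in> \<S>" using assms(3) by blast
    define I where "I = rec_nat I0 (\<lambda>_. g)"
    have I: "I k \<in> \<S>" for k by (induction k) (auto simp: I_def I0 g)
    have "I k \<subset> I (Suc k)" for k using g[OF I[of k]] by (simp add: I_def)
    then show False using no_ascending_chain[of X I, OF assms(1) assms(2)[OF I]] by blast
  qed
  then show ?thesis using that by blast
qed

section \<open>Ideals supported on a line\<close>

lemma total_degree_superset:
  "finite S \<Longrightarrow> keys m \<subseteq> S \<Longrightarrow> total_degree m = (\<Sum>v\<in>S. lookup m v)"
  unfolding total_degree_def by (intro sum.mono_neutral_left) (auto simp: in_keys_iff)

interpretation total_degree: grading total_degree
proof
  fix a b :: "'i expo"
  have "keys (a + b) \<subseteq> keys a \<union> keys b" by (rule Poly_Mapping.keys_add)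
  then show "total_degree (a + b) = total_degree a + total_degree b"
    using total_degree_superset[of "keys a \<union> keys b" "a + b"] total_degree_superset[of "keys a \<union> keys b" a]
      total_degree_superset[of "keys a \<union> keys b" b]
    by (simp add: lookup_add sum.distrib)
qed

lemma total_degree_single: "total_degree (single v c) = c"
  by (cases "c = 0") (auto simp: total_degree_def)

lemma homogeneous_iff: "homogeneous I \<longleftrightarrow> (\<forall>f\<in>I. \<forall>d. pcomp total_degree d f \<in> I)"
  by (simp add: homogeneous_def hom_component_def pcomp_def)

definition lin :: "('i zvar \<Rightarrow> 'k::field) \<Rightarrow> 'i zvar \<Rightarrow> 'i zvar \<Rightarrow> ('i, 'k) laurent" where
  "lin p u v = cst (p v) * zpow u 1 - cst (p u) * zpow v 1"

lemma lin_homdeg: "homdeg total_degree (int k) (lin p u v ^ k)"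
proof (induction k)
  case 0
  then show ?case using total_degree.homdeg_1 by simp
next
  case (Suc k)
  have "homdeg total_degree 1 (lin p u v)" unfolding lin_def
    by (intro total_degree.homdeg_diff) (auto simp: homdeg_def mult_single total_degree_single)
  from total_degree.homdeg_mult[OF this Suc] show ?case by (simp add: add.commute)
qed

lemma lin_laurents_in: "u \<in> X \<Longrightarrow> v \<in> X \<Longrightarrow> lin p u v \<in> laurents_in X"
  unfolding lin_def by (intro laurents_in_diff laurents_in_mult laurents_in_single) auto

definition hom_lideal :: "'i zvar set \<Rightarrow> ('i, 'k::comm_ring_1) laurent set \<Rightarrow> bool" where
  "hom_lideal X I \<longleftrightarrow> lideal X I \<and> homogeneous I"

text \<open>The elements of \<open>I'\<close> that are torsion modulo \<open>I\<close> along the line through \<open>p\<close>.\<close>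

definition line_torsion ::
    "'i zvar set \<Rightarrow> ('i zvar \<Rightarrow> 'k::field) \<Rightarrow> ('i, 'k) laurent set \<Rightarrow> ('i, 'k) laurent set \<Rightarrow> ('i, 'k) laurent set" where
  "line_torsion X p I I' = {R \<in> I'. \<exists>n. \<forall>u\<in>X. \<forall>v\<in>X. lin p u v ^ n * R \<in> I}"

text \<open>
  Take \<open>I\<close> maximal among the homogeneous ideals above \<open>I0\<close> that meet the torsion only in \<open>I0\<close>. For
  \<open>x = lin p u v\<close>, let \<open>n\<close> be such that the ideal quotient of \<open>I\<close> by $x^n$ no longer grows. Then
  $I + (x^n)$ has the same property: if $w = i + x^n r$ is torsion, some $x^k w$ lies in \<open>I\<close>, hence
  $x^{n+k} r$ and therefore $x^n r$ do, so that \<open>w\<close> lies in \<open>I\<close>. By maximality $x^n$ lies in \<open>I\<close>.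
\<close>

lemma supported_ideal_exists:
  fixes I0 :: "('i, 'k::field) laurent set"
  assumes X: "finite X" and I0: "hom_lideal X I0"
  obtains I where "hom_lideal X I" "I0 \<subseteq> I" "I \<inter> line_torsion X p I0 I' \<subseteq> I0"
    "\<And>u v. u \<in> X \<Longrightarrow> v \<in> X \<Longrightarrow> \<exists>k. lin p u v ^ k \<in> I"
proof -
  let ?W = "line_torsion X p I0 I'"
  define \<S> where "\<S> = {I. hom_lideal X I \<and> I0 \<subseteq> I \<and> I \<inter> ?W \<subseteq> I0}"
  have "I0 \<in> \<S>" using I0 by (auto simp: \<S>_def)
  then obtain I where I: "I \<in> \<S>" and max: "\<And>I'. I' \<in> \<S> \<Longrightarrow> I \<subseteq> I' \<Longrightarrow> I' = I"
    using maximal_lideal[OF X, of \<S>] by (auto simp: \<S>_def hom_lideal_def)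
  have lI: "lideal X I" and hI: "homogeneous I" and "I0 \<subseteq> I" and IW: "I \<inter> ?W \<subseteq> I0"
    using I by (auto simp: \<S>_def hom_lideal_def)
  have "\<exists>k. lin p u v ^ k \<in> I" if uv: "u \<in> X" "v \<in> X" for u v
  proof -
    define x where "x = lin p u v"
    have xX: "x ^ k \<in> laurents_in X" for k unfolding x_def by (intro laurents_in_power lin_laurents_in uv)
    define C where "C k = {r \<in> laurents_in X. x ^ k * r \<in> I}" for k
    have C: "lideal X (C k)" for k unfolding lideal_def
      using lidealD[OF lI] by (auto simp: C_def distrib_left mult.left_commute[of _ "_ :: ('i, 'k) laurent"]
          intro: laurents_in_add laurents_in_mult)
    have C_mono: "C k \<subseteq> C (k + j)" for k j
    proof
      fix r assume r: "r \<in> C k"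
      have "x ^ (k + j) * r = x ^ j * (x ^ k * r)" by (simp add: power_add mult_ac)
      moreover have "x ^ j * (x ^ k * r) \<in> I" using r lidealD(4)[OF lI xX] by (auto simp: C_def)
      ultimately have "x ^ (k + j) * r \<in> I" by metis
      then show "r \<in> C (k + j)" using r by (simp add: C_def)
    qed
    obtain n where n: "\<And>k. C n \<subseteq> C k \<Longrightarrow> C k = C n"
    proof -
      have "lideal X I" if "I \<in> range C" for I using that C by auto
      then obtain I where I: "I \<in> range C" "\<And>I'. I' \<in> range C \<Longrightarrow> I \<subseteq> I' \<Longrightarrow> I' = I"
        using maximal_lideal[OF X, of "range C"] by blast
      then obtain n where "I = C n" by blast
      then show ?thesis using that[of n] I(2) by blast
    qed
    define I1 where "I1 = {i + x ^ n * r | i r. i \<in> I \<and> r \<in> laurents_in X}"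
    have "I \<subseteq> I1" unfolding I1_def by (auto intro!: exI[of _ 0] exI)
    have lI1: "lideal X I1" unfolding lideal_def
    proof (intro conjI ballI)
      show "I1 \<subseteq> laurents_in X" unfolding I1_def
        using lidealD(1)[OF lI] xX by (auto intro: laurents_in_add laurents_in_mult)
      show "0 \<in> I1" using \<open>I \<subseteq> I1\<close> lidealD(2)[OF lI] by blast
      fix a b assume "a \<in> I1" "b \<in> I1"
      then obtain i r i' r' where ir: "a = i + x ^ n * r" "i \<in> I" "r \<in> laurents_in X"
        "b = i' + x ^ n * r'" "i' \<in> I" "r' \<in> laurents_in X" unfolding I1_def by blast
      have "a + b = (i + i') + x ^ n * (r + r')" using ir by (simp add: algebra_simps)
      then show "a + b \<in> I1" unfolding I1_def using ir lidealD(3)[OF lI] laurents_in_add by blast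
    next
      fix r a :: "('i, 'k) laurent" assume r: "r \<in> laurents_in X" and "a \<in> I1"
      then obtain i r' where ir: "a = i + x ^ n * r'" "i \<in> I" "r' \<in> laurents_in X" unfolding I1_def by blast
      have "r * a = r * i + x ^ n * (r * r')" using ir by (simp add: algebra_simps)
      then show "r * a \<in> I1" unfolding I1_def using ir r lidealD(4)[OF lI] laurents_in_mult by blast
    qed
    have "homogeneous I1" unfolding homogeneous_iff
    proof (intro ballI allI)
      fix a d assume "a \<in> I1"
      then obtain i r where ir: "a = i + x ^ n * r" "i \<in> I" "r \<in> laurents_in X" unfolding I1_def by blast
      have "pcomp total_degree d a = pcomp total_degree d i + x ^ n * pcomp total_degree (d - int n) r"
        using total_degree.pcomp_mult[OF lin_homdeg, of n "d - int n" p u v r] ir(1)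
        by (simp add: pcomp_add x_def)
      moreover have "pcomp total_degree d i \<in> I" using hI ir(2) unfolding homogeneous_iff by auto
      moreover note laurents_in_pcomp[OF ir(3), of total_degree "d - int n"]
      ultimately show "pcomp total_degree d a \<in> I1" unfolding I1_def by (intro CollectI exI conjI)
    qed
    moreover have "I1 \<inter> ?W \<subseteq> I0"
    proof
      fix w assume w: "w \<in> I1 \<inter> ?W"
      then obtain i r where ir: "w = i + x ^ n * r" "i \<in> I" "r \<in> laurents_in X" unfolding I1_def by blast
      obtain k where "x ^ k * w \<in> I0" using w uv by (auto simp: line_torsion_def x_def)
      then have "x ^ k * w - x ^ k * i \<in> I" using \<open>I0 \<subseteq> I\<close> lidealD(4)[OF lI xX ir(2)]
        by (intro lideal_diff[OF lI]) auto
      then have "x ^ (n + k) * r \<in> I" by (simp add: ir algebra_simps power_add)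
      then have "r \<in> C (n + k)" using ir by (simp add: C_def)
      also have "C (n + k) = C n" by (rule n[OF C_mono])
      finally have "x ^ n * r \<in> I" by (simp add: C_def)
      then have "w \<in> I" using lidealD(3)[OF lI ir(2)] ir(1) by simp
      then show "w \<in> I0" using IW w by blast
    qed
    ultimately have "I1 \<in> \<S>" using lI1 \<open>I \<subseteq> I1\<close> \<open>I0 \<subseteq> I\<close> by (auto simp: \<S>_def hom_lideal_def)
    then have "I1 = I" using max \<open>I \<subseteq> I1\<close> by blast
    moreover have "0 + x ^ n * 1 \<in> I1" unfolding I1_def using lidealD(2)[OF lI] laurents_in_1 by blast
    ultimately show ?thesis by (auto simp: x_def)
  qed
  then show ?thesis using that lI hI \<open>I0 \<subseteq> I\<close> IW unfolding hom_lideal_def by blast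
qed

context zeta_data
begin

abbreviation JX :: "'i zvar set \<Rightarrow> ('i, 'k) laurent set" where
  "JX X \<equiv> J X \<inter> laurents_in X"

text \<open>
  In the induction on the number of variables, this is what the ideals for fewer variables cut out.
\<close>

definition JL :: "'i zvar set \<Rightarrow> ('i, 'k) laurent set" where
  "JL X = {R \<in> laurents_in X. \<forall>A. A \<subset> X \<longrightarrow> R \<in> J A}"

lemma lideal_JX: "lideal X (JX X)"
  unfolding lideal_def by (auto intro: J_0 J_add J_mult laurents_in_add laurents_in_mult)

lemma homogeneous_JX: "finite X \<Longrightarrow> homogeneous (JX X)"
  unfolding homogeneous_iff
  by (auto intro!: J_pcomp[OF total_degree.grading_axioms] laurents_in_pcomp
      simp: shift_def total_degree.diff total_degree_single)

lemma JL_mult: "r \<in> laurents_in X \<Longrightarrow> R \<in> JL X \<Longrightarrow> r * R \<in> JL X"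
  unfolding JL_def by (auto intro: J_mult laurents_in_mult)

text \<open>
  For each partition of \<open>X\<close> into two blocks the prime contains some $z_u - c z_v$ with \<open>u\<close> and \<open>v\<close> in
  different blocks. So the graph of the pairs \<open>(u, v)\<close> linked in this way is connected, and along its
  paths all coordinates become multiples of one of them.
\<close>

lemma prime_contains_line:
  assumes "finite X" and Q: "lideal X Q" "1 \<notin> Q"
    and prime: "\<And>a b. a \<in> laurents_in X \<Longrightarrow> b \<in> laurents_in X \<Longrightarrow> a * b \<in> Q \<Longrightarrow> a \<in> Q \<or> b \<in> Q"
    and cross: "\<And>A. A \<subset> X \<Longrightarrow> A \<noteq> {} \<Longrightarrow> denp (cross A (X - A)) \<in> Q"
  obtains p where "\<And>v. p v \<noteq> (0 :: 'k)" "\<And>u v. u \<in> X \<Longrightarrow> v \<in> X \<Longrightarrow> lin p u v \<in> Q"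
proof -
  have prime_prod: "\<exists>x\<in>S. f x \<in> Q" if "finite S" "\<And>x. x \<in> S \<Longrightarrow> f x \<in> laurents_in X" "(\<Prod>x\<in>S. f x) \<in> Q"
    for S :: "'b set" and f
    using that
  proof (induction S)
    case (insert x S)
    have "(\<Prod>x\<in>S. f x) \<in> laurents_in X" using insert by (intro laurents_in_prod) auto
    then have "f x \<in> Q \<or> (\<Prod>x\<in>S. f x) \<in> Q" using prime[of "f x"] insert by auto
    then show ?case using insert by auto
  qed (use Q in auto)
  have link: "\<exists>u v c. (u, v) \<in> cross A (X - A) \<and> c \<noteq> 0 \<and> zpow u 1 - cst c * zpow v 1 \<in> Q"
    if A: "A \<subset> X" "A \<noteq> {}" for A
  proof -
    have sub: "cross A (X - A) \<subseteq> X \<times> X" using A by (auto simp: cross_def)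
    have one: "1 - single (shift u v) c \<in> laurents_in X" if "u \<in> X" "v \<in> X" for u v and c :: 'k
    proof -
      have "keys (shift u v) \<subseteq> X"
        using that by (auto simp: in_keys_iff shift_def lookup_minus lookup_single when_def split: if_splits)
      then show ?thesis by (intro laurents_in_diff laurents_in_single laurents_in_1)
    qed
    have "finite (cross A (X - A))" using sub assms(1) by (meson finite_SigmaI finite_subset)
    moreover have "den (fst x) (snd x) \<in> laurents_in X" if "x \<in> cross A (X - A)" for x
      unfolding den_def using sub that by (intro laurents_in_prod one) auto
    ultimately obtain x where x: "x \<in> cross A (X - A)" "den (fst x) (snd x) \<in> Q"
      using prime_prod[of "cross A (X - A)" "\<lambda>x. den (fst x) (snd x)"] cross[OF A] unfolding denp_def by blast
    obtain u v where uv: "x = (u, v)" by (cases x)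
    have uvX: "u \<in> X" "v \<in> X" using x uv sub by auto
    obtain e where e: "e \<in> {1..N (colour v) (colour u)}"
      "1 - single (shift u v) (q (colour v) (colour u) e) \<in> Q"
      using prime_prod[OF _ one, of "{1..N (colour v) (colour u)}" "\<lambda>_. u" "\<lambda>_. v" "q (colour v) (colour u)"] x uv uvX
      unfolding den_def by auto
    have "zpow u 1 * (1 - single (shift u v) (q (colour v) (colour u) e)) \<in> Q"
      using uvX by (intro lidealD(4)[OF Q(1)] e laurents_in_single) auto
    also have "zpow u 1 * (1 - single (shift u v) (q (colour v) (colour u) e)) =
      zpow u 1 - cst (q (colour v) (colour u) e) * zpow v 1"
      by (simp add: right_diff_distrib mult_single shift_def)
    finally show ?thesis using x uv q_nz[OF e(1)] by blast
  qed
  show ?thesis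
  proof (cases "X = {}")
    case True
    then show ?thesis using that[of "\<lambda>_. 1"] by auto
  next
    case False
    then obtain v0 where v0: "v0 \<in> X" by blast
    define A where "A = {u \<in> X. \<exists>c. c \<noteq> 0 \<and> zpow u 1 - cst c * zpow v0 1 \<in> Q}"
    have "v0 \<in> A" using v0 lidealD(2)[OF Q(1)] by (auto simp: A_def intro!: exI[of _ 1])
    have comb: "cst c * a + cst c' * b \<in> Q" if "a \<in> Q" "b \<in> Q" for a b and c c' :: 'k
      using that by (intro lidealD(3)[OF Q(1)] lidealD(4)[OF Q(1)] laurents_in_single) auto
    have cc: "cst c * (cst c' * x) = cst (c * c') * x" for c c' :: 'k and x :: "('i, 'k) laurent"
      by (simp add: mult_single flip: mult.assoc)
    have "A = X"
    proof (rule ccontr)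
      assume "A \<noteq> X"
      then have "A \<subset> X" "A \<noteq> {}" using \<open>v0 \<in> A\<close> by (auto simp: A_def)
      from link[OF this] obtain u v c where uv: "(u, v) \<in> cross A (X - A)" "c \<noteq> 0"
        and Quv: "zpow u 1 - cst c * zpow v 1 \<in> Q" by blast
      from uv(1) consider "u \<in> A" "v \<in> X - A" | "v \<in> A" "u \<in> X - A" by (auto simp: cross_def)
      then show False
      proof cases
        case 1
        then obtain c' where c': "c' \<noteq> 0" "zpow u 1 - cst c' * zpow v0 1 \<in> Q" by (auto simp: A_def)
        have "cst (- 1 / c) * (zpow u 1 - cst c * zpow v 1) + cst (1 / c) * (zpow u 1 - cst c' * zpow v0 1) =
          zpow v 1 - cst (c' / c) * zpow v0 1"
          using uv(2) by (simp add: right_diff_distrib cc single_uminus)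
        with comb[OF Quv c'(2)] have "zpow v 1 - cst (c' / c) * zpow v0 1 \<in> Q" by metis
        then have "v \<in> A" using 1 c' uv(2) by (auto simp: A_def intro!: exI[of _ "c' / c"])
        then show False using 1 by blast
      next
        case 2
        then obtain c' where c': "c' \<noteq> 0" "zpow v 1 - cst c' * zpow v0 1 \<in> Q" by (auto simp: A_def)
        have "cst 1 * (zpow u 1 - cst c * zpow v 1) + cst c * (zpow v 1 - cst c' * zpow v0 1) =
          zpow u 1 - cst (c * c') * zpow v0 1"
          by (simp add: right_diff_distrib cc)
        with comb[OF Quv c'(2)] have "zpow u 1 - cst (c * c') * zpow v0 1 \<in> Q" by metis
        then have "u \<in> A" using 2 c' uv(2) by (auto simp: A_def intro!: exI[of _ "c * c'"])
        then show False using 2 by blast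
      qed
    qed
    then have "\<forall>u\<in>X. \<exists>c. c \<noteq> 0 \<and> zpow u 1 - cst c * zpow v0 1 \<in> Q" unfolding A_def by blast
    then obtain c where c: "\<And>u. u \<in> X \<Longrightarrow> c u \<noteq> 0 \<and> zpow u 1 - cst (c u) * zpow v0 1 \<in> Q"
      by metis
    define p where "p u = (if u \<in> X then c u else 1)" for u
    show ?thesis
    proof (rule that[of p])
      show "p v \<noteq> 0" for v using c by (simp add: p_def)
      fix u v assume uv: "u \<in> X" "v \<in> X"
      have "cst (p v) * (zpow u 1 - cst (c u) * zpow v0 1) + cst (- p u) * (zpow v 1 - cst (c v) * zpow v0 1) = lin p u v"
        using uv by (simp add: lin_def p_def right_diff_distrib cc single_uminus mult.commute)
      with comb show "lin p u v \<in> Q" using c uv by metis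
    qed
  qed
qed

text \<open>
  Among the annihilators of multiples of \<open>R\<close> modulo \<open>JX X\<close> choose a maximal one. It is prime, and it
  contains the products of denominators across all partitions of \<open>X\<close>; so it contains a line.
\<close>

lemma associated_line:
  assumes X: "finite X" and R: "R \<in> JL X" "R \<notin> JX X"
  obtains r p where "r \<in> laurents_in X" "r * R \<notin> JX X" "\<And>v. p v \<noteq> (0 :: 'k)"
    "\<And>u v. u \<in> X \<Longrightarrow> v \<in> X \<Longrightarrow> lin p u v * (r * R) \<in> JX X"
proof -
  have RX: "R \<in> laurents_in X" using R by (simp add: JL_def)
  define ann where "ann S = {x \<in> laurents_in X. x * S \<in> JX X}" for S
  have ann: "lideal X (ann S)" for S
    unfolding lideal_def ann_def using lidealD[OF lideal_JX[of X]]
    by (auto simp: distrib_right mult.assoc intro: laurents_in_add laurents_in_mult)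
  define \<S> where "\<S> = {ann (r * R) | r. r \<in> laurents_in X \<and> r * R \<notin> JX X}"
  have "ann (1 * R) \<in> \<S>" unfolding \<S>_def using R by (intro CollectI exI[of _ 1]) auto
  then have "\<S> \<noteq> {}" by blast
  then obtain Q where Q: "Q \<in> \<S>" "\<And>Q'. Q' \<in> \<S> \<Longrightarrow> Q \<subseteq> Q' \<Longrightarrow> Q' = Q"
    using maximal_lideal[OF X, of \<S>] ann by (auto simp: \<S>_def)
  then obtain r where r: "r \<in> laurents_in X" "r * R \<notin> JX X" "Q = ann (r * R)" by (auto simp: \<S>_def)
  have "1 \<notin> Q" using r by (simp add: ann_def)
  have prime: "a \<in> Q \<or> b \<in> Q" if ab: "a \<in> laurents_in X" "b \<in> laurents_in X" "a * b \<in> Q" for a b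
  proof (cases "a \<in> Q")
    case False
    then have "a * r * R \<notin> JX X" using ab r by (simp add: ann_def mult.assoc)
    then have "ann (a * r * R) \<in> \<S>" unfolding \<S>_def using laurents_in_mult[OF ab(1) r(1)] by blast
    moreover have "Q \<subseteq> ann (a * r * R)"
    proof
      fix x assume x: "x \<in> Q"
      have eq: "x * (a * r * R) = a * (x * (r * R))" by (simp add: mult_ac)
      have "a * (x * (r * R)) \<in> JX X"
        using x lidealD(4)[OF lideal_JX ab(1)] unfolding r(3) ann_def by blast
      then have "x * (a * r * R) \<in> JX X" unfolding eq .
      then show "x \<in> ann (a * r * R)" using x unfolding r(3) ann_def by simp
    qed
    ultimately have "ann (a * r * R) = Q" using Q by blast
    moreover have "b \<in> ann (a * r * R)" using ab unfolding r(3) ann_def by (auto simp: mult_ac)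
    ultimately show ?thesis by simp
  qed simp
  \<comment> \<open>Both blocks of the partition are proper subsets.\<close>
  have cross: "denp (cross A (X - A)) \<in> Q" if A: "A \<subset> X" "A \<noteq> {}" for A
  proof -
    have B: "X - A \<subset> X" using A by blast
    have XA: "A \<union> (X - A) = X" using A by blast
    have fin: "finite A" "finite (X - A)" using X A finite_subset by blast+
    have rR: "r * R \<in> JL X" by (rule JL_mult[OF r(1) R(1)])
    have "denp (cross A (X - A)) * (r * R) \<in> J X"
      using separated_blocks[OF fin, of "r * R"] A B rR unfolding XA JL_def by auto
    moreover have "denp (cross A (X - A)) \<in> laurents_in X"
      unfolding homdeg_restrict_exp_iff[symmetric]
      using A by (intro denp_homdeg restrict_exp.grading_axioms restrict_exp_shift) (auto simp: cross_def)
    ultimately show ?thesis unfolding r(3) ann_def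
      using laurents_in_mult laurents_in_mult[OF r(1) RX] by blast
  qed
  obtain p where p: "\<And>v. p v \<noteq> (0 :: 'k)" "\<And>u v. u \<in> X \<Longrightarrow> v \<in> X \<Longrightarrow> lin p u v \<in> Q"
    using prime_contains_line[OF X _ \<open>1 \<notin> Q\<close> prime cross] ann unfolding r(3) by blast
  show ?thesis
    by (rule that[of r p]) (use r p in \<open>auto simp: ann_def\<close>)
qed

end

section \<open>Renaming variables\<close>

text \<open>
  The inverse of a function; \<open>inv\<close> stands for inverses in groups.
\<close>

abbreviation finv :: "('a \<Rightarrow> 'b) \<Rightarrow> 'b \<Rightarrow> 'a" where
  "finv \<equiv> inv_into UNIV"

definition push :: "('i zvar \<Rightarrow> 'i zvar) \<Rightarrow> 'i expo \<Rightarrow> 'i expo" where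
  "push \<sigma> m = (\<Sum>v\<in>keys m. single (\<sigma> v) (lookup m v))"

lemma zmap_eq: "zmap \<sigma> f = (\<Sum>m\<in>keys f. single (push \<sigma> m) (lookup f m))"
  by (simp add: zmap_def push_def)

lemma push_superset: "finite S \<Longrightarrow> keys m \<subseteq> S \<Longrightarrow> push \<sigma> m = (\<Sum>v\<in>S. single (\<sigma> v) (lookup m v))"
  unfolding push_def by (intro sum.mono_neutral_left) (auto simp: in_keys_iff)

lemma push_add: "push \<sigma> (m + m') = push \<sigma> m + push \<sigma> m'"
proof -
  have "keys (m + m') \<subseteq> keys m \<union> keys m'" by (rule Poly_Mapping.keys_add)
  then show ?thesis
    using push_superset[of "keys m \<union> keys m'" "m + m'" \<sigma>] push_superset[of "keys m \<union> keys m'" m \<sigma>]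
      push_superset[of "keys m \<union> keys m'" m' \<sigma>]
    by (simp add: lookup_add single_add sum.distrib)
qed

lemma push_0 [simp]: "push \<sigma> 0 = 0"
  by (simp add: push_def)

lemma push_single [simp]: "push \<sigma> (single v c) = single (\<sigma> v) c"
  by (cases "c = 0") (auto simp: push_def)

lemma push_diff: "push \<sigma> (m - m') = push \<sigma> m - push \<sigma> m'"
  using push_add[of \<sigma> "m - m'" m'] by (simp add: algebra_simps)

lemma push_sum: "push \<sigma> (\<Sum>x\<in>A. f x) = (\<Sum>x\<in>A. push \<sigma> (f x))"
  by (induction A rule: infinite_finite_induct) (auto simp: push_add)

lemma push_push: "push \<sigma> (push \<tau> m) = push (\<sigma> \<circ> \<tau>) m"
  by (simp add: push_def[of \<tau>] push_def[of "\<sigma> \<circ> \<tau>"] push_sum)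

lemma push_id: "push id m = m"
  using poly_mapping_as_sum[of m] by (simp add: push_def)

lemma push_cong: "(\<And>v. v \<in> keys m \<Longrightarrow> \<sigma> v = \<tau> v) \<Longrightarrow> push \<sigma> m = push \<tau> m"
  by (simp add: push_def)

lemma push_shift: "push \<sigma> (shift u v) = shift (\<sigma> u) (\<sigma> v)"
  by (simp add: shift_def push_diff)

lemma keys_push: "keys (push \<sigma> m) \<subseteq> \<sigma> ` keys m"
  unfolding push_def using Poly_Mapping.keys_sum[of "\<lambda>v. single (\<sigma> v) (lookup m v)" "keys m"]
  by (force split: if_splits)

lemma push_inj: "inj \<sigma> \<Longrightarrow> inj (push \<sigma>)"
proof (rule injI)
  fix m m' assume *: "inj \<sigma>" "push \<sigma> m = push \<sigma> m'"
  have "push (finv \<sigma>) (push \<sigma> m) = m" for m by (simp add: push_push push_id inv_o_cancel[OF *(1)])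
  then show "m = m'" using *(2) by metis
qed

lemma zmap_superset: "finite S \<Longrightarrow> keys f \<subseteq> S \<Longrightarrow> zmap \<sigma> f = (\<Sum>m\<in>S. single (push \<sigma> m) (lookup f m))"
  unfolding zmap_eq by (intro sum.mono_neutral_left) (auto simp: in_keys_iff)

lemma zmap_add: "zmap \<sigma> (f + f') = zmap \<sigma> f + zmap \<sigma> f'"
proof -
  have "keys (f + f') \<subseteq> keys f \<union> keys f'" by (rule Poly_Mapping.keys_add)
  then show ?thesis
    using zmap_superset[of "keys f \<union> keys f'" "f + f'" \<sigma>] zmap_superset[of "keys f \<union> keys f'" f \<sigma>]
      zmap_superset[of "keys f \<union> keys f'" f' \<sigma>]
    by (simp add: lookup_add single_add sum.distrib)
qed

lemma zmap_0 [simp]: "zmap \<sigma> 0 = 0"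
  by (simp add: zmap_eq)

lemma zmap_single [simp]: "zmap \<sigma> (single m c) = single (push \<sigma> m) c"
  by (cases "c = 0") (auto simp: zmap_eq)

lemma zmap_1 [simp]: "zmap \<sigma> 1 = 1"
  using zmap_single[of \<sigma> 0 1] by simp

lemma zmap_diff: "zmap \<sigma> (f - f') = zmap \<sigma> f - zmap \<sigma> f'"
  using zmap_add[of \<sigma> "f - f'" f'] by (simp add: algebra_simps)

lemma zmap_uminus: "zmap \<sigma> (- f) = - zmap \<sigma> f"
  using zmap_diff[of \<sigma> 0 f] by simp

lemma zmap_sum: "zmap \<sigma> (\<Sum>x\<in>A. f x) = (\<Sum>x\<in>A. zmap \<sigma> (f x))"
  by (induction A rule: infinite_finite_induct) (auto simp: zmap_add)

lemma zmap_mult: "zmap \<sigma> (f * g) = zmap \<sigma> f * zmap \<sigma> g"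
proof (induction f rule: poly_mapping_linear_induct)
  case (single m c)
  show ?case
    by (induction g rule: poly_mapping_linear_induct)
      (auto simp: mult_single push_add distrib_left zmap_add)
qed (auto simp: distrib_right zmap_add)

lemma zmap_prod: "zmap \<sigma> (\<Prod>x\<in>A. f x) = (\<Prod>x\<in>A. zmap \<sigma> (f x))"
  by (induction A rule: infinite_finite_induct) (auto simp: zmap_mult)

lemma zmap_zmap: "zmap \<sigma> (zmap \<tau> f) = zmap (\<sigma> \<circ> \<tau>) f"
  by (simp add: zmap_eq[of \<tau>] zmap_eq[of "\<sigma> \<circ> \<tau>"] zmap_sum push_push)

lemma zmap_id: "zmap id f = f"
  using poly_mapping_as_sum[of f] by (simp add: zmap_eq push_id)

lemma zmap_cong: "f \<in> laurents_in X \<Longrightarrow> (\<And>v. v \<in> X \<Longrightarrow> \<sigma> v = \<tau> v) \<Longrightarrow> zmap \<sigma> f = zmap \<tau> f"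
  unfolding zmap_eq laurents_in_def by (intro sum.cong refl) (metis (mono_tags, lifting) push_cong mem_Collect_eq subsetD)

lemma zmap_laurents_in: "f \<in> laurents_in X \<Longrightarrow> zmap \<sigma> f \<in> laurents_in (\<sigma> ` X)"
  unfolding zmap_eq laurents_in_def[of X] using keys_push
  by (intro laurents_in_sum laurents_in_single) blast

lemma zmap_inv: "bij \<sigma> \<Longrightarrow> zmap (finv \<sigma>) (zmap \<sigma> f) = f" "bij \<sigma> \<Longrightarrow> zmap \<sigma> (zmap (finv \<sigma>) f) = f"
  by (simp_all add: zmap_zmap zmap_id inv_o_cancel bij_is_inj surj_iff[THEN iffD1] bij_is_surj)

lemma zmap_eq_0_iff: "inj \<sigma> \<Longrightarrow> zmap \<sigma> f = 0 \<longleftrightarrow> f = 0"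
proof
  assume "inj \<sigma>" "zmap \<sigma> f = 0"
  then have "zmap (finv \<sigma>) (zmap \<sigma> f) = 0" by simp
  then show "f = 0" by (simp add: zmap_zmap inv_o_cancel[OF \<open>inj \<sigma>\<close>] zmap_id)
qed simp

subsection \<open>Renaming in rational functions\<close>

text \<open>
  For an injective renaming the value does not depend on the chosen fraction.
\<close>

definition ratmap :: "('i zvar \<Rightarrow> 'i zvar) \<Rightarrow> ('i, 'k::field) ratfun \<Rightarrow> ('i, 'k) ratfun" where
  "ratmap \<sigma> F = (let (a, b) = SOME (a, b). F = rat a / rat b \<and> b \<noteq> 0 in rat (zmap \<sigma> a) / rat (zmap \<sigma> b))"

lemma ratmap_divide:
  assumes "inj \<sigma>" "b \<noteq> 0"
  shows "ratmap \<sigma> (rat a / rat b) = rat (zmap \<sigma> a) / rat (zmap \<sigma> b)"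
proof -
  define F where "F = rat a / rat b"
  define p where "p = (SOME (a, b). F = rat a / rat b \<and> b \<noteq> 0)"
  have "case p of (a, b) \<Rightarrow> F = rat a / rat b \<and> b \<noteq> 0"
    unfolding p_def by (rule someI[of _ "(a, b)"]) (use assms F_def in auto)
  then obtain c d where p: "p = (c, d)" "F = rat c / rat d" "d \<noteq> 0" by (cases p) auto
  have "rat a * rat d = rat c * rat b" using p assms(2) by (simp add: F_def divide_simps split: if_splits)
  then have "a * d = c * b" by (simp flip: rat_mult)
  then have "zmap \<sigma> a * zmap \<sigma> d = zmap \<sigma> c * zmap \<sigma> b" by (metis zmap_mult)
  then have "rat (zmap \<sigma> a) * rat (zmap \<sigma> d) = rat (zmap \<sigma> c) * rat (zmap \<sigma> b)" by (simp flip: rat_mult)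
  moreover have "zmap \<sigma> b \<noteq> 0" "zmap \<sigma> d \<noteq> 0" using assms p by (auto simp: zmap_eq_0_iff)
  moreover have "ratmap \<sigma> F = rat (zmap \<sigma> c) / rat (zmap \<sigma> d)"
    by (simp add: ratmap_def p_def[symmetric] p(1))
  ultimately show ?thesis unfolding F_def[symmetric] by (simp add: frac_eq_eq)
qed

lemma ratmap_rat: "inj \<sigma> \<Longrightarrow> ratmap \<sigma> (rat f) = rat (zmap \<sigma> f)"
  using ratmap_divide[of \<sigma> 1 f] by simp

lemma ratmap_add: "inj \<sigma> \<Longrightarrow> ratmap \<sigma> (F + G) = ratmap \<sigma> F + ratmap \<sigma> G"
proof -
  assume s: "inj \<sigma>"
  obtain a b where F: "F = rat a / rat b" "b \<noteq> 0" by (rule ratfun_cases)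
  obtain c d where G: "G = rat c / rat d" "d \<noteq> 0" by (rule ratfun_cases)
  have eq: "F + G = rat (a * d + c * b) / rat (b * d)" using F G by (simp add: rat_add rat_mult add_frac_eq)
  have "ratmap \<sigma> (F + G) = rat (zmap \<sigma> (a * d + c * b)) / rat (zmap \<sigma> (b * d))"
    unfolding eq by (rule ratmap_divide[OF s]) (use F G in simp)
  moreover have "zmap \<sigma> b \<noteq> 0" "zmap \<sigma> d \<noteq> 0" using s F G by (auto simp: zmap_eq_0_iff)
  ultimately show ?thesis using F G s
    by (simp add: ratmap_divide rat_add rat_mult zmap_add zmap_mult add_frac_eq)
qed

lemma ratmap_mult: "inj \<sigma> \<Longrightarrow> ratmap \<sigma> (F * G) = ratmap \<sigma> F * ratmap \<sigma> G"
proof -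
  assume s: "inj \<sigma>"
  obtain a b where F: "F = rat a / rat b" "b \<noteq> 0" by (rule ratfun_cases)
  obtain c d where G: "G = rat c / rat d" "d \<noteq> 0" by (rule ratfun_cases)
  have eq: "F * G = rat (a * c) / rat (b * d)" using F G by (simp add: rat_mult)
  have "ratmap \<sigma> (F * G) = rat (zmap \<sigma> (a * c)) / rat (zmap \<sigma> (b * d))"
    unfolding eq by (rule ratmap_divide[OF s]) (use F G in simp)
  then show ?thesis using F G s by (simp add: ratmap_divide rat_mult zmap_mult)
qed

lemma ratmap_0: "inj \<sigma> \<Longrightarrow> ratmap \<sigma> 0 = 0"
  using ratmap_rat[of \<sigma> 0] by simp

lemma ratmap_1: "inj \<sigma> \<Longrightarrow> ratmap \<sigma> 1 = 1"
  using ratmap_rat[of \<sigma> 1] by simp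

lemma ratmap_sum: "inj \<sigma> \<Longrightarrow> ratmap \<sigma> (\<Sum>x\<in>A. f x) = (\<Sum>x\<in>A. ratmap \<sigma> (f x))"
  by (induction A rule: infinite_finite_induct) (auto simp: ratmap_add ratmap_0)

lemma ratmap_prod: "inj \<sigma> \<Longrightarrow> ratmap \<sigma> (\<Prod>x\<in>A. f x) = (\<Prod>x\<in>A. ratmap \<sigma> (f x))"
  by (induction A rule: infinite_finite_induct) (auto simp: ratmap_mult ratmap_1)

lemma ratmap_inverse: "inj \<sigma> \<Longrightarrow> ratmap \<sigma> (inverse F) = inverse (ratmap \<sigma> F)"
proof (cases "F = 0")
  case False
  assume s: "inj \<sigma>"
  have "ratmap \<sigma> F * ratmap \<sigma> (inverse F) = 1"
    using False s by (simp add: ratmap_1 flip: ratmap_mult)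
  then show ?thesis by (simp add: inverse_unique)
qed (simp add: ratmap_0)

lemma ratmap_div: "inj \<sigma> \<Longrightarrow> ratmap \<sigma> (F / G) = ratmap \<sigma> F / ratmap \<sigma> G"
  by (simp add: divide_inverse ratmap_mult ratmap_inverse)

lemma ratmap_diff: "inj \<sigma> \<Longrightarrow> ratmap \<sigma> (F - G) = ratmap \<sigma> F - ratmap \<sigma> G"
  using ratmap_add[of \<sigma> "F - G" G] by (simp add: algebra_simps)

lemma ratmap_zrat: "inj \<sigma> \<Longrightarrow> ratmap \<sigma> (zrat v) = zrat (\<sigma> v)"
  by (simp add: zrat_def ratmap_rat)

lemma ratmap_crat: "inj \<sigma> \<Longrightarrow> ratmap \<sigma> (crat c) = crat c"
  by (simp add: crat_def ratmap_rat)

lemma ratmap_power: "inj \<sigma> \<Longrightarrow> ratmap \<sigma> (F ^ k) = ratmap \<sigma> F ^ k"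
  by (induction k) (auto simp: ratmap_mult ratmap_1)

lemma ratmap_powi: "inj \<sigma> \<Longrightarrow> ratmap \<sigma> (F powi k) = ratmap \<sigma> F powi k"
  by (auto simp: power_int_def ratmap_power ratmap_inverse)

lemma ratmap_eq_iff: "inj \<sigma> \<Longrightarrow> ratmap \<sigma> F = ratmap \<sigma> G \<longleftrightarrow> F = G"
proof
  assume s: "inj \<sigma>" and "ratmap \<sigma> F = ratmap \<sigma> G"
  then have 0: "ratmap \<sigma> (F - G) = 0" by (simp add: ratmap_diff)
  show "F = G"
  proof (rule ccontr)
    assume "F \<noteq> G"
    then have "ratmap \<sigma> (F - G) * ratmap \<sigma> (inverse (F - G)) = 1"
      using s by (simp add: ratmap_1 flip: ratmap_mult)
    then show False using 0 by simp
  qed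
qed simp

subsection \<open>Renaming in expansions\<close>

lemma act_push:
  assumes "bij \<sigma>"
  shows "act (zmap \<sigma> D) (\<lambda>m. E (push (finv \<sigma>) m)) m = act D E (push (finv \<sigma>) m)"
proof -
  have inv: "push (finv \<sigma>) (push \<sigma> d) = d" for d
    by (simp add: push_push push_id inv_o_cancel[OF bij_is_inj[OF assms]])
  show ?thesis
    by (induction D rule: poly_mapping_linear_induct)
      (auto simp: act_single push_diff inv zmap_add act_add_left)
qed

lemma push_cone: "m \<in> cone vs \<Longrightarrow> push \<sigma> m \<in> cone (map \<sigma> vs)"
proof (induction rule: cone_induct)
  case (shift m u v)
  have "(\<sigma> u, \<sigma> v) \<in> bef (map \<sigma> vs)" using shift(1) by (force simp: bef_map)
  then show ?case using shift(2) by (auto simp: push_add push_shift intro: cone_add cone_shift)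
qed (simp add: cone_0)

lemma is_expansion_push:
  fixes F :: "('i, 'k::field) ratfun"
  assumes "bij \<sigma>" "is_expansion vs F E"
  shows "is_expansion (map \<sigma> vs) (ratmap \<sigma> F) (\<lambda>m. E (push (finv \<sigma>) m))"
proof -
  have s: "inj \<sigma>" using assms(1) by (rule bij_is_inj)
  have inv: "push \<sigma> (push (finv \<sigma>) d) = d" for d
    using assms(1) by (simp add: push_push push_id surj_iff[THEN iffD1] bij_is_surj)
  obtain N D where 1: "bdd (cone vs) E" "D \<noteq> 0" "rat D * F = rat N" "act D E = lookup N"
    using assms(2) unfolding is_expansion_iff by blast
  show ?thesis unfolding is_expansion_iff
  proof (intro conjI exI)
    show "zmap \<sigma> D \<noteq> 0" using 1 s by (simp add: zmap_eq_0_iff)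
    show "rat (zmap \<sigma> D) * ratmap \<sigma> F = rat (zmap \<sigma> N)"
      using s by (simp flip: 1(3) ratmap_rat ratmap_mult)
    have "lookup N (push (finv \<sigma>) m) = lookup (zmap \<sigma> N) m" for m
    proof -
      have one: "lookup (1 :: ('i, 'k) laurent) (push (finv \<sigma>) m) = lookup 1 m" for m
        using inv[of m] by (auto simp: lookup_one when_def)
      show ?thesis using act_push[OF assms(1), of N "lookup 1" m] unfolding one by (simp add: act_lookup)
    qed
    then show "act (zmap \<sigma> D) (\<lambda>m. E (push (finv \<sigma>) m)) = lookup (zmap \<sigma> N)"
      by (simp add: fun_eq_iff act_push[OF assms(1)] 1)
    obtain M where M: "finite M" "\<And>m. E m \<noteq> 0 \<Longrightarrow> \<exists>m0\<in>M. m - m0 \<in> cone vs"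
      using 1(1) unfolding bdd_def by blast
    show "bdd (cone (map \<sigma> vs)) (\<lambda>m. E (push (finv \<sigma>) m))"
    proof (rule bddI[of "push \<sigma> ` M"])
      fix m assume "E (push (finv \<sigma>) m) \<noteq> 0"
      then obtain m0 where m0: "m0 \<in> M" "push (finv \<sigma>) m - m0 \<in> cone vs" using M by blast
      from push_cone[OF m0(2), of \<sigma>] m0(1) show "\<exists>m0\<in>push \<sigma> ` M. m - m0 \<in> cone (map \<sigma> vs)"
        by (auto simp: push_diff inv)
    qed (use M in auto)
  qed
qed

lemma expn_push:
  assumes "bij \<sigma>" "distinct vs" "expandable vs F"
  shows "expn (map \<sigma> vs) (ratmap \<sigma> F) m = expn vs F (push (finv \<sigma>) m)"
proof -
  have "distinct (map \<sigma> vs)" using assms by (simp add: distinct_map inj_on_subset[OF bij_is_inj[OF assms(1)] subset_UNIV])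
  from expn_eqI[OF this is_expansion_push[OF assms(1) is_expansion_expn[OF assms(2,3)]]] show ?thesis by simp
qed

context zeta_data
begin

lemma ratmap_zt:
  assumes "inj \<sigma>" "\<And>v. colour (\<sigma> v) = colour v"
  shows "ratmap \<sigma> (zt u v) = zt (\<sigma> u) (\<sigma> v)"
  unfolding zt_def zeta_eq assms(2) using assms(1)
  by (simp add: ratmap_mult ratmap_div ratmap_crat ratmap_powi ratmap_zrat ratmap_diff ratmap_1 ratmap_prod)

lemma ratmap_krp:
  assumes "inj \<sigma>" "\<And>v. colour (\<sigma> v) = colour v"
  shows "ratmap \<sigma> (krp P) = krp (map_prod \<sigma> \<sigma> ` P)"
proof -
  have "inj_on (map_prod \<sigma> \<sigma>) P" using assms(1) by (meson prod.inj_map inj_on_subset subset_UNIV)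
  then have "krp (map_prod \<sigma> \<sigma> ` P) = (\<Prod>p\<in>P. kr (map_prod \<sigma> \<sigma> p))"
    unfolding krp_def by (simp add: prod.reindex)
  then show ?thesis unfolding krp_def
    using assms by (simp add: ratmap_prod kr_def ratmap_div ratmap_1 ratmap_zt)
qed

lemma ratmap_kap:
  assumes "inj \<sigma>" "\<And>v. colour (\<sigma> v) = colour v"
  shows "ratmap \<sigma> (kap vs) = kap (map \<sigma> vs)"
  by (simp add: ratmap_krp[OF assms] bef_map)

lemma ords_image:
  assumes "inj \<sigma>" shows "bij_betw (map \<sigma>) (ords A) (ords (\<sigma> ` A))"
proof (rule bij_betw_byWitness[where f' = "map (finv \<sigma>)"])
  have "inj_on \<sigma> X" for X using assms by (rule inj_on_subset) simp
  then show "map \<sigma> ` ords A \<subseteq> ords (\<sigma> ` A)"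
    by (auto simp: ords_def distinct_map)
  show "map (finv \<sigma>) ` ords (\<sigma> ` A) \<subseteq> ords A"
    using assms by (auto simp: ords_def distinct_map image_image inj_on_def)
  show "\<forall>a\<in>ords A. map (finv \<sigma>) (map \<sigma> a) = a" using assms by (simp add: o_def)
  show "\<forall>b\<in>ords (\<sigma> ` A). map \<sigma> (map (finv \<sigma>) b) = b"
  proof
    fix b assume "b \<in> ords (\<sigma> ` A)"
    then have "set b \<subseteq> range \<sigma>" by (auto simp: ords_def)
    then show "map \<sigma> (map (finv \<sigma>) b) = b" by (induction b) (auto simp: f_inv_into_f)
  qed
qed

lemma J_zmap:
  assumes \<sigma>: "bij \<sigma>" "\<And>v. colour (\<sigma> v) = colour v" and R: "R \<in> J A"
  shows "zmap \<sigma> R \<in> J (\<sigma> ` A)"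
proof -
  have s: "inj \<sigma>" using \<sigma>(1) by (rule bij_is_inj)
  have "(\<Sum>vs\<in>ords (\<sigma> ` A). expn vs (rat (f vs * zmap \<sigma> R) * kap vs) m) = 0" if f: "syz (\<sigma> ` A) f" for f m
  proof -
    define f' where "f' vs = zmap (finv \<sigma>) (f (map \<sigma> vs))" for vs
    have f': "zmap \<sigma> (f' vs) = f (map \<sigma> vs)" for vs by (simp add: f'_def zmap_inv[OF \<sigma>(1)])
    have tr: "rat (f (map \<sigma> vs) * zmap \<sigma> r) * kap (map \<sigma> vs) = ratmap \<sigma> (rat (f' vs * r) * kap vs)" for vs r
      using s by (simp add: ratmap_mult ratmap_rat zmap_mult f' ratmap_kap[OF s \<sigma>(2)])
    have "(\<Sum>vs\<in>ords (\<sigma> ` A). rat (f vs) * kap vs) = (\<Sum>vs\<in>ords A. rat (f (map \<sigma> vs)) * kap (map \<sigma> vs))"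
      by (rule sum.reindex_bij_betw[OF ords_image[OF s], symmetric])
    also have "\<dots> = ratmap \<sigma> (\<Sum>vs\<in>ords A. rat (f' vs) * kap vs)"
      using tr[of _ 1] s by (simp add: ratmap_sum)
    finally have "ratmap \<sigma> (\<Sum>vs\<in>ords A. rat (f' vs) * kap vs) = 0" using f by (simp add: syz_def)
    then have "syz A f'"
      using ratmap_eq_iff[OF s, of "\<Sum>vs\<in>ords A. rat (f' vs) * kap vs" 0] by (simp add: syz_def ratmap_0[OF s])
    have "(\<Sum>vs\<in>ords (\<sigma> ` A). expn vs (rat (f vs * zmap \<sigma> R) * kap vs) m) =
      (\<Sum>vs\<in>ords A. expn (map \<sigma> vs) (rat (f (map \<sigma> vs) * zmap \<sigma> R) * kap (map \<sigma> vs)) m)"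
      by (rule sum.reindex_bij_betw[OF ords_image[OF s], symmetric])
    also have "\<dots> = (\<Sum>vs\<in>ords A. expn vs (rat (f' vs * R) * kap vs) (push (finv \<sigma>) m))"
      unfolding tr by (intro sum.cong refl expn_push[OF \<sigma>(1)] expandable_kap) (auto simp: ords_def)
    also have "\<dots> = 0" using R \<open>syz A f'\<close> by (simp add: J_def)
    finally show ?thesis .
  qed
  then show ?thesis by (simp add: J_def)
qed

end

section \<open>Colour-preserving permutations\<close>

lemma finite_zvars: "finite (zvars (n :: 'i::finite \<Rightarrow> nat))"
proof (rule finite_subset)
  show "zvars n \<subseteq> (\<lambda>(i, a). Z i a) ` (SIGMA i:UNIV. {1..n i})"
  proof
    fix v assume "v \<in> zvars n"
    then obtain i a where "v = Z i a" "1 \<le> a" "a \<le> n i" by (auto simp: zvars_def)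
    then show "v \<in> (\<lambda>(i, a). Z i a) ` (SIGMA i:UNIV. {1..n i})" by (intro image_eqI[of _ _ "(i, a)"]) auto
  qed
qed simp

lemma in_zvars_iff: "v \<in> zvars n \<longleftrightarrow> 1 \<le> pos v \<and> pos v \<le> n (colour v)"
  by (cases v) (auto simp: zvars_def)

lemma finite_colour_perms: "finite (colour_perms (n :: 'i::finite \<Rightarrow> nat))"
  unfolding colour_perms_def using finite_permutations[OF finite_zvars] by (rule rev_finite_subset) auto

lemma colour_permsD:
  assumes "\<sigma> \<in> colour_perms n"
  shows "bij \<sigma>" "inj \<sigma>" "colour (\<sigma> v) = colour v" "\<sigma> ` zvars n = zvars n" "\<sigma> permutes zvars n"
  using assms by (auto simp: colour_perms_def permutes_bij permutes_inj permutes_image)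

lemma colour_perms_id: "id \<in> colour_perms n"
  by (simp add: colour_perms_def permutes_id)

lemma colour_perms_comp: "\<sigma> \<in> colour_perms n \<Longrightarrow> \<tau> \<in> colour_perms n \<Longrightarrow> \<sigma> \<circ> \<tau> \<in> colour_perms n"
  by (auto simp: colour_perms_def intro: permutes_compose)

lemma colour_perms_inv: "\<sigma> \<in> colour_perms n \<Longrightarrow> finv \<sigma> \<in> colour_perms n"
  unfolding colour_perms_def by (auto simp: permutes_inv) (metis permutes_inverses(1))

lemma colour_perms_right_mult:
  assumes "\<tau> \<in> colour_perms n" shows "bij_betw (\<lambda>\<sigma>. \<sigma> \<circ> \<tau>) (colour_perms n) (colour_perms n)"
proof (rule bij_betw_byWitness[where f' = "\<lambda>\<sigma>. \<sigma> \<circ> finv \<tau>"])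
  have "\<tau> \<circ> finv \<tau> = id" "finv \<tau> \<circ> \<tau> = id"
    using colour_permsD(5)[OF assms] by (simp_all add: permutes_inv_o)
  then show "\<forall>a\<in>colour_perms n. a \<circ> \<tau> \<circ> finv \<tau> = a" "\<forall>a\<in>colour_perms n. a \<circ> finv \<tau> \<circ> \<tau> = a"
    by (simp_all add: o_assoc[symmetric])
qed (use assms colour_perms_comp colour_perms_inv in blast)+

lemma colour_perms_left_mult:
  assumes "\<tau> \<in> colour_perms n" shows "bij_betw (\<lambda>\<sigma>. \<tau> \<circ> \<sigma>) (colour_perms n) (colour_perms n)"
proof (rule bij_betw_byWitness[where f' = "\<lambda>\<sigma>. finv \<tau> \<circ> \<sigma>"])
  have "\<tau> \<circ> finv \<tau> = id" "finv \<tau> \<circ> \<tau> = id"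
    using colour_permsD(5)[OF assms] by (simp_all add: permutes_inv_o)
  then show "\<forall>a\<in>colour_perms n. finv \<tau> \<circ> (\<tau> \<circ> a) = a" "\<forall>a\<in>colour_perms n. \<tau> \<circ> (finv \<tau> \<circ> a) = a"
    by (simp_all add: o_assoc)
qed (use assms colour_perms_comp colour_perms_inv in blast)+

lemma colour_perm_of_family:
  fixes \<pi> :: "'i \<Rightarrow> nat \<Rightarrow> nat"
  assumes \<pi>: "\<And>i. \<pi> i permutes {1..n i}"
  shows "(\<lambda>v. Z (colour v) (\<pi> (colour v) (pos v))) \<in> colour_perms n"
proof -
  define \<sigma> where "\<sigma> = (\<lambda>v :: 'i zvar. Z (colour v) (\<pi> (colour v) (pos v)))"
  have "bij \<sigma>"
  proof (rule bijI')
    fix x y :: "'i zvar"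
    have "\<pi> (colour x) (pos x) = \<pi> (colour x) (pos y) \<longleftrightarrow> pos x = pos y"
      using permutes_inj[OF \<pi>] by (rule inj_eq)
    then show "\<sigma> x = \<sigma> y \<longleftrightarrow> x = y"
      by (cases x; cases y) (auto simp: \<sigma>_def)
  next
    fix y :: "'i zvar"
    show "\<exists>x. y = \<sigma> x"
      using permutes_surj[OF \<pi>[of "colour y"]]
      by (intro exI[of _ "Z (colour y) (finv (\<pi> (colour y)) (pos y))"]) (simp add: \<sigma>_def surj_f_inv_f)
  qed
  moreover have "\<sigma> x = x" if "x \<notin> zvars n" for x
    using that permutes_not_in[OF \<pi>[of "colour x"], of "pos x"] by (simp add: \<sigma>_def in_zvars_iff)
  ultimately have "\<sigma> permutes zvars n" unfolding permutes_def by (metis bij_pointE)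
  then show ?thesis by (simp add: colour_perms_def \<sigma>_def)
qed

lemma card_colour_perms: "card (colour_perms (n :: 'i::finite \<Rightarrow> nat)) = (\<Prod>i\<in>UNIV. fact (n i))"
proof -
  define \<Phi> where "\<Phi> \<sigma> = (\<lambda>i\<in>UNIV. \<lambda>a. pos (\<sigma> (Z i a)))" for \<sigma> :: "'i zvar \<Rightarrow> 'i zvar"
  define \<Psi> where "\<Psi> \<pi> = (\<lambda>v. Z (colour v) (\<pi> (colour v) (pos v)))" for \<pi> :: "'i \<Rightarrow> nat \<Rightarrow> nat"
  have Z: "Z (colour v) (pos v) = v" for v :: "'i zvar" by simp
  have "bij_betw \<Phi> (colour_perms n) (PiE UNIV (\<lambda>i. {\<pi>. \<pi> permutes {1..n i}}))"
  proof (rule bij_betw_byWitness[where f' = \<Psi>])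
    show "\<forall>\<sigma>\<in>colour_perms n. \<Psi> (\<Phi> \<sigma>) = \<sigma>"
    proof
      fix \<sigma> assume "\<sigma> \<in> colour_perms n"
      then have "Z (colour v) (pos (\<sigma> v)) = \<sigma> v" for v using colour_permsD(3)[of \<sigma> n v] by (metis Z)
      then show "\<Psi> (\<Phi> \<sigma>) = \<sigma>" by (simp add: \<Psi>_def \<Phi>_def fun_eq_iff)
    qed
    show "\<forall>\<pi>\<in>PiE UNIV (\<lambda>i. {\<pi>. \<pi> permutes {1..n i}}). \<Phi> (\<Psi> \<pi>) = \<pi>"
      by (auto simp: \<Psi>_def \<Phi>_def)
    show "\<Phi> ` colour_perms n \<subseteq> PiE UNIV (\<lambda>i. {\<pi>. \<pi> permutes {1..n i}})"
    proof (intro subsetI PiE_I; clarsimp simp: \<Phi>_def)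
      fix \<sigma> i assume \<sigma>: "\<sigma> \<in> colour_perms n"
      show "(\<lambda>a. pos (\<sigma> (Z i a))) permutes {Suc 0..n i}"
        unfolding permutes_def
      proof (intro conjI allI impI)
        fix a assume "a \<notin> {Suc 0..n i}"
        then have "Z i a \<notin> zvars n" by (simp add: in_zvars_iff)
        then show "pos (\<sigma> (Z i a)) = a" using colour_permsD(5)[OF \<sigma>] by (simp add: permutes_not_in)
      next
        fix b :: nat
        have bk: "\<sigma> (finv \<sigma> (Z i b)) = Z i b" using colour_permsD(5)[OF \<sigma>] by (simp add: permutes_inverses)
        have col: "colour (finv \<sigma> (Z i b)) = i" using colour_permsD(3)[OF \<sigma>, of "finv \<sigma> (Z i b)"] bk by simp
        have eq: "Z i (pos (finv \<sigma> (Z i b))) = finv \<sigma> (Z i b)" using col by (metis Z)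
        show "\<exists>!a. pos (\<sigma> (Z i a)) = b"
        proof (rule ex1I[of _ "pos (finv \<sigma> (Z i b))"])
          show "pos (\<sigma> (Z i (pos (finv \<sigma> (Z i b))))) = b" unfolding eq bk by simp
          fix a assume "pos (\<sigma> (Z i a)) = b"
          then have "\<sigma> (Z i a) = Z i b" using colour_permsD(3)[OF \<sigma>, of "Z i a"] by (metis Z zvar.sel(1))
          then have "finv \<sigma> (Z i b) = Z i a" using colour_permsD(2)[OF \<sigma>] by (metis inv_f_f)
          then show "a = pos (finv \<sigma> (Z i b))" by simp
        qed
      qed
    qed
    show "\<Psi> ` PiE UNIV (\<lambda>i. {\<pi>. \<pi> permutes {1..n i}}) \<subseteq> colour_perms n"
    proof clarify
      fix \<pi> assume "\<pi> \<in> PiE UNIV (\<lambda>i. {\<pi>. \<pi> permutes {1..n i}})"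
      then have \<pi>: "\<pi> i permutes {1..n i}" for i by auto
      from colour_perm_of_family[OF this] show "\<Psi> \<pi> \<in> colour_perms n" by (simp add: \<Psi>_def)
    qed
  qed
  then have "card (colour_perms n) = card (PiE UNIV (\<lambda>i. {\<pi>. \<pi> permutes {1..n i}}))" by (rule bij_betw_same_card)
  also have "\<dots> = (\<Prod>i\<in>UNIV. card {\<pi>. \<pi> permutes {1..n i}})" by (rule card_PiE) simp
  also have "\<dots> = (\<Prod>i\<in>UNIV. fact (n i))" by (simp add: card_permutations)
  finally show ?thesis .
qed

section \<open>Words and orderings of variables\<close>

text \<open>
  The exponent of the monomial $\prod_a v_a^{d_a}$.
\<close>

definition mexp :: "'i zvar list \<Rightarrow> int list \<Rightarrow> 'i expo" where
  "mexp vs ds = (\<Sum>(v, d)\<leftarrow>zip vs ds. single v d)"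

lemma mexp_Nil [simp]: "mexp [] ds = 0"
  and mexp_Cons [simp]: "mexp (v # vs) (d # ds) = single v d + mexp vs ds"
  by (simp_all add: mexp_def)

lemma mexp_append: "length vs = length ds \<Longrightarrow> mexp (vs @ vs') (ds @ ds') = mexp vs ds + mexp vs' ds'"
  by (simp add: mexp_def)

lemma push_mexp: "push \<sigma> (mexp vs ds) = mexp (map \<sigma> vs) ds"
proof (induction vs arbitrary: ds)
  case (Cons v vs)
  then show ?case by (cases ds) (auto simp: push_add mexp_def)
qed simp

text \<open>
  The renaming of the second factor in a product whose first factor is a letter of colour \<open>i\<close>.
\<close>

definition shift_index :: "'i \<Rightarrow> 'i zvar \<Rightarrow> 'i zvar" where
  "shift_index i v = Z (colour v) (unit_vec i (colour v) + pos v)"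

lemma inj_shift_index: "inj (shift_index i)"
proof (rule injI)
  fix x y :: "'a zvar" assume "shift_index i x = shift_index i y"
  then show "x = y" by (cases x; cases y) (auto simp: shift_index_def)
qed

lemma colour_shift_index [simp]: "colour (shift_index i v) = colour v"
  by (simp add: shift_index_def)

text \<open>
  The ordering of the variables given by the letters of a word.
\<close>

definition word_ordering :: "('i \<times> int) list \<Rightarrow> 'i zvar list" where
  "word_ordering w = map (word_var w) [0..<length w]"

lemma word_var_Suc: "word_var (x # xs) (Suc a) = shift_index (fst x) (word_var xs a)"
proof -
  let ?c = "fst (xs ! a)"
  have "{b. b \<le> Suc a \<and> fst ((x # xs) ! b) = ?c} =
    (if fst x = ?c then {0} else {}) \<union> Suc ` {b. b \<le> a \<and> fst (xs ! b) = ?c}" (is "?L = ?R")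
  proof (rule Set.set_eqI)
    fix b show "b \<in> ?L \<longleftrightarrow> b \<in> ?R" by (cases b) auto
  qed
  also have "card \<dots> = (if fst x = ?c then 1 else 0) + card (Suc ` {b. b \<le> a \<and> fst (xs ! b) = ?c})"
    by (subst card_Un_disjoint) auto
  finally have "card {b. b \<le> Suc a \<and> fst ((x # xs) ! b) = ?c} = unit_vec (fst x) ?c + card {b. b \<le> a \<and> fst (xs ! b) = ?c}"
    by (auto simp: card_image unit_vec_def)
  then show ?thesis by (simp add: word_var_def shift_index_def)
qed

lemma word_ordering_Nil [simp]: "word_ordering [] = []"
  by (simp add: word_ordering_def)

lemma word_ordering_Cons: "word_ordering (x # xs) = Z (fst x) 1 # map (shift_index (fst x)) (word_ordering xs)"
proof -
  have "word_var (x # xs) 0 = Z (fst x) 1"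
  proof -
    have "{b. b \<le> 0 \<and> fst ((x # xs) ! b) = fst x} = {0}" by auto
    then show ?thesis by (simp add: word_var_def)
  qed
  moreover have "[0..<length (x # xs)] = 0 # map Suc [0..<length xs]"
    by (simp add: upt_conv_Cons map_Suc_upt del: upt_Suc)
  ultimately show ?thesis by (simp add: word_ordering_def word_var_Suc del: upt_Suc)
qed

lemma length_word_ordering [simp]: "length (word_ordering w) = length w"
  by (simp add: word_ordering_def)

lemma weight_Cons: "weight (x # xs) = (\<lambda>i. unit_vec (fst x) i + weight xs i)"
  by (auto simp: weight_def unit_vec_def)

lemma map_colour_word_ordering: "map colour (word_ordering w) = map fst w"
  by (induction w) (auto simp: word_ordering_Cons o_def)

lemma zvars_unit_add: "zvars (\<lambda>j. unit_vec i j + n j) = insert (Z i 1) (shift_index i ` zvars n)"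
proof (intro equalityI subsetI)
  fix v assume v: "v \<in> zvars (\<lambda>j. unit_vec i j + n j)"
  show "v \<in> insert (Z i 1) (shift_index i ` zvars n)"
  proof (cases "v = Z i 1")
    case False
    have "v = shift_index i (Z (colour v) (pos v - unit_vec i (colour v)))" and
      "Z (colour v) (pos v - unit_vec i (colour v)) \<in> zvars n"
      using v False by (cases v; auto simp: shift_index_def in_zvars_iff unit_vec_def)+
    then show ?thesis by blast
  qed simp
qed (auto simp: in_zvars_iff shift_index_def unit_vec_def)

lemma first_not_shifted: "Z i 1 \<notin> shift_index i ` zvars n"
proof
  assume "Z i 1 \<in> shift_index i ` zvars n"
  then obtain v where v: "v \<in> zvars n" "Z i 1 = shift_index i v" by blast
  have "colour v = i" using arg_cong[OF v(2), of colour] by simp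
  then have "pos v = 0" using arg_cong[OF v(2), of pos] by (simp add: shift_index_def unit_vec_def)
  then show False using v(1) by (simp add: in_zvars_iff)
qed

lemma word_ordering_ords: "word_ordering w \<in> ords (zvars (weight w))"
proof (induction w)
  case Nil
  then show ?case by (auto simp: ords_def weight_def zvars_def)
next
  case (Cons x xs)
  then show ?case using first_not_shifted[of "fst x" "weight xs"]
    by (auto simp: ords_def word_ordering_Cons weight_Cons zvars_unit_add distinct_map intro: inj_on_subset[OF inj_shift_index])
qed

text \<open>
  The pairing with the negative half expands in the opposite region, that is, along the reversed
  ordering; likewise the product in the negative half exchanges the arguments of \<open>\<zeta>\<close>.
\<close>

primrec oriented :: "pm \<Rightarrow> 'a list \<Rightarrow> 'a list" where
  "oriented Plus vs = vs"
| "oriented Minus vs = rev vs"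

lemma oriented_oriented [simp]: "oriented \<epsilon> (oriented \<epsilon> vs) = vs"
  by (cases \<epsilon>) auto

lemma oriented_map: "oriented \<epsilon> (map f vs) = map f (oriented \<epsilon> vs)"
  by (cases \<epsilon>) (auto simp: rev_map)

lemma set_oriented [simp]: "set (oriented \<epsilon> vs) = set vs" and distinct_oriented [simp]: "distinct (oriented \<epsilon> vs) = distinct vs"
  by (cases \<epsilon>; simp)+

lemma oriented_ords [simp]: "oriented \<epsilon> vs \<in> ords A \<longleftrightarrow> vs \<in> ords A"
  by (simp add: ords_def)

lemma bef_rev: "bef (rev xs) = prod.swap ` bef xs"
  by (induction xs) (auto simp: bef_append image_Un)

lemma ords_permuted:
  assumes "vs \<in> ords (zvars n)" "vs' \<in> ords (zvars n)" "map colour vs = map colour vs'"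
  obtains \<sigma> where "\<sigma> \<in> colour_perms n" "vs' = map \<sigma> vs"
proof -
  define \<sigma> where "\<sigma> x = (if x \<in> set vs then vs' ! (the_inv_into {..<length vs} ((!) vs) x) else x)" for x
  have len: "length vs = length vs'" using assms(3) by (metis length_map)
  have inj: "inj_on ((!) vs) {..<length vs}" using assms(1) by (auto simp: ords_def inj_on_nth)
  have \<sigma>: "\<sigma> (vs ! a) = vs' ! a" if "a < length vs" for a
    using that inj by (simp add: \<sigma>_def the_inv_into_f_f)
  have map: "vs' = map \<sigma> vs" by (rule nth_equalityI) (simp_all add: len \<sigma>)
  have "set vs = zvars n" "set (map \<sigma> vs) = zvars n" using assms(1,2) by (simp_all add: ords_def map)
  then have "\<sigma> ` zvars n = zvars n" by (metis set_map)
  moreover have "inj_on \<sigma> (zvars n)"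
    using assms(1,2) distinct_map[of \<sigma> vs] by (simp add: ords_def map)
  ultimately have "bij_betw \<sigma> (zvars n) (zvars n)" by (simp add: bij_betw_def)
  moreover have "\<sigma> x = x" if "x \<notin> zvars n" for x using that assms(1) by (auto simp: \<sigma>_def ords_def)
  ultimately have "\<sigma> permutes zvars n" by (rule bij_imp_permutes)
  moreover have "colour (\<sigma> v) = colour v" for v
  proof (cases "v \<in> set vs")
    case True
    then obtain a where a: "a < length vs" "v = vs ! a" by (auto simp: in_set_conv_nth)
    have "colour (vs ! a) = colour (vs' ! a)" using arg_cong[OF assms(3), of "\<lambda>l. l ! a"] a len by simp
    then show ?thesis using a \<sigma> by simp
  qed (simp add: \<sigma>_def)
  ultimately have "\<sigma> \<in> colour_perms n" by (simp add: colour_perms_def)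
  then show ?thesis using that map by blast
qed

lemma colour_perms_ords: "\<sigma> \<in> colour_perms n \<Longrightarrow> vs \<in> ords (zvars n) \<Longrightarrow> map \<sigma> vs \<in> ords (zvars n)"
  using colour_permsD(4)[of \<sigma> n] inj_on_subset[OF colour_permsD(2)[of \<sigma> n] subset_UNIV]
  by (simp add: ords_def distinct_map)

section \<open>Symmetrizations are Laurent polynomials\<close>

definition dz :: "'i zvar \<Rightarrow> 'i zvar \<Rightarrow> ('i, 'k::comm_ring_1) laurent" where
  "dz u v = zpow u 1 - zpow v 1"

abbreviation ident :: "'i zvar \<Rightarrow> 'i zvar \<Rightarrow> 'i zvar \<Rightarrow> 'i zvar" where
  "ident u v \<equiv> id(u := v)"

lemma dz_dvd_power: "(dz u v :: ('i, 'k::comm_ring_1) laurent) dvd zpow u k - zpow v k"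
proof -
  have nat: "(dz u v :: ('i, 'k) laurent) dvd zpow u (int n) - zpow v (int n)" for n
  proof (induction n)
    case (Suc n)
    have "zpow u (int (Suc n)) - zpow v (int (Suc n)) =
      zpow u 1 * (zpow u (int n) - zpow v (int n)) + (dz u v :: ('i, 'k) laurent) * zpow v (int n)"
      by (simp add: dz_def right_diff_distrib left_diff_distrib mult_single single_add[symmetric])
    then show ?case using Suc by (metis dvd_add dvd_mult dvd_triv_left)
  qed simp
  show ?thesis
  proof (cases "k \<ge> 0")
    case True
    then show ?thesis using nat[of "nat k"] by simp
  next
    case False
    have "zpow u k - zpow v k = - (zpow u k * zpow v k * (zpow u (int (nat (- k))) - zpow v (int (nat (- k)))) :: ('i, 'k) laurent)"
      using False by (simp add: right_diff_distrib mult_single single_add[symmetric] add.assoc add.left_commute[of "single u k"])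
    then show ?thesis using nat[of "nat (- k)"] by (simp add: dvd_mult)
  qed
qed

lemma dz_dvd_ident: "(dz u v :: ('i, 'k::comm_ring_1) laurent) dvd f - zmap (ident u v) f"
proof (induction f rule: poly_mapping_linear_induct)
  case (single m c)
  have "m = restrict_exp (- {u}) m + single u (lookup m u)"
    by (rule poly_mapping_eqI) (auto simp: lookup_add lookup_restrict_exp lookup_single when_def)
  moreover have "push (ident u v) (restrict_exp (- {u}) m) = restrict_exp (- {u}) m"
  proof -
    have "push (ident u v) (restrict_exp (- {u}) m) = push id (restrict_exp (- {u}) m)"
      by (rule push_cong) (auto simp: keys_restrict_exp)
    then show ?thesis by (simp add: push_id)
  qed
  ultimately have "push (ident u v) m = restrict_exp (- {u}) m + single v (lookup m u)"
    by (metis fun_upd_same push_add push_single)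
  then have "single m c - zmap (ident u v) (single m c) =
    single (restrict_exp (- {u}) m) c * (zpow u (lookup m u) - zpow v (lookup m u))"
    using \<open>m = restrict_exp (- {u}) m + single u (lookup m u)\<close>
    by (simp add: right_diff_distrib mult_single)
  then show ?case using dz_dvd_power dvd_mult by metis
next
  case (add f g)
  have "f + g - zmap (ident u v) (f + g) = (f - zmap (ident u v) f) + (g - zmap (ident u v) g)"
    by (simp add: zmap_add)
  then show ?case using add by (metis dvd_add)
qed simp

text \<open>
  Identifying two variables is a ring homomorphism with values in a domain, so this shows that their
  difference is prime.
\<close>

lemma dz_dvd_iff: "(dz u v :: ('i, 'k::comm_ring_1) laurent) dvd f \<longleftrightarrow> zmap (ident u v) f = 0"
proof
  assume "dz u v dvd f"
  then obtain g where "f = dz u v * g" by (elim dvdE)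
  then show "zmap (ident u v) f = 0" by (simp add: zmap_mult dz_def zmap_diff)
next
  assume "zmap (ident u v) f = 0"
  then show "dz u v dvd f" using dz_dvd_ident[of u v f] by simp
qed

lemma dz_nz: "u \<noteq> v \<Longrightarrow> (dz u v :: ('i, 'k::comm_ring_1) laurent) \<noteq> 0"
proof
  assume "u \<noteq> v" "dz u v = (0 :: ('i, 'k) laurent)"
  then have "lookup (dz u v :: ('i, 'k) laurent) (single u 1) = 0" by simp
  moreover have "single v 1 \<noteq> (single u 1 :: 'i expo)"
    using \<open>u \<noteq> v\<close> by (metis lookup_single_eq lookup_single_not_eq zero_neq_one)
  ultimately show False by (simp add: dz_def lookup_minus lookup_single)
qed

lemma zmap_dz: "zmap \<sigma> (dz u v) = dz (\<sigma> u) (\<sigma> v)"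
  by (simp add: dz_def zmap_diff)

context zeta_data
begin

definition zprod :: "'i zvar list \<Rightarrow> ('i, 'k) ratfun" where
  "zprod vs = (\<Prod>p\<in>bef vs. zt (fst p) (snd p))"

definition uterm :: "pm \<Rightarrow> 'i zvar list \<Rightarrow> int list \<Rightarrow> ('i, 'k) ratfun" where
  "uterm \<epsilon> vs ds = rat (single (mexp vs ds) 1) * zprod (oriented \<epsilon> vs)"

lemma ratmap_zprod:
  assumes "inj \<sigma>" "\<And>v. colour (\<sigma> v) = colour v"
  shows "ratmap \<sigma> (zprod vs) = zprod (map \<sigma> vs)"
proof -
  have "inj_on (map_prod \<sigma> \<sigma>) (bef vs)" using assms(1) by (meson prod.inj_map inj_on_subset subset_UNIV)
  then show ?thesis using assms
    by (simp add: zprod_def bef_map prod.reindex ratmap_prod ratmap_zt)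
qed

lemma ratmap_uterm:
  assumes "inj \<sigma>" "\<And>v. colour (\<sigma> v) = colour v"
  shows "ratmap \<sigma> (uterm \<epsilon> vs ds) = uterm \<epsilon> (map \<sigma> vs) ds"
  using assms by (simp add: uterm_def ratmap_mult ratmap_rat push_mexp ratmap_zprod oriented_map)

text \<open>
  The only possible pole of \<open>\<zeta>\<close> is simple, lies at equal variables and occurs for equal colours only.
\<close>

lemma zt_explicit:
  assumes "u \<noteq> v"
  obtains g where "g \<in> laurents_in {u, v}"
    "rat g = (if colour u = colour v then zrat u - zrat v else 1) * zt v u"
proof -
  let ?k = "s (colour v) (colour u)"
  let ?c = "\<alpha> (colour v) (colour u)"
  let ?n = "single (single u ?k - single v ?k) (1 / ?c)"
  let ?n' = "single (single v ?k - single u ?k) ?c"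
  let ?D = "if colour u = colour v then zpow u 1 else (1 :: ('i, 'k) laurent)"
  have sh: "keys (shift u v) \<subseteq> {u, v}" for u v :: "'i zvar"
    by (auto simp: in_keys_iff shift_def lookup_minus lookup_single when_def split: if_splits)
  have nn: "?n' * ?n = 1" using alpha_nz by (simp add: mult_single)
  have "(if colour u = colour v then dz u v else 1) = ?D * (if colour u = colour v then 1 - single (shift u v) 1 else (1 :: ('i, 'k) laurent))"
    by (simp add: dz_def right_diff_distrib mult_single shift_def)
  also have "\<dots> = ?D * ?n' * num u v"
    using nn by (simp add: num_def mult.assoc)
  finally have D: "(if colour u = colour v then dz u v else 1) = ?D * ?n' * num u v" .
  have "(if colour u = colour v then zrat u - zrat v else 1) = rat (if colour u = colour v then dz u v else 1)"
    by (simp add: dz_def rat_diff zrat_def)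
  also have "\<dots> = rat (?D * ?n') * rat (num u v)" unfolding D by (rule rat_mult)
  finally have "(if colour u = colour v then zrat u - zrat v else 1) * zt v u = rat (?D * ?n' * den u v)"
    using zt_num_den[OF assms] by (simp add: rat_mult mult.assoc)
  moreover have "?D * ?n' * den u v \<in> laurents_in {u, v}"
  proof (intro laurents_in_mult)
    show "?D \<in> laurents_in {u, v}" by (auto intro: laurents_in_single)
    have "keys (single v ?k - single u ?k) \<subseteq> {u, v}"
      by (auto simp: in_keys_iff lookup_minus lookup_single when_def split: if_splits)
    then show "?n' \<in> laurents_in {u, v}" by (rule laurents_in_single)
    show "den u v \<in> laurents_in {u, v}" unfolding den_def
      by (intro laurents_in_prod laurents_in_diff laurents_in_single laurents_in_1 sh)
  qed
  ultimately show ?thesis using that by metis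
qed

abbreviation is_laurent :: "('i, 'k) ratfun \<Rightarrow> bool" where
  "is_laurent F \<equiv> F \<in> range rat"

lemma is_laurent_mult:
  assumes "is_laurent F" "is_laurent G" shows "is_laurent (F * G)"
proof -
  obtain f g where "F = rat f" "G = rat g" using assms by blast
  then have "F * G = rat (f * g)" by (simp add: rat_mult)
  then show ?thesis by (rule range_eqI)
qed

lemma is_laurent_rat: "is_laurent (rat f)"
  by simp

lemma is_laurent_1: "is_laurent 1"
  by (metis rangeI rat_1)

lemma is_laurent_0: "is_laurent 0"
  by (metis rangeI rat_0)

lemma is_laurent_add:
  assumes "is_laurent F" "is_laurent G" shows "is_laurent (F + G)"
proof -
  obtain f g where "F = rat f" "G = rat g" using assms by blast
  then have "F + G = rat (f + g)" by (simp add: rat_add)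
  then show ?thesis by (rule range_eqI)
qed

lemma is_laurent_prod: "(\<And>x. x \<in> A \<Longrightarrow> is_laurent (f x)) \<Longrightarrow> is_laurent (\<Prod>x\<in>A. f x)"
proof (induction A rule: infinite_finite_induct)
  case (insert x A)
  show ?case unfolding prod.insert[OF insert.hyps]
    by (rule is_laurent_mult[OF insert.prems insert.IH[OF insert.prems]]) auto
next
  case (infinite A)
  then show ?case unfolding prod.infinite[OF infinite(1)] by (intro is_laurent_1)
next
  case empty
  show ?case unfolding prod.empty by (rule is_laurent_1)
qed

lemma is_laurent_sum: "(\<And>x. x \<in> A \<Longrightarrow> is_laurent (f x)) \<Longrightarrow> is_laurent (\<Sum>x\<in>A. f x)"
proof (induction A rule: infinite_finite_induct)
  case (insert x A)
  show ?case unfolding sum.insert[OF insert.hyps]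
    by (rule is_laurent_add[OF insert.prems insert.IH[OF insert.prems]]) auto
next
  case (infinite A)
  then show ?case unfolding sum.infinite[OF infinite(1)] by (intro is_laurent_0)
next
  case empty
  show ?case unfolding sum.empty by (rule is_laurent_0)
qed

definition same_col :: "'i zvar set \<Rightarrow> ('i zvar \<times> 'i zvar) set" where
  "same_col V = {(a, b). a \<in> V \<and> b \<in> V \<and> a \<noteq> b \<and> colour a = colour b}"

text \<open>
  The summands have at most simple poles along $z_u = z_v$ for \<open>u\<close> and \<open>v\<close> of the same colour. Let \<open>D u v\<close>
  clear all of them except the one along $z_u = z_v$. Then $(z_u - z_v) D S$ is a Laurent polynomial \<open>x\<close>
  that changes sign under the exchange of \<open>u\<close> and \<open>v\<close>, so it vanishes at $z_u = z_v$ as the characteristic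
  is not 2, and $D S$ is a Laurent polynomial. Hence the sum \<open>S\<close> has no pole along any $z_u = z_v$; as the
  differences are pairwise coprime primes, \<open>S\<close> is a Laurent polynomial.
\<close>

lemma symmetrization_is_laurent:
  fixes n :: "'i \<Rightarrow> nat"
  assumes vs: "vs \<in> ords (zvars n)"
  shows "is_laurent (\<Sum>\<sigma>\<in>colour_perms n. uterm \<epsilon> (map \<sigma> vs) ds)" (is "is_laurent ?S")
proof -
  let ?V = "zvars n"
  define pr where "pr P = (\<Prod>p\<in>P. dz (fst p) (snd p) :: ('i, 'k) laurent)" for P
  have fin: "finite (same_col ?V)"
    by (rule finite_subset[of _ "?V \<times> ?V"]) (auto simp: same_col_def finite_zvars)
  define D where "D u v = pr (same_col ?V - {(u, v), (v, u)})" for u v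
  have clear: "is_laurent (rat (D u v) * (rat (dz u v) * zprod us))"
    if uv: "(u, v) \<in> same_col ?V" and us: "us \<in> ords ?V" for u v us
  proof -
    have total: "(u, v) \<in> bef us \<or> (v, u) \<in> bef us"
      using uv us by (intro bef_total) (auto simp: same_col_def ords_def)
    have d: "distinct us" using us by (simp add: ords_def)
    define B where "B = bef us \<inter> same_col ?V"
    have "bef us = B \<union> (bef us - same_col ?V)" by (auto simp: B_def)
    then have zprod: "zprod us = (\<Prod>p\<in>B. zt (fst p) (snd p)) * (\<Prod>p\<in>bef us - same_col ?V. zt (fst p) (snd p))"
      unfolding zprod_def by (subst prod.union_disjoint[symmetric]) (auto simp: B_def)
    have pole: "is_laurent (rat (dz a b) * zt a b)" "is_laurent (rat (dz a b) * zt b a)" if "(a, b) \<in> same_col ?V" for a b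
    proof -
      have ab: "a \<noteq> b" "colour a = colour b" using that by (auto simp: same_col_def)
      obtain g where g: "rat g = (zrat a - zrat b) * zt b a" using zt_explicit[OF ab(1)] unfolding ab(2) if_P[OF refl] by blast
      obtain h where h: "rat h = (zrat b - zrat a) * zt a b" using zt_explicit[OF ab(1)[symmetric]] unfolding ab(2) if_P[OF refl] by blast
      have "rat (dz a b) * zt b a = rat g" "rat (dz a b) * zt a b = rat (- h)"
        by (simp_all add: g h dz_def rat_diff zrat_def rat_minus algebra_simps)
      then show "is_laurent (rat (dz a b) * zt a b)" "is_laurent (rat (dz a b) * zt b a)" by (metis rangeI)+
    qed
    have nopole: "is_laurent (zt a b)" if "(a, b) \<in> bef us - same_col ?V" for a b
    proof -
      have "a \<noteq> b" "colour b \<noteq> colour a" using that bef_ords[OF us] by (auto simp: same_col_def)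
      then obtain g where "rat g = 1 * zt a b" using zt_explicit[of b a] by auto
      then show ?thesis by (metis mult_1 rangeI)
    qed
    let ?P = "same_col ?V - {(u, v), (v, u)}"
    have "\<exists>p0. (p0 = (u, v) \<or> p0 = (v, u)) \<and> p0 \<in> B \<and> B - {p0} \<subseteq> ?P"
      using total
    proof
      assume "(u, v) \<in> bef us"
      with bef_antisym[OF d this] show ?thesis
        by (intro exI[of _ "(u, v)"]) (use uv in \<open>auto simp: B_def\<close>)
    next
      assume vu: "(v, u) \<in> bef us"
      have "(v, u) \<in> same_col ?V" using uv by (auto simp: same_col_def)
      with bef_antisym[OF d vu] vu show ?thesis
        by (intro exI[of _ "(v, u)"]) (auto simp: B_def)
    qed
    then obtain p0 where p0: "p0 = (u, v) \<or> p0 = (v, u)" "p0 \<in> B" "B - {p0} \<subseteq> ?P" by blast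
    have "is_laurent (rat (dz u v) * zt (fst p0) (snd p0))" using p0(1) pole[OF uv] by auto
    moreover have "is_laurent (rat (D u v) * (\<Prod>p\<in>B - {p0}. zt (fst p) (snd p)))"
    proof -
      have "D u v = pr (B - {p0}) * pr (?P - (B - {p0}))"
        unfolding D_def pr_def using prod.subset_diff[OF p0(3), of "\<lambda>p. dz (fst p) (snd p)"] fin
        by (simp add: mult.commute)
      then have "rat (D u v) * (\<Prod>p\<in>B - {p0}. zt (fst p) (snd p)) =
        rat (pr (?P - (B - {p0}))) * (\<Prod>p\<in>B - {p0}. rat (dz (fst p) (snd p)) * zt (fst p) (snd p))"
        by (simp add: rat_mult prod.distrib pr_def rat_prod mult_ac)
      moreover have "is_laurent (\<Prod>p\<in>B - {p0}. rat (dz (fst p) (snd p)) * zt (fst p) (snd p))"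
        by (rule is_laurent_prod) (use pole in \<open>auto simp: B_def\<close>)
      ultimately show ?thesis by (simp only: is_laurent_mult is_laurent_rat)
    qed
    moreover have "is_laurent (\<Prod>p\<in>bef us - same_col ?V. zt (fst p) (snd p))"
      by (rule is_laurent_prod) (use nopole in auto)
    moreover have "(\<Prod>p\<in>B. zt (fst p) (snd p)) = zt (fst p0) (snd p0) * (\<Prod>p\<in>B - {p0}. zt (fst p) (snd p))"
      using p0(2) by (intro prod.remove) (auto simp: B_def)
    then have "rat (D u v) * (rat (dz u v) * zprod us) =
      (rat (dz u v) * zt (fst p0) (snd p0)) * (rat (D u v) * (\<Prod>p\<in>B - {p0}. zt (fst p) (snd p))) *
      (\<Prod>p\<in>bef us - same_col ?V. zt (fst p) (snd p))"
      unfolding zprod by (simp only: mult_ac)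
    ultimately show ?thesis by (simp only: is_laurent_mult)
  qed
  have D_S: "is_laurent (rat (D u v) * ?S)" if uv: "(u, v) \<in> same_col ?V" for u v
  proof -
    have ne: "u \<noteq> v" using uv by (simp add: same_col_def)
    have "rat (D u v * dz u v) * ?S = (\<Sum>\<sigma>\<in>colour_perms n. rat (single (mexp (map \<sigma> vs) ds) 1) *
        (rat (D u v) * (rat (dz u v) * zprod (oriented \<epsilon> (map \<sigma> vs)))))"
      by (simp add: sum_distrib_left uterm_def rat_mult mult_ac)
    moreover have "is_laurent \<dots>"
    proof (rule is_laurent_sum, rule is_laurent_mult[OF is_laurent_rat])
      fix \<sigma> assume "\<sigma> \<in> colour_perms n"
      then have "oriented \<epsilon> (map \<sigma> vs) \<in> ords ?V" using colour_perms_ords[OF _ vs] by simp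
      then show "is_laurent (rat (D u v) * (rat (dz u v) * zprod (oriented \<epsilon> (map \<sigma> vs))))" by (rule clear[OF uv])
    qed
    ultimately obtain x where x: "rat (D u v * dz u v) * ?S = rat x" by auto
    define \<tau> where "\<tau> = transpose u v"
    have \<tau>: "\<tau> \<in> colour_perms n" unfolding colour_perms_def \<tau>_def
      using uv by (auto simp: same_col_def transpose_def intro!: permutes_swap_id)
    have inj: "inj \<tau>" using colour_permsD(2)[OF \<tau>] .
    have "ratmap \<tau> ?S = (\<Sum>\<sigma>\<in>colour_perms n. uterm \<epsilon> (map (\<tau> \<circ> \<sigma>) vs) ds)"
      using inj colour_permsD(3)[OF \<tau>] by (simp add: ratmap_sum ratmap_uterm)
    also have "\<dots> = ?S"
      by (rule sum.reindex_bij_betw[OF colour_perms_left_mult[OF \<tau>], of "\<lambda>\<sigma>. uterm \<epsilon> (map \<sigma> vs) ds"])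
    finally have S: "ratmap \<tau> ?S = ?S" .
    have D: "zmap \<tau> (D u v) = D u v"
    proof -
      let ?P = "same_col ?V - {(u, v), (v, u)}"
      have "zmap \<tau> (D u v) = (\<Prod>p\<in>?P. dz (fst (map_prod \<tau> \<tau> p)) (snd (map_prod \<tau> \<tau> p)))"
        by (simp add: D_def pr_def zmap_prod dz_def zmap_diff)
      also have "\<dots> = D u v"
      proof -
        have \<tau>\<tau>: "\<tau> (\<tau> x) = x" for x by (simp add: \<tau>_def)
        have \<tau>V: "\<tau> x \<in> ?V \<longleftrightarrow> x \<in> ?V" for x using colour_permsD(5)[OF \<tau>] by (rule permutes_in_image)
        have sub: "map_prod \<tau> \<tau> ` ?P \<subseteq> ?P"
        proof
          fix x assume "x \<in> map_prod \<tau> \<tau> ` ?P"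
          then obtain a b where ab: "(a, b) \<in> same_col ?V" "(a, b) \<notin> {(u, v), (v, u)}"
            and x: "x = (\<tau> a, \<tau> b)" by auto
          have "(\<tau> a, \<tau> b) \<in> same_col ?V"
            using ab(1) colour_permsD(3)[OF \<tau>] inj \<tau>V by (auto simp: same_col_def inj_eq)
          moreover have "(\<tau> a, \<tau> b) \<noteq> (u, v)" "(\<tau> a, \<tau> b) \<noteq> (v, u)"
            using ab(2) by (auto simp: \<tau>_def transpose_def split: if_splits)
          ultimately show "x \<in> ?P" unfolding x by blast
        qed
        have "bij_betw (map_prod \<tau> \<tau>) ?P ?P"
          by (rule bij_betw_byWitness[where f' = "map_prod \<tau> \<tau>"]) (use sub in \<open>auto simp: \<tau>\<tau>\<close>)
        from prod.reindex_bij_betw[OF this, of "\<lambda>p. dz (fst p) (snd p)"] show ?thesis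
          by (simp only: D_def pr_def)
      qed
      finally show ?thesis .
    qed
    have "zmap \<tau> (dz u v) = (- dz u v :: ('i, 'k) laurent)"
      by (simp add: \<tau>_def dz_def zmap_diff)
    then have "ratmap \<tau> (rat (D u v * dz u v) * ?S) = - (rat (D u v * dz u v) * ?S)"
      using inj S D by (simp add: ratmap_mult ratmap_rat zmap_mult rat_minus rat_mult)
    then have "rat (zmap \<tau> x) = rat (- x)" using inj by (simp add: x ratmap_rat rat_minus)
    then have \<tau>x: "zmap \<tau> x = - x" by simp
    have "ident u v \<circ> \<tau> = ident u v" by (auto simp: \<tau>_def transpose_def fun_eq_iff)
    then have "zmap (ident u v) x = zmap (ident u v) (zmap \<tau> x)" by (simp add: zmap_zmap)
    also have "\<dots> = - zmap (ident u v) x" by (simp add: \<tau>x zmap_uminus)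
    finally have "zmap (ident u v) x + zmap (ident u v) x = 0" by simp
    then have "2 * zmap (ident u v) x = 0" by (simp only: mult_2)
    then have "dz u v dvd x" unfolding dz_dvd_iff by (metis mult_eq_0_iff zero_neq_numeral)
    then obtain y where y: "x = dz u v * y" by (elim dvdE)
    have "rat (dz u v) * (rat (D u v) * ?S) = rat (dz u v) * rat y"
      using x by (simp add: y rat_mult mult_ac)
    then have "rat (D u v) * ?S = rat y" using dz_nz[OF ne, where ?'k = 'k] by simp
    then show ?thesis by (metis rangeI)
  qed
  \<comment> \<open>The cleared factors are removed one at a time.\<close>
  have "finite Q \<Longrightarrow> Q \<subseteq> same_col ?V \<Longrightarrow> is_laurent (rat (pr Q) * ?S) \<Longrightarrow> is_laurent ?S" for Q
  proof (induction Q rule: finite_induct)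
    case empty
    then show ?case by (simp add: pr_def)
  next
    case (insert p Q)
    obtain u v where p: "p = (u, v)" by (cases p)
    have uv: "(u, v) \<in> same_col ?V" using insert.prems p by simp
    have ne: "u \<noteq> v" using uv by (simp add: same_col_def)
    obtain x where x: "rat (dz u v * pr Q) * ?S = rat x"
      using insert.prems(2) insert.hyps p by (auto simp: pr_def)
    obtain y where y: "rat (D u v) * ?S = rat y" using D_S[OF uv] by auto
    have "rat (D u v * x) = rat (dz u v * pr Q * y)"
      unfolding rat_mult x[symmetric] y[symmetric] by (simp only: mult_ac)
    then have "D u v * x = dz u v * pr Q * y" by simp
    then have "dz u v dvd D u v * x" by (metis dvd_triv_left mult.assoc)
    then have "zmap (ident u v) (D u v) * zmap (ident u v) x = 0" by (simp add: dz_dvd_iff zmap_mult)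
    moreover have "zmap (ident u v) (D u v) \<noteq> 0"
    proof -
      have nz: "dz (ident u v a) (ident u v b) \<noteq> (0 :: ('i, 'k) laurent)"
        if "(a, b) \<in> same_col ?V - {(u, v), (v, u)}" for a b
        using that by (intro dz_nz) (auto simp: same_col_def)
      show ?thesis unfolding D_def pr_def zmap_prod zmap_dz prod_zero_iff[OF finite_Diff[OF fin]]
      proof
        assume "\<exists>p\<in>same_col ?V - {(u, v), (v, u)}. dz (ident u v (fst p)) (ident u v (snd p)) = (0 :: ('i, 'k) laurent)"
        then obtain p where p: "p \<in> same_col ?V - {(u, v), (v, u)}"
          "dz (ident u v (fst p)) (ident u v (snd p)) = (0 :: ('i, 'k) laurent)" by blast
        from nz[of "fst p" "snd p"] p show False unfolding prod.collapse by blast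
      qed
    qed
    ultimately have "dz u v dvd x" by (simp add: dz_dvd_iff)
    then obtain x' where x': "x = dz u v * x'" by (elim dvdE)
    have "rat (dz u v) * (rat (pr Q) * ?S) = rat (dz u v) * rat x'"
      using x by (simp add: x' rat_mult mult_ac)
    then have "rat (pr Q) * ?S = rat x'" using dz_nz[OF ne, where ?'k = 'k] by simp
    then have "is_laurent (rat (pr Q) * ?S)" by (metis rangeI)
    then show ?case using insert by auto
  qed
  moreover have "is_laurent (rat (pr (same_col ?V)) * ?S)"
  proof (cases "same_col ?V = {}")
    case True
    have "is_laurent ?S"
    proof (rule is_laurent_sum)
      fix \<sigma> assume "\<sigma> \<in> colour_perms n"
      then have us: "oriented \<epsilon> (map \<sigma> vs) \<in> ords ?V" using colour_perms_ords[OF _ vs] by simp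
      have "is_laurent (zprod (oriented \<epsilon> (map \<sigma> vs)))" unfolding zprod_def
      proof (rule is_laurent_prod)
        fix p assume p: "p \<in> bef (oriented \<epsilon> (map \<sigma> vs))"
        obtain a b where ab: "p = (a, b)" by (cases p)
        have "a \<noteq> b" "colour b \<noteq> colour a" using p ab bef_ords[OF us, of a b] True by (auto simp: same_col_def)
        then obtain g where "rat g = 1 * zt a b" using zt_explicit[of b a] by auto
        then have "is_laurent (zt a b)" by (metis mult_1 rangeI)
        then show "is_laurent (zt (fst p) (snd p))" by (simp add: ab)
      qed
      then show "is_laurent (uterm \<epsilon> (map \<sigma> vs) ds)" unfolding uterm_def by (intro is_laurent_mult is_laurent_rat)
    qed
    then show ?thesis using True by (simp add: pr_def)
  next
    case False
    then obtain u v where uv: "(u, v) \<in> same_col ?V" by auto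
    let ?P = "same_col ?V - {(u, v), (v, u)}"
    have "pr (same_col ?V) = pr (same_col ?V - ?P) * pr ?P" unfolding pr_def
      using prod.subset_diff[of ?P "same_col ?V"] fin by auto
    then have "rat (pr (same_col ?V)) * ?S = rat (pr (same_col ?V - ?P)) * (rat (D u v) * ?S)"
      by (simp add: D_def rat_mult mult.assoc)
    then show ?thesis using D_S[OF uv] by (simp only: is_laurent_mult is_laurent_rat)
  qed
  ultimately show ?thesis using fin by blast
qed

end

section \<open>The shuffle algebra and its pairing on words\<close>

lemma crat_0 [simp]: "crat 0 = 0"
  by (simp add: crat_def)

lemma crat_add: "crat (c + d) = crat c + crat d" and crat_mult: "crat (c * d) = crat c * crat d"
  by (simp_all add: crat_def single_add rat_add rat_mult[symmetric] mult_single)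

lemma crat_eq_iff [simp]: "crat c = (crat d :: ('i, 'k::field) ratfun) \<longleftrightarrow> c = d"
proof
  assume "crat c = (crat d :: ('i, 'k) ratfun)"
  then have "cst c = (cst d :: ('i, 'k) laurent)" by (simp add: crat_def)
  then show "c = d" by (metis lookup_single_eq)
qed simp

lemma crat_sum: "crat (\<Sum>x\<in>A. f x) = (\<Sum>x\<in>A. crat (f x))"
  by (induction A rule: infinite_finite_induct) (auto simp: crat_add)

context zeta_data
begin

definition signed_zt :: "pm \<Rightarrow> 'i zvar \<Rightarrow> 'i zvar \<Rightarrow> ('i, 'k) ratfun" where
  "signed_zt \<epsilon> u v = (case \<epsilon> of Plus \<Rightarrow> zt u v | Minus \<Rightarrow> zt v u)"

lemma zprod_oriented: "zprod (oriented \<epsilon> vs) = (\<Prod>p\<in>bef vs. signed_zt \<epsilon> (fst p) (snd p))"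
  by (cases \<epsilon>) (simp_all add: zprod_def signed_zt_def bef_rev prod.reindex)

lemma kap_oriented: "kap (oriented \<epsilon> vs) = (\<Prod>p\<in>bef vs. 1 / signed_zt \<epsilon> (snd p) (fst p))"
  by (cases \<epsilon>) (simp_all add: krp_def kr_def signed_zt_def bef_rev prod.reindex)

lemma uterm_Cons:
  assumes "distinct (u # us)"
  shows "uterm \<epsilon> (u # us) (d # ds) = rat (zpow u d) * (\<Prod>v\<in>set us. signed_zt \<epsilon> u v) * uterm \<epsilon> us ds"
proof -
  have "{u} \<times> set us \<inter> bef us = {}" using assms bef_subset[of us] by auto
  then have "zprod (oriented \<epsilon> (u # us)) = (\<Prod>p\<in>{u} \<times> set us. signed_zt \<epsilon> (fst p) (snd p)) * zprod (oriented \<epsilon> us)"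
    unfolding zprod_oriented by (simp add: prod.union_disjoint)
  also have "(\<Prod>p\<in>{u} \<times> set us. signed_zt \<epsilon> (fst p) (snd p)) = (\<Prod>v\<in>set us. signed_zt \<epsilon> u v)"
    by (rule prod.reindex_bij_witness[of _ "\<lambda>v. (u, v)" snd]) auto
  finally have eq: "zprod (oriented \<epsilon> (u # us)) = (\<Prod>v\<in>set us. signed_zt \<epsilon> u v) * zprod (oriented \<epsilon> us)" .
  have "rat (single (mexp (u # us) (d # ds)) 1) = rat (zpow u d) * (rat (single (mexp us ds) 1) :: ('i, 'k) ratfun)"
    by (simp add: rat_mult[symmetric] mult_single)
  then show ?thesis unfolding uterm_def eq by (simp only: mult_ac)
qed

text \<open>
  The value of $\widetilde\Upsilon$ on a word, as a rational function.
\<close>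

definition upsilon_rat :: "pm \<Rightarrow> ('i \<times> int) list \<Rightarrow> ('i, 'k) ratfun" where
  "upsilon_rat \<epsilon> w = (\<Sum>\<sigma>\<in>colour_perms (weight w). uterm \<epsilon> (map \<sigma> (word_ordering w)) (map snd w))"

lemma upsilon_rat_Nil: "upsilon_rat \<epsilon> [] = 1"
proof -
  have "colour_perms (weight []) = {id :: 'i zvar \<Rightarrow> 'i zvar}"
  proof -
    have "zvars (weight []) = ({} :: 'i zvar set)" by (auto simp: zvars_def weight_def)
    then show ?thesis by (auto simp: colour_perms_def)
  qed
  then show ?thesis by (simp add: upsilon_rat_def uterm_def zprod_oriented)
qed

text \<open>
  Each \<open>\<tau>\<close> permuting the variables of \<open>xs\<close> extends to a permutation \<open>hat \<tau>\<close> of the variables of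
  \<open>x # xs\<close>, and right multiplication by it permutes the outer sum. So all terms of the inner
  symmetrization contribute the same, which cancels the factorials.
\<close>

lemma upsilon_rat_Cons:
  fixes x :: "'i \<times> int" and xs :: "('i \<times> int) list"
  defines "i \<equiv> fst x" and "d \<equiv> snd x" and "n' \<equiv> weight xs"
  shows "(\<Sum>\<sigma>\<in>colour_perms (weight (x # xs)). rat (zpow (\<sigma> (Z i 1)) d) * ratmap (\<sigma> \<circ> shift_index i) (upsilon_rat \<epsilon> xs) /
      of_nat (\<Prod>j\<in>UNIV. fact (n' j)) * (\<Prod>v\<in>zvars n'. signed_zt \<epsilon> (\<sigma> (Z i 1)) (\<sigma> (shift_index i v)))) = upsilon_rat \<epsilon> (x # xs)"
proof -
  define nn where "nn = weight (x # xs)"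
  define ds where "ds = map snd xs"
  have nn: "zvars nn = insert (Z i 1) (shift_index i ` zvars n')"
    by (simp add: nn_def n'_def i_def weight_Cons zvars_unit_add)
  have word_ordering: "word_ordering xs \<in> ords (zvars n')" by (simp add: n'_def word_ordering_ords)
  define T where "T \<sigma> = uterm \<epsilon> (map \<sigma> (word_ordering (x # xs))) (d # ds)" for \<sigma>
  have upsilon_rat: "upsilon_rat \<epsilon> (x # xs) = (\<Sum>\<sigma>\<in>colour_perms nn. T \<sigma>)" by (simp add: upsilon_rat_def T_def nn_def d_def ds_def)
  define hat where "hat \<tau> = (\<lambda>v. if v \<in> shift_index i ` zvars n' then shift_index i (\<tau> (inv_into (zvars n') (shift_index i) v)) else v)" for \<tau>
  have inj: "inj_on (shift_index i) (zvars n')" by (rule inj_on_subset[OF inj_shift_index]) simp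
  have hat_shift_index: "hat \<tau> (shift_index i v) = shift_index i (\<tau> v)" if "v \<in> zvars n'" for \<tau> v
    using that inj by (simp add: hat_def)
  have hat_Z: "hat \<tau> (Z i 1) = Z i 1" for \<tau> using first_not_shifted[of i n'] by (simp add: hat_def)
  have hat: "hat \<tau> \<in> colour_perms nn" if \<tau>: "\<tau> \<in> colour_perms n'" for \<tau>
  proof -
    have "bij_betw (shift_index i) (zvars n') (shift_index i ` zvars n')" using inj by (rule inj_on_imp_bij_betw)
    from permutes_bij_inv_into[OF colour_permsD(5)[OF \<tau>] this]
    have "hat \<tau> permutes shift_index i ` zvars n'" by (simp add: hat_def)
    then have "hat \<tau> permutes zvars nn" by (rule permutes_subset) (auto simp: nn)
    moreover have "colour (hat \<tau> v) = colour v" for v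
    proof (cases "v \<in> shift_index i ` zvars n'")
      case True
      then obtain v' where "v' \<in> zvars n'" "v = shift_index i v'" by blast
      then show ?thesis using hat_shift_index colour_permsD(3)[OF \<tau>] by simp
    qed (simp add: hat_def)
    ultimately show ?thesis by (simp add: colour_perms_def)
  qed
  have summand: "rat (zpow (\<sigma> (Z i 1)) d) * uterm \<epsilon> (map (\<sigma> \<circ> shift_index i) (map \<tau> (word_ordering xs))) ds *
      (\<Prod>v\<in>zvars n'. signed_zt \<epsilon> (\<sigma> (Z i 1)) (\<sigma> (shift_index i v))) = T (\<sigma> \<circ> hat \<tau>)"
    if \<sigma>: "\<sigma> \<in> colour_perms nn" and \<tau>: "\<tau> \<in> colour_perms n'" for \<sigma> \<tau>
  proof -
    define us where "us = map (\<sigma> \<circ> shift_index i) (map \<tau> (word_ordering xs))"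
    have inj': "inj (\<sigma> \<circ> shift_index i)" using inj_compose[OF colour_permsD(2)[OF \<sigma>] inj_shift_index] .
    have "map (\<sigma> \<circ> hat \<tau>) (word_ordering (x # xs)) = \<sigma> (Z i 1) # us"
      using word_ordering hat_shift_index hat_Z by (simp add: word_ordering_Cons us_def ords_def flip: i_def)
    moreover have "map (\<sigma> \<circ> hat \<tau>) (word_ordering (x # xs)) \<in> ords (zvars nn)"
      by (intro colour_perms_ords colour_perms_comp \<sigma> hat \<tau>) (simp add: nn_def word_ordering_ords)
    ultimately have eq: "map (\<sigma> \<circ> hat \<tau>) (word_ordering (x # xs)) = \<sigma> (Z i 1) # us" and dist: "distinct (\<sigma> (Z i 1) # us)"
      by (simp_all add: ords_def)
    have "set us = (\<sigma> \<circ> shift_index i) ` zvars n'"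
      using word_ordering colour_permsD(4)[OF \<tau>] unfolding us_def set_map by (simp add: ords_def)
    moreover have "inj_on (\<sigma> \<circ> shift_index i) (zvars n')" by (rule inj_on_subset[OF inj']) simp
    ultimately have "(\<Prod>v\<in>set us. signed_zt \<epsilon> (\<sigma> (Z i 1)) v) = (\<Prod>v\<in>zvars n'. signed_zt \<epsilon> (\<sigma> (Z i 1)) (\<sigma> (shift_index i v)))"
      using prod.reindex[of "\<sigma> \<circ> shift_index i" "zvars n'" "signed_zt \<epsilon> (\<sigma> (Z i 1))"] by (simp add: o_def)
    then show ?thesis unfolding T_def eq uterm_Cons[OF dist] us_def[symmetric] by (simp add: mult_ac)
  qed
  let ?c = "of_nat (\<Prod>j\<in>UNIV. fact (n' j)) :: ('i, 'k) ratfun"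
  have card: "?c = of_nat (card (colour_perms n'))" by (simp add: card_colour_perms)
  have c: "?c \<noteq> 0" by simp
  have "(\<Sum>\<sigma>\<in>colour_perms nn. rat (zpow (\<sigma> (Z i 1)) d) * ratmap (\<sigma> \<circ> shift_index i) (upsilon_rat \<epsilon> xs) /
      ?c * (\<Prod>v\<in>zvars n'. signed_zt \<epsilon> (\<sigma> (Z i 1)) (\<sigma> (shift_index i v)))) =
    (\<Sum>\<sigma>\<in>colour_perms nn. \<Sum>\<tau>\<in>colour_perms n'. T (\<sigma> \<circ> hat \<tau>) / ?c)"
  proof (intro sum.cong refl)
    fix \<sigma> assume \<sigma>: "\<sigma> \<in> colour_perms nn"
    have "inj (\<sigma> \<circ> shift_index i)" using inj_compose[OF colour_permsD(2)[OF \<sigma>] inj_shift_index] .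
    then have "ratmap (\<sigma> \<circ> shift_index i) (upsilon_rat \<epsilon> xs) = (\<Sum>\<tau>\<in>colour_perms n'. uterm \<epsilon> (map (\<sigma> \<circ> shift_index i) (map \<tau> (word_ordering xs))) ds)"
      using colour_permsD(3)[OF \<sigma>] by (simp add: upsilon_rat_def ratmap_sum ratmap_uterm ds_def n'_def)
    then have "rat (zpow (\<sigma> (Z i 1)) d) * ratmap (\<sigma> \<circ> shift_index i) (upsilon_rat \<epsilon> xs) / ?c * (\<Prod>v\<in>zvars n'. signed_zt \<epsilon> (\<sigma> (Z i 1)) (\<sigma> (shift_index i v))) =
      (\<Sum>\<tau>\<in>colour_perms n'. rat (zpow (\<sigma> (Z i 1)) d) * uterm \<epsilon> (map (\<sigma> \<circ> shift_index i) (map \<tau> (word_ordering xs))) ds *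
      (\<Prod>v\<in>zvars n'. signed_zt \<epsilon> (\<sigma> (Z i 1)) (\<sigma> (shift_index i v))) / ?c)"
      by (simp only: sum_distrib_left sum_distrib_right sum_divide_distrib times_divide_eq_left)
    also have "\<dots> = (\<Sum>\<tau>\<in>colour_perms n'. T (\<sigma> \<circ> hat \<tau>) / ?c)"
      by (intro sum.cong refl) (simp only: summand[OF \<sigma>])
    finally show "rat (zpow (\<sigma> (Z i 1)) d) * ratmap (\<sigma> \<circ> shift_index i) (upsilon_rat \<epsilon> xs) / ?c *
      (\<Prod>v\<in>zvars n'. signed_zt \<epsilon> (\<sigma> (Z i 1)) (\<sigma> (shift_index i v))) = (\<Sum>\<tau>\<in>colour_perms n'. T (\<sigma> \<circ> hat \<tau>) / ?c)" .
  qed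
  also have "\<dots> = (\<Sum>\<tau>\<in>colour_perms n'. (\<Sum>\<sigma>\<in>colour_perms nn. T (\<sigma> \<circ> hat \<tau>)) / ?c)"
    by (subst sum.swap) (simp only: sum_divide_distrib)
  also have "\<dots> = (\<Sum>\<tau>\<in>colour_perms n'. upsilon_rat \<epsilon> (x # xs) / ?c)"
  proof (intro sum.cong refl)
    fix \<tau> assume "\<tau> \<in> colour_perms n'"
    from sum.reindex_bij_betw[OF colour_perms_right_mult[OF hat[OF this]], of T]
    show "(\<Sum>\<sigma>\<in>colour_perms nn. T (\<sigma> \<circ> hat \<tau>)) / ?c = upsilon_rat \<epsilon> (x # xs) / ?c" by (simp add: upsilon_rat)
  qed
  also have "\<dots> = upsilon_rat \<epsilon> (x # xs)" using c unfolding card sum_constant by simp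
  finally show ?thesis by (simp only: nn_def)
qed

lemma unit_product:
  fixes G :: "'i \<Rightarrow> 'i \<Rightarrow> nat \<Rightarrow> nat \<Rightarrow> 'c::comm_monoid_mult"
  shows "(\<Prod>i'\<in>UNIV. \<Prod>j\<in>UNIV. \<Prod>a\<in>{1..unit_vec i i'}. \<Prod>b\<in>{unit_vec i j<..unit_vec i j + n j}. G i' j a b) =
    (\<Prod>v\<in>zvars n. G i (colour v) 1 (unit_vec i (colour v) + pos v))"
proof -
  have "(\<Prod>i'\<in>UNIV. \<Prod>j\<in>UNIV. \<Prod>a\<in>{1..unit_vec i i'}. \<Prod>b\<in>{unit_vec i j<..unit_vec i j + n j}. G i' j a b) =
    (\<Prod>i'\<in>{i}. \<Prod>j\<in>UNIV. \<Prod>a\<in>{1..unit_vec i i'}. \<Prod>b\<in>{unit_vec i j<..unit_vec i j + n j}. G i' j a b)"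
    by (rule prod.mono_neutral_right) (auto simp: unit_vec_def)
  also have "\<dots> = (\<Prod>j\<in>UNIV. \<Prod>b\<in>{unit_vec i j<..unit_vec i j + n j}. G i j 1 b)"
    by (simp add: unit_vec_def)
  also have "\<dots> = (\<Prod>(j, b)\<in>(SIGMA j:UNIV. {unit_vec i j<..unit_vec i j + n j}). G i j 1 b)"
    by (rule prod.Sigma) auto
  also have "\<dots> = (\<Prod>v\<in>zvars n. G i (colour v) 1 (unit_vec i (colour v) + pos v))"
    by (rule prod.reindex_bij_witness[of _ "\<lambda>v. (colour v, unit_vec i (colour v) + pos v)"
        "\<lambda>(j, b). Z j (b - unit_vec i j)"]) (auto simp: in_zvars_iff)
  finally show ?thesis .
qed

lemma inj_rat: "inj (rat :: ('i, 'k) laurent \<Rightarrow> ('i, 'k) ratfun)"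
  by (rule injI) simp

lemma shuffle_comp_letter:
  fixes x :: "'i \<times> int"
  assumes U: "rat U = upsilon_rat \<epsilon> xs"
  shows "rat (shuffle_comp \<epsilon> \<zeta> (unit_vec (fst x)) (weight xs) (zpow (Z (fst x) 1) (snd x)) U) = upsilon_rat \<epsilon> (x # xs)"
proof -
  define i where "i = fst x"
  define d where "d = snd x"
  have fact1: "(\<Prod>j\<in>UNIV. fact (unit_vec i j)) = (1 :: nat)" by (rule prod.neutral) (auto simp: unit_vec_def)
  have summand: "rat (zmap \<sigma> (zpow (Z i 1) d) * zmap (\<lambda>v. \<sigma> (Z (colour v) (unit_vec i (colour v) + pos v))) U) /
        of_nat ((\<Prod>j\<in>UNIV. fact (unit_vec i j)) * (\<Prod>j\<in>UNIV. fact (weight xs j))) *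
        (\<Prod>i'\<in>UNIV. \<Prod>j\<in>UNIV. \<Prod>a\<in>{1..unit_vec i i'}. \<Prod>b\<in>{unit_vec i j<..unit_vec i j + weight xs j}.
           case \<epsilon> of
             Plus \<Rightarrow> \<zeta> i' j (zrat (\<sigma> (Z i' a)) / zrat (\<sigma> (Z j b)))
           | Minus \<Rightarrow> \<zeta> j i' (zrat (\<sigma> (Z j b)) / zrat (\<sigma> (Z i' a)))) =
    rat (zpow (\<sigma> (Z i 1)) d) * ratmap (\<sigma> \<circ> shift_index i) (upsilon_rat \<epsilon> xs) / of_nat (\<Prod>j\<in>UNIV. fact (weight xs j)) *
      (\<Prod>v\<in>zvars (weight xs). signed_zt \<epsilon> (\<sigma> (Z i 1)) (\<sigma> (shift_index i v)))"
    if \<sigma>: "\<sigma> \<in> colour_perms (weight (x # xs))" for \<sigma>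
  proof -
    have inj: "inj (\<sigma> \<circ> shift_index i)" using inj_compose[OF colour_permsD(2)[OF \<sigma>] inj_shift_index] .
    have "(\<lambda>v. \<sigma> (Z (colour v) (unit_vec i (colour v) + pos v))) = \<sigma> \<circ> shift_index i" by (simp add: fun_eq_iff shift_index_def)
    then have 1: "rat (zmap \<sigma> (zpow (Z i 1) d) * zmap (\<lambda>v. \<sigma> (Z (colour v) (unit_vec i (colour v) + pos v))) U) =
      rat (zpow (\<sigma> (Z i 1)) d) * ratmap (\<sigma> \<circ> shift_index i) (upsilon_rat \<epsilon> xs)"
      using inj by (simp add: rat_mult ratmap_rat flip: U)
    have "(case \<epsilon> of Plus \<Rightarrow> \<zeta> i' j (zrat (\<sigma> (Z i' a)) / zrat (\<sigma> (Z j b)))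
           | Minus \<Rightarrow> \<zeta> j i' (zrat (\<sigma> (Z j b)) / zrat (\<sigma> (Z i' a)))) = signed_zt \<epsilon> (\<sigma> (Z i' a)) (\<sigma> (Z j b))" for i' j a b
      using colour_permsD(3)[OF \<sigma>] by (cases \<epsilon>) (simp_all add: signed_zt_def zt_def)
    then have 2: "(\<Prod>i'\<in>UNIV. \<Prod>j\<in>UNIV. \<Prod>a\<in>{1..unit_vec i i'}. \<Prod>b\<in>{unit_vec i j<..unit_vec i j + weight xs j}.
           case \<epsilon> of
             Plus \<Rightarrow> \<zeta> i' j (zrat (\<sigma> (Z i' a)) / zrat (\<sigma> (Z j b)))
           | Minus \<Rightarrow> \<zeta> j i' (zrat (\<sigma> (Z j b)) / zrat (\<sigma> (Z i' a)))) = (\<Prod>v\<in>zvars (weight xs). signed_zt \<epsilon> (\<sigma> (Z i 1)) (\<sigma> (shift_index i v)))"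
      by (simp only: unit_product) (simp only: shift_index_def)
    show ?thesis unfolding 1 2 fact1 by simp
  qed
  have "shuffle_comp \<epsilon> \<zeta> (unit_vec i) (weight xs) (zpow (Z i 1) d) U = the_inv rat (upsilon_rat \<epsilon> (x # xs))"
    unfolding shuffle_comp_def upsilon_rat_Cons[symmetric] weight_Cons[symmetric] i_def[symmetric] d_def[symmetric]
    using weight_Cons[of x xs] summand by (intro arg_cong[of _ _ "the_inv rat"] sum.cong) (auto simp: i_def d_def)
  moreover have "upsilon_rat \<epsilon> (x # xs) \<in> range rat"
    unfolding upsilon_rat_def by (rule symmetrization_is_laurent[OF word_ordering_ords])
  ultimately show ?thesis unfolding i_def d_def by (simp add: f_the_inv_into_f[OF inj_rat])
qed

lemma shuffle_single:
  "shuffle \<epsilon> \<zeta> (single n R) (single n' R') = single (\<lambda>i. n i + n' i) (shuffle_comp \<epsilon> \<zeta> n n' R R')"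
  if "R \<noteq> 0"
proof (cases "R' = 0")
  case True
  have "shuffle_comp \<epsilon> \<zeta> n n' R 0 = the_inv rat (rat 0)" by (simp add: shuffle_comp_def)
  also have "\<dots> = 0" by (rule the_inv_f_f[OF inj_rat])
  finally show ?thesis using True by (simp add: shuffle_def)
next
  case False
  then show ?thesis using that by (simp add: shuffle_def)
qed

lemma upsilon_word_eq: "\<exists>U. upsilon_word \<epsilon> \<zeta> w = single (weight w) U \<and> rat U = upsilon_rat \<epsilon> w"
proof (induction w)
  case Nil
  then show ?case by (intro exI[of _ 1]) (simp add: upsilon_rat_Nil weight_def)
next
  case (Cons x xs)
  then obtain U where U: "upsilon_word \<epsilon> \<zeta> xs = single (weight xs) U" "rat U = upsilon_rat \<epsilon> xs" by blast
  then show ?case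
    by (intro exI[of _ "shuffle_comp \<epsilon> \<zeta> (unit_vec (fst x)) (weight xs) (zpow (Z (fst x) 1) (snd x)) U"])
      (simp add: shuffle_single shuffle_comp_letter weight_Cons del: One_nat_def)
qed

text \<open>
  Linear extension of a function on words. With values in the field of rational functions it covers
  both $\widetilde\Upsilon$ and the pairing.
\<close>

definition lext :: "(('i \<times> int) list \<Rightarrow> ('i, 'k) ratfun) \<Rightarrow> ('i, 'k) free \<Rightarrow> ('i, 'k) ratfun" where
  "lext \<phi> x = (\<Sum>w\<in>keys x. crat (lookup x w) * \<phi> (letters w))"

lemma lext_superset: "finite S \<Longrightarrow> keys x \<subseteq> S \<Longrightarrow> lext \<phi> x = (\<Sum>w\<in>S. crat (lookup x w) * \<phi> (letters w))"
  unfolding lext_def by (intro sum.mono_neutral_left) (auto simp: in_keys_iff)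

lemma lext_add: "lext \<phi> (x + y) = lext \<phi> x + lext \<phi> y"
proof -
  have "keys (x + y) \<subseteq> keys x \<union> keys y" by (rule Poly_Mapping.keys_add)
  then show ?thesis
    using lext_superset[of "keys x \<union> keys y" "x + y" \<phi>] lext_superset[of "keys x \<union> keys y" x \<phi>]
      lext_superset[of "keys x \<union> keys y" y \<phi>]
    by (simp add: lookup_add crat_add distrib_right sum.distrib)
qed

lemma lext_0 [simp]: "lext \<phi> 0 = 0"
  by (simp add: lext_def)

lemma lext_single: "lext \<phi> (single w c) = crat c * \<phi> (letters w)"
  by (cases "c = 0") (auto simp: lext_def)

lemma lext_sum: "lext \<phi> (\<Sum>x\<in>A. f x) = (\<Sum>x\<in>A. lext \<phi> (f x))"
  by (induction A rule: infinite_finite_induct) (auto simp: lext_add)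

lemma lext_diff: "lext \<phi> (x - y) = lext \<phi> x - lext \<phi> y"
  using lext_add[of \<phi> "x - y" y] by simp

definition upsilon_rat_at :: "pm \<Rightarrow> ('i \<Rightarrow> nat) \<Rightarrow> ('i \<times> int) list \<Rightarrow> ('i, 'k) ratfun" where
  "upsilon_rat_at \<epsilon> n w = (if weight w = n then upsilon_rat \<epsilon> w else 0)"

lemma rat_upsilon_free: "rat (lookup (upsilon_free \<epsilon> \<zeta> x) n) = lext (upsilon_rat_at \<epsilon> n) x"
  unfolding upsilon_free_def lext_def lookup_sum rat_sum
proof (intro sum.cong refl)
  fix w assume "w \<in> keys x"
  obtain U where U: "upsilon_word \<epsilon> \<zeta> (letters w) = single (weight (letters w)) U" "rat U = upsilon_rat \<epsilon> (letters w)"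
    using upsilon_word_eq by blast
  have "Poly_Mapping.map (\<lambda>f. cst (lookup x w) * f) (upsilon_word \<epsilon> \<zeta> (letters w)) =
    single (weight (letters w)) (cst (lookup x w) * U)"
    unfolding U by (rule poly_mapping_eqI) (auto simp: map.rep_eq lookup_single when_def)
  then show "rat (lookup (Poly_Mapping.map (\<lambda>f. cst (lookup x w) * f) (upsilon_word \<epsilon> \<zeta> (letters w))) n) =
    crat (lookup x w) * upsilon_rat_at \<epsilon> n (letters w)"
    by (simp add: lookup_single when_def upsilon_rat_at_def U rat_mult crat_def)
qed

lemma upsilon_free_eq_0_iff: "upsilon_free \<epsilon> \<zeta> x = 0 \<longleftrightarrow> (\<forall>n. lext (upsilon_rat_at \<epsilon> n) x = 0)"
  unfolding rat_upsilon_free[symmetric] by (auto simp: poly_mapping_eq_iff fun_eq_iff)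

text \<open>
  The pairing of a word with \<open>R\<close> when its letters are matched with the variables in \<open>vs\<close>.
\<close>

definition pairing_value :: "pm \<Rightarrow> ('i, 'k) laurent \<Rightarrow> 'i zvar list \<Rightarrow> int list \<Rightarrow> 'k" where
  "pairing_value \<epsilon> R vs ds = expn (oriented \<epsilon> vs) (rat (single (mexp vs ds) 1 * R) * kap (oriented \<epsilon> vs)) 0"

lemma prod_powi_eq:
  "length vs = length ds \<Longrightarrow> (\<Prod>a<length vs. zrat (vs ! a) powi (ds ! a)) = (rat (single (mexp vs ds) 1) :: ('i, 'k) ratfun)"
proof (induction vs ds rule: list_induct2)
  case (Cons v vs d ds)
  have "(\<Prod>a<length (v # vs). zrat ((v # vs) ! a) powi ((d # ds) ! a)) =
    (zrat v :: ('i, 'k) ratfun) powi d * (\<Prod>a<length vs. zrat (vs ! a) powi (ds ! a))"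
    by (simp add: prod.lessThan_Suc_shift del: prod.lessThan_Suc)
  also have "\<dots> = rat (zpow v d) * rat (single (mexp vs ds) 1)" using Cons.IH by (simp only: zrat_powi)
  also have "\<dots> = rat (single (mexp (v # vs) (d # ds)) 1)" by (simp add: rat_mult[symmetric] mult_single)
  finally show ?case .
qed simp

lemma prod_pairs_eq:
  fixes g :: "'i zvar \<Rightarrow> 'i zvar \<Rightarrow> 'c::comm_monoid_mult"
  assumes "distinct vs"
  shows "(\<Prod>b<length vs. \<Prod>a<b. g (vs ! a) (vs ! b)) = (\<Prod>p\<in>bef vs. g (fst p) (snd p))"
proof -
  have "(\<Prod>b<length vs. \<Prod>a<b. g (vs ! a) (vs ! b)) = (\<Prod>(b, a)\<in>(SIGMA b:{..<length vs}. {..<b}). g (vs ! a) (vs ! b))"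
    by (rule prod.Sigma) auto
  also have "\<dots> = (\<Prod>p\<in>(\<lambda>(b, a). (vs ! a, vs ! b)) ` (SIGMA b:{..<length vs}. {..<b}). g (fst p) (snd p))"
    using assms by (subst prod.reindex) (auto intro!: inj_onI prod.cong simp: nth_eq_iff_index_eq)
  also have "(\<lambda>(b, a). (vs ! a, vs ! b)) ` (SIGMA b:{..<length vs}. {..<b}) = bef vs"
    unfolding bef_conv_nth by force
  finally show ?thesis .
qed

lemma pairing_word_eq:
  "pairing_word \<epsilon> \<zeta> w (single n R) = (if weight w = n then pairing_value \<epsilon> R (word_ordering w) (map snd w) else 0)"
proof -
  let ?vs = "word_ordering w"
  have d: "distinct ?vs" using word_ordering_ords[of w] by (simp add: ords_def)
  have nth: "word_var w a = ?vs ! a" if "a < length w" for a using that by (simp add: word_ordering_def)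
  have col: "fst (w ! a) = colour (?vs ! a)" if "a < length w" for a
    using that arg_cong[OF map_colour_word_ordering[of w], of "\<lambda>l. l ! a"] by simp
  have ord: "(case \<epsilon> of Plus \<Rightarrow> map (word_var w) [0..<length w] | Minus \<Rightarrow> rev (map (word_var w) [0..<length w])) = oriented \<epsilon> ?vs"
    by (cases \<epsilon>) (simp_all add: word_ordering_def)
  have 1: "(\<Prod>a<length w. zrat (word_var w a) powi snd (w ! a)) = (rat (single (mexp ?vs (map snd w)) 1) :: ('i, 'k) ratfun)"
    using prod_powi_eq[of ?vs "map snd w"] by (simp add: nth)
  have "(\<Prod>b<length w. \<Prod>a<b. case \<epsilon> of
             Plus \<Rightarrow> \<zeta> (fst (w ! b)) (fst (w ! a)) (zrat (word_var w b) / zrat (word_var w a))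
           | Minus \<Rightarrow> \<zeta> (fst (w ! a)) (fst (w ! b)) (zrat (word_var w a) / zrat (word_var w b))) =
    (\<Prod>b<length ?vs. \<Prod>a<b. signed_zt \<epsilon> (?vs ! b) (?vs ! a))"
    by (intro prod.cong) (auto simp: nth col signed_zt_def zt_def split: pm.split)
  also have "\<dots> = (\<Prod>p\<in>bef ?vs. signed_zt \<epsilon> (snd p) (fst p))" by (rule prod_pairs_eq[OF d])
  finally have "pairing_word \<epsilon> \<zeta> w (single n R) =
    constant_term (oriented \<epsilon> ?vs) (rat (single (mexp ?vs (map snd w)) 1) * rat (lookup (single n R) (weight w)) / (\<Prod>p\<in>bef ?vs. signed_zt \<epsilon> (snd p) (fst p)))"
    unfolding pairing_word_def Let_def 1 ord by simp
  also have "rat (single (mexp ?vs (map snd w)) 1) * rat (lookup (single n R) (weight w)) / (\<Prod>p\<in>bef ?vs. signed_zt \<epsilon> (snd p) (fst p)) =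
    rat (single (mexp ?vs (map snd w)) 1 * lookup (single n R) (weight w)) * kap (oriented \<epsilon> ?vs)"
    unfolding kap_oriented rat_mult prod_dividef by simp
  also have "constant_term (oriented \<epsilon> ?vs) \<dots> = pairing_value \<epsilon> (lookup (single n R) (weight w)) ?vs (map snd w)"
  proof -
    have "distinct (oriented \<epsilon> ?vs)" using d by simp
    from constant_term_eq[OF this is_expansion_expn[OF this expandable_kap[OF this]]] show ?thesis unfolding pairing_value_def .
  qed
  also have "\<dots> = (if weight w = n then pairing_value \<epsilon> R ?vs (map snd w) else 0)"
    using d by (auto simp: lookup_single when_def pairing_value_def expn_0)
  finally show ?thesis .
qed

definition pairing_value_at :: "pm \<Rightarrow> ('i \<Rightarrow> nat) \<Rightarrow> ('i, 'k) laurent \<Rightarrow> ('i \<times> int) list \<Rightarrow> ('i, 'k) ratfun" where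
  "pairing_value_at \<epsilon> n R w = (if weight w = n then crat (pairing_value \<epsilon> R (word_ordering w) (map snd w)) else 0)"

lemma crat_pairing_free: "crat (pairing_free \<epsilon> \<zeta> x (single n R)) = lext (pairing_value_at \<epsilon> n R) x"
  unfolding pairing_free_def lext_def crat_sum
  by (intro sum.cong refl) (simp add: pairing_word_eq crat_mult pairing_value_at_def)

text \<open>
  Two orderings with the same sequence of colours differ by a colour-preserving permutation, over which
  the sum runs anyway.
\<close>

lemma upsilon_rat_any:
  assumes "weight w = n" "vs \<in> ords (zvars n)" "map colour vs = map fst w"
  shows "upsilon_rat \<epsilon> w = (\<Sum>\<sigma>\<in>colour_perms n. uterm \<epsilon> (map \<sigma> vs) (map snd w))"
proof -
  obtain \<tau> where \<tau>: "\<tau> \<in> colour_perms n" "vs = map \<tau> (word_ordering w)"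
    using ords_permuted[of "word_ordering w" n vs] assms word_ordering_ords[of w] map_colour_word_ordering[of w] by auto
  have "(\<Sum>\<sigma>\<in>colour_perms n. uterm \<epsilon> (map (\<sigma> \<circ> \<tau>) (word_ordering w)) (map snd w)) = upsilon_rat \<epsilon> w"
    unfolding upsilon_rat_def assms(1)
    by (rule sum.reindex_bij_betw[OF colour_perms_right_mult[OF \<tau>(1)], of "\<lambda>\<sigma>. uterm \<epsilon> (map \<sigma> (word_ordering w)) (map snd w)"])
  then show ?thesis by (simp add: \<tau>(2))
qed

lemma pairing_value_permute:
  assumes "\<sigma> \<in> colour_perms n" "R \<in> sym_laurents n" "distinct vs"
  shows "pairing_value \<epsilon> R (map \<sigma> vs) ds = pairing_value \<epsilon> R vs ds"
proof -
  let ?o = "oriented \<epsilon> vs"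
  have d: "distinct ?o" using assms(3) by simp
  have inj: "inj \<sigma>" using colour_permsD[OF assms(1)] by simp
  have R: "zmap \<sigma> R = R" using assms(1,2) by (simp add: sym_laurents_def)
  have "ratmap \<sigma> (rat (single (mexp vs ds) 1 * R) * kap ?o) = rat (single (mexp (map \<sigma> vs) ds) 1 * R) * kap (map \<sigma> ?o)"
    using inj colour_permsD(3)[OF assms(1)] by (simp add: ratmap_mult ratmap_rat zmap_mult R push_mexp ratmap_kap)
  then show ?thesis
    using expn_push[OF colour_permsD(1)[OF assms(1)] d expandable_kap[OF d], of "single (mexp vs ds) 1 * R" 0]
    by (simp add: pairing_value_def oriented_map)
qed

lemma pairing_value_any:
  assumes "weight w = n" "vs \<in> ords (zvars n)" "map colour vs = map fst w" "R \<in> sym_laurents n"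
  shows "pairing_value_at \<epsilon> n R w = crat (pairing_value \<epsilon> R vs (map snd w))"
proof -
  obtain \<tau> where \<tau>: "\<tau> \<in> colour_perms n" "vs = map \<tau> (word_ordering w)"
    using ords_permuted[of "word_ordering w" n vs] assms word_ordering_ords[of w] map_colour_word_ordering[of w] by auto
  have "distinct (word_ordering w)" using word_ordering_ords[of w] by (simp add: ords_def)
  then show ?thesis using pairing_value_permute[OF \<tau>(1) assms(4)] by (simp add: pairing_value_at_def assms(1) \<tau>(2))
qed

end

section \<open>The quadratic relations\<close>

lemma ring_on_UNIV: "ring (ring_on (UNIV :: 'a::ring_1 set))"
proof (rule ringI)
  show "abelian_group (ring_on (UNIV :: 'a set))"
  proof (rule abelian_groupI)
    fix x :: 'a
    show "\<exists>y\<in>carrier (ring_on UNIV). y \<oplus>\<^bsub>ring_on UNIV\<^esub> x = \<zero>\<^bsub>ring_on UNIV\<^esub>"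
      by (intro bexI[of _ "- x"]) (auto simp: ring_on_def)
  qed (auto simp: ring_on_def)
  show "Group.monoid (ring_on (UNIV :: 'a set))"
    by (rule Group.monoidI) (auto simp: ring_on_def mult.assoc)
qed (auto simp: ring_on_def distrib_left distrib_right)

lemma ideal_ring_on_UNIV:
  fixes K :: "'a::ring_1 set"
  assumes "0 \<in> K" "\<And>x y. x \<in> K \<Longrightarrow> y \<in> K \<Longrightarrow> x + y \<in> K" "\<And>x r. x \<in> K \<Longrightarrow> r * x \<in> K" "\<And>x r. x \<in> K \<Longrightarrow> x * r \<in> K"
  shows "ideal K (ring_on UNIV)"
proof -
  interpret ring "ring_on (UNIV :: 'a set)" by (rule ring_on_UNIV)
  show ?thesis
  proof (rule idealI)
    show "ring (ring_on (UNIV :: 'a set))" by (rule ring_on_UNIV)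
    show "subgroup K (add_monoid (ring_on UNIV))"
    proof (rule add.subgroupI)
      fix a assume a: "a \<in> K"
      have "\<ominus>\<^bsub>ring_on UNIV\<^esub> a = - a" by (intro minus_equality) (auto simp: ring_on_def)
      then show "\<ominus>\<^bsub>ring_on UNIV\<^esub> a \<in> K" using assms(3)[OF a, of "- 1"] by simp
    qed (use assms in \<open>auto simp: ring_on_def\<close>)
  qed (use assms in \<open>auto simp: ring_on_def\<close>)
qed

lemma loop_group_carrier:
  "X \<in> carrier (loop_group \<epsilon> \<zeta>) \<longleftrightarrow>
     (\<exists>x. X = (\<lambda>h. h + x) ` (Idl\<^bsub>ring_on UNIV\<^esub> (relations \<epsilon> \<zeta>)))"
  by (simp add: loop_group_def FactRing_def A_RCOSETS_def' a_r_coset_def' ring_on_def image_def) blast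

context zeta_data
begin

text \<open>
  Compatibility with the quadratic relation, multiplied by words from both sides.
\<close>

definition descends :: "pm \<Rightarrow> (('i \<times> int) list \<Rightarrow> ('i, 'k) ratfun) \<Rightarrow> bool" where
  "descends \<epsilon> \<phi> \<longleftrightarrow> (\<forall>i j z w A B a b u v.
     z = Z i 1 \<longrightarrow> w = Z j 2 \<longrightarrow>
     rat A = (if i = j then zrat z - zrat w else 1) * signed_zt \<epsilon> w z \<longrightarrow>
     rat B = (if i = j then zrat z - zrat w else 1) * signed_zt \<epsilon> z w \<longrightarrow>
     (\<Sum>m\<in>keys A. crat (lookup A m) * \<phi> (u @ [(i, lookup m z - a), (j, lookup m w - b)] @ v)) =
     (\<Sum>m\<in>keys B. crat (lookup B m) * \<phi> (u @ [(j, lookup m w - b), (i, lookup m z - a)] @ v)))"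

lemma lext_vanishes_on_ideal:
  assumes "descends \<epsilon> \<phi>" "x \<in> Idl\<^bsub>ring_on UNIV\<^esub> (relations \<epsilon> \<zeta>)"
  shows "lext \<phi> x = 0"
proof -
  define K where "K = {x. \<forall>a b. lext \<phi> (a * x * b) = 0}"
  have "ideal K (ring_on UNIV)"
  proof (rule ideal_ring_on_UNIV)
    fix x r assume x: "x \<in> K"
    have "a * (r * x) * b = (a * r) * x * b" "a * (x * r) * b = a * x * (r * b)" for a b
      by (simp_all add: mult.assoc)
    then show "r * x \<in> K" "x * r \<in> K" using x by (simp_all only: K_def mem_Collect_eq) simp_all
  qed (auto simp: K_def distrib_left distrib_right lext_add)
  moreover have "relations \<epsilon> \<zeta> \<subseteq> K"
  proof
    fix x assume "x \<in> relations \<epsilon> \<zeta>"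
    then obtain i j z w A B a b where zw: "z = Z i 1" "w = Z j 2"
      and A0: "rat A = (if i = j then zrat z - zrat w else 1) *
          (case \<epsilon> of Plus \<Rightarrow> \<zeta> j i (zrat w / zrat z) | Minus \<Rightarrow> \<zeta> i j (zrat z / zrat w))"
      and B0: "rat B = (if i = j then zrat z - zrat w else 1) *
          (case \<epsilon> of Plus \<Rightarrow> \<zeta> i j (zrat z / zrat w) | Minus \<Rightarrow> \<zeta> j i (zrat w / zrat z))"
      and x: "x = (\<Sum>m\<in>keys A. single 0 (lookup A m) * gen i (lookup m z - a) * gen j (lookup m w - b)) -
        (\<Sum>m\<in>keys B. single 0 (lookup B m) * gen j (lookup m w - b) * gen i (lookup m z - a))"
      unfolding relations_def by blast
    have A: "rat A = (if i = j then zrat z - zrat w else 1) * signed_zt \<epsilon> w z"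
      and B: "rat B = (if i = j then zrat z - zrat w else 1) * signed_zt \<epsilon> z w"
      using A0 B0 zw by (cases \<epsilon>; simp add: signed_zt_def zt_def)+
    have word: "lext \<phi> (single (Word u) c * (single 0 k * gen i' d * gen j' e) * single (Word v) c') =
      crat (c * c') * (crat k * \<phi> (u @ [(i', d), (j', e)] @ v))" for u v c c' k i' j' d e
      by (simp add: mult_single lext_single plus_word_def zero_word_def crat_mult mult_ac)
    have basic: "lext \<phi> (single (Word u) c * x * single (Word v) c') = 0" for u v c c'
    proof -
      have "lext \<phi> (single (Word u) c * x * single (Word v) c') =
        crat (c * c') * ((\<Sum>m\<in>keys A. crat (lookup A m) * \<phi> (u @ [(i, lookup m z - a), (j, lookup m w - b)] @ v)) -
        (\<Sum>m\<in>keys B. crat (lookup B m) * \<phi> (u @ [(j, lookup m w - b), (i, lookup m z - a)] @ v)))"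
        unfolding x right_diff_distrib left_diff_distrib lext_diff sum_distrib_left sum_distrib_right lext_sum word ..
      also have "\<dots> = 0"
        using assms(1)[unfolded descends_def, rule_format, OF zw A B, of u a b v] by simp
      finally show ?thesis .
    qed
    have "lext \<phi> (f * x * g) = 0" for f g
    proof (induction f rule: poly_mapping_linear_induct)
      case (single p c)
      show ?case
      proof (induction g rule: poly_mapping_linear_induct)
        case (single p' c')
        show ?case using basic[of "letters p" c "letters p'" c'] by simp
      qed (simp_all add: distrib_left lext_add)
    qed (simp_all add: distrib_right lext_add)
    then show "x \<in> K" by (simp add: K_def)
  qed
  ultimately have "Idl\<^bsub>ring_on UNIV\<^esub> (relations \<epsilon> \<zeta>) \<subseteq> K"
    by (rule ring.genideal_minimal[OF ring_on_UNIV])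
  then have "lext \<phi> (1 * x * 1) = 0" using assms(2) unfolding K_def by blast
  then show ?thesis by simp
qed

lemma signed_zt_explicit:
  assumes "u \<noteq> v"
  obtains g where "g \<in> laurents_in {u, v}"
    "rat g = (if colour u = colour v then zrat u - zrat v else 1) * signed_zt \<epsilon> v u"
proof (cases \<epsilon>)
  case Plus
  then show ?thesis using zt_explicit[OF assms] that by (auto simp: signed_zt_def)
next
  case Minus
  obtain g where g: "g \<in> laurents_in {v, u}"
    "rat g = (if colour v = colour u then zrat v - zrat u else 1) * zt u v"
    using zt_explicit[OF assms[symmetric]] by blast
  show ?thesis
  proof (cases "colour u = colour v")
    case True
    show ?thesis
    proof (rule that[of "- g"])
      show "- g \<in> laurents_in {u, v}" using g(1) by (simp add: laurents_in_uminus insert_commute)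
      show "rat (- g) = (if colour u = colour v then zrat u - zrat v else 1) * signed_zt \<epsilon> v u"
        using g(2) True Minus by (simp add: signed_zt_def rat_minus algebra_simps)
    qed
  next
    case False
    show ?thesis
      by (rule that[of g]) (use g False Minus in \<open>simp_all add: signed_zt_def insert_commute\<close>)
  qed
qed

lemma ratmap_signed_zt:
  assumes "inj \<sigma>" "\<And>v. colour (\<sigma> v) = colour v"
  shows "ratmap \<sigma> (signed_zt \<epsilon> u v) = signed_zt \<epsilon> (\<sigma> u) (\<sigma> v)"
  using assms by (cases \<epsilon>) (simp_all add: signed_zt_def ratmap_zt)

lemma renaming_exists:
  fixes z w r t :: "'i zvar"
  assumes "z \<noteq> w" "r \<noteq> t" "colour z = colour r" "colour w = colour t"
  obtains \<rho> where "inj \<rho>" "\<And>v. colour (\<rho> v) = colour v" "\<rho> z = r" "\<rho> w = t"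
proof -
  define \<rho>1 where "\<rho>1 = transpose z r"
  have \<rho>1: "inj \<rho>1" "\<rho>1 z = r" "colour (\<rho>1 v) = colour v" for v
    using assms(3) by (auto simp: \<rho>1_def transpose_def)
  define \<rho> where "\<rho> = transpose (\<rho>1 w) t \<circ> \<rho>1"
  have "\<rho>1 w \<noteq> r" using \<rho>1(1,2) assms(1) by (metis injD)
  show ?thesis
  proof (rule that[of \<rho>])
    show "inj \<rho>" unfolding \<rho>_def using \<rho>1(1) by (intro inj_compose) auto
    have "colour (\<rho>1 w) = colour t" using \<rho>1(3)[of w] assms(4) by simp
    then have "colour (transpose (\<rho>1 w) t x) = colour x" for x by (simp add: transpose_def)
    then show "colour (\<rho> v) = colour v" for v by (simp add: \<rho>_def \<rho>1(3))
    show "\<rho> z = r" using \<open>\<rho>1 w \<noteq> r\<close> assms(2) by (simp add: \<rho>_def \<rho>1(2) transpose_def)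
    show "\<rho> w = t" by (simp add: \<rho>_def)
  qed
qed

text \<open>
  The expansion is supported in the intersection of the two cones, so it serves both orderings.
\<close>

lemma expn_common:
  assumes "distinct vs" "distinct vs'" "P \<subseteq> bef vs" "P \<subseteq> bef vs'"
  shows "expn vs (rat r * krp P) = expn vs' (rat r * krp P)"
proof -
  let ?K = "cone vs \<inter> cone vs'"
  have "\<exists>E. is_expansion vs (rat r * krp P) E \<and> bdd ?K E"
    by (rule expansion_krp[OF assms(1)]) (use assms in \<open>auto simp: cone_0 intro: cone_add cone_shift\<close>)
  then obtain E where E: "is_expansion vs (rat r * krp P) E" "bdd ?K E" by blast
  have "bdd (cone vs') E" using bdd_mono[OF E(2)] by blast
  then have "is_expansion vs' (rat r * krp P) E" using E(1) unfolding is_expansion_iff by blast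
  from expn_eqI[OF assms(2) this] show ?thesis using expn_eqI[OF assms(1) E(1)] by simp
qed

text \<open>
  Exchanging two neighbours affects a single pair.
\<close>

lemma swap_neighbours:
  assumes "distinct (v1 @ [r, t] @ v2)"
  defines "vs \<equiv> v1 @ [r, t] @ v2" and "vs' \<equiv> v1 @ [t, r] @ v2"
  obtains P where "bef vs = insert (r, t) P" "bef vs' = insert (t, r) P" "(r, t) \<notin> P" "(t, r) \<notin> P" "finite P"
proof -
  define P where "P = bef v1 \<union> bef v2 \<union> set v1 \<times> {r, t} \<union> set v1 \<times> set v2 \<union> {r, t} \<times> set v2"
  have "bef vs = insert (r, t) P" "bef vs' = insert (t, r) P"
    by (auto simp: vs_def vs'_def P_def bef_append)
  moreover have "(r, t) \<notin> P" "(t, r) \<notin> P"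
    using assms(1) bef_subset[of v1] bef_subset[of v2] by (auto simp: P_def)
  moreover have "finite P" by (simp add: P_def)
  ultimately show ?thesis using that by blast
qed

text \<open>
  The coefficients of the relation are those of \<open>A\<close>; summed up, they give \<open>A\<close> in the variables matched
  with the two letters.
\<close>

lemma relation_sum:
  assumes "A \<in> laurents_in {z, w}" "z \<noteq> w" "\<rho> z = r" "\<rho> w = t"
  shows "(\<Sum>m\<in>keys A. cst (lookup A m) * single (e + single r (lookup m z - a) + single t (lookup m w - b)) 1) =
    single (e - single r a - single t b) 1 * zmap \<rho> A"
proof -
  have "push \<rho> m = single r (lookup m z) + single t (lookup m w)" if "m \<in> keys A" for m
  proof -
    have "keys m \<subseteq> {z, w}" using assms(1) that by (auto simp: laurents_in_def)
    then show ?thesis using push_superset[of "{z, w}" m \<rho>] assms(2-) by simp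
  qed
  then show ?thesis unfolding zmap_eq sum_distrib_left
    by (intro sum.cong refl) (simp add: mult_single single_diff algebra_simps)
qed

text \<open>
  Match both sides of the relation with orderings that differ by exchanging the neighbours \<open>r\<close> and \<open>t\<close>.
  The two sides of the relation carry the factors $\zeta(z_t/z_r)$ and $\zeta(z_r/z_t)$. In the symmetrization
  the remaining product of \<open>\<zeta>\<close> contains the other one of the two, so the summands agree as rational functions. In the
  pairing each factor cancels against the kernel of the exchanged pair. What remains is a kernel for the
  pairs common to both orderings, and its expansions along the two orderings coincide.
\<close>

lemma descends_symmetrization_and_pairing:
  assumes R: "R \<in> sym_laurents n"
  shows "descends \<epsilon> (upsilon_rat_at \<epsilon> n)" "descends \<epsilon> (pairing_value_at \<epsilon> n R)"
proof -
  have perm: "inj \<sigma>" "colour (\<sigma> v) = colour v" if "\<sigma> \<in> colour_perms n" for \<sigma> v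
    using colour_permsD[OF that] by simp_all
  have "(\<Sum>m\<in>keys A. crat (lookup A m) * upsilon_rat_at \<epsilon> n (u @ [(i, lookup m z - a), (j, lookup m w - b)] @ v)) =
     (\<Sum>m\<in>keys B. crat (lookup B m) * upsilon_rat_at \<epsilon> n (u @ [(j, lookup m w - b), (i, lookup m z - a)] @ v)) \<and>
    (\<Sum>m\<in>keys A. crat (lookup A m) * pairing_value_at \<epsilon> n R (u @ [(i, lookup m z - a), (j, lookup m w - b)] @ v)) =
     (\<Sum>m\<in>keys B. crat (lookup B m) * pairing_value_at \<epsilon> n R (u @ [(j, lookup m w - b), (i, lookup m z - a)] @ v))"
    if zw: "z = Z i 1" "w = Z j 2"
      and A: "rat A = (if i = j then zrat z - zrat w else 1) * signed_zt \<epsilon> w z"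
      and B: "rat B = (if i = j then zrat z - zrat w else 1) * signed_zt \<epsilon> z w"
    for i j z w A B a b u v
  proof -
    let ?W0 = "u @ [(i, 0), (j, 0)] @ v"
    let ?WA = "\<lambda>m. u @ [(i, lookup m z - a), (j, lookup m w - b)] @ v"
    let ?WB = "\<lambda>m. u @ [(j, lookup m w - b), (i, lookup m z - a)] @ v"
    have wt: "weight (?WA m) = weight ?W0" "weight (?WB m) = weight ?W0" for m
      by (auto simp: weight_def fun_eq_iff)
    show ?thesis
    proof (cases "weight ?W0 = n")
      case False
      then show ?thesis unfolding upsilon_rat_at_def pairing_value_at_def wt by simp
    next
      case True
      have zw': "z \<noteq> w" using zw by simp
      define o0 where "o0 = word_ordering ?W0"
      define v1 where "v1 = take (length u) o0"
      define r where "r = o0 ! length u"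
      define t where "t = o0 ! Suc (length u)"
      define v2 where "v2 = drop (Suc (Suc (length u))) o0"
      have len: "length o0 = length u + 2 + length v" by (simp add: o0_def)
      have "o0 = v1 @ drop (length u) o0" by (simp add: v1_def)
      also have "drop (length u) o0 = r # drop (Suc (length u)) o0"
        using len by (simp add: r_def Cons_nth_drop_Suc)
      also have "drop (Suc (length u)) o0 = t # v2"
        using len by (simp add: t_def v2_def Cons_nth_drop_Suc)
      finally have o0: "o0 = v1 @ [r, t] @ v2" by simp
      have l1: "length v1 = length u" and l2: "length v2 = length v" using len by (simp_all add: v1_def v2_def)
      have "map colour (v1 @ [r, t] @ v2) = map fst ?W0" unfolding o0[symmetric] o0_def by (rule map_colour_word_ordering)
      then have col: "map colour v1 = map fst u" "colour r = i" "colour t = j" "map colour v2 = map fst v"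
        using l1 l2 by (simp_all add: append_eq_append_conv)
      define vs where "vs = v1 @ [r, t] @ v2"
      define vs' where "vs' = v1 @ [t, r] @ v2"
      have vs: "vs \<in> ords (zvars n)" using word_ordering_ords[of ?W0] unfolding True o0_def[symmetric] o0 vs_def .
      then have vs': "vs' \<in> ords (zvars n)" by (auto simp: ords_def vs_def vs'_def)
      have d: "distinct vs" "distinct vs'" using vs vs' by (auto simp: ords_def)
      have st: "r \<noteq> t" using d by (auto simp: vs_def)
      have colA: "map colour vs = map fst (?WA m)" and colB: "map colour vs' = map fst (?WB m)" for m
        by (simp_all add: vs_def vs'_def col)
      define e where "e = mexp v1 (map snd u) + mexp v2 (map snd v)"
      define mA where "mA m = e + single r (lookup m z - a) + single t (lookup m w - b)" for m
      have mexpA: "mexp vs (map snd (?WA m)) = mA m" and mexpB: "mexp vs' (map snd (?WB m)) = mA m" for m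
        using l1 by (simp_all add: vs_def vs'_def mexp_append e_def mA_def)
      obtain \<rho> where \<rho>: "inj \<rho>" "\<And>v. colour (\<rho> v) = colour v" "\<rho> z = r" "\<rho> w = t"
        using renaming_exists[OF zw' st, of] zw col by auto
      define M where "M = (single (e - single r a - single t b) 1 :: ('i, 'k) laurent)"
      define \<delta> where "\<delta> = (if i = j then dz r t else (1 :: ('i, 'k) laurent))"
      have \<delta>: "rat \<delta> = ratmap \<rho> (if i = j then zrat z - zrat w else 1)"
        using \<rho> by (simp add: \<delta>_def dz_def rat_diff zrat_def[symmetric] ratmap_diff ratmap_zrat ratmap_1)
      have AL: "A \<in> laurents_in {z, w}"
      proof -
        obtain g where g: "g \<in> laurents_in {z, w}"
          "rat g = (if colour z = colour w then zrat z - zrat w else 1) * signed_zt \<epsilon> w z" using signed_zt_explicit[OF zw'] by blast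
        then have "rat A = rat g" using A zw by simp
        then have "A = g" by (simp only: rat_eq_iff)
        then show ?thesis using g(1) by simp
      qed
      have BL: "B \<in> laurents_in {z, w}"
      proof -
        obtain g where g: "g \<in> laurents_in {w, z}"
          "rat g = (if colour w = colour z then zrat w - zrat z else 1) * signed_zt \<epsilon> z w" using signed_zt_explicit[OF zw'[symmetric]] by blast
        have "rat B = rat (if i = j then - g else g)" using g B zw by (auto simp: rat_minus algebra_simps)
        then have "B = (if i = j then - g else g)" by (simp only: rat_eq_iff)
        then show ?thesis using g(1) by (simp add: laurents_in_uminus insert_commute)
      qed
      have rA: "rat (zmap \<rho> A) = rat \<delta> * signed_zt \<epsilon> t r"
        using A \<rho> by (simp add: \<delta> ratmap_mult ratmap_signed_zt flip: ratmap_rat)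
      have rB: "rat (zmap \<rho> B) = rat \<delta> * signed_zt \<epsilon> r t"
        using B \<rho> by (simp add: \<delta> ratmap_mult ratmap_signed_zt flip: ratmap_rat)
      obtain P where P: "bef vs = insert (r, t) P" "bef vs' = insert (t, r) P" "(r, t) \<notin> P" "(t, r) \<notin> P" "finite P"
        using swap_neighbours[of v1 r t v2] d(1) unfolding vs_def vs'_def by metis
      have zpA: "zprod (oriented \<epsilon> vs) = signed_zt \<epsilon> r t * (\<Prod>p\<in>P. signed_zt \<epsilon> (fst p) (snd p))"
        and zpB: "zprod (oriented \<epsilon> vs') = signed_zt \<epsilon> t r * (\<Prod>p\<in>P. signed_zt \<epsilon> (fst p) (snd p))"
        unfolding zprod_oriented P(1,2) using P(3-5) by simp_all
      have sumA: "(\<Sum>m\<in>keys A. cst (lookup A m) * single (mA m) 1) = M * zmap \<rho> A"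
        unfolding mA_def M_def by (rule relation_sum[OF AL zw' \<rho>(3,4)])
      have sumB: "(\<Sum>m\<in>keys B. cst (lookup B m) * single (mA m) 1) = M * zmap \<rho> B"
        unfolding mA_def M_def by (rule relation_sum[OF BL zw' \<rho>(3,4)])
      have U: "(\<Sum>m\<in>keys C. crat (lookup C m) * (\<Sum>\<sigma>\<in>colour_perms n. uterm \<epsilon> (map \<sigma> us) (ds m))) =
        (\<Sum>\<sigma>\<in>colour_perms n. ratmap \<sigma> (rat (M * zmap \<rho> C) * zprod (oriented \<epsilon> us)))"
        if sumC: "(\<Sum>m\<in>keys C. cst (lookup C m) * single (mA m) 1) = M * zmap \<rho> C"
          and ds: "\<And>m. mexp us (ds m) = mA m" for C us ds
      proof -
        have "(\<Sum>m\<in>keys C. crat (lookup C m) * (\<Sum>\<sigma>\<in>colour_perms n. uterm \<epsilon> (map \<sigma> us) (ds m))) =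
          (\<Sum>\<sigma>\<in>colour_perms n. \<Sum>m\<in>keys C. crat (lookup C m) * uterm \<epsilon> (map \<sigma> us) (ds m))"
          unfolding sum_distrib_left by (rule sum.swap)
        also have "\<dots> = (\<Sum>\<sigma>\<in>colour_perms n. ratmap \<sigma> (\<Sum>m\<in>keys C. crat (lookup C m) * uterm \<epsilon> us (ds m)))"
          by (intro sum.cong refl) (simp add: perm ratmap_sum ratmap_mult ratmap_crat ratmap_uterm)
        also have "(\<Sum>m\<in>keys C. crat (lookup C m) * uterm \<epsilon> us (ds m)) =
          rat (\<Sum>m\<in>keys C. cst (lookup C m) * single (mA m) 1) * zprod (oriented \<epsilon> us)"
          by (simp add: uterm_def ds rat_sum sum_distrib_right rat_mult crat_def mult.assoc)
        finally show ?thesis unfolding sumC .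
      qed
      have "(\<Sum>m\<in>keys A. crat (lookup A m) * upsilon_rat_at \<epsilon> n (?WA m)) = (\<Sum>m\<in>keys A. crat (lookup A m) * (\<Sum>\<sigma>\<in>colour_perms n. uterm \<epsilon> (map \<sigma> vs) (map snd (?WA m))))"
        using upsilon_rat_any[OF _ vs colA] wt True by (simp add: upsilon_rat_at_def del: append.simps map_append)
      also have "\<dots> = (\<Sum>\<sigma>\<in>colour_perms n. ratmap \<sigma> (rat (M * zmap \<rho> A) * zprod (oriented \<epsilon> vs)))"
        by (rule U[OF sumA mexpA])
      also have "rat (M * zmap \<rho> A) * zprod (oriented \<epsilon> vs) = rat (M * zmap \<rho> B) * zprod (oriented \<epsilon> vs')"
        unfolding rat_mult rA rB zpA zpB by (simp only: mult_ac)
      also have "(\<Sum>\<sigma>\<in>colour_perms n. ratmap \<sigma> (rat (M * zmap \<rho> B) * zprod (oriented \<epsilon> vs'))) =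
        (\<Sum>m\<in>keys B. crat (lookup B m) * (\<Sum>\<sigma>\<in>colour_perms n. uterm \<epsilon> (map \<sigma> vs') (map snd (?WB m))))"
        by (rule U[OF sumB mexpB, symmetric])
      also have "\<dots> = (\<Sum>m\<in>keys B. crat (lookup B m) * upsilon_rat_at \<epsilon> n (?WB m))"
        using upsilon_rat_any[OF _ vs' colB] wt True by (simp add: upsilon_rat_at_def del: append.simps map_append)
      finally have first: "(\<Sum>m\<in>keys A. crat (lookup A m) * upsilon_rat_at \<epsilon> n (?WA m)) = (\<Sum>m\<in>keys B. crat (lookup B m) * upsilon_rat_at \<epsilon> n (?WB m))" .
      have V: "(\<Sum>m\<in>keys C. lookup C m * pairing_value \<epsilon> R us (ds m)) = expn (oriented \<epsilon> us) (rat (M * zmap \<rho> C * R) * kap (oriented \<epsilon> us)) 0"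
        if sumC: "(\<Sum>m\<in>keys C. cst (lookup C m) * single (mA m) 1) = M * zmap \<rho> C"
          and ds: "\<And>m. mexp us (ds m) = mA m" and us: "distinct us" for C us ds
      proof -
        have dus: "distinct (oriented \<epsilon> us)" using us by simp
        have "lookup C m * pairing_value \<epsilon> R us (ds m) = expn (oriented \<epsilon> us) (rat (cst (lookup C m) * (single (mA m) 1 * R)) * kap (oriented \<epsilon> us)) 0" for m
          unfolding pairing_value_def ds expn_kap_mult[OF dus, of "cst (lookup C m)"] by (simp add: act_single)
        then have "(\<Sum>m\<in>keys C. lookup C m * pairing_value \<epsilon> R us (ds m)) =
          expn (oriented \<epsilon> us) (rat (\<Sum>m\<in>keys C. cst (lookup C m) * (single (mA m) 1 * R)) * kap (oriented \<epsilon> us)) 0"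
          by (simp add: expn_kap_sum[OF dus])
        also have "(\<Sum>m\<in>keys C. cst (lookup C m) * (single (mA m) 1 * R)) = M * zmap \<rho> C * R"
          unfolding sumC[symmetric] sum_distrib_right by (simp only: mult.assoc)
        finally show ?thesis .
      qed
      have xnz: "signed_zt \<epsilon> r t \<noteq> 0" "signed_zt \<epsilon> t r \<noteq> 0" using st zt_nz by (cases \<epsilon>; auto simp: signed_zt_def)+
      define P' where "P' = (case \<epsilon> of Plus \<Rightarrow> P | Minus \<Rightarrow> prod.swap ` P)"
      have kP: "krp P' = (\<Prod>p\<in>P. 1 / signed_zt \<epsilon> (snd p) (fst p))"
        by (cases \<epsilon>) (simp_all add: P'_def krp_def kr_def signed_zt_def prod.reindex)
      have "kap (oriented \<epsilon> vs) = 1 / signed_zt \<epsilon> t r * krp P'" "kap (oriented \<epsilon> vs') = 1 / signed_zt \<epsilon> r t * krp P'"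
        unfolding kap_oriented P(1,2) kP using P(3-5) by simp_all
      then have kA: "rat (M * zmap \<rho> A * R) * kap (oriented \<epsilon> vs) = rat (M * \<delta> * R) * krp P'"
        and kB: "rat (M * zmap \<rho> B * R) * kap (oriented \<epsilon> vs') = rat (M * \<delta> * R) * krp P'"
        unfolding rat_mult rA rB using xnz by simp_all
      have sub: "P' \<subseteq> bef (oriented \<epsilon> vs)" "P' \<subseteq> bef (oriented \<epsilon> vs')"
        by (cases \<epsilon>; simp add: P'_def bef_rev P(1,2); blast)+
      have "(\<Sum>m\<in>keys A. crat (lookup A m) * pairing_value_at \<epsilon> n R (?WA m)) = crat (\<Sum>m\<in>keys A. lookup A m * pairing_value \<epsilon> R vs (map snd (?WA m)))"
        using pairing_value_any[OF _ vs colA R] wt True by (simp add: crat_sum crat_mult del: append.simps map_append)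
      also have "(\<Sum>m\<in>keys A. lookup A m * pairing_value \<epsilon> R vs (map snd (?WA m))) = (\<Sum>m\<in>keys B. lookup B m * pairing_value \<epsilon> R vs' (map snd (?WB m)))"
        unfolding V[OF sumA mexpA d(1)] V[OF sumB mexpB d(2)] kA kB
        using expn_common[of "oriented \<epsilon> vs" "oriented \<epsilon> vs'" P' "M * \<delta> * R"] d sub by simp
      also have "crat \<dots> = (\<Sum>m\<in>keys B. crat (lookup B m) * pairing_value_at \<epsilon> n R (?WB m))"
        using pairing_value_any[OF _ vs' colB R] wt True by (simp add: crat_sum crat_mult del: append.simps map_append)
      finally show ?thesis using first by blast
    qed
  qed
  then show "descends \<epsilon> (upsilon_rat_at \<epsilon> n)" "descends \<epsilon> (pairing_value_at \<epsilon> n R)" unfolding descends_def by blast+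
qed

section \<open>The shuffle algebra as an ideal of symmetric Laurent polynomials\<close>

lemma zero_sym_laurents: "0 \<in> sym_laurents n"
  by (simp add: sym_laurents_def laurents_def)

lemma upsilon_free_vanishes:
  assumes "x \<in> Idl\<^bsub>ring_on UNIV\<^esub> (relations \<epsilon> \<zeta>)" shows "upsilon_free \<epsilon> \<zeta> x = 0"
  unfolding upsilon_free_eq_0_iff
  using lext_vanishes_on_ideal[OF descends_symmetrization_and_pairing(1)[OF zero_sym_laurents] assms] by blast

lemma Idl_facts:
  fixes S :: "('i, 'k) free set"
  shows "0 \<in> Idl\<^bsub>ring_on UNIV\<^esub> S"
proof -
  interpret ring "ring_on (UNIV :: ('i, 'k) free set)" by (rule ring_on_UNIV)
  interpret ideal "Idl\<^bsub>ring_on UNIV\<^esub> S" "ring_on (UNIV :: ('i, 'k) free set)"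
    by (rule genideal_ideal) (simp add: ring_on_def)
  show ?thesis using zero_closed by (simp add: ring_on_def)
qed

lemma coset_value:
  assumes "\<And>h. h \<in> Idl\<^bsub>ring_on UNIV\<^esub> (relations \<epsilon> \<zeta>) \<Longrightarrow> g (h + x) = c"
  shows "the_elem (g ` (\<lambda>h. h + x) ` (Idl\<^bsub>ring_on UNIV\<^esub> (relations \<epsilon> \<zeta>))) = c"
proof -
  have "g ` (\<lambda>h. h + x) ` (Idl\<^bsub>ring_on UNIV\<^esub> (relations \<epsilon> \<zeta>)) = {c}"
    using assms Idl_facts by auto
  then show ?thesis by simp
qed

lemma upsilon_free_add: "upsilon_free \<epsilon> \<zeta> (x + y) = upsilon_free \<epsilon> \<zeta> x + upsilon_free \<epsilon> \<zeta> y"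
proof (rule poly_mapping_eqI)
  fix n
  have "rat (lookup (upsilon_free \<epsilon> \<zeta> (x + y)) n) = rat (lookup (upsilon_free \<epsilon> \<zeta> x + upsilon_free \<epsilon> \<zeta> y) n)"
    by (simp add: rat_upsilon_free lext_add lookup_add rat_add)
  then show "lookup (upsilon_free \<epsilon> \<zeta> (x + y)) n = lookup (upsilon_free \<epsilon> \<zeta> x + upsilon_free \<epsilon> \<zeta> y) n" by simp
qed

lemma pairing_free_add: "pairing_free \<epsilon> \<zeta> (x + y) (single n R) = pairing_free \<epsilon> \<zeta> x (single n R) + pairing_free \<epsilon> \<zeta> y (single n R)"
proof -
  have "crat (pairing_free \<epsilon> \<zeta> (x + y) (single n R)) =
    (crat (pairing_free \<epsilon> \<zeta> x (single n R) + pairing_free \<epsilon> \<zeta> y (single n R)) :: ('i, 'k) ratfun)"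
    unfolding crat_add crat_pairing_free lext_add ..
  then show ?thesis by simp
qed

text \<open>
  Both maps vanish on the ideal of relations, so that their values on cosets are values on
  representatives.
\<close>

lemma shuffle_part_iff:
  "R \<in> shuffle_part \<epsilon> \<zeta> n \<longleftrightarrow> R \<in> sym_laurents n \<and>
     (\<forall>x. upsilon_free (opp \<epsilon>) \<zeta> x = 0 \<longrightarrow> pairing_free (opp \<epsilon>) \<zeta> x (single n R) = 0)"
proof (cases "R \<in> sym_laurents n")
  case False
  then show ?thesis by (simp add: shuffle_part_def)
next
  case True
  let ?\<epsilon> = "opp \<epsilon>"
  let ?I = "Idl\<^bsub>ring_on UNIV\<^esub> (relations ?\<epsilon> \<zeta>)"
  have big: "single n R \<in> big_shuffle"
    using True zero_sym_laurents by (auto simp: big_shuffle_def lookup_single when_def)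
  have pI: "pairing_free ?\<epsilon> \<zeta> h (single n R) = 0" if "h \<in> ?I" for h
  proof -
    have "crat (pairing_free ?\<epsilon> \<zeta> h (single n R)) = (0 :: ('i, 'k) ratfun)"
      unfolding crat_pairing_free
      by (rule lext_vanishes_on_ideal[OF descends_symmetrization_and_pairing(2)[OF True] that])
    then have "crat (pairing_free ?\<epsilon> \<zeta> h (single n R)) = (crat 0 :: ('i, 'k) ratfun)" by simp
    then show ?thesis by (simp only: crat_eq_iff)
  qed
  have ups: "upsilon ?\<epsilon> \<zeta> ((\<lambda>h. h + x) ` ?I) = upsilon_free ?\<epsilon> \<zeta> x" for x
    unfolding upsilon_def by (rule coset_value) (simp add: upsilon_free_add upsilon_free_vanishes)
  have pair: "pairing ?\<epsilon> \<zeta> ((\<lambda>h. h + x) ` ?I) (single n R) = pairing_free ?\<epsilon> \<zeta> x (single n R)" for x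
    unfolding pairing_def by (rule coset_value) (simp add: pairing_free_add pI)
  have "single n R \<in> shuffle_algebra \<epsilon> \<zeta> \<longleftrightarrow>
    (\<forall>x. upsilon_free ?\<epsilon> \<zeta> x = 0 \<longrightarrow> pairing_free ?\<epsilon> \<zeta> x (single n R) = 0)"
    unfolding shuffle_algebra_def ker_upsilon_def using big ups pair by (auto simp: loop_group_carrier)
  then show ?thesis using True by (simp add: shuffle_part_def)
qed

text \<open>
  The product of \<open>\<zeta>\<close> over all pairs of distinct variables does not depend on the ordering. So relations
  between the products of \<open>\<zeta>\<close> over the pairs of orderings are relations between kernels.
\<close>

lemma zprod_kap:
  assumes "finite V" "vs \<in> ords V"
  shows "zprod vs = kap vs * (\<Prod>p\<in>V \<times> V - Id. zt (fst p) (snd p))"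
proof -
  let ?g = "\<lambda>p. zt (fst p) (snd p)"
  have d: "distinct vs" using assms(2) by (simp add: ords_def)
  have "V \<times> V - Id = bef vs \<union> prod.swap ` bef vs"
  proof (intro equalityI subsetI)
    fix p assume "p \<in> V \<times> V - Id"
    then show "p \<in> bef vs \<union> prod.swap ` bef vs"
      using bef_total[of "fst p" vs "snd p"] assms(2) by (force simp: ords_def image_iff)
  qed (use bef_ords[OF assms(2)] in auto)
  moreover have "bef vs \<inter> prod.swap ` bef vs = {}" using bef_antisym[OF d] by auto
  ultimately have "(\<Prod>p\<in>V \<times> V - Id. ?g p) = zprod vs * (\<Prod>p\<in>prod.swap ` bef vs. ?g p)"
    by (simp add: prod.union_disjoint zprod_def)
  also have "(\<Prod>p\<in>prod.swap ` bef vs. ?g p) = (\<Prod>p\<in>bef vs. zt (snd p) (fst p))"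
    by (simp add: prod.reindex)
  finally have eq: "(\<Prod>p\<in>V \<times> V - Id. ?g p) = zprod vs * (\<Prod>p\<in>bef vs. zt (snd p) (fst p))" .
  have "kap vs * (\<Prod>p\<in>bef vs. zt (snd p) (fst p)) = (\<Prod>p\<in>bef vs. kr p * zt (snd p) (fst p))"
    by (simp add: krp_def prod.distrib)
  also have "\<dots> = 1"
    by (rule prod.neutral) (use zt_nz bef_irrefl[OF d] in \<open>auto simp: kr_def\<close>)
  finally have one: "kap vs * (\<Prod>p\<in>bef vs. zt (snd p) (fst p)) = 1" .
  show ?thesis unfolding eq using one by (metis (no_types, lifting) mult.commute mult.left_commute mult_1)
qed

lemma zprod_sum_eq_0_iff:
  assumes "finite V" "finite W" "\<And>w. w \<in> W \<Longrightarrow> vs w \<in> ords V"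
  shows "(\<Sum>w\<in>W. F w * zprod (vs w)) = 0 \<longleftrightarrow> (\<Sum>w\<in>W. F w * kap (vs w)) = 0"
proof -
  let ?c = "\<Prod>p\<in>V \<times> V - Id. zt (fst p) (snd p)"
  have "(\<Sum>w\<in>W. F w * zprod (vs w)) = (\<Sum>w\<in>W. F w * kap (vs w)) * ?c"
    unfolding sum_distrib_right by (intro sum.cong refl) (simp add: zprod_kap[OF assms(1) assms(3)] mult.assoc)
  moreover have "?c \<noteq> 0" using assms(1) by (auto simp: prod_zero_iff zt_nz)
  ultimately show ?thesis by simp
qed

lemma lext_as_sum:
  assumes "\<And>w. weight w \<noteq> n \<Longrightarrow> \<phi> w = 0"
  shows "lext \<phi> x = (\<Sum>w | w \<in> keys x \<and> weight (letters w) = n. crat (lookup x w) * \<phi> (letters w))"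
  unfolding lext_def by (rule sum.mono_neutral_right) (use assms in auto)

lemma mexp_lookup:
  "distinct vs \<Longrightarrow> keys m \<subseteq> set vs \<Longrightarrow> mexp vs (map (lookup m) vs) = m"
proof (rule poly_mapping_eqI)
  fix v assume *: "distinct vs" "keys m \<subseteq> set vs"
  have "lookup (mexp vs (map (lookup m) vs)) v = (if v \<in> set vs then lookup m v else 0)"
    using *(1) by (induction vs) (auto simp: lookup_add lookup_single when_def)
  then show "lookup (mexp vs (map (lookup m) vs)) v = lookup m v" using *(2) by (auto simp: in_keys_iff)
qed

text \<open>
  Up to the common factor in \<open>zprod_kap\<close>, $\widetilde\Upsilon(x) = 0$ is a relation among kernels with
  coefficients read off from \<open>x\<close>, and the pairing of \<open>x\<close> with a symmetric \<open>R\<close> is, up to the number of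
  permutations, the constant term of its discrepancy multiplied by \<open>R\<close>. This shows that \<open>J\<close> is contained
  in the shuffle algebra. Conversely, each relation gives rise to an element \<open>x\<close> of the kernel: a monomial
  in the variables, along an ordering, is a word. A coefficient other than the constant term is made the
  constant term by a shift, and then only the part of the relation in the variables of \<open>V\<close> matters.
\<close>

theorem shuffle_part_eq: "shuffle_part \<epsilon> \<zeta> n = sym_laurents n \<inter> J (zvars n)"
proof (intro equalityI subsetI)
  let ?V = "zvars n" and ?e = "opp \<epsilon>" and ?G = "colour_perms n"
  note V = finite_zvars[of n]
  fix R assume R: "R \<in> sym_laurents n \<inter> J ?V"
  have "pairing_free ?e \<zeta> x (single n R) = 0" if x: "upsilon_free ?e \<zeta> x = 0" for x
  proof -
    define K where "K = {w \<in> keys x. weight (letters w) = n}"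
    define W where "W = K \<times> ?G"
    define vs where "vs = (\<lambda>(w :: ('i \<times> int) word, \<sigma> :: 'i zvar \<Rightarrow> 'i zvar). map \<sigma> (word_ordering (letters w)))"
    define f where "f = (\<lambda>(w, \<sigma>). cst (lookup x w) * single (mexp (map \<sigma> (word_ordering (letters w))) (map snd (letters w))) 1 :: ('i, 'k) laurent)"
    have fin: "finite K" "finite W" by (simp_all add: K_def W_def finite_colour_perms)
    have vs: "oriented ?e (vs p) \<in> ords ?V" if "p \<in> W" for p
      using that colour_perms_ords word_ordering_ords by (force simp: W_def K_def vs_def)
    have "(\<Sum>p\<in>W. rat (f p) * zprod (oriented ?e (vs p))) = (\<Sum>w\<in>K. \<Sum>\<sigma>\<in>?G. crat (lookup x w) * uterm ?e (map \<sigma> (word_ordering (letters w))) (map snd (letters w)))"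
      unfolding W_def sum.cartesian_product by (intro sum.cong refl) (auto simp: f_def vs_def uterm_def rat_mult crat_def)
    also have "\<dots> = (\<Sum>w\<in>K. crat (lookup x w) * upsilon_rat_at ?e n (letters w))"
      by (intro sum.cong refl) (auto simp: K_def upsilon_rat_at_def upsilon_rat_def sum_distrib_left)
    also have "\<dots> = lext (upsilon_rat_at ?e n) x" unfolding K_def by (rule lext_as_sum[symmetric]) (simp add: upsilon_rat_at_def)
    also have "\<dots> = 0" using x upsilon_free_eq_0_iff by blast
    finally have "(\<Sum>p\<in>W. rat (f p) * kap (oriented ?e (vs p))) = 0"
      using zprod_sum_eq_0_iff[OF V fin(2) vs, where F = "\<lambda>p. rat (f p)"] by simp
    from J_indexed[OF V _ fin(2) vs this, of R 0] R
    have "(\<Sum>p\<in>W. expn (oriented ?e (vs p)) (rat (f p * R) * kap (oriented ?e (vs p))) 0) = 0" by blast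
    also have "(\<Sum>p\<in>W. expn (oriented ?e (vs p)) (rat (f p * R) * kap (oriented ?e (vs p))) 0) =
      (\<Sum>w\<in>K. \<Sum>\<sigma>\<in>?G. lookup x w * pairing_value ?e R (word_ordering (letters w)) (map snd (letters w)))"
      unfolding W_def sum.cartesian_product
    proof (intro sum.cong refl, clarify)
      fix w \<sigma> assume w: "w \<in> K" and \<sigma>: "\<sigma> \<in> ?G"
      have d: "distinct (word_ordering (letters w))" using word_ordering_ords[of "letters w"] by (simp add: ords_def)
      have d': "distinct (oriented ?e (vs (w, \<sigma>)))" using vs[of "(w, \<sigma>)"] w \<sigma> by (simp add: W_def ords_def)
      have "expn (oriented ?e (vs (w, \<sigma>))) (rat (f (w, \<sigma>) * R) * kap (oriented ?e (vs (w, \<sigma>)))) 0 =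
        lookup x w * pairing_value ?e R (map \<sigma> (word_ordering (letters w))) (map snd (letters w))"
        using expn_kap_mult[OF d', of "cst (lookup x w)"] by (simp add: f_def mult.assoc pairing_value_def vs_def act_single)
      then show "expn (oriented ?e (vs (w, \<sigma>))) (rat (f (w, \<sigma>) * R) * kap (oriented ?e (vs (w, \<sigma>)))) 0 =
        lookup x w * pairing_value ?e R (word_ordering (letters w)) (map snd (letters w))"
        using pairing_value_permute[OF \<sigma> _ d] R by simp
    qed
    also have "\<dots> = of_nat (card ?G) * (\<Sum>w\<in>K. lookup x w * pairing_value ?e R (word_ordering (letters w)) (map snd (letters w)))"
      by (simp add: sum_distrib_left)
    finally have "(\<Sum>w\<in>K. lookup x w * pairing_value ?e R (word_ordering (letters w)) (map snd (letters w))) = 0"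
      by (simp add: card_colour_perms)
    then have "crat (\<Sum>w\<in>K. lookup x w * pairing_value ?e R (word_ordering (letters w)) (map snd (letters w))) = (crat 0 :: ('i, 'k) ratfun)"
      by (simp only:)
    then have "(\<Sum>w\<in>K. crat (lookup x w) * pairing_value_at ?e n R (letters w)) = 0"
      by (simp add: crat_sum crat_mult K_def pairing_value_at_def)
    also have "(\<Sum>w\<in>K. crat (lookup x w) * pairing_value_at ?e n R (letters w)) = lext (pairing_value_at ?e n R) x"
      unfolding K_def by (rule lext_as_sum[symmetric]) (simp add: pairing_value_at_def)
    finally have "crat (pairing_free ?e \<zeta> x (single n R)) = (crat 0 :: ('i, 'k) ratfun)" by (simp add: crat_pairing_free)
    then show ?thesis by (simp only: crat_eq_iff)
  qed
  then show "R \<in> shuffle_part \<epsilon> \<zeta> n" using R by (simp add: shuffle_part_iff)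
next
  let ?V = "zvars n" and ?e = "opp \<epsilon>" and ?G = "colour_perms n"
  note V = finite_zvars[of n]
  have perm: "inj \<sigma>" "colour (\<sigma> v) = colour v" if "\<sigma> \<in> colour_perms n" for \<sigma> v
    using colour_permsD[OF that] by simp_all
  fix R assume "R \<in> shuffle_part \<epsilon> \<zeta> n"
  then have R: "R \<in> sym_laurents n"
    and pair0: "\<And>x. upsilon_free ?e \<zeta> x = 0 \<Longrightarrow> pairing_free ?e \<zeta> x (single n R) = 0"
    by (auto simp: shuffle_part_iff)
  have RV: "R \<in> laurents_in ?V" using R by (simp add: sym_laurents_def laurents_eq)
  have "(\<Sum>vs\<in>ords ?V. expn vs (rat (f vs * R) * kap vs) m) = 0" if f: "syz ?V f" for f m
  proof -
    let ?r = "restrict_exp (- ?V)"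
    \<comment> \<open>Move the coefficient of \<open>m\<close> to the constant term and drop the other variables.\<close>
    define f1 where "f1 vs = single (- m) 1 * f vs" for vs
    define f2 where "f2 vs = pcomp ?r 0 (f1 vs)" for vs
    have "syz ?V f1"
    proof -
      have "(\<Sum>vs\<in>ords ?V. rat (f1 vs) * kap vs) = rat (single (- m) 1) * (\<Sum>vs\<in>ords ?V. rat (f vs) * kap vs)"
        by (simp add: f1_def rat_mult sum_distrib_left mult.assoc)
      then show ?thesis using f by (simp add: syz_def)
    qed
    then have f2: "syz ?V f2" unfolding f2_def
      by (rule syz_pcomp[OF restrict_exp.grading_axioms V, rotated]) (rule restrict_exp_shift)
    have f2V: "f2 vs \<in> laurents_in ?V" for vs
      unfolding f2_def homdeg_restrict_exp_iff[symmetric] by (rule restrict_exp.homdeg_pcomp)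
    have red: "expn vs (rat (f vs * R) * kap vs) m = expn vs (rat (f2 vs * R) * kap vs) 0" if vs: "vs \<in> ords ?V" for vs
    proof -
      have d: "distinct vs" using vs by (simp add: ords_def)
      have "expn vs (rat (f1 vs * R) * kap vs) 0 = act (single (- m) 1) (expn vs (rat (f vs * R) * kap vs)) 0"
        unfolding f1_def mult.assoc by (subst expn_kap_mult[OF d]) simp
      then have 1: "expn vs (rat (f vs * R) * kap vs) m = expn vs (rat (f1 vs * R) * kap vs) 0"
        by (simp add: act_single)
      have "pcomp ?r 0 (R * f1 vs) = R * f2 vs" unfolding f2_def
        using restrict_exp.pcomp_mult_0 RV[folded homdeg_restrict_exp_iff] by blast
      then have eq: "f2 vs * R = pcomp ?r 0 (f1 vs * R)" by (simp add: mult.commute)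
      have "expn vs (rat (f2 vs * R) * kap vs) = scomp ?r 0 (expn vs (rat (f1 vs * R) * kap vs))"
        unfolding eq by (rule expn_kap_pcomp[OF restrict_exp.grading_axioms d]) (use bef_ords[OF vs] restrict_exp_shift in blast)
      then show ?thesis unfolding 1 by (simp add: scomp_def restrict_exp.zero)
    qed
    \<comment> \<open>The word \<open>wd vs m'\<close> spells the monomial \<open>m'\<close> along \<open>vs\<close>.\<close>
    define us where "us vs = oriented ?e vs" for vs :: "'i zvar list"
    define wd where "wd vs m' = zip (map colour (us vs)) (map (lookup m') (us vs))" for vs and m' :: "'i expo"
    define x where "x = (\<Sum>vs\<in>ords ?V. \<Sum>m'\<in>keys (f2 vs). single (Word (wd vs m')) (lookup (f2 vs) m'))"
    have lext: "lext \<phi> x = (\<Sum>vs\<in>ords ?V. \<Sum>m'\<in>keys (f2 vs). crat (lookup (f2 vs) m') * \<phi> (wd vs m'))" for \<phi>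
      by (simp add: x_def lext_sum lext_single)
    have us: "us vs \<in> ords ?V" "oriented ?e (us vs) = vs" if "vs \<in> ords ?V" for vs using that by (simp_all add: us_def)
    have wd: "map fst (wd vs m') = map colour (us vs)" "map snd (wd vs m') = map (lookup m') (us vs)" for vs m'
      by (simp_all add: wd_def)
    have wt: "weight (wd vs m') = n" if vs: "vs \<in> ords ?V" for vs m'
    proof
      fix i
      have "weight (wd vs m') i = length (filter (\<lambda>c. c = i) (map fst (wd vs m')))"
        by (simp add: weight_def filter_map o_def)
      also have "\<dots> = length (filter (\<lambda>v. colour v = i) (us vs))" by (simp add: wd filter_map o_def)
      also have "\<dots> = card (set (filter (\<lambda>v. colour v = i) (us vs)))"
        using us(1)[OF vs] by (intro distinct_card[symmetric]) (simp add: ords_def)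
      also have "set (filter (\<lambda>v. colour v = i) (us vs)) = Z i ` {1..n i}"
        using us(1)[OF vs] by (auto simp: ords_def zvars_def)
      also have "card \<dots> = n i" by (subst card_image) (auto intro: inj_onI)
      finally show "weight (wd vs m') i = n i" .
    qed
    have mexp: "mexp (us vs) (map snd (wd vs m')) = m'" if vs: "vs \<in> ords ?V" and m': "m' \<in> keys (f2 vs)" for vs m'
      unfolding wd using us(1)[OF vs] f2V[of vs] m' by (intro mexp_lookup) (auto simp: ords_def laurents_in_def)
    have "lext (upsilon_rat_at ?e n') x = 0" for n'
    proof (cases "n' = n")
      case False
      then show ?thesis unfolding lext using wt by (intro sum.neutral) (auto simp: upsilon_rat_at_def)
    next
      case True
      have "lext (upsilon_rat_at ?e n') x = (\<Sum>vs\<in>ords ?V. \<Sum>m'\<in>keys (f2 vs). \<Sum>\<sigma>\<in>?G. crat (lookup (f2 vs) m') * uterm ?e (map \<sigma> (us vs)) (map snd (wd vs m')))"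
        unfolding lext True
        by (intro sum.cong refl) (simp add: upsilon_rat_at_def wt sum_distrib_left upsilon_rat_any[OF wt us(1) wd(1)[symmetric]])
      also have "\<dots> = (\<Sum>vs\<in>ords ?V. \<Sum>m'\<in>keys (f2 vs). \<Sum>\<sigma>\<in>?G. ratmap \<sigma> (crat (lookup (f2 vs) m') * (rat (single m' 1) * zprod vs)))"
        by (intro sum.cong refl) (simp add: ratmap_mult ratmap_crat perm ratmap_rat uterm_def push_mexp[symmetric] mexp
            ratmap_zprod oriented_map us)
      also have "\<dots> = (\<Sum>vs\<in>ords ?V. \<Sum>\<sigma>\<in>?G. \<Sum>m'\<in>keys (f2 vs). ratmap \<sigma> (crat (lookup (f2 vs) m') * (rat (single m' 1) * zprod vs)))"
        by (intro sum.cong refl sum.swap)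
      also have "\<dots> = (\<Sum>\<sigma>\<in>?G. \<Sum>vs\<in>ords ?V. \<Sum>m'\<in>keys (f2 vs). ratmap \<sigma> (crat (lookup (f2 vs) m') * (rat (single m' 1) * zprod vs)))"
        by (rule sum.swap)
      also have "\<dots> = (\<Sum>\<sigma>\<in>?G. ratmap \<sigma> (\<Sum>vs\<in>ords ?V. \<Sum>m'\<in>keys (f2 vs). crat (lookup (f2 vs) m') * (rat (single m' 1) * zprod vs)))"
        by (intro sum.cong refl) (simp add: ratmap_sum perm)
      also have "(\<Sum>vs\<in>ords ?V. \<Sum>m'\<in>keys (f2 vs). crat (lookup (f2 vs) m') * (rat (single m' 1) * zprod vs)) =
        (\<Sum>vs\<in>ords ?V. rat (f2 vs) * zprod vs)"
      proof (intro sum.cong refl)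
        fix vs
        have "rat (f2 vs) = rat (\<Sum>m'\<in>keys (f2 vs). cst (lookup (f2 vs) m') * single m' 1)"
          using poly_mapping_as_sum[of "f2 vs"] by (simp add: mult_single)
        then show "(\<Sum>m'\<in>keys (f2 vs). crat (lookup (f2 vs) m') * (rat (single m' 1) * zprod vs)) = rat (f2 vs) * zprod vs"
          by (simp add: rat_sum rat_mult crat_def sum_distrib_right mult.assoc)
      qed
      also have "\<dots> = 0"
        using f2 zprod_sum_eq_0_iff[OF V finite_ords[OF V], where vs = "\<lambda>vs. vs" and F = "\<lambda>vs. rat (f2 vs)"] by (simp add: syz_def)
      finally show ?thesis by (simp add: ratmap_0 perm)
    qed
    then have "upsilon_free ?e \<zeta> x = 0" by (simp add: upsilon_free_eq_0_iff)
    then have "crat (pairing_free ?e \<zeta> x (single n R)) = (0 :: ('i, 'k) ratfun)" using pair0 by simp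
    then have "0 = lext (pairing_value_at ?e n R) x" by (simp add: crat_pairing_free)
    also have "\<dots> = (\<Sum>vs\<in>ords ?V. \<Sum>m'\<in>keys (f2 vs). crat (lookup (f2 vs) m' * expn vs (rat (single m' 1 * R) * kap vs) 0))"
      unfolding lext
      by (intro sum.cong refl) (simp add: pairing_value_any[OF wt us(1) wd(1)[symmetric] R] pairing_value_def mexp us crat_mult)
    also have "\<dots> = (\<Sum>vs\<in>ords ?V. crat (expn vs (rat (f2 vs * R) * kap vs) 0))"
    proof (intro sum.cong refl)
      fix vs assume "vs \<in> ords ?V"
      then have d: "distinct vs" by (simp add: ords_def)
      have "f2 vs * R = (\<Sum>m'\<in>keys (f2 vs). cst (lookup (f2 vs) m') * (single m' 1 * R))"
        using poly_mapping_as_sum[of "f2 vs"] by (simp add: sum_distrib_right[symmetric] mult_single mult.assoc[symmetric])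
      then have "expn vs (rat (f2 vs * R) * kap vs) 0 =
        (\<Sum>m'\<in>keys (f2 vs). expn vs (rat (cst (lookup (f2 vs) m') * (single m' 1 * R)) * kap vs) 0)"
        by (simp add: expn_kap_sum[OF d])
      also have "\<dots> = (\<Sum>m'\<in>keys (f2 vs). lookup (f2 vs) m' * expn vs (rat (single m' 1 * R) * kap vs) 0)"
        by (intro sum.cong refl) (subst expn_kap_mult[OF d], simp add: act_single)
      finally show "(\<Sum>m'\<in>keys (f2 vs). crat (lookup (f2 vs) m' * expn vs (rat (single m' 1 * R) * kap vs) 0)) =
        (crat (expn vs (rat (f2 vs * R) * kap vs) 0) :: ('i, 'k) ratfun)" by (simp add: crat_sum)
    qed
    also have "\<dots> = crat (\<Sum>vs\<in>ords ?V. expn vs (rat (f vs * R) * kap vs) m)"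
      by (simp add: crat_sum red)
    finally have "(crat (\<Sum>vs\<in>ords ?V. expn vs (rat (f vs * R) * kap vs) m) :: ('i, 'k) ratfun) = crat 0" by simp
    then show ?thesis by (simp only: crat_eq_iff)
  qed
  then show "R \<in> sym_laurents n \<inter> J ?V" using R by (simp add: J_def)
qed

end

section \<open>Extending ideals to more variables\<close>

lemma lookup_push: "inj \<sigma> \<Longrightarrow> lookup (push \<sigma> m) (\<sigma> v) = lookup m v"
  unfolding push_def lookup_sum
  by (auto simp: lookup_single when_def inj_eq sum.delta in_keys_iff)

lemma push_restrict_exp:
  assumes "bij \<sigma>" shows "push \<sigma> (restrict_exp (- X) m) = restrict_exp (- \<sigma> ` X) (push \<sigma> m)"
proof (rule poly_mapping_eqI)
  fix v
  obtain u where u: "v = \<sigma> u" using assms by (metis bij_pointE)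
  have "\<sigma> u \<in> \<sigma> ` X \<longleftrightarrow> u \<in> X" using bij_is_inj[OF assms] by (rule inj_image_mem_iff)
  then show "lookup (push \<sigma> (restrict_exp (- X) m)) v = lookup (restrict_exp (- \<sigma> ` X) (push \<sigma> m)) v"
    by (simp add: u lookup_restrict_exp lookup_push[OF bij_is_inj[OF assms]])
qed

lemma lookup_zmap: "inj \<sigma> \<Longrightarrow> lookup (zmap \<sigma> f) (push \<sigma> m) = lookup f m"
  unfolding zmap_eq lookup_sum using push_inj[of \<sigma>]
  by (auto simp: lookup_single when_def inj_eq sum.delta in_keys_iff)

lemma zmap_coef:
  assumes "bij \<sigma>"
  shows "zmap \<sigma> (coef X e f) = coef (\<sigma> ` X) (push \<sigma> e) (zmap \<sigma> f)"
proof (rule poly_mapping_eqI)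
  fix m'
  have inj: "inj \<sigma>" using assms by (rule bij_is_inj)
  have "push \<sigma> (push (finv \<sigma>) m') = m'"
    using assms by (simp add: push_push push_id surj_iff[THEN iffD1] bij_is_surj)
  then obtain m where m: "m' = push \<sigma> m" by metis
  show "lookup (zmap \<sigma> (coef X e f)) m' = lookup (coef (\<sigma> ` X) (push \<sigma> e) (zmap \<sigma> f)) m'"
    unfolding m lookup_zmap[OF inj] lookup_coef push_add[symmetric] push_restrict_exp[OF assms, symmetric]
    using push_inj[OF inj] by (simp add: inj_eq)
qed

lemma coef_0 [simp]: "coef X e 0 = 0"
  by (simp add: coef_def)

lemma coef_outside: "restrict_exp (- X) e \<noteq> e \<Longrightarrow> coef X e f = 0"
proof (rule poly_mapping_eqI)
  fix m assume e: "restrict_exp (- X) e \<noteq> e"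
  have "restrict_exp (- X) (m + e) \<noteq> e"
  proof
    assume *: "restrict_exp (- X) (m + e) = e"
    have "restrict_exp (- X) e = restrict_exp (- X) (restrict_exp (- X) (m + e))" by (simp add: *)
    also have "\<dots> = restrict_exp (- X) (m + e)" by (rule poly_mapping_eqI) (simp add: lookup_restrict_exp)
    finally show False using * e by simp
  qed
  then show "lookup (coef X e f) m = lookup 0 m" by (simp add: lookup_coef)
qed

lemma coef_single_mult:
  assumes "restrict_exp (- X) h = h"
  shows "coef X e (single h 1 * f) = coef X (e - h) f"
proof -
  have "homdeg (restrict_exp (- X)) h (single h (1 :: 'b))" by (simp add: homdeg_def assms)
  from restrict_exp.pcomp_mult[OF this, of "e - h" f] show ?thesis
    by (simp add: coef_def mult_single flip: mult.assoc)
qed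

lemma coef_coef:
  assumes "A' \<subseteq> A" "restrict_exp (- A) e = e" "keys e' \<subseteq> A" "restrict_exp (- A') e' = e'"
  shows "coef A' e' (coef A e f) = coef A' (e' + e) f"
proof (rule poly_mapping_eqI)
  fix m
  have e: "restrict_exp (- A') e = e"
  proof (rule restrict_exp_id)
    have "keys e = keys e \<inter> - A" using keys_restrict_exp[of "- A" e] assms(2) by simp
    then show "keys e \<subseteq> - A'" using assms(1) by blast
  qed
  have e': "restrict_exp (- A) e' = 0" using assms(3) by (intro restrict_exp_eq_0) blast
  show "lookup (coef A' e' (coef A e f)) m = lookup (coef A' (e' + e) f) m"
  proof (cases "restrict_exp (- A') m = 0")
    case True
    have "keys m \<inter> - A' = {}" using keys_restrict_exp[of "- A'" m] True by simp
    then have "restrict_exp (- A) m = 0" using assms(1) by (intro restrict_exp_eq_0) blast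
    then show ?thesis by (simp add: lookup_coef restrict_exp.add True e e' assms(2,4) add.assoc)
  next
    case False
    then show ?thesis by (simp add: lookup_coef restrict_exp.add e assms(4) add.assoc[symmetric])
  qed
qed

lemma lideal_image:
  fixes I :: "('i, 'k::comm_ring_1) laurent set"
  assumes "bij \<sigma>" "lideal X I" shows "lideal (\<sigma> ` X) (zmap \<sigma> ` I)"
  unfolding lideal_def
proof (intro conjI ballI)
  show "zmap \<sigma> ` I \<subseteq> laurents_in (\<sigma> ` X)" using zmap_laurents_in lidealD(1)[OF assms(2)] by blast
  show "0 \<in> zmap \<sigma> ` I" using lidealD(2)[OF assms(2)] by (intro image_eqI[of _ _ 0]) simp_all
  fix a b assume "a \<in> zmap \<sigma> ` I" "b \<in> zmap \<sigma> ` I"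
  then show "a + b \<in> zmap \<sigma> ` I" using lidealD(3)[OF assms(2)] by (auto simp: zmap_add[symmetric])
next
  fix r a :: "('i, 'k) laurent" assume r: "r \<in> laurents_in (\<sigma> ` X)" and "a \<in> zmap \<sigma> ` I"
  then obtain a' where a: "a = zmap \<sigma> a'" "a' \<in> I" by blast
  have "zmap (finv \<sigma>) r \<in> laurents_in X"
    using zmap_laurents_in[OF r, of "finv \<sigma>"] bij_is_inj[OF assms(1)] by (simp add: image_image)
  then have "zmap (finv \<sigma>) r * a' \<in> I" using lidealD(4)[OF assms(2)] a by blast
  moreover have "r * a = zmap \<sigma> (zmap (finv \<sigma>) r * a')" by (simp add: a zmap_mult zmap_inv[OF assms(1)])
  ultimately show "r * a \<in> zmap \<sigma> ` I" by blast
qed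

text \<open>
  The right-hand side describes an ideal, because multiplication by monomials in the other variables
  just moves coefficients.
\<close>

lemma extended_ideal_iff:
  fixes K :: "('i, 'k::comm_ring_1) laurent set"
  assumes K: "lideal A K" and "A \<subseteq> V"
  shows "R \<in> Idl\<^bsub>ring_on (laurents_in V)\<^esub> K \<longleftrightarrow> R \<in> laurents_in V \<and> (\<forall>e. coef A e R \<in> K)"
proof
  let ?S = "{R \<in> laurents_in V. \<forall>e. coef A e R \<in> K}"
  have "lideal V ?S" unfolding lideal_def
  proof (intro conjI ballI)
    show "0 \<in> ?S" using lidealD(2)[OF K] by simp
    fix a b assume "a \<in> ?S" "b \<in> ?S"
    then show "a + b \<in> ?S" using lidealD(3)[OF K] by (auto simp: coef_add laurents_in_add)
  next
    fix r a :: "('i, 'k) laurent" assume r: "r \<in> laurents_in V" and a: "a \<in> ?S"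
    have "coef A e (r * a) \<in> K" for e
    proof -
      have "r * a = (\<Sum>h\<in>restrict_exp (- A) ` keys r. single h 1 * (coef A h r * a))"
        using coef_decompose[of r A] by (metis (no_types, lifting) mult.assoc sum.cong sum_distrib_right)
      then have "coef A e (r * a) = (\<Sum>h\<in>restrict_exp (- A) ` keys r. coef A e (single h 1 * (coef A h r * a)))"
        by (simp add: coef_sum)
      also have "\<dots> = (\<Sum>h\<in>restrict_exp (- A) ` keys r. coef A h r * coef A (e - h) a)"
      proof (intro sum.cong refl)
        fix h assume "h \<in> restrict_exp (- A) ` keys r"
        then have "restrict_exp (- A) h = h" by (auto simp: poly_mapping_eq_iff lookup_restrict_exp fun_eq_iff)
        then show "coef A e (single h 1 * (coef A h r * a)) = coef A h r * coef A (e - h) a"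
          by (simp add: coef_single_mult coef_mult[OF coef_laurents_in])
      qed
      also have "\<dots> \<in> K" using a by (intro lideal_sum[OF K] lidealD(4)[OF K] coef_laurents_in) auto
      finally show ?thesis .
    qed
    then show "r * a \<in> ?S" using r a by (auto intro: laurents_in_mult)
  qed simp
  moreover have "K \<subseteq> ?S"
  proof
    fix f assume f: "f \<in> K"
    then have fA: "f \<in> laurents_in A" using lidealD(1)[OF K] by blast
    have "coef A e f \<in> K" for e
    proof -
      have "coef A e 1 * f \<in> K" by (rule lidealD(4)[OF K coef_laurents_in f])
      then show ?thesis using coef_mult[OF fA, of e 1] by (simp add: mult.commute)
    qed
    then show "f \<in> ?S" using fA laurents_in_mono[OF assms(2)] by blast
  qed
  moreover assume "R \<in> Idl\<^bsub>ring_on (laurents_in V)\<^esub> K"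
  ultimately show "R \<in> laurents_in V \<and> (\<forall>e. coef A e R \<in> K)" unfolding Idl_eq by blast
next
  assume R: "R \<in> laurents_in V \<and> (\<forall>e. coef A e R \<in> K)"
  show "R \<in> Idl\<^bsub>ring_on (laurents_in V)\<^esub> K" unfolding Idl_eq
  proof clarify
    fix I assume I: "lideal V I" "K \<subseteq> I"
    have "(\<Sum>e\<in>restrict_exp (- A) ` keys R. single e 1 * coef A e R) \<in> I"
    proof (intro lideal_sum[OF I(1)] lidealD(4)[OF I(1)])
      fix e assume "e \<in> restrict_exp (- A) ` keys R"
      then obtain m where "m \<in> keys R" "e = restrict_exp (- A) m" by blast
      then have "keys e \<subseteq> V" using R by (auto simp: keys_restrict_exp laurents_in_def)
      then show "single e 1 \<in> laurents_in V" by (rule laurents_in_single)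
      show "coef A e R \<in> I" using R I(2) by blast
    qed
    then show "R \<in> I" using coef_decompose[of R A] by simp
  qed
qed

lemma zvars_mono: "k \<le> n \<Longrightarrow> zvars k \<subseteq> zvars n"
  by (auto simp: in_zvars_iff) (metis le_funD order_trans)

lemma choice_extends:
  assumes C: "C \<in> choices k n" and kn: "k \<le> n"
  obtains \<sigma> where "\<sigma> \<in> colour_perms n" "\<And>v. v \<in> zvars k \<Longrightarrow> \<sigma> v = Z (colour v) (C (colour v) (pos v))"
proof -
  have "\<exists>\<pi>. \<pi> permutes {1..n i} \<and> (\<forall>a\<in>{1..k i}. \<pi> a = C i a)" for i
  proof -
    have inj: "inj_on (C i) {1..k i}" and sub: "C i ` {1..k i} \<subseteq> {1..n i}" using C by (auto simp: choices_def)
    have ki: "{1..k i} \<subseteq> {1..n i}" using kn by (auto simp: le_fun_def intro: order_trans)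
    have "card ({1..n i} - {1..k i}) = card ({1..n i} - C i ` {1..k i})"
      using card_Diff_subset[OF _ ki] card_Diff_subset[OF _ sub] card_image[OF inj] by simp
    then obtain g where g: "bij_betw g ({1..n i} - {1..k i}) ({1..n i} - C i ` {1..k i})"
      using finite_same_card_bij[of "{1..n i} - {1..k i}" "{1..n i} - C i ` {1..k i}"] by auto
    define \<pi> where "\<pi> a = (if a \<in> {1..k i} then C i a else if a \<in> {1..n i} then g a else a)" for a
    have "bij_betw \<pi> {1..k i} (C i ` {1..k i})"
      using inj_on_imp_bij_betw[OF inj] by (rule bij_betw_cong[THEN iffD1, rotated]) (simp add: \<pi>_def)
    moreover have "bij_betw \<pi> ({1..n i} - {1..k i}) ({1..n i} - C i ` {1..k i})"
      using g by (rule bij_betw_cong[THEN iffD1, rotated]) (auto simp: \<pi>_def)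
    ultimately have "bij_betw \<pi> ({1..k i} \<union> ({1..n i} - {1..k i})) (C i ` {1..k i} \<union> ({1..n i} - C i ` {1..k i}))"
      by (rule bij_betw_combine) auto
    moreover have "{1..k i} \<union> ({1..n i} - {1..k i}) = {1..n i}" "C i ` {1..k i} \<union> ({1..n i} - C i ` {1..k i}) = {1..n i}"
      using ki sub by blast+
    ultimately have "bij_betw \<pi> {1..n i} {1..n i}" by simp
    then have "\<pi> permutes {1..n i}" by (rule bij_imp_permutes) (use ki in \<open>auto simp: \<pi>_def\<close>)
    then show ?thesis by (auto simp: \<pi>_def)
  qed
  then obtain \<pi> where \<pi>: "\<And>i. \<pi> i permutes {1..n i}" "\<And>i a. a \<in> {1..k i} \<Longrightarrow> \<pi> i a = C i a" by metis
  show ?thesis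
    by (rule that[OF colour_perm_of_family[of \<pi> n]]) (use \<pi> in \<open>auto simp: in_zvars_iff\<close>)
qed

text \<open>
  Every choice of distinct positions extends to a colour-preserving permutation.
\<close>

lemma induced_ideal_iff:
  fixes I :: "('i::finite, 'k::comm_ring_1) laurent set"
  assumes kn: "k \<le> n" and I: "lideal (zvars k) I" and R: "R \<in> laurents_in (zvars n)"
  shows "R \<in> induced_ideal k n I \<longleftrightarrow>
    (\<forall>\<sigma>\<in>colour_perms n. \<forall>e. coef (\<sigma> ` zvars k) e R \<in> zmap \<sigma> ` I)"
proof -
  have gen: "R \<in> Idl\<^bsub>laurent_ring n\<^esub> (zmap \<tau> ` I) \<longleftrightarrow> (\<forall>e. coef (\<sigma> ` zvars k) e R \<in> zmap \<sigma> ` I)"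
    if \<sigma>: "\<sigma> \<in> colour_perms n" and eq: "\<And>v. v \<in> zvars k \<Longrightarrow> \<tau> v = \<sigma> v" for \<sigma> \<tau>
  proof -
    have "zmap \<tau> f = zmap \<sigma> f" if "f \<in> I" for f
      using lidealD(1)[OF I that] eq by (rule zmap_cong)
    then have "zmap \<tau> ` I = zmap \<sigma> ` I" by (intro image_cong refl)
    moreover have "\<sigma> ` zvars k \<subseteq> zvars n" using zvars_mono[OF kn] colour_permsD(4)[OF \<sigma>] by blast
    ultimately show ?thesis
      using extended_ideal_iff[OF lideal_image[OF colour_permsD(1)[OF \<sigma>] I]] R by (simp add: laurents_eq)
  qed
  show ?thesis
  proof
    assume *: "R \<in> induced_ideal k n I"
    show "\<forall>\<sigma>\<in>colour_perms n. \<forall>e. coef (\<sigma> ` zvars k) e R \<in> zmap \<sigma> ` I"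
    proof
      fix \<sigma> assume \<sigma>: "\<sigma> \<in> colour_perms n"
      define C where "C i a = pos (\<sigma> (Z i a))" for i a
      have Z: "Z i (C i a) = \<sigma> (Z i a)" for i a
        using colour_permsD(3)[OF \<sigma>, of "Z i a"] unfolding C_def by (metis zvar.collapse zvar.sel(1))
      have "C \<in> choices k n"
      proof -
        have "inj_on (C i) {1..k i}" for i
        proof (rule inj_onI)
          fix a b assume "C i a = C i b"
          then have "\<sigma> (Z i a) = \<sigma> (Z i b)" by (simp flip: Z)
          then show "a = b" using colour_permsD(2)[OF \<sigma>] by (simp add: inj_eq)
        qed
        moreover have "C i a \<in> {1..n i}" if "a \<in> {1..k i}" for i a
        proof -
          have "Z i a \<in> zvars k" using that by (simp add: in_zvars_iff)
          then have "Z i a \<in> zvars n" using zvars_mono[OF kn] by blast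
          then have "\<sigma> (Z i a) \<in> zvars n" using colour_permsD(4)[OF \<sigma>] by blast
          then show ?thesis unfolding Z[symmetric] by (simp add: in_zvars_iff)
        qed
        ultimately show ?thesis by (auto simp: choices_def)
      qed
      then have "R \<in> Idl\<^bsub>laurent_ring n\<^esub> (zmap (\<lambda>v. Z (colour v) (C (colour v) (pos v))) ` I)"
        using * unfolding induced_ideal_def by blast
      then show "\<forall>e. coef (\<sigma> ` zvars k) e R \<in> zmap \<sigma> ` I"
        by (subst (asm) gen[OF \<sigma>]) (simp_all add: Z)
    qed
  next
    assume *: "\<forall>\<sigma>\<in>colour_perms n. \<forall>e. coef (\<sigma> ` zvars k) e R \<in> zmap \<sigma> ` I"
    show "R \<in> induced_ideal k n I" unfolding induced_ideal_def
    proof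
      fix C assume "C \<in> choices k n"
      then obtain \<sigma> where \<sigma>: "\<sigma> \<in> colour_perms n" "\<And>v. v \<in> zvars k \<Longrightarrow> \<sigma> v = Z (colour v) (C (colour v) (pos v))"
        using choice_extends[OF _ kn] by blast
      show "R \<in> Idl\<^bsub>laurent_ring n\<^esub> (zmap (\<lambda>v. Z (colour v) (C (colour v) (pos v))) ` I)"
        by (subst gen[OF \<sigma>(1)]) (use \<sigma> * in auto)
    qed
  qed
qed

lemma subset_of_zvars:
  assumes "A \<subseteq> zvars n"
  obtains k \<sigma> where "k \<le> n" "\<sigma> \<in> colour_perms n" "A = \<sigma> ` zvars k"
proof -
  define S where "S i = {a. Z i a \<in> A}" for i
  define k where "k i = card (S i)" for i
  have S: "S i \<subseteq> {1..n i}" for i using assms by (auto simp: S_def in_zvars_iff subset_iff)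
  have fin: "finite (S i)" for i using S[of i] finite_subset by blast
  have kn: "k \<le> n" unfolding le_fun_def k_def using card_mono[OF _ S] by fastforce
  have "\<exists>g. bij_betw g {1..k i} (S i)" for i
    using finite_same_card_bij[of "{1..k i}" "S i"] fin by (simp add: k_def)
  then obtain C where C: "\<And>i. bij_betw (C i) {1..k i} (S i)" by metis
  have "C \<in> choices k n" unfolding choices_def
  proof (intro CollectI allI conjI)
    fix i
    show "inj_on (C i) {1..k i}" using C[of i] by (rule bij_betw_imp_inj_on)
    show "C i ` {1..k i} \<subseteq> {1..n i}" using bij_betw_imp_surj_on[OF C[of i]] S[of i] by simp
  qed
  then obtain \<sigma> where \<sigma>: "\<sigma> \<in> colour_perms n" "\<And>v. v \<in> zvars k \<Longrightarrow> \<sigma> v = Z (colour v) (C (colour v) (pos v))"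
    using choice_extends[OF _ kn] by blast
  have "A = \<sigma> ` zvars k"
  proof (intro equalityI subsetI)
    fix v assume v: "v \<in> A"
    then have "pos v \<in> S (colour v)" by (simp add: S_def)
    then obtain a where a: "a \<in> {1..k (colour v)}" "pos v = C (colour v) a"
      using bij_betw_imp_surj_on[OF C[of "colour v"]] by blast
    then have "Z (colour v) a \<in> zvars k" by (simp add: in_zvars_iff)
    moreover from \<sigma>(2)[OF this] have "\<sigma> (Z (colour v) a) = v" using a(2) by (metis zvar.collapse zvar.sel)
    ultimately show "v \<in> \<sigma> ` zvars k" by force
  next
    fix v assume "v \<in> \<sigma> ` zvars k"
    then obtain u where u: "u \<in> zvars k" "v = Z (colour u) (C (colour u) (pos u))" using \<sigma>(2) by auto
    then have "C (colour u) (pos u) \<in> S (colour u)"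
      using bij_betw_imp_surj_on[OF C[of "colour u"]] by (auto simp: in_zvars_iff)
    then show "v \<in> A" using u by (simp add: S_def)
  qed
  then show ?thesis using that kn \<sigma>(1) by blast
qed

section \<open>The local ideals\<close>

context zeta_data
begin

text \<open>
  Rescaling a point multiplies the generators of its line ideal by a constant, so that one ideal serves all
  points of an orbit.
\<close>

lemma local_ideal_exists:
  assumes P: "P \<in> torus_orbits n"
  shows "\<exists>I. hom_lideal (zvars n) I \<and> JX (zvars n) \<subseteq> I \<and>
    (\<forall>p\<in>P. I \<inter> line_torsion (zvars n) p (JX (zvars n)) (JL (zvars n)) \<subseteq> JX (zvars n) \<and>
      (\<forall>u\<in>zvars n. \<forall>v\<in>zvars n. \<exists>k. lin p u v ^ k \<in> I))"
proof -
  let ?V = "zvars n"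
  obtain p0 where p0: "P = rescaling n `` {p0}" using P by (auto simp: torus_orbits_def quotient_def)
  have hom: "hom_lideal ?V (JX ?V)"
    unfolding hom_lideal_def using lideal_JX homogeneous_JX[OF finite_zvars] by blast
  obtain I where I: "hom_lideal ?V I" "JX ?V \<subseteq> I" "I \<inter> line_torsion ?V p0 (JX ?V) (JL ?V) \<subseteq> JX ?V"
    "\<And>u v. u \<in> ?V \<Longrightarrow> v \<in> ?V \<Longrightarrow> \<exists>k. lin p0 u v ^ k \<in> I"
    using supported_ideal_exists[OF finite_zvars hom, where p = p0 and I' = "JL ?V"] by blast
  have lI: "lideal ?V I" using I(1) by (simp add: hom_lideal_def)
  have "I \<inter> line_torsion ?V p (JX ?V) (JL ?V) \<subseteq> JX ?V \<and> (\<forall>u\<in>?V. \<forall>v\<in>?V. \<exists>k. lin p u v ^ k \<in> I)"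
    if p: "p \<in> P" for p
  proof -
    obtain c where c: "c \<noteq> 0" "\<And>v. v \<in> ?V \<Longrightarrow> p v = c * p0 v"
      using p p0 by (auto simp: rescaling_def)
    have lin: "lin p u v = cst c * lin p0 u v" if "u \<in> ?V" "v \<in> ?V" for u v
      using that by (simp add: lin_def c(2) right_diff_distrib mult_single flip: mult.assoc)
    have cst: "cst a ^ k = cst (a ^ k)" for a :: 'k and k
      by (induction k) (simp_all add: mult_single)
    have inv: "cst (inverse c ^ k) * lin p u v ^ k = lin p0 u v ^ k" if "u \<in> ?V" "v \<in> ?V" for u v k
    proof -
      have "cst (inverse c ^ k) * cst (c ^ k) = (1 :: ('i, 'k) laurent)"
        using c(1) by (simp add: mult_single flip: power_mult_distrib)
      then show ?thesis by (simp add: lin[OF that] power_mult_distrib cst flip: mult.assoc)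
    qed
    have "line_torsion ?V p (JX ?V) (JL ?V) \<subseteq> line_torsion ?V p0 (JX ?V) (JL ?V)"
    proof
      fix R assume "R \<in> line_torsion ?V p (JX ?V) (JL ?V)"
      then obtain k where R: "R \<in> JL ?V" and k: "\<And>u v. u \<in> ?V \<Longrightarrow> v \<in> ?V \<Longrightarrow> lin p u v ^ k * R \<in> JX ?V"
        by (auto simp: line_torsion_def)
      have "lin p0 u v ^ k * R \<in> JX ?V" if "u \<in> ?V" "v \<in> ?V" for u v
      proof -
        have "cst (inverse c ^ k) * (lin p u v ^ k * R) \<in> JX ?V"
          by (rule lidealD(4)[OF lideal_JX laurents_in_single k[OF that]]) simp
        then show ?thesis using inv[OF that, of k] by (simp flip: mult.assoc)
      qed
      then show "R \<in> line_torsion ?V p0 (JX ?V) (JL ?V)" using R by (auto simp: line_torsion_def)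
    qed
    moreover have "\<exists>k. lin p u v ^ k \<in> I" if uv: "u \<in> ?V" "v \<in> ?V" for u v
    proof -
      obtain k where "lin p0 u v ^ k \<in> I" using I(4)[OF uv] by blast
      then have "cst (c ^ k) * lin p0 u v ^ k \<in> I"
        by (intro lidealD(4)[OF lI laurents_in_single]) auto
      then show ?thesis by (intro exI[of _ k]) (simp add: lin[OF uv] power_mult_distrib cst)
    qed
    ultimately show ?thesis using I(3) by blast
  qed
  then show ?thesis using I(1,2) by blast
qed

definition local_ideal :: "('i zvar \<Rightarrow> 'k) set \<Rightarrow> ('i \<Rightarrow> nat) \<Rightarrow> ('i, 'k) laurent set" where
  "local_ideal P n = (SOME I. hom_lideal (zvars n) I \<and> JX (zvars n) \<subseteq> I \<and>
    (\<forall>p\<in>P. I \<inter> line_torsion (zvars n) p (JX (zvars n)) (JL (zvars n)) \<subseteq> JX (zvars n) \<and>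
      (\<forall>u\<in>zvars n. \<forall>v\<in>zvars n. \<exists>k. lin p u v ^ k \<in> I)))"

lemma local_ideal:
  assumes P: "P \<in> torus_orbits n"
  shows "lideal (zvars n) (local_ideal P n)" "homogeneous (local_ideal P n)" "JX (zvars n) \<subseteq> local_ideal P n"
    "\<And>p. p \<in> P \<Longrightarrow> local_ideal P n \<inter> line_torsion (zvars n) p (JX (zvars n)) (JL (zvars n)) \<subseteq> JX (zvars n)"
    "\<And>p u v. p \<in> P \<Longrightarrow> u \<in> zvars n \<Longrightarrow> v \<in> zvars n \<Longrightarrow> \<exists>k. lin p u v ^ k \<in> local_ideal P n"
  using someI_ex[OF local_ideal_exists[OF P], folded local_ideal_def] unfolding hom_lideal_def by blast+

text \<open>
  A prime ideal that contains a power of each generator of the line ideal contains the line ideal.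
\<close>

lemma local_ideal_supported:
  assumes P: "P \<in> torus_orbits n"
  shows "supported_on_line n P (local_ideal P n)"
  unfolding supported_on_line_def quot_support_def
proof (intro ballI subsetI CollectI, elim CollectE conjE, intro conjI)
  fix p Q assume p: "p \<in> P" and Q: "primeideal Q (laurent_ring n)" and sub: "local_ideal P n \<subseteq> Q"
  interpret primeideal Q "laurent_ring n" by (rule Q)
  have lQ: "lideal (zvars n) Q" using is_ideal by (simp add: laurents_eq ideal_iff_lideal)
  have prime: "a \<in> Q \<or> b \<in> Q" if "a \<in> laurents_in (zvars n)" "b \<in> laurents_in (zvars n)" "a * b \<in> Q" for a b
    using I_prime[of a b] that by (simp add: ring_on_def laurents_eq)
  have "1 \<notin> Q"
  proof
    assume "1 \<in> Q"
    then have "f \<in> Q" if "f \<in> laurents_in (zvars n)" for f using lidealD(4)[OF lQ that, of 1] by simp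
    then have "carrier (laurent_ring n) = Q" using lidealD(1)[OF lQ] by (auto simp: ring_on_def laurents_eq)
    then show False using I_notcarr by simp
  qed
  have lin: "lin p u v \<in> Q" if uv: "u \<in> zvars n" "v \<in> zvars n" for u v
  proof -
    obtain k where k: "lin p u v ^ k \<in> Q" using local_ideal(5)[OF P p uv] sub by blast
    have "lin p u v ^ k \<in> Q \<Longrightarrow> lin p u v \<in> Q" for k
    proof (induction k)
      case (Suc k)
      then show ?case
        using prime[OF lin_laurents_in[OF uv] laurents_in_power[OF lin_laurents_in[OF uv]], of p p k] by auto
    qed (use \<open>1 \<notin> Q\<close> in simp)
    then show ?thesis using k by blast
  qed
  show "line_ideal n p \<subseteq> Q" unfolding line_ideal_def
    using lin by (intro genideal_minimal[OF is_ideal]) (auto simp: lin_def)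
qed

text \<open>
  Otherwise some multiple of \<open>R\<close> outside \<open>J\<close> would be annihilated, modulo \<open>J\<close>, by a line. It would be
  torsion along this line and lie in the ideal of that line, hence in \<open>J\<close> by the choice of the ideal.
\<close>

lemma intersection_of_local_ideals:
  assumes R: "R \<in> JL (zvars n)" "\<And>P. P \<in> torus_orbits n \<Longrightarrow> R \<in> local_ideal P n"
  shows "R \<in> JX (zvars n)"
proof (rule ccontr)
  let ?V = "zvars n"
  assume "R \<notin> JX ?V"
  then obtain r p where r: "r \<in> laurents_in ?V" "r * R \<notin> JX ?V" and p: "\<And>v. p v \<noteq> (0 :: 'k)"
    "\<And>u v. u \<in> ?V \<Longrightarrow> v \<in> ?V \<Longrightarrow> lin p u v * (r * R) \<in> JX ?V"
    using associated_line[OF finite_zvars R(1)] by blast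
  define p' where "p' = restrict p ?V"
  define P where "P = rescaling n `` {p'}"
  have p': "p' \<in> torus n" using p(1) by (auto simp: torus_def p'_def)
  then have P: "P \<in> torus_orbits n" unfolding P_def torus_orbits_def by (rule quotientI)
  have "p' \<in> P" using p' unfolding P_def rescaling_def by (auto intro!: exI[of _ 1])
  moreover have "r * R \<in> line_torsion ?V p' (JX ?V) (JL ?V)"
    unfolding line_torsion_def using JL_mult[OF r(1) R(1)] p(2)
    by (intro CollectI conjI exI[of _ 1]) (auto simp: lin_def p'_def)
  moreover have "r * R \<in> local_ideal P n" by (rule lidealD(4)[OF local_ideal(1)[OF P] r(1) R(2)[OF P]])
  ultimately show False using local_ideal(4)[OF P] r(2) by blast
qed

text \<open>
  The ideals \<open>J\<close> grow when the set of variables shrinks, are closed under coefficients and are permuted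
  by renamings.
\<close>

lemma J_in_induced_ideals:
  fixes P :: "('i zvar \<Rightarrow> 'k) set"
  assumes R: "R \<in> JX (zvars n)" and kn: "k \<le> n" and P: "P \<in> torus_orbits k"
  shows "R \<in> induced_ideal k n (local_ideal P k)"
proof -
  have "coef (\<sigma> ` zvars k) e R \<in> zmap \<sigma> ` local_ideal P k" if \<sigma>: "\<sigma> \<in> colour_perms n" for \<sigma> e
  proof -
    let ?A = "\<sigma> ` zvars k" and ?f = "coef (\<sigma> ` zvars k) e R"
    have A: "?A \<subseteq> zvars n" using zvars_mono[OF kn] colour_permsD(4)[OF \<sigma>] by blast
    have "R \<in> J ?A" using J_antimono[OF finite_zvars A] R by blast
    then have "?f \<in> J ?A" using J_coef finite_subset[OF A finite_zvars] by blast
    then have "zmap (finv \<sigma>) ?f \<in> J (finv \<sigma> ` ?A)"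
      using colour_permsD[OF colour_perms_inv[OF \<sigma>]] by (intro J_zmap)
    moreover have "zmap (finv \<sigma>) ?f \<in> laurents_in (finv \<sigma> ` ?A)" by (rule zmap_laurents_in[OF coef_laurents_in])
    moreover have "finv \<sigma> ` ?A = zvars k" using colour_permsD(2)[OF \<sigma>] by (simp add: image_image)
    ultimately have "zmap (finv \<sigma>) ?f \<in> local_ideal P k" using local_ideal(3)[OF P] by auto
    then show ?thesis using zmap_inv(2)[OF colour_permsD(1)[OF \<sigma>], of ?f] by (metis image_eqI)
  qed
  then show ?thesis using induced_ideal_iff[OF kn local_ideal(1)[OF P]] R by blast
qed

text \<open>
  By induction, the coefficients of \<open>R\<close> with respect to a proper subset of the variables lie in \<open>J\<close> of
  that subset, since their membership in induced ideals follows from that of \<open>R\<close>. Hence \<open>R\<close> is in \<open>JL\<close>,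
  and the ideals \<open>local_ideal P n\<close> of the full set of variables do the rest.
\<close>

lemma induced_ideals_in_J:
  assumes "R \<in> laurents_in (zvars n)"
    "\<And>k P. k \<le> n \<Longrightarrow> P \<in> torus_orbits k \<Longrightarrow> R \<in> induced_ideal k n (local_ideal P k)"
  shows "R \<in> J (zvars n)"
  using assms
proof (induction "card (zvars n)" arbitrary: n R rule: less_induct)
  case less
  let ?V = "zvars n"
  have coefs: "coef (\<sigma> ` zvars k) e R \<in> zmap \<sigma> ` local_ideal P k"
    if "k \<le> n" "P \<in> torus_orbits k" "\<sigma> \<in> colour_perms n"
    for k and P :: "('i zvar \<Rightarrow> 'k) set" and \<sigma> e
    using less.prems(2)[OF that(1,2)] induced_ideal_iff[OF that(1) local_ideal(1)[OF that(2)] less.prems(1)] that(3) by blast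
  have "R \<in> J A" if A: "A \<subset> ?V" for A
  proof -
    obtain k \<sigma> where k: "k \<le> n" and \<sigma>: "\<sigma> \<in> colour_perms n" and Ak: "A = \<sigma> ` zvars k"
      using subset_of_zvars[of A n] A by blast
    have bij: "bij \<sigma>" and inj: "inj \<sigma>" using colour_permsD[OF \<sigma>] by blast+
    have "card (zvars k) = card A" unfolding Ak by (rule card_image[symmetric]) (rule inj_on_subset[OF inj], simp)
    also have "\<dots> < card ?V" using A finite_zvars by (rule psubset_card_mono[rotated])
    finally have card: "card (zvars k) < card ?V" .
    have fA: "finite A" using A finite_zvars finite_subset by blast
    have "coef A e R \<in> J A" for e
    proof (cases "restrict_exp (- A) e = e")
      case False
      then show ?thesis by (simp add: coef_outside J_0)
    next
      case e: True
      define r where "r = zmap (finv \<sigma>) (coef A e R)"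
      have \<sigma>r: "zmap \<sigma> r = coef A e R" unfolding r_def by (rule zmap_inv(2)[OF bij])
      have "r \<in> laurents_in (finv \<sigma> ` A)" unfolding r_def by (rule zmap_laurents_in[OF coef_laurents_in])
      then have rk: "r \<in> laurents_in (zvars k)" using inj by (simp add: Ak image_image)
      have "r \<in> J (zvars k)"
      proof (rule less.hyps[OF card rk])
        fix k' and P :: "('i zvar \<Rightarrow> 'k) set" assume k': "k' \<le> k" and P: "P \<in> torus_orbits k'"
        have "coef (\<sigma>' ` zvars k') e' r \<in> zmap \<sigma>' ` local_ideal P k'" if \<sigma>': "\<sigma>' \<in> colour_perms k" for \<sigma>' e'
        proof (cases "keys e' \<subseteq> zvars k \<and> restrict_exp (- (\<sigma>' ` zvars k')) e' = e'")
          case False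
          have "coef (\<sigma>' ` zvars k') e' r = 0"
          proof (cases "restrict_exp (- (\<sigma>' ` zvars k')) e' = e'")
            case True
            then have nk: "\<not> keys e' \<subseteq> zvars k" using False by blast
            have sub: "\<sigma>' ` zvars k' \<subseteq> zvars k" using zvars_mono[OF k'] colour_permsD(4)[OF \<sigma>'] by blast
            have "pcomp (restrict_exp (- (\<sigma>' ` zvars k'))) e' r = 0"
            proof (rule poly_mapping_eqI)
              fix m
              show "lookup (pcomp (restrict_exp (- (\<sigma>' ` zvars k'))) e' r) m = lookup 0 m"
              proof (cases "m \<in> keys r")
                case True
                then have "keys m \<subseteq> zvars k" using rk by (auto simp: laurents_in_def)
                then have "restrict_exp (- (\<sigma>' ` zvars k')) m \<noteq> e'" using nk keys_restrict_exp by blast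
                then show ?thesis by (simp add: lookup_pcomp)
              qed (simp add: lookup_pcomp in_keys_iff)
            qed
            then show ?thesis by (simp add: coef_def)
          qed (rule coef_outside)
          then show ?thesis using lidealD(2)[OF local_ideal(1)[OF P]] by (metis image_eqI zmap_0)
        next
          case e': True
          have "\<sigma>' permutes zvars n" using colour_permsD(5)[OF \<sigma>'] zvars_mono[OF k] by (rule permutes_subset)
          then have \<sigma>'n: "\<sigma>' \<in> colour_perms n" using colour_permsD(3)[OF \<sigma>'] by (simp add: colour_perms_def)
          let ?A' = "\<sigma>' ` zvars k'"
          have A'k: "?A' \<subseteq> zvars k" using zvars_mono[OF k'] colour_permsD(4)[OF \<sigma>'] by blast
          have "zmap \<sigma> (coef ?A' e' r) = coef (\<sigma> ` ?A') (push \<sigma> e') (coef A e R)"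
            by (simp add: zmap_coef[OF bij] \<sigma>r)
          also have "\<dots> = coef (\<sigma> ` ?A') (push \<sigma> e' + e) R"
          proof (rule coef_coef[OF _ e])
            show "\<sigma> ` ?A' \<subseteq> A" using A'k by (auto simp: Ak)
            show "keys (push \<sigma> e') \<subseteq> A" using keys_push[of \<sigma> e'] e' by (auto simp: Ak)
            show "restrict_exp (- (\<sigma> ` ?A')) (push \<sigma> e') = push \<sigma> e'"
              using push_restrict_exp[OF bij, of ?A' e'] e' by simp
          qed
          also have "\<dots> = coef ((\<sigma> \<circ> \<sigma>') ` zvars k') (push \<sigma> e' + e) R" by (simp add: image_comp)
          also have "\<dots> \<in> zmap (\<sigma> \<circ> \<sigma>') ` local_ideal P k'"
            by (rule coefs[OF order_trans[OF k' k] P colour_perms_comp[OF \<sigma> \<sigma>'n]])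
          finally obtain g where g: "g \<in> local_ideal P k'" "zmap \<sigma> (coef ?A' e' r) = zmap \<sigma> (zmap \<sigma>' g)"
            by (auto simp: zmap_zmap)
          then have "coef ?A' e' r = zmap \<sigma>' g" using zmap_inv(1)[OF bij] by metis
          then show ?thesis using g(1) by blast
        qed
        then show "r \<in> induced_ideal k' k (local_ideal P k')"
          using induced_ideal_iff[OF k' local_ideal(1)[OF P] rk] by blast
      qed
      then have "zmap \<sigma> r \<in> J (\<sigma> ` zvars k)" using colour_permsD(3)[OF \<sigma>] by (intro J_zmap[OF bij])
      then show ?thesis by (simp add: \<sigma>r Ak)
    qed
    then show ?thesis using J_iff_coef[OF fA] by blast
  qed
  then have "R \<in> JL ?V" using less.prems(1) by (simp add: JL_def)
  moreover have "R \<in> local_ideal P n" if P: "P \<in> torus_orbits n" for P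
  proof -
    have "R \<in> zmap id ` local_ideal P n"
    proof -
      have "coef (id ` ?V) 0 R \<in> zmap id ` local_ideal P n" by (rule coefs[OF order_refl P colour_perms_id])
      moreover have "coef ?V 0 R = R"
      proof (rule poly_mapping_eqI)
        fix m
        show "lookup (coef ?V 0 R) m = lookup R m"
        proof (cases "m \<in> keys R")
          case True
          then have "keys m \<subseteq> ?V" using less.prems(1) by (auto simp: laurents_in_def)
          then have "restrict_exp (- ?V) m = 0" by (intro restrict_exp_eq_0) blast
          then show ?thesis by (simp add: lookup_coef)
        qed (simp add: lookup_coef in_keys_iff)
      qed
      ultimately show ?thesis by simp
    qed
    then show ?thesis by (auto simp: zmap_id)
  qed
  ultimately show "R \<in> J ?V" using intersection_of_local_ideals by blast
qed

end

theorem theorem1p8: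
  fixes \<zeta> :: "'i::finite \<Rightarrow> 'i \<Rightarrow> ('i, 'k::field_char_0) ratfun \<Rightarrow> ('i, 'k) ratfun"
    and \<alpha> :: "'i \<Rightarrow> 'i \<Rightarrow> 'k"
    and s :: "'i \<Rightarrow> 'i \<Rightarrow> int"
    and N :: "'i \<Rightarrow> 'i \<Rightarrow> nat"
    and q :: "'i \<Rightarrow> 'i \<Rightarrow> nat \<Rightarrow> 'k"
  assumes "\<And>i j. \<alpha> i j \<noteq> 0"
    and "\<And>i j e. e \<in> {1..N i j} \<Longrightarrow> q i j e \<noteq> 0"
    and "\<And>i j x. \<zeta> i j x =
      crat (\<alpha> i j) * x powi s i j / (1 - x) ^ (if i = j then 1 else 0) *
      (\<Prod>e = 1..N i j. 1 - x * crat (q i j e))"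
  shows "\<exists>I :: ('i zvar \<Rightarrow> 'k) set \<Rightarrow> ('i \<Rightarrow> nat) \<Rightarrow> ('i, 'k) laurent set.
    (\<forall>n. \<forall>p\<in>torus_orbits n.
       ideal (I p n) (laurent_ring n) \<and> homogeneous (I p n) \<and> supported_on_line n p (I p n)) \<and>
    (\<forall>n. \<forall>\<epsilon>. shuffle_part \<epsilon> \<zeta> n =
       sym_laurents n \<inter> (\<Inter>k\<in>{k. k \<le> n}. \<Inter>p\<in>torus_orbits k. induced_ideal k n (I p k)))"
proof -
  interpret zeta_data \<zeta> \<alpha> s N q using assms by unfold_locales
  show ?thesis
  proof (intro exI[of _ local_ideal] conjI allI ballI)
    fix n :: "'i \<Rightarrow> nat" and P :: "('i zvar \<Rightarrow> 'k) set" assume P: "P \<in> torus_orbits n"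
    show "ideal (local_ideal P n) (laurent_ring n)"
      using local_ideal(1)[OF P] by (simp add: laurents_eq ideal_iff_lideal)
    show "homogeneous (local_ideal P n)" by (rule local_ideal(2)[OF P])
    show "supported_on_line n P (local_ideal P n)" by (rule local_ideal_supported[OF P])
  next
    fix n :: "'i \<Rightarrow> nat" and \<epsilon>
    have L: "sym_laurents n \<subseteq> laurents_in (zvars n)" by (auto simp: sym_laurents_def laurents_eq)
    show "shuffle_part \<epsilon> \<zeta> n =
       sym_laurents n \<inter> (\<Inter>k\<in>{k. k \<le> n}. \<Inter>p\<in>torus_orbits k. induced_ideal k n (local_ideal p k))"
      unfolding shuffle_part_eq
      using L J_in_induced_ideals induced_ideals_in_J by (intro equalityI subsetI) auto
  qed
qed

end
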